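(* Let $\bm A\in\mathbb R^{n\times n}$ be symmetric positive semi-definite, $2\le k\le\operatorname{rank}(\bm A)$, and $p\ge4$. Let $\bm\Omega\in\mathbb R^{n\times(k+p)}$ have i.i.d. $\mathcal N(\bm0,\bm K)$ columns, with $\bm K$ symmetric positive semi-definite such that $\widetilde{\bm K}_{11}$ is invertible, and let $\widehat{\bm A}=\bm A\bm\Omega(\bm\Omega^*\bm A\bm\Omega)^\dagger\bm\Omega^*\bm A$. Define $d_1=\frac{3k}{p+1}$ and $d_2=e^2\frac{k+p}{(p+1)^2}$. Then for any $u,t\ge1$, each of the two inequalities \[ \|\bm A-\widehat{\bm A}\|_2\le\big(1+4\delta_k^{(2)}+4(d_1+d_2u^2)t^2\beta_k^{(2)}\big)\|\bm\Sigma_2\|_2+4d_2t^2\beta_k^{( * )}\|\bm\Sigma_2\|_*, \] \[ \|\bm A-\widehat{\bm A}\|_*\le\big(1+2\delta_k^{( * )}+d_1t^2\beta_k^{( * )}\big)\|\bm\Sigma_2\|_*+2d_2t^2u^2\beta_k^{(2)}\|\bm\Sigma_2\|_2 \] holds with probability at least $1-2t^{-p}-e^{-u^2/2}$.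
   Context: Write $\bm A=\bm U\bm\Sigma\bm U^*$ with $\bm U=[\bm U_1\ \bm U_2]$ orthogonal, $\bm U_1\in\mathbb R^{n\times k}$, eigenvalues $\sigma_1\ge\dots\ge\sigma_n\ge0$, $\bm\Sigma_2=\operatorname{diag}(\sigma_{k+1},\dots,\sigma_n)$. Set $\widetilde{\bm K}_{11}=\bm U_1^*\bm K\bm U_1$, $\widetilde{\bm K}_{21}=\bm U_2^*\bm K\bm U_1$, $\widetilde{\bm K}_{22}=\bm U_2^*\bm K\bm U_2$, $\widetilde{\bm K}_{22.1}=\widetilde{\bm K}_{22}-\widetilde{\bm K}_{21}\widetilde{\bm K}_{11}^{-1}\widetilde{\bm K}_{21}^*$. For $\xi\in\{\mathrm F,2,*\}$, $\beta_k^{(\xi)}=\frac{\|\bm\Sigma_2^{1/2}\widetilde{\bm K}_{22.1}\bm\Sigma_2^{1/2}\|_\xi}{\|\bm\Sigma_2\|_\xi}\|\widetilde{\bm K}_{11}^{-1}\|_2$, $\delta_k^{(\xi)}=\frac{\|\bm\Sigma_2^{1/2}\widetilde{\bm K}_{21}\widetilde{\bm K}_{11}^{-2}\widetilde{\bm K}_{21}^*\bm\Sigma_2^{1/2}\|_\xi}{\|\bm\Sigma_2\|_\xi}$. Norms: Frobenius, spectral ($\|\cdot\|_2$), nuclear ($\|\cdot\|_*$); $\dagger$ is the Moore–Penrose pseudoinverse. *)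

theory Defs
  imports "Jordan_Normal_Form.DL_Rank" "Jordan_Normal_Form.Char_Poly" "HOL-Probability.Probability"
begin

definition sym_psd :: "nat \<Rightarrow> real mat \<Rightarrow> bool" where
  "sym_psd n M \<longleftrightarrow> M \<in> carrier_mat n n \<and> transpose_mat M = M \<and>
     (\<forall>v \<in> carrier_vec n. 0 \<le> v \<bullet> (M *\<^sub>v v))"

definition orthonormal_mat :: "nat \<Rightarrow> real mat \<Rightarrow> bool" where
  "orthonormal_mat n U \<longleftrightarrow> U \<in> carrier_mat n n \<and> transpose_mat U * U = 1\<^sub>m n"

text \<open>Singular values of M: square roots of the eigenvalues (with multiplicity) of M^T M,
  i.e. of the roots of its characteristic polynomial (which splits over the reals).\<close>
definition singular_values :: "real mat \<Rightarrow> real multiset" where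
  "singular_values M = image_mset sqrt (proots (char_poly (transpose_mat M * M)))"

definition spec_norm :: "real mat \<Rightarrow> real" where
  "spec_norm M = Max (insert 0 (set_mset (singular_values M)))"

definition nuc_norm :: "real mat \<Rightarrow> real" where
  "nuc_norm M = sum_mset (singular_values M)"

definition pinv :: "real mat \<Rightarrow> real mat" where
  "pinv M = (THE X. X \<in> carrier_mat (dim_col M) (dim_row M) \<and> M * X * M = M \<and> X * M * X = X \<and>
      transpose_mat (M * X) = M * X \<and> transpose_mat (X * M) = X * M)"

definition mat_inv :: "real mat \<Rightarrow> real mat" where
  "mat_inv M = (THE X. X \<in> carrier_mat (dim_row M) (dim_row M) \<and>
      M * X = 1\<^sub>m (dim_row M) \<and> X * M = 1\<^sub>m (dim_row M))"

section \<open>Blocks of the eigendecomposition A = U Sigma U^T\<close>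

definition U1 :: "nat \<Rightarrow> nat \<Rightarrow> real mat \<Rightarrow> real mat" where
  "U1 n k U = Matrix.mat n k (\<lambda>(i,j). U $$ (i, j))"

definition U2 :: "nat \<Rightarrow> nat \<Rightarrow> real mat \<Rightarrow> real mat" where
  "U2 n k U = Matrix.mat n (n - k) (\<lambda>(i,j). U $$ (i, j + k))"

definition Ktil11 :: "nat \<Rightarrow> nat \<Rightarrow> real mat \<Rightarrow> real mat \<Rightarrow> real mat" where
  "Ktil11 n k U K = transpose_mat (U1 n k U) * K * U1 n k U"

definition Ktil21 :: "nat \<Rightarrow> nat \<Rightarrow> real mat \<Rightarrow> real mat \<Rightarrow> real mat" where
  "Ktil21 n k U K = transpose_mat (U2 n k U) * K * U1 n k U"

definition Ktil22 :: "nat \<Rightarrow> nat \<Rightarrow> real mat \<Rightarrow> real mat \<Rightarrow> real mat" where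
  "Ktil22 n k U K = transpose_mat (U2 n k U) * K * U2 n k U"

definition Ktil22_1 :: "nat \<Rightarrow> nat \<Rightarrow> real mat \<Rightarrow> real mat \<Rightarrow> real mat" where
  "Ktil22_1 n k U K = Ktil22 n k U K -
     Ktil21 n k U K * mat_inv (Ktil11 n k U K) * transpose_mat (Ktil21 n k U K)"

text \<open>Sigma_2 = diag(sigma_{k+1},...,sigma_n) (0-based: sigma k, ..., sigma (n-1)) and its square root.\<close>
definition Sigma2 :: "nat \<Rightarrow> nat \<Rightarrow> (nat \<Rightarrow> real) \<Rightarrow> real mat" where
  "Sigma2 n k \<sigma> = mat_diag (n - k) (\<lambda>i. \<sigma> (i + k))"

definition Sigma2_half :: "nat \<Rightarrow> nat \<Rightarrow> (nat \<Rightarrow> real) \<Rightarrow> real mat" where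
  "Sigma2_half n k \<sigma> = mat_diag (n - k) (\<lambda>i. sqrt (\<sigma> (i + k)))"

definition beta_k :: "(real mat \<Rightarrow> real) \<Rightarrow> nat \<Rightarrow> nat \<Rightarrow> real mat \<Rightarrow> (nat \<Rightarrow> real) \<Rightarrow> real mat \<Rightarrow> real" where
  "beta_k nrm n k U \<sigma> K =
     nrm (Sigma2_half n k \<sigma> * Ktil22_1 n k U K * Sigma2_half n k \<sigma>) / nrm (Sigma2 n k \<sigma>)
     * spec_norm (mat_inv (Ktil11 n k U K))"

definition delta_k :: "(real mat \<Rightarrow> real) \<Rightarrow> nat \<Rightarrow> nat \<Rightarrow> real mat \<Rightarrow> (nat \<Rightarrow> real) \<Rightarrow> real mat \<Rightarrow> real" where
  "delta_k nrm n k U \<sigma> K =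
     nrm (Sigma2_half n k \<sigma> * Ktil21 n k U K * mat_inv (Ktil11 n k U K) * mat_inv (Ktil11 n k U K)
          * transpose_mat (Ktil21 n k U K) * Sigma2_half n k \<sigma>) / nrm (Sigma2 n k \<sigma>)"

definition gauss_mat_measure :: "nat \<Rightarrow> nat \<Rightarrow> ((nat \<times> nat) \<Rightarrow> real) measure" where
  "gauss_mat_measure n m = PiM ({0..<n} \<times> {0..<m}) (\<lambda>_. density lborel std_normal_density)"

definition to_mat :: "nat \<Rightarrow> nat \<Rightarrow> ((nat \<times> nat) \<Rightarrow> real) \<Rightarrow> real mat" where
  "to_mat n m g = Matrix.mat n m g"

definition nystrom :: "real mat \<Rightarrow> real mat \<Rightarrow> real mat" where
  "nystrom A \<Omega> = A * \<Omega> * pinv (transpose_mat \<Omega> * A * \<Omega>) * transpose_mat \<Omega> * A"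

end

theory Submission
 imports Defs "HOL-Real_Asymp.Real_Asymp"
begin

text \<open>Rotating the Gaussian matrix by an orthonormal basis adapted to the kernel of \<open>U\<^sub>1\<^sup>T S\<close> reduces the
 sample to \<open>U\<^sub>1\<^sup>T \<Omega> = L G\<close> and \<open>U\<^sub>2\<^sup>T \<Omega> = M G + R H\<close> with independent Gaussian \<open>G\<close>, \<open>H\<close>. The Nystrom
 error is a partial minimum of the quadratic form of \<open>A\<close>, so inserting the right inverse \<open>N\<close> of \<open>L G\<close> bounds its
 excess over \<open>\<Sigma>\<^sub>2\<close> by \<open>\<parallel>B + D H N\<parallel>\<^sup>2\<close>, where \<open>B B\<^sup>T\<close> and \<open>D D\<^sup>T\<close> are the matrices in \<open>\<delta>\<close> and \<open>\<beta>\<close>.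

 For the nuclear norm, conditionally on \<open>G\<close> an exponential moment of an affine image of \<open>H\<close> gives the sharp tail
 \<open>exp (- u\<^sup>2 / 2)\<close>. The Young weight is not fixed but depends on the Frobenius norm of \<open>N\<close>; the constant \<open>d\<^sub>1\<close>
 without a factor 2 is then affordable because pairs of columns of \<open>N\<close> have smaller inverse moments than single ones.
 For the spectral norm, testing \<open>D H N\<close> against a third independent Gaussian vector bounds high moments of the
 operator norm, and the order of the moment is chosen according to \<open>u\<close>.\<close>

section \<open>Gaussian product measures\<close>

text \<open>\<open>d1\<close> and \<open>d2\<close> are the squares of the classical thresholds for
  the Frobenius and the spectral norm of the pseudoinverse of a \<open>k\<close> by
  \<open>k + p\<close> Gaussian matrix. Putting both norms into events and adding a tail event for
  \<open>H\<close> would use up the whole failure budget, while an even split of the square would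
  double \<open>d1\<close>. The obstacle is that inverse moments are scarce: given the other rows,
  the part of a row that counts is a chi variable with \<open>p + 1\<close> degrees of freedom, so
  \<open>p\<close> is the largest integer order with a finite moment. Only moments of order at most
  \<open>p\<close> of the inverse are used, and its operator norm is never confined to an event: in
  the nuclear case it is a random scale inside the exponent, traded pointwise for a moment of order
  \<open>p\<close>; in the spectral case the whole product is averaged. Order \<open>p\<close> also
  turns a threshold scaled by \<open>t^2\<close> into the factor \<open>t powr (- real p)\<close>.
  All inverse moments are expressed by the one-dimensional \<open>gmom\<close>, whose Stirling-type
  lower bound accounts for the factor \<open>e^2\<close> in \<open>d2\<close>.\<close>

abbreviation std_gauss :: "real measure" where
 "std_gauss \<equiv> density lborel (\<lambda>x. ennreal (std_normal_density x))"

definition gauss :: "'i set \<Rightarrow> ('i \<Rightarrow> real) measure" where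
 "gauss I = PiM I (\<lambda>_. std_gauss)"

abbreviation gaussm :: "nat \<Rightarrow> nat \<Rightarrow> (nat \<times> nat \<Rightarrow> real) measure" where
 "gaussm a b \<equiv> gauss ({0..<a} \<times> {0..<b})"

abbreviation borelm :: "nat \<Rightarrow> nat \<Rightarrow> (nat \<times> nat \<Rightarrow> real) measure" where
 "borelm a b \<equiv> PiM ({0..<a} \<times> {0..<b}) (\<lambda>_. borel)"

section \<open>Gaussian products as densities; translation and rotation invariance\<close>

lemma prob_space_std_gauss: "prob_space std_gauss"
 by (rule prob_space_normal_density) simp

interpretation std_gauss: prob_space std_gauss
 by (rule prob_space_std_gauss)

interpretation gaussP: product_sigma_finite "\<lambda>_::'i. std_gauss"
 by standard

interpretation lborelP: product_sigma_finite "\<lambda>_::'i. lborel :: real measure"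
 by standard

lemma prob_space_gauss: "prob_space (gauss I)"
 unfolding gauss_def by (rule prob_space_PiM) (rule prob_space_std_gauss)

lemma nn_integral_gauss_const: "(\<integral>\<^sup>+x. c \<partial>gauss I) = c"
 using prob_space.emeasure_space_1[OF prob_space_gauss[of I]] by simp_all

lemma sets_gauss [measurable_cong]: "sets (gauss I) = sets (PiM I (\<lambda>_. borel))"
 unfolding gauss_def by (rule sets_PiM_cong) auto

lemma space_gauss: "space (gauss I) = (\<Pi>\<^sub>E i\<in>I. UNIV)"
 unfolding gauss_def by (simp add: space_PiM)

text \<open>Product measures are determined by boxes, and on a box the density factors into
  one-dimensional integrals. The density form makes translation and scaling of Lebesgue measure
  available.\<close>

lemma gauss_eq_density:
 assumes "finite I"
 shows "gauss I = density (PiM I (\<lambda>_. lborel)) (\<lambda>x. \<Prod>i\<in>I. ennreal (std_normal_density (x i)))"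
 unfolding gauss_def
proof (rule gaussP.PiM_eqI[symmetric, OF assms])
 show "sets (density (PiM I (\<lambda>_. lborel)) (\<lambda>x. \<Prod>i\<in>I. ennreal (std_normal_density (x i))))
   = sets (PiM I (\<lambda>_. std_gauss))"
  by (simp, rule sets_PiM_cong) auto
 fix A :: "'a \<Rightarrow> real set" assume A: "\<And>i. i \<in> I \<Longrightarrow> A i \<in> sets std_gauss"
 have A': "\<And>i. i \<in> I \<Longrightarrow> A i \<in> sets borel" using A by simp
 have PA: "Pi\<^sub>E I A \<in> sets (PiM I (\<lambda>_. lborel))"
  using assms A' by (intro sets_PiM_I_finite) auto
 have "emeasure (density (PiM I (\<lambda>_. lborel)) (\<lambda>x. \<Prod>i\<in>I. ennreal (std_normal_density (x i)))) (Pi\<^sub>E I A)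
  = (\<integral>\<^sup>+x. (\<Prod>i\<in>I. ennreal (std_normal_density (x i))) * indicator (Pi\<^sub>E I A) x \<partial>PiM I (\<lambda>_. lborel))"
  by (rule emeasure_density[OF _ PA]) measurable
 also have "... = (\<integral>\<^sup>+x. (\<Prod>i\<in>I. ennreal (std_normal_density (x i)) * indicator (A i) (x i)) \<partial>PiM I (\<lambda>_. lborel))"
 proof (rule nn_integral_cong)
  fix x :: "'a \<Rightarrow> real" assume x: "x \<in> space (PiM I (\<lambda>_. lborel))"
  have "indicator (Pi\<^sub>E I A) x = (\<Prod>i\<in>I. indicator (A i) (x i) :: ennreal)"
  proof (cases "x \<in> Pi\<^sub>E I A")
   case True
   then show ?thesis by (auto simp: indicator_def PiE_def Pi_def intro!: prod.neutral[symmetric])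
  next
   case False
   then obtain i where "i \<in> I" "x i \<notin> A i" using x by (auto simp: space_PiM PiE_def Pi_def)
   then have "(\<Prod>i\<in>I. indicator (A i) (x i) :: ennreal) = 0"
    using assms by (intro prod_zero bexI[of _ i]) auto
   then show ?thesis using False by simp
  qed
  then show "(\<Prod>i\<in>I. ennreal (std_normal_density (x i))) * indicator (Pi\<^sub>E I A) x
   = (\<Prod>i\<in>I. ennreal (std_normal_density (x i)) * indicator (A i) (x i))"
   by (simp add: prod.distrib)
 qed
 also have "... = (\<Prod>i\<in>I. \<integral>\<^sup>+t. ennreal (std_normal_density t) * indicator (A i) t \<partial>lborel)"
  using A' by (intro lborelP.product_nn_integral_prod assms) auto
 also have "... = (\<Prod>i\<in>I. emeasure std_gauss (A i))"
  by (intro prod.cong refl, subst emeasure_density) (use A' in auto)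
 finally show "emeasure (density (PiM I (\<lambda>_. lborel)) (\<lambda>x. \<Prod>i\<in>I. ennreal (std_normal_density (x i)))) (Pi\<^sub>E I A)
   = (\<Prod>i\<in>I. emeasure std_gauss (A i))" .
qed

lemma prod_std_normal_density:
 assumes "finite I"
 shows "(\<Prod>i\<in>I. ennreal (std_normal_density (x i))) = ennreal ((1 / sqrt (2 * pi)) ^ card I) * ennreal (exp (- (\<Sum>i\<in>I. (x i)^2) / 2))"
proof -
 have "(\<Prod>i\<in>I. ennreal (std_normal_density (x i))) = ennreal (\<Prod>i\<in>I. std_normal_density (x i))"
  by (rule prod_ennreal) auto
 also have "(\<Prod>i\<in>I. std_normal_density (x i)) = (1 / sqrt (2 * pi)) ^ card I * (\<Prod>i\<in>I. exp (- (x i)\<^sup>2 / 2))"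
  unfolding std_normal_density_def prod.distrib by simp
 also have "(\<Prod>i\<in>I. exp (- (x i)\<^sup>2 / 2)) = exp (- (\<Sum>i\<in>I. (x i)^2) / 2)"
  by (simp only: exp_sum[OF assms, symmetric] sum_divide_distrib[symmetric] sum_negf)
 finally show ?thesis by (simp add: ennreal_mult'')
qed

text \<open>Only the squared norm of \<open>x\<close> enters the weight; this is the source of both
  rotation invariance and the polar formula.\<close>

lemma nn_integral_gauss:
 assumes "finite I" and [measurable]: "f \<in> borel_measurable (PiM I (\<lambda>_. borel))"
 shows "(\<integral>\<^sup>+x. f x \<partial>gauss I) = ennreal ((1 / sqrt (2 * pi)) ^ card I) *
  (\<integral>\<^sup>+x. ennreal (exp (- (\<Sum>i\<in>I. (x i)^2) / 2)) * f x \<partial>PiM I (\<lambda>_. lborel))"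
proof -
 have "(\<integral>\<^sup>+x. f x \<partial>gauss I) = (\<integral>\<^sup>+x. (\<Prod>i\<in>I. ennreal (std_normal_density (x i))) * f x \<partial>PiM I (\<lambda>_. lborel))"
  unfolding gauss_eq_density[OF assms(1)] by (rule nn_integral_density) measurable
 also have "... = (\<integral>\<^sup>+x. ennreal ((1 / sqrt (2 * pi)) ^ card I) * (ennreal (exp (- (\<Sum>i\<in>I. (x i)^2) / 2)) * f x) \<partial>PiM I (\<lambda>_. lborel))"
  unfolding prod_std_normal_density[OF assms(1)] mult.assoc ..
 also have "... = ennreal ((1 / sqrt (2 * pi)) ^ card I) *
  (\<integral>\<^sup>+x. ennreal (exp (- (\<Sum>i\<in>I. (x i)^2) / 2)) * f x \<partial>PiM I (\<lambda>_. lborel))"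
  by (rule nn_integral_cmult) measurable
 finally show ?thesis .
qed

text \<open>A translate of a box is a box with translated sides, so the one-dimensional invariance
  suffices. Translations are the only changes of variables behind rotation invariance; no
  determinant occurs.\<close>

lemma nn_integral_lborelP_translate:
 fixes y :: "'i \<Rightarrow> real"
 assumes I: "finite I" and f[measurable]: "f \<in> borel_measurable (PiM I (\<lambda>_. borel))"
 shows "(\<integral>\<^sup>+x. f (\<lambda>i\<in>I. x i + y i) \<partial>PiM I (\<lambda>_. lborel)) = (\<integral>\<^sup>+x. f x \<partial>PiM I (\<lambda>_. lborel))"
proof -
 let ?L = "PiM I (\<lambda>_. lborel :: real measure)"
 let ?T = "\<lambda>x. \<lambda>i\<in>I. x i + y i"
 have T[measurable]: "?T \<in> measurable ?L ?L" by measurable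
 have "distr ?L ?L ?T = ?L"
 proof (rule lborelP.PiM_eqI[OF I])
  fix A :: "'i \<Rightarrow> real set" assume A: "\<And>i. i \<in> I \<Longrightarrow> A i \<in> sets lborel"
  have PA: "Pi\<^sub>E I A \<in> sets ?L" using I A by (intro sets_PiM_I_finite) auto
  have "emeasure (distr ?L ?L ?T) (Pi\<^sub>E I A) = emeasure ?L (?T -` Pi\<^sub>E I A \<inter> space ?L)"
   by (rule emeasure_distr[OF T PA])
  also have "?T -` Pi\<^sub>E I A \<inter> space ?L = Pi\<^sub>E I (\<lambda>i. (\<lambda>t. t + y i) -` A i)"
   by (auto simp: space_PiM PiE_def Pi_def)
  also have "emeasure ?L ... = (\<Prod>i\<in>I. emeasure lborel ((\<lambda>t. t + y i) -` A i))"
  proof (rule lborelP.emeasure_PiM[OF I])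
   fix i assume "i \<in> I"
   then have "(\<lambda>t. t + y i) -` A i \<inter> space borel \<in> sets borel"
    using A by (intro measurable_sets[where A=borel]) auto
   then show "(\<lambda>t. t + y i) -` A i \<in> sets lborel" by simp
  qed
  also have "... = (\<Prod>i\<in>I. emeasure lborel (A i))"
  proof (rule prod.cong[OF refl])
   fix i assume i: "i \<in> I"
   have "emeasure lborel (A i) = emeasure (distr lborel borel ((+) (y i))) (A i)"
    by (simp add: lborel_distr_plus)
   also have "... = emeasure lborel ((\<lambda>t. t + y i) -` A i)"
    using A[OF i] by (subst emeasure_distr) (auto simp: add.commute intro!: arg_cong[where f="emeasure lborel"])
   finally show "emeasure lborel ((\<lambda>t. t + y i) -` A i) = emeasure lborel (A i)" by simp
  qed
  finally show "emeasure (distr ?L ?L ?T) (Pi\<^sub>E I A) = (\<Prod>i\<in>I. emeasure lborel (A i))" .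
 qed simp
 then have "(\<integral>\<^sup>+x. f x \<partial>?L) = (\<integral>\<^sup>+x. f x \<partial>distr ?L ?L ?T)" by simp
 also have "... = (\<integral>\<^sup>+x. f (?T x) \<partial>?L)"
  by (rule nn_integral_distr) measurable
 finally show ?thesis by simp
qed

text \<open>Orthonormal rows without completeness: \<open>J\<close> may be smaller than
  \<open>I\<close>. One notion thus covers full rotations, selections of coordinates and single
  linear functionals, and its invariance lemma also integrates out the remaining directions.\<close>

definition orthonormal_on :: "'j set \<Rightarrow> 'i set \<Rightarrow> ('j \<Rightarrow> 'i \<Rightarrow> real) \<Rightarrow> bool" where
 "orthonormal_on J I Q \<longleftrightarrow> (\<forall>j\<in>J. \<forall>j'\<in>J. (\<Sum>i\<in>I. Q j i * Q j' i) = (if j = j' then 1 else 0))"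

text \<open>The Haar-measure trick: averaging over the translations \<open>x \<mapsto> x + Q\<^sup>T y\<close> shows that
 the push-forward of the Gaussian weight under \<open>Q\<close> is a multiple of the Gaussian weight, and the
 total masses agree.\<close>
lemma nn_integral_gauss_orthonormal:
 fixes Q :: "'j \<Rightarrow> 'i \<Rightarrow> real" and F :: "('j \<Rightarrow> real) \<Rightarrow> ennreal"
 assumes fI: "finite I" and fJ: "finite J" and Q: "orthonormal_on J I Q"
  and F[measurable]: "F \<in> borel_measurable (PiM J (\<lambda>_. borel))"
 shows "(\<integral>\<^sup>+x. F (\<lambda>j\<in>J. \<Sum>i\<in>I. Q j i * x i) \<partial>gauss I) = (\<integral>\<^sup>+x. F x \<partial>gauss J)"
proof -
 let ?LI = "PiM I (\<lambda>_. lborel :: real measure)"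
 let ?LJ = "PiM J (\<lambda>_. lborel :: real measure)"
 define q where "q = (\<lambda>x j. \<Sum>i\<in>I. Q j i * x i)"
 define a where "a = (\<lambda>y i. \<Sum>j\<in>J. Q j i * y j)"
 define eI where "eI = (\<lambda>x. ennreal (exp (- (\<Sum>i\<in>I. (x i :: real)^2) / 2)))"
 define eJ where "eJ = (\<lambda>x. ennreal (exp (- (\<Sum>j\<in>J. (x j :: real)^2) / 2)))"
 \<comment> \<open>\<open>h\<close> is the Gaussian weight of the part of \<open>x\<close>
   orthogonal to the rows of \<open>Q\<close>; by \<open>sq_add\<close> it does not change under the
   translations by \<open>a y\<close>.\<close>
 define h where "h = (\<lambda>x. ennreal (exp (- ((\<Sum>i\<in>I. (x i :: real)^2) - (\<Sum>j\<in>J. (q x j)^2)) / 2)))"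
 define cI where "cI = ennreal ((1 / sqrt (2 * pi)) ^ card I)"
 define cJ where "cJ = ennreal ((1 / sqrt (2 * pi)) ^ card J)"
 \<comment> \<open>\<open>ph\<close> has total mass one; its translates insert the extra variable
   \<open>y\<close> over which the translations are averaged.\<close>
 define ph where "ph = (\<lambda>x. cJ * eJ x)"
 have cJ0: "cJ \<noteq> 0" "cJ \<noteq> \<infinity>" unfolding cJ_def by auto
 interpret LI: sigma_finite_measure ?LI by (rule lborelP.sigma_finite[OF fI])
 interpret LJ: sigma_finite_measure ?LJ by (rule lborelP.sigma_finite[OF fJ])
 interpret LIJ: pair_sigma_finite ?LI ?LJ ..
 have [measurable]: "\<And>j. (\<lambda>x. q x j) \<in> borel_measurable (PiM I (\<lambda>_. borel))" unfolding q_def by measurable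
 have [measurable]: "eI \<in> borel_measurable (PiM I (\<lambda>_. borel))" unfolding eI_def by measurable
 have [measurable]: "eJ \<in> borel_measurable (PiM J (\<lambda>_. borel))" unfolding eJ_def by measurable
 have [measurable]: "h \<in> borel_measurable (PiM I (\<lambda>_. borel))" unfolding h_def by measurable
 have [measurable]: "ph \<in> borel_measurable (PiM J (\<lambda>_. borel))" unfolding ph_def by measurable
 have q_add: "q (\<lambda>i\<in>I. x i + a y i) j = q x j + y j" if "j \<in> J" for x y j
 proof -
  have "q (\<lambda>i\<in>I. x i + a y i) j = q x j + (\<Sum>i\<in>I. Q j i * a y i)"
   unfolding q_def by (simp add: sum.distrib distrib_left)
  also have "(\<Sum>i\<in>I. Q j i * a y i) = (\<Sum>j'\<in>J. (\<Sum>i\<in>I. Q j i * Q j' i) * y j')"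
   unfolding a_def sum_distrib_left sum_distrib_right by (subst sum.swap) (simp add: mult.assoc)
  also have "... = (\<Sum>j'\<in>J. if j = j' then y j' else 0)"
   using Q that unfolding orthonormal_on_def by (intro sum.cong) auto
  also have "... = y j" using fJ that by simp
  finally show ?thesis .
 qed
 have sq_add: "(\<Sum>i\<in>I. (x i + a y i)^2) = (\<Sum>i\<in>I. (x i)^2) - (\<Sum>j\<in>J. (q x j)^2) + (\<Sum>j\<in>J. (q x j + y j)^2)" for x y
 proof -
  have 1: "(\<Sum>i\<in>I. x i * a y i) = (\<Sum>j\<in>J. q x j * y j)"
   unfolding a_def q_def sum_distrib_left sum_distrib_right by (subst sum.swap) (simp add: mult_ac)
  have 2: "(\<Sum>i\<in>I. a y i * a y i) = (\<Sum>j\<in>J. y j * y j)"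
  proof -
   have "(\<Sum>i\<in>I. a y i * a y i) = (\<Sum>j\<in>J. q (a y) j * y j)"
    unfolding a_def q_def sum_distrib_left sum_distrib_right by (subst sum.swap) (simp add: mult_ac)
   also have "... = (\<Sum>j\<in>J. y j * y j)"
   proof (rule sum.cong[OF refl])
    fix j assume "j \<in> J"
    have "q (a y) j = q (\<lambda>i\<in>I. 0 + a y i) j" unfolding q_def by simp
    also have "... = q (\<lambda>_. 0) j + y j" using q_add[OF \<open>j \<in> J\<close>, of "\<lambda>_. 0" y] by simp
    finally show "q (a y) j * y j = y j * y j" by (simp add: q_def)
   qed
   finally show ?thesis .
  qed
  have 3: "(\<Sum>i\<in>I. (x i + a y i)^2) = (\<Sum>i\<in>I. (x i)^2) + (\<Sum>i\<in>I. a y i * a y i) + 2 * (\<Sum>i\<in>I. x i * a y i)"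
   unfolding power2_sum sum.distrib by (simp add: power2_eq_square sum_distrib_left mult.assoc)
  have 4: "(\<Sum>j\<in>J. (q x j + y j)^2) = (\<Sum>j\<in>J. (q x j)^2) + (\<Sum>j\<in>J. y j * y j) + 2 * (\<Sum>j\<in>J. q x j * y j)"
   unfolding power2_sum sum.distrib by (simp add: power2_eq_square sum_distrib_left mult.assoc)
  show ?thesis unfolding 3 4 1 2 by simp
 qed
 have eI_add: "eI (\<lambda>i\<in>I. x i + a y i) = h x * eJ (\<lambda>j\<in>J. y j + q x j)" for x y
 proof -
  have "(\<Sum>i\<in>I. ((\<lambda>i\<in>I. x i + a y i) i)^2) = (\<Sum>i\<in>I. (x i + a y i)^2)" by simp
  moreover have "(\<Sum>j\<in>J. ((\<lambda>j\<in>J. y j + q x j) j)^2) = (\<Sum>j\<in>J. (q x j + y j)^2)" by (simp add: add.commute)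
  ultimately show ?thesis
   unfolding eI_def h_def eJ_def sq_add
   by (simp add: ennreal_mult''[symmetric] exp_add[symmetric] diff_divide_distrib add_divide_distrib)
 qed
 have mass: "(\<integral>\<^sup>+y. ph y \<partial>?LJ) = 1"
 proof -
  have "(\<integral>\<^sup>+y. ph y \<partial>?LJ) = (\<integral>\<^sup>+y. 1 \<partial>gauss J)"
   using nn_integral_gauss[OF fJ, of "\<lambda>_. 1"] unfolding ph_def cJ_def eJ_def
   by (simp add: nn_integral_cmult)
  then show ?thesis using prob_space.emeasure_space_1[OF prob_space_gauss[of J]] by simp
 qed
 define K where "K = (\<integral>\<^sup>+x. h x * ph (\<lambda>j\<in>J. - q x j) \<partial>?LI)"
 have main: "(\<integral>\<^sup>+x. eI x * F (\<lambda>j\<in>J. q x j) \<partial>?LI) = K * (\<integral>\<^sup>+y. eJ y * F y \<partial>?LJ)"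
  if F[measurable]: "F \<in> borel_measurable (PiM J (\<lambda>_. borel))" for F
 proof -
  \<comment> \<open>The factor \<open>1\<close> is written as the integral of
    \<open>ph (y - q x)\<close>. After exchanging the integrals and translating \<open>x\<close> by
    \<open>a y\<close>, \<open>F\<close> sees only \<open>y + q x\<close>; translating
    \<open>y\<close> back then separates the integral of \<open>F\<close> from the rest, which is
    the constant \<open>K\<close>.\<close>
  have "(\<integral>\<^sup>+x. eI x * F (\<lambda>j\<in>J. q x j) \<partial>?LI)
   = (\<integral>\<^sup>+x. (\<integral>\<^sup>+y. eI x * F (\<lambda>j\<in>J. q x j) * ph (\<lambda>j\<in>J. y j + - q x j) \<partial>?LJ) \<partial>?LI)"
  proof (rule nn_integral_cong)
   fix x
   have "(\<integral>\<^sup>+y. ph (\<lambda>j\<in>J. y j + - q x j) \<partial>?LJ) = 1"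
    by (subst nn_integral_lborelP_translate[OF fJ]) (auto simp: mass)
   then show "eI x * F (\<lambda>j\<in>J. q x j) = (\<integral>\<^sup>+y. eI x * F (\<lambda>j\<in>J. q x j) * ph (\<lambda>j\<in>J. y j + - q x j) \<partial>?LJ)"
    by (subst nn_integral_cmult) auto
  qed
  also have "... = (\<integral>\<^sup>+y. (\<integral>\<^sup>+x. eI x * F (\<lambda>j\<in>J. q x j) * ph (\<lambda>j\<in>J. y j + - q x j) \<partial>?LI) \<partial>?LJ)"
   by (rule LIJ.Fubini'[symmetric]) measurable
  also have "... = (\<integral>\<^sup>+y. (\<integral>\<^sup>+x. h x * eJ (\<lambda>j\<in>J. y j + q x j) * F (\<lambda>j\<in>J. y j + q x j) * ph (\<lambda>j\<in>J. - q x j) \<partial>?LI) \<partial>?LJ)"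
  proof (rule nn_integral_cong)
   fix y
   have *: "eI (\<lambda>i\<in>I. x i + a y i) * F (\<lambda>j\<in>J. q (\<lambda>i\<in>I. x i + a y i) j) * ph (\<lambda>j\<in>J. y j + - q (\<lambda>i\<in>I. x i + a y i) j)
    = h x * eJ (\<lambda>j\<in>J. y j + q x j) * F (\<lambda>j\<in>J. y j + q x j) * ph (\<lambda>j\<in>J. - q x j)" for x
   proof -
    have "(\<lambda>j\<in>J. q (\<lambda>i\<in>I. x i + a y i) j) = (\<lambda>j\<in>J. y j + q x j)"
     "(\<lambda>j\<in>J. y j + - q (\<lambda>i\<in>I. x i + a y i) j) = (\<lambda>j\<in>J. - q x j)"
     by (auto simp: q_add intro!: restrict_ext)
    then show ?thesis by (simp only: eI_add)
   qed
   show "(\<integral>\<^sup>+x. eI x * F (\<lambda>j\<in>J. q x j) * ph (\<lambda>j\<in>J. y j + - q x j) \<partial>?LI)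
    = (\<integral>\<^sup>+x. h x * eJ (\<lambda>j\<in>J. y j + q x j) * F (\<lambda>j\<in>J. y j + q x j) * ph (\<lambda>j\<in>J. - q x j) \<partial>?LI)"
    unfolding *[symmetric]
    by (subst nn_integral_lborelP_translate[OF fI, of "\<lambda>x. eI x * F (\<lambda>j\<in>J. q x j) * ph (\<lambda>j\<in>J. y j + - q x j)" "a y"]) auto
  qed
  also have "... = (\<integral>\<^sup>+x. (\<integral>\<^sup>+y. h x * eJ (\<lambda>j\<in>J. y j + q x j) * F (\<lambda>j\<in>J. y j + q x j) * ph (\<lambda>j\<in>J. - q x j) \<partial>?LJ) \<partial>?LI)"
   by (rule LIJ.Fubini') measurable
  also have "... = (\<integral>\<^sup>+x. h x * ph (\<lambda>j\<in>J. - q x j) * (\<integral>\<^sup>+y. eJ y * F y \<partial>?LJ) \<partial>?LI)"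
  proof (rule nn_integral_cong)
   fix x
   have "(\<integral>\<^sup>+y. h x * eJ (\<lambda>j\<in>J. y j + q x j) * F (\<lambda>j\<in>J. y j + q x j) * ph (\<lambda>j\<in>J. - q x j) \<partial>?LJ)
    = (\<integral>\<^sup>+y. (h x * ph (\<lambda>j\<in>J. - q x j)) * (eJ (\<lambda>j\<in>J. y j + q x j) * F (\<lambda>j\<in>J. y j + q x j)) \<partial>?LJ)"
    by (simp add: mult_ac)
   also have "... = h x * ph (\<lambda>j\<in>J. - q x j) * (\<integral>\<^sup>+y. eJ (\<lambda>j\<in>J. y j + q x j) * F (\<lambda>j\<in>J. y j + q x j) \<partial>?LJ)"
    by (rule nn_integral_cmult) measurable
   also have "(\<integral>\<^sup>+y. eJ (\<lambda>j\<in>J. y j + q x j) * F (\<lambda>j\<in>J. y j + q x j) \<partial>?LJ) = (\<integral>\<^sup>+y. eJ y * F y \<partial>?LJ)"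
    by (rule nn_integral_lborelP_translate[OF fJ, of "\<lambda>y. eJ y * F y" "q x"]) measurable
   finally show "(\<integral>\<^sup>+y. h x * eJ (\<lambda>j\<in>J. y j + q x j) * F (\<lambda>j\<in>J. y j + q x j) * ph (\<lambda>j\<in>J. - q x j) \<partial>?LJ)
    = h x * ph (\<lambda>j\<in>J. - q x j) * (\<integral>\<^sup>+y. eJ y * F y \<partial>?LJ)" .
  qed
  also have "... = K * (\<integral>\<^sup>+y. eJ y * F y \<partial>?LJ)"
   unfolding K_def by (rule nn_integral_multc) measurable
  finally show ?thesis .
 qed
 have gI: "(\<integral>\<^sup>+x. F (\<lambda>j\<in>J. q x j) \<partial>gauss I) = cI * K * (\<integral>\<^sup>+y. eJ y * F y \<partial>?LJ)"
  if F[measurable]: "F \<in> borel_measurable (PiM J (\<lambda>_. borel))" for F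
  using nn_integral_gauss[OF fI, of "\<lambda>x. F (\<lambda>j\<in>J. q x j)"] main[OF F]
  by (simp add: cI_def eI_def mult.assoc)
 have gJ: "(\<integral>\<^sup>+x. F x \<partial>gauss J) = cJ * (\<integral>\<^sup>+y. eJ y * F y \<partial>?LJ)"
  if F[measurable]: "F \<in> borel_measurable (PiM J (\<lambda>_. borel))" for F
  using nn_integral_gauss[OF fJ F] by (simp add: cJ_def eJ_def)
 define m where "m = (\<integral>\<^sup>+y. eJ y * 1 \<partial>?LJ)"
 have mI: "cI * K * m = 1" unfolding m_def using gI[of "\<lambda>_. 1"] by (simp add: prob_space.emeasure_space_1[OF prob_space_gauss])
 have mJ: "cJ * m = 1" unfolding m_def using gJ[of "\<lambda>_. 1"] by (simp add: prob_space.emeasure_space_1[OF prob_space_gauss])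
 have eq: "cI * K = cJ"
 proof -
  have "cI * K = cI * K * (cJ * m)" unfolding mJ by simp
  also have "... = (cI * K * m) * cJ" by (simp only: mult_ac)
  also have "... = cJ" by (simp only: mI mult_1_left)
  finally show ?thesis .
 qed
 define X where "X = (\<integral>\<^sup>+y. eJ y * F y \<partial>?LJ)"
 have g1: "(\<integral>\<^sup>+x. F (\<lambda>j\<in>J. q x j) \<partial>gauss I) = cI * K * X"
  using gI[OF F] by (simp only: X_def)
 have g2: "(\<integral>\<^sup>+x. F x \<partial>gauss J) = cJ * X"
  using gJ[OF F] by (simp only: X_def)
 have g3: "(\<integral>\<^sup>+x. F (\<lambda>j\<in>J. \<Sum>i\<in>I. Q j i * x i) \<partial>gauss I) = cI * K * X"
  using g1 by (simp only: q_def)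
 show ?thesis by (rule trans[OF g3], rule trans[OF _ g2[symmetric]], simp only: eq)
qed

section \<open>Selecting, splitting and projecting Gaussian coordinates; absolute moments\<close>

lemma ennreal_divide_mult_cancel:
 fixes a c x :: ennreal
 assumes "c \<noteq> 0" "c \<noteq> \<infinity>"
 shows "a / c * (c * x) = a * x"
 using assms by (metis ennreal_divide_times ennreal_mult_divide_eq infinity_ennreal_def mult.commute)

lemma sum_cases_index:
 fixes f :: "'i \<Rightarrow> real"
 assumes "finite I" "i0 \<in> I"
 shows "(\<Sum>i\<in>I. (if i = i0 then 1 else 0) * f i) = f i0"
 using assms by (simp add: if_distrib[where f="\<lambda>c. c * _"] cong: if_cong)

text \<open>A selection of coordinates is a matrix with rows taken from the identity; injectivity of
  \<open>h\<close> is what makes these rows orthonormal.\<close>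

lemma nn_integral_gauss_reindex:
 fixes h :: "'j \<Rightarrow> 'i"
 assumes fI: "finite I" and fJ: "finite J" and h: "inj_on h J" "h ` J \<subseteq> I"
  and F: "F \<in> borel_measurable (PiM J (\<lambda>_. borel))"
 shows "(\<integral>\<^sup>+x. F (\<lambda>j\<in>J. x (h j)) \<partial>gauss I) = (\<integral>\<^sup>+x. F x \<partial>gauss J)"
proof -
 define Q where "Q = (\<lambda>j i. if i = h j then 1 else 0 :: real)"
 have Q: "(\<Sum>i\<in>I. Q j i * f i) = f (h j)" if "j \<in> J" for j and f :: "'i \<Rightarrow> real"
  unfolding Q_def using that h fI by (intro sum_cases_index) auto
 have "orthonormal_on J I Q"
  unfolding orthonormal_on_def
 proof (intro ballI)
  fix j j' assume j: "j \<in> J" "j' \<in> J"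
  have "(\<Sum>i\<in>I. Q j i * Q j' i) = Q j' (h j)" by (rule Q[OF j(1)])
  also have "... = (if j = j' then 1 else 0)"
   using h(1) j by (auto simp: Q_def inj_on_def)
  finally show "(\<Sum>i\<in>I. Q j i * Q j' i) = (if j = j' then 1 else 0)" .
 qed
 from nn_integral_gauss_orthonormal[OF fI fJ this F]
 have "(\<integral>\<^sup>+x. F (\<lambda>j\<in>J. \<Sum>i\<in>I. Q j i * x i) \<partial>gauss I) = (\<integral>\<^sup>+x. F x \<partial>gauss J)" .
 moreover have "(\<lambda>j\<in>J. \<Sum>i\<in>I. Q j i * x i) = (\<lambda>j\<in>J. x (h j))" for x :: "'i \<Rightarrow> real"
  by (auto simp: Q intro!: restrict_ext)
 ultimately show ?thesis by simp
qed

lemma nn_integral_gauss_fold: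
 assumes "finite I" "finite J" "I \<inter> J = {}" and F: "F \<in> borel_measurable (PiM (I \<union> J) (\<lambda>_. borel))"
 shows "(\<integral>\<^sup>+x. F x \<partial>gauss (I \<union> J)) = (\<integral>\<^sup>+x. (\<integral>\<^sup>+y. F (merge I J (x, y)) \<partial>gauss J) \<partial>gauss I)"
 using assms sets_gauss unfolding gauss_def
 by (intro gaussP.product_nn_integral_fold) (auto cong: measurable_cong_sets)

text \<open>The independent blocks \<open>G\<close> and \<open>H\<close> carry overlapping index
  sets, so their joint law lives on the disjoint sum. \<open>nn_integral_gauss_mix\<close> uses this
  form.\<close>

lemma nn_integral_gauss_Plus:
 fixes F :: "('i + 'j \<Rightarrow> real) \<Rightarrow> ennreal"
 assumes fI: "finite I" and fJ: "finite J"
  and F[measurable]: "F \<in> borel_measurable (PiM (I <+> J) (\<lambda>_. borel))"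
 shows "(\<integral>\<^sup>+x. F x \<partial>gauss (I <+> J))
  = (\<integral>\<^sup>+x. (\<integral>\<^sup>+y. F (\<lambda>s\<in>I <+> J. case s of Inl i \<Rightarrow> x i | Inr j \<Rightarrow> y j) \<partial>gauss J) \<partial>gauss I)"
proof -
 let ?I = "Inl ` I :: ('i + 'j) set" and ?J = "Inr ` J :: ('i + 'j) set"
 have IJ: "I <+> J = ?I \<union> ?J" by (auto simp: Plus_def)
 let ?c = "\<lambda>x y. \<lambda>s\<in>I <+> J. case s of Inl i \<Rightarrow> x i | Inr j \<Rightarrow> y j"
 have cm: "(\<lambda>p. ?c (fst p) (snd p)) \<in> measurable (PiM I (\<lambda>_. borel) \<Otimes>\<^sub>M PiM J (\<lambda>_. borel)) (PiM (I <+> J) (\<lambda>_. borel))"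
  by (rule measurable_restrict) (auto split: sum.split)
 have cm2: "(\<lambda>p. F (?c (fst p) (snd p))) \<in> borel_measurable (PiM I (\<lambda>_. borel) \<Otimes>\<^sub>M PiM J (\<lambda>_. borel))"
  by (rule measurable_compose[OF cm F])
 have cy: "(\<lambda>y. F (?c x y)) \<in> borel_measurable (PiM J (\<lambda>_. borel))" for x :: "'i \<Rightarrow> real"
  by (rule measurable_compose[OF _ F], rule measurable_restrict) (auto split: sum.split)
 have sf: "sigma_finite_measure (gauss J)"
  by (rule prob_space_imp_sigma_finite[OF prob_space_gauss])
 have cx: "(\<lambda>x. \<integral>\<^sup>+y. F (?c x y) \<partial>gauss J) \<in> borel_measurable (PiM I (\<lambda>_. borel))"
 proof -
  have "(\<lambda>p. F (?c (fst p) (snd p))) \<in> borel_measurable (PiM I (\<lambda>_. borel) \<Otimes>\<^sub>M gauss J)"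
   using cm2 by (subst measurable_cong_sets[OF sets_pair_measure_cong[OF refl sets_gauss] refl])
  then show ?thesis
   using sigma_finite_measure.borel_measurable_nn_integral[OF sf, of "\<lambda>x y. F (?c x y)" "PiM I (\<lambda>_. borel)"]
   by (simp add: case_prod_unfold)
 qed
 have "(\<integral>\<^sup>+x. F x \<partial>gauss (I <+> J)) = (\<integral>\<^sup>+x. (\<integral>\<^sup>+y. F (merge ?I ?J (x, y)) \<partial>gauss ?J) \<partial>gauss ?I)"
  unfolding IJ using fI fJ F by (intro nn_integral_gauss_fold) (auto simp: IJ)
 also have "... = (\<integral>\<^sup>+x. (\<integral>\<^sup>+y. F (?c (\<lambda>i\<in>I. x (Inl i)) (\<lambda>j\<in>J. y (Inr j))) \<partial>gauss ?J) \<partial>gauss ?I)"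
 proof -
  have "merge ?I ?J (x, y) = ?c (\<lambda>i\<in>I. x (Inl i)) (\<lambda>j\<in>J. y (Inr j))" for x y :: "'i + 'j \<Rightarrow> real"
   by (auto simp: merge_def fun_eq_iff Plus_def split: sum.split)
  then show ?thesis by (simp only:)
 qed
 also have "... = (\<integral>\<^sup>+x. (\<integral>\<^sup>+y. F (?c (\<lambda>i\<in>I. x (Inl i)) y) \<partial>gauss J) \<partial>gauss ?I)"
  by (subst nn_integral_gauss_reindex[of ?J J Inr, OF _ _ _ _ cy]) (use fJ in auto)
 also have "... = (\<integral>\<^sup>+x. (\<integral>\<^sup>+y. F (?c x y) \<partial>gauss J) \<partial>gauss I)"
  by (subst nn_integral_gauss_reindex[of ?I I Inl, OF _ _ _ _ cx]) (use fI in auto)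
 finally show ?thesis .
qed

lemma borel_measurable_nn_integral_gauss:
 assumes "(\<lambda>z. f (fst z) (snd z)) \<in> borel_measurable (N \<Otimes>\<^sub>M gauss J)"
 shows "(\<lambda>x. \<integral>\<^sup>+y. f x y \<partial>gauss J) \<in> borel_measurable N"
 using assms by (intro sigma_finite_measure.borel_measurable_nn_integral prob_space_imp_sigma_finite prob_space_gauss) (simp add: case_prod_beta')

lemma nn_integral_gauss_singleton:
 assumes [measurable]: "f \<in> borel_measurable borel"
 shows "(\<integral>\<^sup>+x. f (x i) \<partial>gauss {i}) = (\<integral>\<^sup>+z. f z \<partial>std_gauss)"
 unfolding gauss_def by (rule gaussP.product_nn_integral_singleton) simp

text \<open>After division by \<open>s\<close> the functional \<open>c\<close> is a single
  orthonormal row. The case \<open>s = 0\<close> is included so that later arguments need no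
  nondegeneracy.\<close>

lemma nn_integral_gauss_linear:
 fixes c :: "'i \<Rightarrow> real"
 assumes fI: "finite I" and s: "(\<Sum>i\<in>I. (c i)^2) = s^2" "s \<ge> 0" and f[measurable]: "f \<in> borel_measurable borel"
 shows "(\<integral>\<^sup>+x. f (\<Sum>i\<in>I. c i * x i) \<partial>gauss I) = (\<integral>\<^sup>+z. f (s * z) \<partial>std_gauss)"
proof (cases "s = 0")
 case True
 then have "\<And>i. i \<in> I \<Longrightarrow> c i = 0" using s fI by (simp add: sum_nonneg_eq_0_iff)
 then show ?thesis using True std_gauss.emeasure_space_1 by (simp add: prob_space.emeasure_space_1[OF prob_space_gauss])
next
 case False
 define Q where "Q = (\<lambda>(_::unit) i. c i / s)"
 have "orthonormal_on {()} I Q"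
  using s(1) False unfolding orthonormal_on_def Q_def
  by (simp add: power2_eq_square[symmetric] sum_divide_distrib[symmetric] power_divide)
 from nn_integral_gauss_orthonormal[OF fI _ this, of "\<lambda>y. f (s * y ())"]
 have "(\<integral>\<^sup>+x. f (s * (\<Sum>i\<in>I. c i / s * x i)) \<partial>gauss I) = (\<integral>\<^sup>+x. f (s * x ()) \<partial>gauss {()})"
  by (simp add: Q_def)
 also have "... = (\<integral>\<^sup>+z. f (s * z) \<partial>std_gauss)"
  by (rule nn_integral_gauss_singleton[of "\<lambda>z. f (s * z)"]) simp
 finally show ?thesis using False by (simp add: sum_distrib_left)
qed

text \<open>The absolute moment of order \<open>j\<close> of a standard normal variable:
  \<open>(j - 1)!!\<close>, with an additional factor \<open>sqrt (2 / pi)\<close> for odd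
  \<open>j\<close>.\<close>

definition gmom :: "nat \<Rightarrow> real" where
 "gmom j = (if even j then fact j / (2 ^ (j div 2) * fact (j div 2)) else sqrt (2 / pi) * 2 ^ (j div 2) * fact (j div 2))"

lemma gmom_pos: "0 < gmom j"
 unfolding gmom_def by auto

lemma gmom_Suc_Suc: "gmom (j + 2) = (real j + 1) * gmom j"
proof (cases "even j")
 case True
 then obtain k where j: "j = 2 * k" by blast
 have a: "(fact (2 * k + 2) :: real) = (2 * real k + 1) * (2 * (real k + 1)) * fact (2 * k)"
  by (simp add: algebra_simps)
 have b: "(2 ^ (k + 1) * fact (k + 1) :: real) = (2 * (real k + 1)) * (2 ^ k * fact k)"
  by (simp add: algebra_simps)
 have "gmom (j + 2) = fact (2 * k + 2) / (2 ^ (k + 1) * fact (k + 1))" unfolding gmom_def j by simp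
 also have "... = (2 * real k + 1) * (fact (2 * k) / (2 ^ k * fact k))" unfolding a b by simp
 finally show ?thesis unfolding gmom_def j by simp
next
 case False
 then obtain k where j: "j = 2 * k + 1" by (metis oddE)
 show ?thesis unfolding gmom_def j by (simp add: field_simps)
qed

lemma nn_integral_gmom: "(\<integral>\<^sup>+z. ennreal (\<bar>z\<bar> ^ j) \<partial>std_gauss) = ennreal (gmom j)"
proof -
 have hb: "has_bochner_integral lborel (\<lambda>x. std_normal_density x * \<bar>x\<bar> ^ j) (gmom j)"
 proof (cases "even j")
  case True
  then obtain k where j: "j = 2 * k" by blast
  then show ?thesis using std_normal_moment_even[of k] by (simp add: gmom_def power_mult)
 next
  case False
  then obtain k where j: "j = 2 * k + 1" by (metis oddE)
  then show ?thesis using std_normal_moment_abs_odd[of k] by (simp add: gmom_def)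
 qed
 have "(\<integral>\<^sup>+z. ennreal (\<bar>z\<bar> ^ j) \<partial>std_gauss) = (\<integral>\<^sup>+x. ennreal (std_normal_density x * \<bar>x\<bar> ^ j) \<partial>lborel)"
  by (subst nn_integral_density) (auto simp: ennreal_mult'')
 also have "... = ennreal (gmom j)"
  using hb by (subst nn_integral_eq_integral) (auto simp: has_bochner_integral_iff)
 finally show ?thesis .
qed

section \<open>Polar coordinates\<close>

lemma nn_integral_lborelP_scale:
 assumes I: "finite I" and c: "c > (0::real)" and f[measurable]: "f \<in> borel_measurable (PiM I (\<lambda>_. borel))"
 shows "(\<integral>\<^sup>+x. f x \<partial>PiM I (\<lambda>_. lborel)) = ennreal (c ^ card I) * (\<integral>\<^sup>+x. f (\<lambda>i\<in>I. c * x i) \<partial>PiM I (\<lambda>_. lborel))"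
proof -
 let ?L = "PiM I (\<lambda>_. lborel :: real measure)"
 let ?T = "\<lambda>x. \<lambda>i\<in>I. c * x i"
 have T[measurable]: "?T \<in> measurable ?L ?L" by measurable
 have eq: "density (distr ?L ?L ?T) (\<lambda>_. ennreal (c ^ card I)) = ?L"
 proof (rule lborelP.PiM_eqI[OF I])
  fix A :: "'a \<Rightarrow> real set" assume A: "\<And>i. i \<in> I \<Longrightarrow> A i \<in> sets lborel"
  have PA: "Pi\<^sub>E I A \<in> sets ?L" using I A by (intro sets_PiM_I_finite) auto
  have "emeasure (density (distr ?L ?L ?T) (\<lambda>_. ennreal (c ^ card I))) (Pi\<^sub>E I A)
   = ennreal (c ^ card I) * emeasure (distr ?L ?L ?T) (Pi\<^sub>E I A)"
   using PA by (subst emeasure_density_const) auto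
  also have "emeasure (distr ?L ?L ?T) (Pi\<^sub>E I A) = emeasure ?L (?T -` Pi\<^sub>E I A \<inter> space ?L)"
   by (rule emeasure_distr[OF T PA])
  also have "?T -` Pi\<^sub>E I A \<inter> space ?L = Pi\<^sub>E I (\<lambda>i. (\<lambda>t. c * t) -` A i)"
   by (auto simp: space_PiM PiE_def Pi_def)
  also have "emeasure ?L ... = (\<Prod>i\<in>I. emeasure lborel ((\<lambda>t. c * t) -` A i))"
  proof (rule lborelP.emeasure_PiM[OF I])
   fix i assume "i \<in> I"
   then have "(\<lambda>t. c * t) -` A i \<inter> space borel \<in> sets borel"
    using A by (intro measurable_sets[where A=borel]) auto
   then show "(\<lambda>t. c * t) -` A i \<in> sets lborel" by simp
  qed
  also have "ennreal (c ^ card I) * ... = (\<Prod>i\<in>I. ennreal c * emeasure lborel ((\<lambda>t. c * t) -` A i))"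
   using c by (simp add: prod.distrib ennreal_power)
  also have "... = (\<Prod>i\<in>I. emeasure lborel (A i))"
  proof (rule prod.cong[OF refl])
   fix i assume i: "i \<in> I"
   have "emeasure lborel (A i) = emeasure (density (distr lborel borel ((*) c)) (\<lambda>_. ennreal \<bar>c\<bar>)) (A i)"
    using lborel_real_affine[of c 0] c by (simp add: comp_def)
   also have "... = ennreal c * emeasure (distr lborel borel ((*) c)) (A i)"
    using A[OF i] c by (subst emeasure_density_const) auto
   also have "... = ennreal c * emeasure lborel ((\<lambda>t. c * t) -` A i)"
    using A[OF i] by (subst emeasure_distr) auto
   finally show "ennreal c * emeasure lborel ((\<lambda>t. c * t) -` A i) = emeasure lborel (A i)" by simp
  qed
  finally show "emeasure (density (distr ?L ?L ?T) (\<lambda>_. ennreal (c ^ card I))) (Pi\<^sub>E I A) = (\<Prod>i\<in>I. emeasure lborel (A i))" .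
 qed simp
 have "(\<integral>\<^sup>+x. f x \<partial>?L) = (\<integral>\<^sup>+x. f x \<partial>density (distr ?L ?L ?T) (\<lambda>_. ennreal (c ^ card I)))" unfolding eq ..
 also have "... = (\<integral>\<^sup>+x. ennreal (c ^ card I) * f x \<partial>distr ?L ?L ?T)"
  by (rule nn_integral_density) auto
 also have "... = ennreal (c ^ card I) * (\<integral>\<^sup>+x. f x \<partial>distr ?L ?L ?T)"
  by (rule nn_integral_cmult) auto
 also have "(\<integral>\<^sup>+x. f x \<partial>distr ?L ?L ?T) = (\<integral>\<^sup>+x. f (?T x) \<partial>?L)"
  by (rule nn_integral_distr) auto
 finally show ?thesis .
qed

lemma nn_integral_lborel_even:
 fixes h :: "real \<Rightarrow> ennreal"
 assumes [measurable]: "h \<in> borel_measurable borel"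
 shows "(\<integral>\<^sup>+x. h \<bar>x\<bar> \<partial>lborel) = 2 * (\<integral>\<^sup>+x. h x * indicator {0<..} x \<partial>lborel)"
proof -
 let ?A = "\<integral>\<^sup>+x. h x * indicator {0<..} x \<partial>lborel"
 have "(\<integral>\<^sup>+x. h \<bar>x\<bar> \<partial>lborel) = (\<integral>\<^sup>+x. h x * indicator {0<..} x + h (- x) * indicator {0<..} (- x) \<partial>lborel)"
  by (rule nn_integral_cong_AE, rule AE_mp[OF AE_lborel_singleton[of 0]])
   (auto intro!: AE_I2 simp: indicator_def)
 also have "... = ?A + (\<integral>\<^sup>+x. h (- x) * indicator {0<..} (- x) \<partial>lborel)"
  by (rule nn_integral_add) auto
 also have "(\<integral>\<^sup>+x. h (- x) * indicator {0<..} (- x) \<partial>lborel) = ?A"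
  using nn_integral_real_affine[of "\<lambda>x. h x * indicator {0<..} x" "-1" 0] by simp
 finally show ?thesis by (simp add: mult_2)
qed

text \<open>By scaling, the ball of radius \<open>r\<close> has volume \<open>r ^ d * w\<close>, and
  these values determine the law of the norm. The constant stays unspecified because it cancels
  against the total Gaussian mass. The integral runs over the whole line, with
  \<open>\<bar>r\<bar>\<close>, so that it can be read as an integral against
  \<open>std_gauss\<close>.\<close>

lemma nn_integral_lborelP_radial:
 assumes I: "finite I" "I \<noteq> {}"
 shows "\<exists>w. w \<noteq> \<infinity> \<and> (\<forall>f\<in>borel_measurable borel.
  (\<integral>\<^sup>+x. f (sqrt (\<Sum>i\<in>I. (x i)^2)) \<partial>PiM I (\<lambda>_. lborel))
   = w * (\<integral>\<^sup>+r. f \<bar>r\<bar> * ennreal (\<bar>r\<bar> ^ (card I - 1)) \<partial>lborel))"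
proof -
 let ?L = "PiM I (\<lambda>_. lborel :: real measure)"
 let ?n = "\<lambda>x. sqrt (\<Sum>i\<in>I. (x i :: real)^2)"
 define d where "d = card I"
 have d: "d > 0" using I unfolding d_def by (simp add: card_gt_0_iff)
 have nm[measurable]: "?n \<in> borel_measurable (PiM I (\<lambda>_. borel))" by measurable
 have nm'[measurable]: "?n \<in> borel_measurable ?L" by measurable
 define w where "w = emeasure ?L {x \<in> space ?L. ?n x \<le> 1}"
 have wfin: "w \<noteq> \<infinity>"
 proof -
  have "w \<le> emeasure ?L (Pi\<^sub>E I (\<lambda>_. {-1..1}))"
   unfolding w_def
  proof (rule emeasure_mono)
   show "{x \<in> space ?L. ?n x \<le> 1} \<subseteq> Pi\<^sub>E I (\<lambda>_. {-1..1})"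
   proof (rule subsetI)
    fix x assume "x \<in> {x \<in> space ?L. ?n x \<le> 1}"
    then have x: "x \<in> space ?L" "?n x \<le> 1" by auto
    have "x i \<in> {-1..1}" if "i \<in> I" for i
    proof -
     have "(x i)^2 \<le> (\<Sum>i\<in>I. (x i)^2)" using that I by (intro member_le_sum) auto
     also have "... \<le> 1" using x(2) by simp
     finally have "\<bar>x i\<bar> \<le> 1" by (simp add: abs_square_le_1)
     then show ?thesis by auto
    qed
    then show "x \<in> Pi\<^sub>E I (\<lambda>_. {-1..1})" using x(1) by (auto simp: space_PiM PiE_def Pi_def)
   qed
  qed (use I in \<open>auto intro!: sets_PiM_I_finite\<close>)
  also have "... = (\<Prod>i\<in>I. emeasure lborel {-1..1::real})" using I by (intro lborelP.emeasure_PiM) auto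
  also have "... < \<infinity>" by (simp add: power_less_top_ennreal)
  finally show ?thesis by simp
 qed
 have N: "emeasure ?L {x \<in> space ?L. ?n x \<le> r} = ennreal (r ^ d) * w" if r: "r > 0" for r
 proof -
  have "emeasure ?L {x \<in> space ?L. ?n x \<le> r} = (\<integral>\<^sup>+x. indicator {x \<in> space ?L. ?n x \<le> r} x \<partial>?L)"
   by (rule nn_integral_indicator[symmetric]) measurable
  also have "... = (\<integral>\<^sup>+x. indicator {..r} (?n x) \<partial>?L)"
   by (rule nn_integral_cong) (auto simp: indicator_def)
  also have "... = ennreal (r ^ d) * (\<integral>\<^sup>+x. indicator {..r} (?n (\<lambda>i\<in>I. r * x i)) \<partial>?L)"
   unfolding d_def by (rule nn_integral_lborelP_scale[OF I(1) r]) measurable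
  also have "(\<integral>\<^sup>+x. indicator {..r} (?n (\<lambda>i\<in>I. r * x i)) \<partial>?L) = (\<integral>\<^sup>+x. indicator {x \<in> space ?L. ?n x \<le> 1} x \<partial>?L)"
  proof (rule nn_integral_cong)
   fix x assume x: "x \<in> space ?L"
   have "?n (\<lambda>i\<in>I. r * x i) = r * ?n x"
    using r by (simp add: power_mult_distrib sum_distrib_left[symmetric] real_sqrt_mult)
   then show "indicator {..r} (?n (\<lambda>i\<in>I. r * x i)) = (indicator {x \<in> space ?L. ?n x \<le> 1} x :: ennreal)"
    using x r by (auto simp: indicator_def mult_le_cancel_left1)
  qed
  also have "... = w" unfolding w_def by (rule nn_integral_indicator) measurable
  finally show ?thesis .
 qed
 let ?M = "density lborel (\<lambda>r. w * ennreal (real d * r ^ (d - 1)) * indicator {0<..} r)"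
 have eq: "distr ?L borel ?n = ?M"
 proof (rule measure_eqI_generator_eq[where E="range (\<lambda>r. {..r::real})" and \<Omega>=UNIV and A="\<lambda>i. {..real i}"])
  show "Int_stable (range (\<lambda>r. {..r::real}))"
   by (auto simp: Int_stable_def intro!: exI[of _ "min _ _"])
  fix X assume "X \<in> range (\<lambda>r. {..r::real})"
  then obtain r where X: "X = {..r}" by auto
  have 1: "emeasure (distr ?L borel ?n) {..r} = emeasure ?L {x \<in> space ?L. ?n x \<le> r}"
   by (subst emeasure_distr) (auto intro!: arg_cong[where f="emeasure ?L"])
  have 2: "emeasure ?M {..r} = w * (\<integral>\<^sup>+s. ennreal (real d * s ^ (d - 1)) * indicator {0<..r} s \<partial>lborel)"
   by (subst emeasure_density, simp, simp, subst nn_integral_cmult[symmetric], simp)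
    (auto intro!: nn_integral_cong simp: indicator_def)
  show "emeasure (distr ?L borel ?n) X = emeasure ?M X"
  proof (cases "r > 0")
   case True
   have "(\<integral>\<^sup>+s. ennreal (real d * s ^ (d - 1)) * indicator {0<..r} s \<partial>lborel)
    = (\<integral>\<^sup>+s. ennreal (real d * s ^ (d - 1)) * indicator {0..r} s \<partial>lborel)"
    by (rule nn_integral_cong_AE, rule AE_mp[OF AE_lborel_singleton[of 0]])
     (auto intro!: AE_I2 simp: indicator_def)
   also have "... = ennreal (r ^ d - 0 ^ d)"
    using True d by (intro nn_integral_FTC_Icc)
     (auto intro!: derivative_eq_intros simp: has_real_derivative_iff_has_vector_derivative[symmetric])
   finally show ?thesis unfolding X 1 2 N[OF True] using d by (simp add: mult.commute zero_power)
  next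
   case False
   \<comment> \<open>For \<open>r <= 0\<close> the set is contained in every ball of positive radius
     \<open>e\<close>, whose volume \<open>e ^ d * w\<close> tends to zero since
     \<open>d > 0\<close>.\<close>
   have "emeasure ?L {x \<in> space ?L. ?n x \<le> r} = 0"
   proof -
    have "emeasure ?L {x \<in> space ?L. ?n x \<le> r} \<le> ennreal (e ^ d) * w" if e: "e > 0" for e
     unfolding N[OF e, symmetric] using False e by (intro emeasure_mono) auto
    note b = this
    obtain W where W: "w = ennreal W" "W \<ge> 0" using wfin by (cases w) auto
    have "((\<lambda>e. ennreal (e ^ d * W)) \<longlongrightarrow> ennreal (0 ^ d * W)) (at_right 0)"
     by (intro tendsto_ennrealI tendsto_intros)
    then have "((\<lambda>e. ennreal (e ^ d) * w) \<longlongrightarrow> 0) (at_right (0::real))"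
     using d W by (simp add: ennreal_mult'' zero_power)
    then have "emeasure ?L {x \<in> space ?L. ?n x \<le> r} \<le> 0"
     by (rule tendsto_lowerbound) (auto simp: eventually_at_filter b)
    then show ?thesis by simp
   qed
   moreover have "(\<integral>\<^sup>+s. ennreal (real d * s ^ (d - 1)) * indicator {0<..r} s \<partial>lborel) = 0"
    using False by (intro nn_integral_zero') (auto simp: indicator_def)
   ultimately show ?thesis unfolding X 1 2 by simp
  qed
 next
  show "sets (distr ?L borel ?n) = sigma_sets UNIV (range (\<lambda>r. {..r}))"
   by (simp add: borel_eq_atMost)
  show "sets ?M = sigma_sets UNIV (range (\<lambda>r. {..r}))"
   by (simp add: borel_eq_atMost)
  show "(\<Union>i. {..real i}) = UNIV" by (auto simp: real_arch_simple)
  fix i :: nat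
  show "emeasure (distr ?L borel ?n) {..real i} \<noteq> \<infinity>"
  proof -
   have "emeasure (distr ?L borel ?n) {..real i} = emeasure ?L {x \<in> space ?L. ?n x \<le> real i}"
    by (subst emeasure_distr) (auto intro!: arg_cong[where f="emeasure ?L"])
   also have "... \<le> emeasure ?L {x \<in> space ?L. ?n x \<le> real i + 1}"
    by (intro emeasure_mono) auto
   also have "... < \<infinity>" using wfin by (subst N) (auto simp: ennreal_mult_less_top top.not_eq_extremum)
   finally show ?thesis by simp
  qed
 qed auto
 \<comment> \<open>\<open>w * d\<close> is the surface constant; it is halved because the integral
   over the line counts every radius twice.\<close>
 have "(\<integral>\<^sup>+x. f (?n x) \<partial>?L) = (w * ennreal (real d) / 2) * (\<integral>\<^sup>+r. f \<bar>r\<bar> * ennreal (\<bar>r\<bar> ^ (card I - 1)) \<partial>lborel)"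
  if f[measurable]: "f \<in> borel_measurable borel" for f
 proof -
  have "(\<integral>\<^sup>+x. f (?n x) \<partial>?L) = (\<integral>\<^sup>+r. f r \<partial>distr ?L borel ?n)"
   by (rule nn_integral_distr[symmetric]) measurable
  also have "... = (\<integral>\<^sup>+r. (w * ennreal (real d * r ^ (d - 1)) * indicator {0<..} r) * f r \<partial>lborel)"
   unfolding eq by (rule nn_integral_density) measurable
  also have "... = (\<integral>\<^sup>+r. (w * ennreal (real d)) * (f r * ennreal (r ^ (d - 1)) * indicator {0<..} r) \<partial>lborel)"
   by (rule nn_integral_cong) (auto simp: indicator_def ennreal_mult mult_ac)
  also have "... = (w * ennreal (real d)) * (\<integral>\<^sup>+r. (f r * ennreal (r ^ (d - 1))) * indicator {0<..} r \<partial>lborel)"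
   by (rule nn_integral_cmult) measurable
  also have "... = (w * ennreal (real d) / 2) * (2 * (\<integral>\<^sup>+r. (f r * ennreal (r ^ (d - 1))) * indicator {0<..} r \<partial>lborel))"
   by (simp add: ennreal_divide_mult_cancel)
  also have "... = (w * ennreal (real d) / 2) * (\<integral>\<^sup>+r. f \<bar>r\<bar> * ennreal (\<bar>r\<bar> ^ (d - 1)) \<partial>lborel)"
   by (subst nn_integral_lborel_even[symmetric]) auto
  finally show ?thesis by (simp add: d_def)
 qed
 moreover have "w * ennreal (real d) / 2 \<noteq> \<infinity>"
  using wfin by (simp add: ennreal_divide_eq_top_iff ennreal_mult_eq_top_iff)
 ultimately show ?thesis by blast
qed

text \<open>The choice \<open>f = 1\<close> identifies the unknown constant as
  \<open>1 / gmom (card I - 1)\<close>. Radial integrals in dimension \<open>d\<close> become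
  one-dimensional integrals with weight \<open>\<bar>z\<bar> ^ (d - 1)\<close>, and this weight is
  what cancels the poles of inverse moments.\<close>

lemma nn_integral_gauss_radial:
 assumes I: "finite I" "I \<noteq> {}" and f[measurable]: "f \<in> borel_measurable borel"
 shows "ennreal (gmom (card I - 1)) * (\<integral>\<^sup>+x. f (sqrt (\<Sum>i\<in>I. (x i)^2)) \<partial>gauss I)
  = (\<integral>\<^sup>+z. f \<bar>z\<bar> * ennreal (\<bar>z\<bar> ^ (card I - 1)) \<partial>std_gauss)"
proof -
 obtain w where w: "w \<noteq> \<infinity>" "\<And>f. f \<in> borel_measurable borel \<Longrightarrow>
  (\<integral>\<^sup>+x. f (sqrt (\<Sum>i\<in>I. (x i)^2)) \<partial>PiM I (\<lambda>_. lborel))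
   = w * (\<integral>\<^sup>+r. f \<bar>r\<bar> * ennreal (\<bar>r\<bar> ^ (card I - 1)) \<partial>lborel)"
  using nn_integral_lborelP_radial[OF I] by blast
 define c where "c = ennreal ((1 / sqrt (2 * pi)) ^ card I)"
 define c1 where "c1 = ennreal (1 / sqrt (2 * pi))"
 let ?X = "\<lambda>f. \<integral>\<^sup>+z. f \<bar>z\<bar> * ennreal (\<bar>z\<bar> ^ (card I - 1)) \<partial>std_gauss"
 define K where "K = c * w / c1"
 have c10: "c1 \<noteq> 0" "c1 \<noteq> \<infinity>" unfolding c1_def by auto
 have g: "(\<integral>\<^sup>+x. f (sqrt (\<Sum>i\<in>I. (x i)^2)) \<partial>gauss I) = K * ?X f"
  if f[measurable]: "f \<in> borel_measurable borel" for f
 proof -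
  define h where "h = (\<lambda>r. ennreal (exp (- r\<^sup>2 / 2)) * f r)"
  have [measurable]: "h \<in> borel_measurable borel" unfolding h_def by measurable
  have "(\<integral>\<^sup>+x. f (sqrt (\<Sum>i\<in>I. (x i)^2)) \<partial>gauss I) = c * (\<integral>\<^sup>+x. h (sqrt (\<Sum>i\<in>I. (x i)^2)) \<partial>PiM I (\<lambda>_. lborel))"
   unfolding c_def h_def by (subst nn_integral_gauss[OF I(1)]) (auto simp: sum_nonneg)
  also have "... = c * w * (\<integral>\<^sup>+r. h \<bar>r\<bar> * ennreal (\<bar>r\<bar> ^ (card I - 1)) \<partial>lborel)"
   by (subst w(2)) (auto simp: mult.assoc)
  also have "... = K * (c1 * (\<integral>\<^sup>+r. h \<bar>r\<bar> * ennreal (\<bar>r\<bar> ^ (card I - 1)) \<partial>lborel))"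
   unfolding K_def by (rule ennreal_divide_mult_cancel[OF c10, symmetric])
  also have "c1 * (\<integral>\<^sup>+r. h \<bar>r\<bar> * ennreal (\<bar>r\<bar> ^ (card I - 1)) \<partial>lborel)
   = (\<integral>\<^sup>+r. ennreal (std_normal_density r) * (f \<bar>r\<bar> * ennreal (\<bar>r\<bar> ^ (card I - 1))) \<partial>lborel)"
  proof -
   have "ennreal (std_normal_density r) = c1 * ennreal (exp (- r\<^sup>2 / 2))" for r
    unfolding std_normal_density_def c1_def by (rule ennreal_mult'') simp
   then show ?thesis
    by (subst nn_integral_cmult[symmetric]) (auto simp: h_def mult_ac)
  qed
  also have "... = ?X f"
   by (rule nn_integral_density[symmetric]) auto
  finally show ?thesis .
 qed
 have K: "ennreal (gmom (card I - 1)) * K = 1"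
  using g[of "\<lambda>_. 1"] by (simp add: prob_space.emeasure_space_1[OF prob_space_gauss] nn_integral_gmom mult.commute)
 show ?thesis unfolding g[OF f] mult.assoc[symmetric] K by simp
qed

section \<open>Orthonormal families and symmetric matrices\<close>

unbundle no vec_syntax
hide_type (open) Finite_Cartesian_Product.vec

abbreviation ip :: "real vec \<Rightarrow> real vec \<Rightarrow> real" where
 "ip \<equiv> scalar_prod"

definition orthonormal_family :: "nat \<Rightarrow> nat \<Rightarrow> (nat \<Rightarrow> real vec) \<Rightarrow> bool" where
 "orthonormal_family m d w \<longleftrightarrow>
  (\<forall>i<d. w i \<in> carrier_vec m) \<and> (\<forall>i<d. \<forall>j<d. ip (w i) (w j) = (if i = j then 1 else 0))"

lemma ip_sum: "v \<in> carrier_vec m \<Longrightarrow> w \<in> carrier_vec m \<Longrightarrow> ip v w = (\<Sum>r<m. v $ r * w $ r)"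
 by (simp add: scalar_prod_def atLeast0LessThan)

lemma ip_self_pos: "v \<in> carrier_vec m \<Longrightarrow> v \<noteq> 0\<^sub>v m \<Longrightarrow> ip v v > 0"
proof -
 assume v: "v \<in> carrier_vec m" "v \<noteq> 0\<^sub>v m"
 then obtain r where r: "r < m" "v $ r \<noteq> 0" by (metis carrier_vecD eq_vecI index_zero_vec)
 have "0 < (v $ r)^2" using r by simp
 also have "... \<le> (\<Sum>r<m. (v $ r)^2)" using r by (intro member_le_sum) auto
 finally show ?thesis using v by (simp add: ip_sum power2_eq_square)
qed

lemma ip_self_nonneg: "ip v v \<ge> 0"
 by (auto simp: scalar_prod_def intro!: sum_nonneg)

lemma mult_mat_vec_entry: "A \<in> carrier_mat a m \<Longrightarrow> v \<in> carrier_vec m \<Longrightarrow> i < a \<Longrightarrow> (A *\<^sub>v v) $ i = (\<Sum>j<m. A $$ (i, j) * v $ j)"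
 by (auto simp: scalar_prod_def atLeast0LessThan intro!: sum.cong)

lemma mult_mat_entry: "A \<in> carrier_mat a m \<Longrightarrow> B \<in> carrier_mat m c \<Longrightarrow> i < a \<Longrightarrow> j < c \<Longrightarrow> (A * B) $$ (i, j) = (\<Sum>l<m. A $$ (i, l) * B $$ (l, j))"
 by (auto simp: scalar_prod_def atLeast0LessThan intro!: sum.cong)

text \<open>Padded with zero rows to a square matrix, \<open>R\<close> has a transpose that
  annihilates the unit vector of a zero row; the determinant vanishes and gives a kernel vector,
  which is then normalised.\<close>

lemma wide_mat_kernel:
 fixes R :: "real mat"
 assumes R: "R \<in> carrier_mat a m" and am: "a < m"
 obtains v where "v \<in> carrier_vec m" "ip v v = 1" "R *\<^sub>v v = 0\<^sub>v a"
proof -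
 define R' where "R' = Matrix.mat m m (\<lambda>(i,j). if i < a then R $$ (i,j) else 0)"
 have R': "R' \<in> carrier_mat m m" unfolding R'_def by simp
 have "R'\<^sup>T *\<^sub>v unit_vec m a = 0\<^sub>v m"
  using am by (intro eq_vecI) (auto simp: R'_def)
 moreover have "unit_vec m a \<noteq> (0\<^sub>v m :: real vec)" using am by (simp add: unit_vec_nonzero)
 ultimately have "Determinant.det (R'\<^sup>T) = 0"
  using R' by (subst det_0_iff_vec_prod_zero_field[of _ m]) (auto intro!: exI[of _ "unit_vec m a"])
 then have "Determinant.det R' = 0" using Determinant.det_transpose[OF R'] by simp
 then obtain v where v: "v \<in> carrier_vec m" "v \<noteq> 0\<^sub>v m" "R' *\<^sub>v v = 0\<^sub>v m"
  using det_0_iff_vec_prod_zero_field[OF R'] by auto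
 have Rv: "R *\<^sub>v v = 0\<^sub>v a"
 proof (rule eq_vecI)
  fix i assume i: "i < dim_vec (0\<^sub>v a :: real vec)"
  have "(R *\<^sub>v v) $ i = (R' *\<^sub>v v) $ i"
   using mult_mat_vec_entry[OF R v(1), of i] mult_mat_vec_entry[OF R' v(1), of i] i am by (simp add: R'_def)
  then show "(R *\<^sub>v v) $ i = 0\<^sub>v a $ i" using i am v(3) by simp
 qed (use R in auto)
 define c where "c = 1 / sqrt (ip v v)"
 have pos: "ip v v > 0" by (rule ip_self_pos[OF v(1,2)])
 have "ip (c \<cdot>\<^sub>v v) (c \<cdot>\<^sub>v v) = c * c * ip v v" using v(1) by simp
 also have "... = 1" using pos unfolding c_def by (simp add: real_sqrt_mult_self)
 finally have "ip (c \<cdot>\<^sub>v v) (c \<cdot>\<^sub>v v) = 1" .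
 moreover have "R *\<^sub>v (c \<cdot>\<^sub>v v) = 0\<^sub>v a"
  using mult_mat_vec[OF R v(1), of c] Rv by (auto intro!: eq_vecI)
 ultimately show ?thesis using v(1) by (intro that[of "c \<cdot>\<^sub>v v"]) auto
qed

text \<open>Each new vector is taken from the kernel of \<open>R\<close> with the previous vectors
  appended as rows, so orthogonality is built in and no Gram-Schmidt step occurs;
  \<open>a + d <= m\<close> is the dimension count.\<close>

lemma orthonormal_in_kernel:
 fixes R :: "real mat"
 assumes R: "R \<in> carrier_mat a m" and "a + d \<le> m"
 shows "\<exists>w. orthonormal_family m d w \<and> (\<forall>i<d. R *\<^sub>v w i = 0\<^sub>v a)"
 using assms(2)
proof (induction d)
 case 0
 then show ?case by (simp add: orthonormal_family_def)
next
 case (Suc d)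
 then obtain w where w: "orthonormal_family m d w" "\<forall>i<d. R *\<^sub>v w i = 0\<^sub>v a" by auto
 have wc: "w i \<in> carrier_vec m" if "i < d" for i using w that by (simp add: orthonormal_family_def)
 define R' where "R' = Matrix.mat (a + d) m (\<lambda>(i,j). if i < a then R $$ (i,j) else w (i - a) $ j)"
 have R': "R' \<in> carrier_mat (a + d) m" unfolding R'_def by simp
 obtain v where v: "v \<in> carrier_vec m" "ip v v = 1" "R' *\<^sub>v v = 0\<^sub>v (a + d)"
  using wide_mat_kernel[OF R'] Suc.prems by auto
 have Rv: "R *\<^sub>v v = 0\<^sub>v a"
 proof (rule eq_vecI)
  fix i assume i: "i < dim_vec (0\<^sub>v a :: real vec)"
  have "(R *\<^sub>v v) $ i = (R' *\<^sub>v v) $ i"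
   using mult_mat_vec_entry[OF R v(1), of i] mult_mat_vec_entry[OF R' v(1), of i] i by (simp add: R'_def)
  then show "(R *\<^sub>v v) $ i = 0\<^sub>v a $ i" using i v(3) by simp
 qed (use R in auto)
 have wv: "ip (w i) v = 0" if i: "i < d" for i
 proof -
  have "ip (w i) v = (R' *\<^sub>v v) $ (a + i)"
   using i v(1) R' wc[OF i] Suc.prems by (subst mult_mat_vec_entry[OF R']) (auto simp: R'_def ip_sum)
  then show ?thesis using i v(3) by simp
 qed
 define w' where "w' = w(d := v)"
 have "orthonormal_family m (Suc d) w'"
  unfolding orthonormal_family_def
 proof (intro conjI allI impI)
  fix i assume "i < Suc d" then show "w' i \<in> carrier_vec m" using wc v(1) by (auto simp: w'_def less_Suc_eq)
 next
  fix i j assume ij: "i < Suc d" "j < Suc d"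
  show "ip (w' i) (w' j) = (if i = j then 1 else 0)"
   using ij w(1) wv wc v comm_scalar_prod[OF v(1) wc]
   by (auto simp: w'_def less_Suc_eq orthonormal_family_def)
 qed
 moreover have "\<forall>i<Suc d. R *\<^sub>v w' i = 0\<^sub>v a" using w(2) Rv by (auto simp: w'_def less_Suc_eq)
 ultimately show ?case by blast
qed

definition fam_mat :: "nat \<Rightarrow> nat \<Rightarrow> (nat \<Rightarrow> real vec) \<Rightarrow> real mat" where
 "fam_mat m d w = Matrix.mat m d (\<lambda>(r,i). w i $ r)"

lemma fam_mat_carrier [simp]: "fam_mat m d w \<in> carrier_mat m d"
 by (simp add: fam_mat_def)

lemma fam_mat_dim [simp]: "dim_row (fam_mat m d w) = m" "dim_col (fam_mat m d w) = d"
 by (simp_all add: fam_mat_def)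

lemma fam_mat_orth:
 assumes "orthonormal_family m d w"
 shows "(fam_mat m d w)\<^sup>T * fam_mat m d w = 1\<^sub>m d"
proof (rule eq_matI)
 fix i j assume ij: "i < dim_row (1\<^sub>m d :: real mat)" "j < dim_col (1\<^sub>m d :: real mat)"
 then have "((fam_mat m d w)\<^sup>T * fam_mat m d w) $$ (i, j) = ip (w i) (w j)"
  using assms ip_sum[of "w i" m "w j"] unfolding orthonormal_family_def
  by (subst mult_mat_entry[of _ d m _ d]) (auto simp: fam_mat_def)
 then show "((fam_mat m d w)\<^sup>T * fam_mat m d w) $$ (i, j) = 1\<^sub>m d $$ (i, j)"
  using assms ij unfolding orthonormal_family_def by auto
qed auto

lemma fam_mat_orth':
 assumes "orthonormal_family n n w"
 shows "fam_mat n n w * (fam_mat n n w)\<^sup>T = 1\<^sub>m n"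
 by (rule mat_mult_left_right_inverse[OF _ _ fam_mat_orth[OF assms]]) auto

text \<open>Orthonormal columns of a square matrix give orthonormal rows; the expansion and the norm
  identity are consequences.\<close>

lemma orthonormal_parseval:
 assumes w: "orthonormal_family n n w"
 shows "r < n \<Longrightarrow> s < n \<Longrightarrow> (\<Sum>i<n. w i $ r * w i $ s) = (if r = s then 1 else 0)"
  and "x \<in> carrier_vec n \<Longrightarrow> r < n \<Longrightarrow> x $ r = (\<Sum>i<n. ip (w i) x * w i $ r)"
  and "x \<in> carrier_vec n \<Longrightarrow> ip x x = (\<Sum>i<n. (ip (w i) x)^2)"
proof -
 show *: "(\<Sum>i<n. w i $ r * w i $ s) = (if r = s then 1 else 0)" if "r < n" "s < n" for r s
 proof -
  have "(\<Sum>i<n. w i $ r * w i $ s) = (fam_mat n n w * (fam_mat n n w)\<^sup>T) $$ (r, s)"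
   using that by (subst mult_mat_entry[of _ n n _ n]) (auto simp: fam_mat_def)
  then show ?thesis using that by (simp add: fam_mat_orth'[OF w])
 qed
 have wc: "w i \<in> carrier_vec n" if "i < n" for i using w that by (simp add: orthonormal_family_def)
 show **: "x $ r = (\<Sum>i<n. ip (w i) x * w i $ r)" if x: "x \<in> carrier_vec n" and r: "r < n" for x r
 proof -
  have "(\<Sum>i<n. ip (w i) x * w i $ r) = (\<Sum>i<n. \<Sum>s<n. x $ s * (w i $ r * w i $ s))"
   using wc by (intro sum.cong) (simp_all add: ip_sum[OF _ x] sum_distrib_left sum_distrib_right mult_ac)
  also have "... = (\<Sum>s<n. x $ s * (\<Sum>i<n. w i $ r * w i $ s))"
   by (subst sum.swap) (simp add: sum_distrib_left)
  also have "... = (\<Sum>s<n. if r = s then x $ s else 0)" using r by (intro sum.cong) (auto simp: *)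
  also have "... = x $ r" using r by simp
  finally show ?thesis by simp
 qed
 show "ip x x = (\<Sum>i<n. (ip (w i) x)^2)" if x: "x \<in> carrier_vec n"
 proof -
  have "ip x x = (\<Sum>r<n. x $ r * (\<Sum>i<n. ip (w i) x * w i $ r))"
   using x by (simp add: ip_sum **[OF x, symmetric])
  also have "... = (\<Sum>i<n. ip (w i) x * (\<Sum>r<n. w i $ r * x $ r))"
   unfolding sum_distrib_left by (subst sum.swap) (simp add: mult_ac)
  also have "... = (\<Sum>i<n. (ip (w i) x)^2)"
   using wc by (intro sum.cong) (simp_all add: ip_sum[OF _ x] power2_eq_square)
  finally show ?thesis .
 qed
qed

section \<open>Spectral theorem for real symmetric matrices\<close>

lemma ip_mult_mat_vec:
 "A \<in> carrier_mat a m \<Longrightarrow> x \<in> carrier_vec m \<Longrightarrow> y \<in> carrier_vec a \<Longrightarrow> ip y (A *\<^sub>v x) = ip (A\<^sup>T *\<^sub>v y) x"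
 using transpose_vec_mult_scalar[of A a m x y] by simp

text \<open>A complex eigenvector \<open>x + i y\<close> exists by the fundamental theorem of
  algebra. Comparing \<open>ip x (M y)\<close> with \<open>ip (M x) y\<close> leaves
  \<open>Im z * (ip x x + ip y y) = 0\<close>, so the eigenvalue is real and whichever of
  \<open>x\<close>, \<open>y\<close> is nonzero is a real eigenvector.\<close>

lemma symmetric_mat_eigenvector:
 fixes M :: "real mat"
 assumes M: "M \<in> carrier_mat n n" and sym: "M\<^sup>T = M" and n: "n > 0"
 obtains v l where "v \<in> carrier_vec n" "v \<noteq> 0\<^sub>v n" "M *\<^sub>v v = l \<cdot>\<^sub>v v"
proof -
 define C where "C = map_mat complex_of_real M"
 have C: "C \<in> carrier_mat n n" using M by (simp add: C_def)
 have "\<not> constant (poly (char_poly C))"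
  using degree_monic_char_poly[OF C] n by (simp add: constant_degree)
 then obtain z where "poly (char_poly C) z = 0" using fundamental_theorem_of_algebra by blast
 then have "eigenvalue C z" by (simp add: eigenvalue_root_char_poly[OF C])
 then obtain v where v: "v \<in> carrier_vec n" "v \<noteq> 0\<^sub>v n" "C *\<^sub>v v = z \<cdot>\<^sub>v v"
  using C unfolding eigenvalue_def eigenvector_def by auto
 define x where "x = map_vec Re v"
 define y where "y = map_vec Im v"
 have x: "x \<in> carrier_vec n" and y: "y \<in> carrier_vec n" using v by (auto simp: x_def y_def)
 have ev: "(\<Sum>j<n. complex_of_real (M $$ (i,j)) * v $ j) = z * v $ i" if i: "i < n" for i
 proof -
  have "(\<Sum>j<n. complex_of_real (M $$ (i,j)) * v $ j) = (C *\<^sub>v v) $ i"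
   using i M C v(1) by (auto simp: scalar_prod_def atLeast0LessThan C_def intro!: sum.cong)
  then show ?thesis using i v by simp
 qed
 have Mx: "M *\<^sub>v x = Re z \<cdot>\<^sub>v x - Im z \<cdot>\<^sub>v y"
 proof (rule eq_vecI)
  fix i assume i: "i < dim_vec (Re z \<cdot>\<^sub>v x - Im z \<cdot>\<^sub>v y)"
  then have i': "i < n" using y by simp
  have "(M *\<^sub>v x) $ i = Re (\<Sum>j<n. complex_of_real (M $$ (i,j)) * v $ j)"
   using i' M x v(1) by (subst mult_mat_vec_entry[OF M x]) (auto simp: x_def)
  then show "(M *\<^sub>v x) $ i = (Re z \<cdot>\<^sub>v x - Im z \<cdot>\<^sub>v y) $ i"
   using i' x y v(1) by (simp add: ev x_def y_def)
 qed (use M x y in auto)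
 have My: "M *\<^sub>v y = Im z \<cdot>\<^sub>v x + Re z \<cdot>\<^sub>v y"
 proof (rule eq_vecI)
  fix i assume i: "i < dim_vec (Im z \<cdot>\<^sub>v x + Re z \<cdot>\<^sub>v y)"
  then have i': "i < n" using y by simp
  have "(M *\<^sub>v y) $ i = Im (\<Sum>j<n. complex_of_real (M $$ (i,j)) * v $ j)"
   using i' M y v(1) by (subst mult_mat_vec_entry[OF M y]) (auto simp: y_def)
  then show "(M *\<^sub>v y) $ i = (Im z \<cdot>\<^sub>v x + Re z \<cdot>\<^sub>v y) $ i"
   using i' x y v(1) by (simp add: ev x_def y_def)
 qed (use M x y in auto)
 have xy: "ip x y = ip y x" by (rule comm_scalar_prod[OF x y])
 have "ip x (M *\<^sub>v y) = ip (M *\<^sub>v x) y" using ip_mult_mat_vec[OF M y x] sym by simp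
 then have "Im z * ip x x + Re z * ip x y = Re z * ip x y - Im z * ip y y"
  unfolding Mx My using x y
  by (simp add: scalar_prod_add_distrib[of _ n] minus_scalar_prod_distrib[of _ n])
 then have *: "Im z * (ip x x + ip y y) = 0" by (simp add: algebra_simps)
 have nz: "x \<noteq> 0\<^sub>v n \<or> y \<noteq> 0\<^sub>v n"
 proof (rule ccontr)
  assume "\<not> ?thesis"
  then have xy0: "x = 0\<^sub>v n" "y = 0\<^sub>v n" by auto
  have "v = 0\<^sub>v n"
  proof (rule eq_vecI)
   fix i assume "i < dim_vec (0\<^sub>v n :: complex vec)"
   then have i: "i < n" by simp
   have "x $ i = Re (v $ i)" "y $ i = Im (v $ i)" using i v(1) by (auto simp: x_def y_def)
   then show "v $ i = 0\<^sub>v n $ i" using i xy0 by (simp add: complex_eq_iff)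
  qed (use v in auto)
  then show False using v by simp
 qed
 then have "ip x x + ip y y > 0"
  using ip_self_pos[OF x] ip_self_pos[OF y] ip_self_nonneg[of x] ip_self_nonneg[of y] by auto
 then have "Im z = 0" using * by simp
 then have "M *\<^sub>v x = Re z \<cdot>\<^sub>v x" "M *\<^sub>v y = Re z \<cdot>\<^sub>v y"
  using Mx My x y by (auto intro!: eq_vecI)
 then show ?thesis using nz x y that by blast
qed

definition eigenbasis :: "nat \<Rightarrow> real mat \<Rightarrow> (nat \<Rightarrow> real vec) \<Rightarrow> (nat \<Rightarrow> real) \<Rightarrow> bool" where
 "eigenbasis n M w l \<longleftrightarrow> orthonormal_family n n w \<and> (\<forall>i<n. M *\<^sub>v w i = l i \<cdot>\<^sub>v w i)"

text \<open>Induction on the number of eigenvectors found. \<open>M\<close> maps the orthogonal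
  complement of these into itself, so an eigenvector of the compression
  \<open>C\<^sup>T * M * C\<close> to that complement lifts to an eigenvector of
  \<open>M\<close>.\<close>

theorem symmetric_mat_eigenbasis:
 fixes M :: "real mat"
 assumes M: "M \<in> carrier_mat n n" and sym: "M\<^sup>T = M"
 shows "\<exists>w l. eigenbasis n M w l"
proof -
 have "\<exists>w l. orthonormal_family n j w \<and> (\<forall>i<j. M *\<^sub>v w i = l i \<cdot>\<^sub>v w i)" if "j \<le> n" for j
  using that
 proof (induction j)
  case 0
  then show ?case by (simp add: orthonormal_family_def)
 next
  case (Suc j)
  then obtain w l where w: "orthonormal_family n j w" and ev: "\<forall>i<j. M *\<^sub>v w i = l i \<cdot>\<^sub>v w i" by auto
  have wc: "w i \<in> carrier_vec n" if "i < j" for i using w that by (simp add: orthonormal_family_def)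
  define R where "R = (fam_mat n j w)\<^sup>T"
  have R: "R \<in> carrier_mat j n" by (simp add: R_def)
  have Rx: "(R *\<^sub>v x) $ i = ip (w i) x" if "i < j" "x \<in> carrier_vec n" for i x
   using that ip_sum[OF wc that(2)] by (subst mult_mat_vec_entry[OF R]) (auto simp: R_def fam_mat_def)
  obtain c where c: "orthonormal_family n (n - j) c" "\<forall>i<n-j. R *\<^sub>v c i = 0\<^sub>v j"
   using orthonormal_in_kernel[OF R, of "n - j"] Suc.prems by auto
  have cc: "c i \<in> carrier_vec n" if "i < n - j" for i using c that by (simp add: orthonormal_family_def)
  have wcz: "ip (w i) (c i') = 0" if "i < j" "i' < n - j" for i i'
   using Rx[OF that(1) cc[OF that(2)]] c(2) that by simp
  define C where "C = fam_mat n (n - j) c"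
  have C: "C \<in> carrier_mat n (n - j)" by (simp add: C_def)
  define b where "b = (\<lambda>i. if i < j then w i else c (i - j))"
  have b: "orthonormal_family n n b"
   unfolding orthonormal_family_def
  proof (intro conjI allI impI)
   fix i assume "i < n" then show "b i \<in> carrier_vec n" using wc cc by (auto simp: b_def)
  next
   fix i i' assume ii: "i < n" "i' < n"
   show "ip (b i) (b i') = (if i = i' then 1 else 0)"
    using ii w c(1) wcz[of i "i' - j"] wcz[of i' "i - j"] comm_scalar_prod[OF wc[of i'] cc[of "i - j"]]
    by (auto simp: b_def orthonormal_family_def)
  qed
  define M' where "M' = C\<^sup>T * M * C"
  have M': "M' \<in> carrier_mat (n - j) (n - j)" using M C by (simp add: M'_def)
  have "M'\<^sup>T = M'"
  proof -
   have "M'\<^sup>T = C\<^sup>T * (C\<^sup>T * M)\<^sup>T"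
    unfolding M'_def using M C by (subst transpose_mult[of _ "n - j" n _ "n - j"]) auto
   also have "(C\<^sup>T * M)\<^sup>T = M * C"
    using M C sym by (subst transpose_mult[of _ "n - j" n _ n]) auto
   finally show ?thesis unfolding M'_def using M C by (simp add: assoc_mult_mat[of _ "n - j" n _ n _ "n - j"])
  qed
  then obtain y mu where y: "y \<in> carrier_vec (n - j)" "y \<noteq> 0\<^sub>v (n - j)" "M' *\<^sub>v y = mu \<cdot>\<^sub>v y"
   using symmetric_mat_eigenvector[OF M'] Suc.prems by auto
  define x where "x = C *\<^sub>v y"
  have x: "x \<in> carrier_vec n" unfolding x_def using C y by auto
  have cix: "ip (c i) x = y $ i" if i: "i < n - j" for i
  proof -
   have "ip (c i) x = (C\<^sup>T *\<^sub>v x) $ i"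
    using i x C cc[OF i] by (subst mult_mat_vec_entry[of _ "n - j" n]) (auto simp: C_def fam_mat_def ip_sum)
   also have "C\<^sup>T *\<^sub>v x = (C\<^sup>T * C) *\<^sub>v y"
    unfolding x_def using C y by (subst assoc_mult_mat_vec[of _ "n - j" n _ "n - j"]) auto
   also have "... = y" using fam_mat_orth[OF c(1)] y by (simp add: C_def)
   finally show ?thesis .
  qed
  have wx: "ip (w i) x = 0" if i: "i < j" for i
  proof -
   have "ip (w i) x = (R *\<^sub>v x) $ i" using Rx[OF i x] by simp
   also have "R *\<^sub>v x = (R * C) *\<^sub>v y" unfolding x_def using R C y by (subst assoc_mult_mat_vec[of _ j n _ "n - j"]) auto
   also have "R * C = 0\<^sub>m j (n - j)"
   proof (rule eq_matI)
    fix i i' assume i: "i < dim_row (0\<^sub>m j (n - j) :: real mat)" "i' < dim_col (0\<^sub>m j (n - j) :: real mat)"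
    have "(R * C) $$ (i, i') = ip (w i) (c i')"
     using i ip_sum[OF wc cc, of i i'] by (subst mult_mat_entry[OF R C]) (auto simp: R_def C_def fam_mat_def)
    then show "(R * C) $$ (i, i') = 0\<^sub>m j (n - j) $$ (i, i')" using i wcz by simp
   qed (use R C in auto)
   finally show ?thesis using i y by simp
  qed
  have Mx: "M *\<^sub>v x \<in> carrier_vec n" using M x by auto
  have ciMx: "ip (c i) (M *\<^sub>v x) = mu * y $ i" if i: "i < n - j" for i
  proof -
   have "ip (c i) (M *\<^sub>v x) = (C\<^sup>T *\<^sub>v (M *\<^sub>v x)) $ i"
    using i Mx C cc[OF i] by (subst mult_mat_vec_entry[of _ "n - j" n]) (auto simp: C_def fam_mat_def ip_sum)
   also have "C\<^sup>T *\<^sub>v (M *\<^sub>v x) = M' *\<^sub>v y"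
    unfolding x_def M'_def using C M y
    by (simp add: assoc_mult_mat_vec[of _ "n - j" n _ n] assoc_mult_mat_vec[of _ "n - j" n _ "n - j"])
   finally show ?thesis using i y by simp
  qed
  have wMx: "ip (w i) (M *\<^sub>v x) = 0" if i: "i < j" for i
   using ip_mult_mat_vec[OF M x wc[OF i]] sym ev i wx[OF i] wc[OF i] x by simp
  have eig: "M *\<^sub>v x = mu \<cdot>\<^sub>v x"
  proof (rule eq_vecI)
   fix r assume "r < dim_vec (mu \<cdot>\<^sub>v x)"
   then have r: "r < n" using x by simp
   \<comment> \<open>In the basis \<open>b\<close> the old directions contribute nothing to
     \<open>M x\<close> and the complementary ones contribute the compressed matrix, so the
     eigenvalue equation can be read off coordinatewise.\<close>
   have "(M *\<^sub>v x) $ r = (\<Sum>i<n. ip (b i) (M *\<^sub>v x) * b i $ r)" by (rule orthonormal_parseval(2)[OF b Mx r])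
   also have "... = (\<Sum>i<n. mu * (ip (b i) x * b i $ r))"
    by (intro sum.cong) (auto simp: b_def wx wMx cix ciMx)
   also have "... = mu * x $ r" using orthonormal_parseval(2)[OF b x r] by (simp add: sum_distrib_left)
   finally show "(M *\<^sub>v x) $ r = (mu \<cdot>\<^sub>v x) $ r" using r x by simp
  qed (use M x in auto)
  have "x \<noteq> 0\<^sub>v n"
  proof
   assume "x = 0\<^sub>v n"
   then have "y = 0\<^sub>v (n - j)" using cix cc y(1) by (intro eq_vecI) (auto simp flip: cix)
   then show False using y by simp
  qed
  then have pos: "ip x x > 0" using ip_self_pos[OF x] by simp
  define v where "v = (1 / sqrt (ip x x)) \<cdot>\<^sub>v x"
  have v: "v \<in> carrier_vec n" "ip v v = 1" "M *\<^sub>v v = mu \<cdot>\<^sub>v v" "\<And>i. i < j \<Longrightarrow> ip (w i) v = 0"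
   using x pos eig wx wc mult_mat_vec[OF M x] by (auto simp: v_def smult_smult_assoc mult.commute)
  define w' where "w' = w(j := v)"
  have "orthonormal_family n (Suc j) w'"
   unfolding orthonormal_family_def
  proof (intro conjI allI impI)
   fix i assume "i < Suc j" then show "w' i \<in> carrier_vec n" using wc v(1) by (auto simp: w'_def less_Suc_eq)
  next
   fix i i' assume ij: "i < Suc j" "i' < Suc j"
   show "ip (w' i) (w' i') = (if i = i' then 1 else 0)"
    using ij w(1) v(2,4) wc v comm_scalar_prod[OF v(1) wc]
    by (auto simp: w'_def less_Suc_eq orthonormal_family_def)
  qed
  moreover have "\<forall>i<Suc j. M *\<^sub>v w' i = (l(j := mu)) i \<cdot>\<^sub>v w' i"
   using ev v(3) by (auto simp: w'_def less_Suc_eq)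
  ultimately show ?case by blast
 qed
 from this[of n] show ?thesis by (simp add: eigenbasis_def)
qed

lemma square_mult_carrier [simp]:
 "A \<in> carrier_mat n n \<Longrightarrow> B \<in> carrier_mat n n \<Longrightarrow> A * B \<in> carrier_mat n n"
 by (rule mult_carrier_mat)

lemma mat_diag_dims [simp]: "dim_row (mat_diag n f) = n" "dim_col (mat_diag n f) = n"
 by (simp_all add: mat_diag_def)

lemma ip_comm: "v \<in> carrier_vec n \<Longrightarrow> w \<in> carrier_vec n \<Longrightarrow> ip v w = ip w v"
 by (rule comm_scalar_prod)

lemma orthonormal_parseval_bilinear:
 assumes w: "orthonormal_family n n w" and x: "x \<in> carrier_vec n" and y: "y \<in> carrier_vec n"
 shows "ip x y = (\<Sum>i<n. ip (w i) x * ip (w i) y)"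
proof -
 have wc: "w i \<in> carrier_vec n" if "i < n" for i using w that by (simp add: orthonormal_family_def)
 have "ip x y = (\<Sum>r<n. x $ r * (\<Sum>i<n. ip (w i) y * w i $ r))"
  by (simp add: ip_sum[OF x y] orthonormal_parseval(2)[OF w y, symmetric])
 also have "... = (\<Sum>i<n. ip (w i) y * (\<Sum>r<n. w i $ r * x $ r))"
  unfolding sum_distrib_left by (subst sum.swap) (simp add: mult_ac)
 also have "... = (\<Sum>i<n. ip (w i) x * ip (w i) y)"
  using wc by (intro sum.cong) (simp_all add: ip_sum[OF _ x])
 finally show ?thesis .
qed

context
 fixes n M w l
 assumes M: "M \<in> carrier_mat n n" and sym: "M\<^sup>T = (M :: real mat)" and eb: "eigenbasis n M w l"
begin

lemma eb_orth: "orthonormal_family n n w"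
 using eb by (simp add: eigenbasis_def)

lemma eb_carrier: "i < n \<Longrightarrow> w i \<in> carrier_vec n"
 using eb_orth by (simp add: orthonormal_family_def)

lemma eb_coord: "i < n \<Longrightarrow> x \<in> carrier_vec n \<Longrightarrow> ip (w i) (M *\<^sub>v x) = l i * ip (w i) x"
 using ip_mult_mat_vec[OF M, of x "w i"] sym eb eb_carrier[of i] by (simp add: eigenbasis_def)

lemma eb_quad: "x \<in> carrier_vec n \<Longrightarrow> y \<in> carrier_vec n \<Longrightarrow> ip x (M *\<^sub>v y) = (\<Sum>i<n. l i * ip (w i) x * ip (w i) y)"
 using M by (subst orthonormal_parseval_bilinear[OF eb_orth]) (auto simp: eb_coord mult_ac intro!: sum.cong)

lemma eb_entry:
 assumes "r < n" "s < n"
 shows "M $$ (r, s) = (\<Sum>i<n. l i * w i $ r * w i $ s)"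
proof -
 have "M $$ (r, s) = ip (unit_vec n r) (M *\<^sub>v unit_vec n s)"
 proof -
  have "ip (unit_vec n r) (M *\<^sub>v unit_vec n s) = (M *\<^sub>v unit_vec n s) $ r"
   using assms M by (intro scalar_prod_left_unit) auto
  also have "... = M $$ (r, s)"
   using assms by (subst mult_mat_vec_entry[OF M]) (auto simp: unit_vec_def if_distrib cong: if_cong)
  finally show ?thesis by simp
 qed
 also have "... = (\<Sum>i<n. l i * ip (w i) (unit_vec n r) * ip (w i) (unit_vec n s))"
  by (rule eb_quad) auto
 also have "... = (\<Sum>i<n. l i * w i $ r * w i $ s)"
  using assms eb_carrier by (intro sum.cong) auto
 finally show ?thesis .
qed

lemma eb_decomp:
 "M = fam_mat n n w * mat_diag n l * (fam_mat n n w)\<^sup>T"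
proof (rule eq_matI)
 let ?V = "fam_mat n n w"
 fix r s assume "r < dim_row (?V * mat_diag n l * ?V\<^sup>T)" "s < dim_col (?V * mat_diag n l * ?V\<^sup>T)"
 then have rs: "r < n" "s < n" by auto
 have "?V * mat_diag n l = Matrix.mat n n (\<lambda>(i,j). ?V $$ (i,j) * l j)"
  by (rule mat_diag_mult_right) simp
 then have "(?V * mat_diag n l * ?V\<^sup>T) $$ (r, s) = (\<Sum>i<n. ?V $$ (r,i) * l i * ?V $$ (s,i))"
  using rs by (subst mult_mat_entry[of _ n n _ n]) auto
 then show "M $$ (r, s) = (?V * mat_diag n l * ?V\<^sup>T) $$ (r, s)"
  using rs by (auto simp: eb_entry fam_mat_def mult_ac intro!: sum.cong)
qed (use M in auto)

text \<open>\<open>M\<^sup>T * M\<close> is similar to the diagonal matrix of the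
  \<open>l i * l i\<close>, and similar matrices have the same characteristic polynomial. This ties
  the definition of \<open>singular_values\<close> by polynomial roots to every eigenbasis.\<close>

lemma eb_singular_values: "singular_values M = image_mset (\<lambda>i. \<bar>l i\<bar>) (mset_set {..<n})"
proof -
 let ?V = "fam_mat n n w" and ?D = "mat_diag n (\<lambda>i. l i * l i)"
 have c[simp]: "?V \<in> carrier_mat n n" "?V\<^sup>T \<in> carrier_mat n n" "mat_diag n l \<in> carrier_mat n n" by auto
 have VV: "?V\<^sup>T * ?V = 1\<^sub>m n" "?V * ?V\<^sup>T = 1\<^sub>m n"
  using fam_mat_orth[OF eb_orth] fam_mat_orth'[OF eb_orth] by auto
 have "M\<^sup>T * M = M * M" by (simp add: sym)
 also have "... = (?V * mat_diag n l * ?V\<^sup>T) * (?V * mat_diag n l * ?V\<^sup>T)"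
  using eb_decomp by simp
 also have "... = (?V * mat_diag n l) * (?V\<^sup>T * (?V * mat_diag n l * ?V\<^sup>T))"
  by (rule assoc_mult_mat[of _ n n _ n _ n]) auto
 also have "?V\<^sup>T * (?V * mat_diag n l * ?V\<^sup>T) = ?V\<^sup>T * (?V * (mat_diag n l * ?V\<^sup>T))"
  by (subst assoc_mult_mat[of ?V n n _ n _ n]) auto
 also have "... = (?V\<^sup>T * ?V) * (mat_diag n l * ?V\<^sup>T)"
  by (subst assoc_mult_mat[of "?V\<^sup>T" n n _ n _ n]) auto
 also have "... = mat_diag n l * ?V\<^sup>T"
  unfolding VV by (rule left_mult_one_mat[of _ n n]) simp
 also have "(?V * mat_diag n l) * ... = ?V * (mat_diag n l * (mat_diag n l * ?V\<^sup>T))"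
  by (rule assoc_mult_mat[of _ n n _ n _ n]) auto
 also have "mat_diag n l * (mat_diag n l * ?V\<^sup>T) = (mat_diag n l * mat_diag n l) * ?V\<^sup>T"
  by (rule assoc_mult_mat[symmetric, of _ n n _ n _ n]) auto
 also have "... = ?D * ?V\<^sup>T" by simp
 also have "?V * (?D * ?V\<^sup>T) = ?V * ?D * ?V\<^sup>T"
  by (rule assoc_mult_mat[symmetric, of _ n n _ n _ n]) auto
 finally have MM: "M\<^sup>T * M = ?V * ?D * ?V\<^sup>T" .
 have "similar_mat (M\<^sup>T * M) ?D"
  unfolding similar_mat_def similar_mat_wit_def
  by (intro exI[of _ ?V] exI[of _ "?V\<^sup>T"]) (use M MM VV in \<open>auto simp: Let_def\<close>)
 then have "char_poly (M\<^sup>T * M) = char_poly ?D" by (rule char_poly_similar)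
 also have "... = (\<Prod>a\<leftarrow>diag_mat ?D. [:- a, 1:])"
  by (rule char_poly_upper_triangular[of _ n]) (auto simp: mat_diag_def)
 also have "diag_mat ?D = map (\<lambda>i. l i * l i) [0..<n]"
  by (auto simp: diag_mat_def mat_diag_def intro!: map_cong)
 also have "(\<Prod>a\<leftarrow>map (\<lambda>i. l i * l i) [0..<n]. [:- a, 1:]) = (\<Prod>i\<in>{..<n}. [:- (l i * l i), 1:])"
  by (simp add: comp_def prod.distinct_set_conv_list[symmetric] atLeast0LessThan)
 finally have "proots (char_poly (M\<^sup>T * M)) = (\<Sum>i\<in>{..<n}. {#l i * l i#})"
  by (simp add: proots_prod)
 also have "... = image_mset (\<lambda>i. l i * l i) (mset_set {..<n})"
  by (simp add: sum_unfold_sum_mset)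
 finally show ?thesis
  unfolding singular_values_def by (simp add: image_mset.compositionality comp_def)
qed

end

section \<open>Norms of positive semidefinite matrices\<close>

lemma sym_psdD:
 assumes "sym_psd n M"
 shows "M \<in> carrier_mat n n" "M\<^sup>T = M" "v \<in> carrier_vec n \<Longrightarrow> 0 \<le> ip v (M *\<^sub>v v)"
 using assms by (auto simp: sym_psd_def)

lemma sym_psd_eigenbasis:
 assumes "sym_psd n M"
 shows "\<exists>w l. eigenbasis n M w l \<and> (\<forall>i<n. 0 \<le> l i)"
proof -
 obtain w l where eb: "eigenbasis n M w l"
  using symmetric_mat_eigenbasis[OF sym_psdD(1,2)[OF assms]] by auto
 note e = sym_psdD(1,2)[OF assms] eb
 have "0 \<le> l i" if i: "i < n" for i
 proof -
  have "ip (w i) (M *\<^sub>v w i) = l i * ip (w i) (w i)" by (rule eb_coord[OF e i eb_carrier[OF e i]])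
  also have "... = l i" using eb_orth[OF e] i by (simp add: orthonormal_family_def)
  finally show ?thesis using sym_psdD(3)[OF assms eb_carrier[OF e i]] by simp
 qed
 then show ?thesis using eb by blast
qed

text \<open>For a positive semidefinite matrix the singular values are the eigenvalues, whose sum is
  the trace. The trace is linear in the matrix, which makes the nuclear norm measurable and
  computable in any orthonormal basis.\<close>

lemma nuc_norm_psd:
 assumes "sym_psd n M"
 shows "nuc_norm M = (\<Sum>i<n. M $$ (i, i))"
proof -
 obtain w l where eb: "eigenbasis n M w l" and l: "\<And>i. i < n \<Longrightarrow> 0 \<le> l i" using sym_psd_eigenbasis[OF assms] by blast
 note e = sym_psdD(1,2)[OF assms] eb
 have "nuc_norm M = (\<Sum>i<n. \<bar>l i\<bar>)" unfolding nuc_norm_def eb_singular_values[OF e] by (simp add: sum_unfold_sum_mset)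
 also have "... = (\<Sum>i<n. l i * ip (w i) (w i))" using l eb_orth[OF e] by (intro sum.cong) (auto simp: orthonormal_family_def)
 also have "... = (\<Sum>i<n. \<Sum>r<n. l i * w i $ r * w i $ r)"
  using eb_carrier[OF e] by (intro sum.cong) (auto simp: ip_sum[OF eb_carrier[OF e] eb_carrier[OF e]] sum_distrib_left mult_ac)
 also have "... = (\<Sum>r<n. M $$ (r, r))" by (subst sum.swap) (simp add: eb_entry[OF e])
 finally show ?thesis .
qed

lemma spec_norm_nonneg: "0 \<le> spec_norm M"
 unfolding spec_norm_def by (rule Max_ge) auto

lemma spec_norm_psd_eq:
 assumes "M \<in> carrier_mat n n" "M\<^sup>T = M" "eigenbasis n M w l"
 shows "spec_norm M = Max (insert 0 ((\<lambda>i. \<bar>l i\<bar>) ` {..<n}))"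
 unfolding spec_norm_def eb_singular_values[OF assms] by simp

text \<open>Together with \<open>spec_norm_psd_ge\<close> this is the Rayleigh quotient description,
  through which the spectral norm is estimated below.\<close>

lemma spec_norm_psd_le:
 assumes psd: "sym_psd n M" and c: "0 \<le> c" and le: "\<And>v. v \<in> carrier_vec n \<Longrightarrow> ip v (M *\<^sub>v v) \<le> c * ip v v"
 shows "spec_norm M \<le> c"
proof -
 obtain w l where eb: "eigenbasis n M w l" and l: "\<And>i. i < n \<Longrightarrow> 0 \<le> l i" using sym_psd_eigenbasis[OF psd] by blast
 note e = sym_psdD(1,2)[OF psd] eb
 have "\<bar>l i\<bar> \<le> c" if i: "i < n" for i
 proof -
  have 1: "ip (w i) (w i) = 1" using eb_orth[OF e] i by (simp add: orthonormal_family_def)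
  have "l i = ip (w i) (M *\<^sub>v w i)" using eb_coord[OF e i eb_carrier[OF e i]] 1 by simp
  also have "... \<le> c" using le[OF eb_carrier[OF e i]] 1 by simp
  finally show ?thesis using l[OF i] by simp
 qed
 then show ?thesis unfolding spec_norm_psd_eq[OF e] using c by auto
qed

lemma spec_norm_psd_ge:
 assumes psd: "sym_psd n M" and v: "v \<in> carrier_vec n"
 shows "ip v (M *\<^sub>v v) \<le> spec_norm M * ip v v"
proof -
 obtain w l where eb: "eigenbasis n M w l" and l: "\<And>i. i < n \<Longrightarrow> 0 \<le> l i" using sym_psd_eigenbasis[OF psd] by blast
 note e = sym_psdD(1,2)[OF psd] eb
 have "l i \<le> spec_norm M" if i: "i < n" for i
  unfolding spec_norm_psd_eq[OF e] using i by (intro order_trans[OF abs_ge_self[of "l i"] Max_ge]) auto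
 then have "(\<Sum>i<n. l i * ip (w i) v * ip (w i) v) \<le> (\<Sum>i<n. spec_norm M * (ip (w i) v)^2)"
  by (intro sum_mono) (auto simp: power2_eq_square mult.assoc intro!: mult_right_mono)
 then show ?thesis
  unfolding eb_quad[OF e v v] orthonormal_parseval(3)[OF eb_orth[OF e] v] by (simp add: sum_distrib_left)
qed

text \<open>In an eigenbasis the form is a sum of nonnegative terms
  \<open>l i * (ip (w i) v)^2\<close>. It serves to show that \<open>\<Omega>\<^sup>T A x\<close>
  lies in the range of \<open>\<Omega>\<^sup>T A \<Omega>\<close>, also when the latter is
  singular.\<close>

lemma psd_quad_zero:
 assumes psd: "sym_psd n M" and v: "v \<in> carrier_vec n" and z: "ip v (M *\<^sub>v v) = 0"
 shows "M *\<^sub>v v = 0\<^sub>v n"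
proof -
 obtain w l where eb: "eigenbasis n M w l" and l: "\<And>i. i < n \<Longrightarrow> 0 \<le> l i" using sym_psd_eigenbasis[OF psd] by blast
 note e = sym_psdD(1,2)[OF psd] eb
 have Mv: "M *\<^sub>v v \<in> carrier_vec n" using e(1) v by auto
 have "(\<Sum>i<n. l i * (ip (w i) v)^2) = 0"
  using z unfolding eb_quad[OF e v v] by (simp add: power2_eq_square mult.assoc)
 then have "l i * (ip (w i) v)^2 = 0" if "i < n" for i
  using that l by (subst (asm) sum_nonneg_eq_0_iff) auto
 then have "ip (w i) (M *\<^sub>v v) = 0" if "i < n" for i
  using that by (auto simp: eb_coord[OF e _ v])
 then have "ip (M *\<^sub>v v) (M *\<^sub>v v) = 0"
  unfolding orthonormal_parseval(3)[OF eb_orth[OF e] Mv] by simp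
 then show ?thesis using ip_self_pos[OF Mv] by force
qed

section \<open>Moore-Penrose inverse of a symmetric matrix\<close>

definition penrose :: "nat \<Rightarrow> real mat \<Rightarrow> real mat \<Rightarrow> bool" where
 "penrose n M X \<longleftrightarrow> X \<in> carrier_mat n n \<and> M * X * M = M \<and> X * M * X = X \<and>
   (M * X)\<^sup>T = M * X \<and> (X * M)\<^sup>T = X * M"

text \<open>\<open>M X\<close> and \<open>M Y\<close> are symmetric and absorb each other, hence
  agree; the same holds for \<open>X M\<close> and \<open>Y M\<close>, and \<open>X = X M X\<close>
  then turns into \<open>Y\<close>.\<close>

lemma penrose_unique:
 assumes M: "M \<in> carrier_mat n n" and X: "penrose n M X" and Y: "penrose n M Y"
 shows "X = Y"
proof -
 have c: "X \<in> carrier_mat n n" "Y \<in> carrier_mat n n" using X Y by (auto simp: penrose_def)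
 note as = assoc_mult_mat[of _ n n _ n _ n]
 have 1: "(M * Y) * (M * X) = M * X"
 proof -
  have "(M * Y) * (M * X) = (M * Y * M) * X" using M c by (intro as[symmetric]) auto
  then show ?thesis using Y by (simp add: penrose_def)
 qed
 have 2: "(M * X) * (M * Y) = M * Y"
 proof -
  have "(M * X) * (M * Y) = (M * X * M) * Y" using M c by (intro as[symmetric]) auto
  then show ?thesis using X by (simp add: penrose_def)
 qed
 have "M * X = ((M * Y) * (M * X))\<^sup>T" using X unfolding 1 by (simp add: penrose_def)
 also have "... = (M * X)\<^sup>T * (M * Y)\<^sup>T"
  using M c by (intro transpose_mult[of _ n n _ n]) auto
 also have "... = (M * X) * (M * Y)" using X Y by (simp add: penrose_def)
 finally have MX: "M * X = M * Y" unfolding 2 .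
 have 3: "(X * M) * (Y * M) = X * M"
 proof -
  have "(X * M) * (Y * M) = X * (M * (Y * M))" using M c by (intro as) auto
  also have "M * (Y * M) = M * Y * M" using M c by (intro as[symmetric]) auto
  finally show ?thesis using Y by (simp add: penrose_def)
 qed
 have 4: "(Y * M) * (X * M) = Y * M"
 proof -
  have "(Y * M) * (X * M) = Y * (M * (X * M))" using M c by (intro as) auto
  also have "M * (X * M) = M * X * M" using M c by (intro as[symmetric]) auto
  finally show ?thesis using X by (simp add: penrose_def)
 qed
 have "X * M = ((X * M) * (Y * M))\<^sup>T" using X unfolding 3 by (simp add: penrose_def)
 also have "... = (Y * M)\<^sup>T * (X * M)\<^sup>T"
  using M c by (intro transpose_mult[of _ n n _ n]) auto
 also have "... = (Y * M) * (X * M)" using X Y by (simp add: penrose_def)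
 finally have XM: "X * M = Y * M" unfolding 4 .
 have "X = X * M * X" using X by (simp add: penrose_def)
 also have "... = Y * M * X" by (simp add: XM)
 also have "... = Y * (M * X)" using M c by (intro as) auto
 also have "... = Y * (M * Y)" by (simp add: MX)
 also have "... = Y * M * Y" using M c by (intro as[symmetric]) auto
 also have "... = Y" using Y by (simp add: penrose_def)
 finally show ?thesis .
qed

text \<open>\<open>pinv\<close> is a definite description, so a witness has to be exhibited. It is
  obtained by inverting the eigenvalues in an eigenbasis, which also shows its symmetry.\<close>

lemma symmetric_pinv:
 assumes M: "M \<in> carrier_mat n n" and sym: "M\<^sup>T = M"
 shows "penrose n M (pinv M)" "(pinv M)\<^sup>T = pinv M"
proof -
 obtain w l where eb: "eigenbasis n M w l" using symmetric_mat_eigenbasis[OF M sym] by auto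
 let ?V = "fam_mat n n w"
 define D where "D = (\<lambda>f. ?V * mat_diag n f * ?V\<^sup>T)"
 have Dc[simp]: "D f \<in> carrier_mat n n" for f by (simp add: D_def)
 have De: "D f $$ (r, s) = (\<Sum>i<n. ?V $$ (r,i) * f i * ?V $$ (s,i))" if "r < n" "s < n" for f r s
  unfolding D_def using that
  by (subst mat_diag_mult_right[of _ n n], simp, subst mult_mat_entry[of _ n n _ n]) auto
 have Dt: "(D f)\<^sup>T = D f" for f
  by (rule eq_matI) (auto simp: De mult_ac carrier_matD[OF Dc])
 have VV: "?V\<^sup>T * ?V = 1\<^sub>m n"
  using fam_mat_orth[OF eb_orth[OF M sym eb]] .
 have Dm: "D f * D g = D (\<lambda>i. f i * g i)" for f g
 proof -
  have "D f * D g = (?V * mat_diag n f) * (?V\<^sup>T * (?V * mat_diag n g * ?V\<^sup>T))"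
   unfolding D_def by (rule assoc_mult_mat[of _ n n _ n _ n]) auto
  also have "?V\<^sup>T * (?V * mat_diag n g * ?V\<^sup>T) = ?V\<^sup>T * (?V * (mat_diag n g * ?V\<^sup>T))"
   by (subst assoc_mult_mat[of ?V n n _ n _ n]) auto
  also have "... = (?V\<^sup>T * ?V) * (mat_diag n g * ?V\<^sup>T)"
   by (subst assoc_mult_mat[of "?V\<^sup>T" n n _ n _ n]) auto
  also have "... = mat_diag n g * ?V\<^sup>T"
   unfolding VV by (rule left_mult_one_mat[of _ n n]) simp
  also have "(?V * mat_diag n f) * ... = ?V * (mat_diag n f * (mat_diag n g * ?V\<^sup>T))"
   by (rule assoc_mult_mat[of _ n n _ n _ n]) auto
  also have "mat_diag n f * (mat_diag n g * ?V\<^sup>T) = (mat_diag n f * mat_diag n g) * ?V\<^sup>T"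
   by (rule assoc_mult_mat[symmetric, of _ n n _ n _ n]) auto
  also have "... = mat_diag n (\<lambda>i. f i * g i) * ?V\<^sup>T" by simp
  also have "?V * ... = D (\<lambda>i. f i * g i)" unfolding D_def
   by (rule assoc_mult_mat[symmetric, of _ n n _ n _ n]) auto
  finally show ?thesis .
 qed
 \<comment> \<open>The convention \<open>inverse 0 = 0\<close> puts zero on the kernel, as the
   Penrose equations demand.\<close>
 define X where "X = D (\<lambda>i. inverse (l i))"
 have MD: "M = D l" using eb_decomp[OF M sym eb] by (simp add: D_def)
 have i1: "(\<lambda>i. l i * inverse (l i) * l i) = l"
  by (rule ext, case_tac "l i = 0") auto
 have i2: "(\<lambda>i. inverse (l i) * l i * inverse (l i)) = (\<lambda>i. inverse (l i))"
  by (rule ext, case_tac "l i = 0") auto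
 have pX: "penrose n M X"
  unfolding penrose_def X_def MD by (simp add: Dm Dt i1 i2)
 have "pinv M = X"
  unfolding pinv_def
 proof (rule the_equality)
  show "X \<in> carrier_mat (dim_col M) (dim_row M) \<and> M * X * M = M \<and> X * M * X = X \<and>
   (M * X)\<^sup>T = M * X \<and> (X * M)\<^sup>T = X * M"
   using pX M by (simp add: penrose_def)
  fix Y assume "Y \<in> carrier_mat (dim_col M) (dim_row M) \<and> M * Y * M = M \<and> Y * M * Y = Y \<and>
   (M * Y)\<^sup>T = M * Y \<and> (Y * M)\<^sup>T = Y * M"
  then have "penrose n M Y" using M by (simp add: penrose_def)
  then show "Y = X" using penrose_unique[OF M _ pX] by blast
 qed
 then show "penrose n M (pinv M)" "(pinv M)\<^sup>T = pinv M" using pX by (simp_all add: X_def Dt)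
qed

lemma mat_inv_eq:
 assumes M: "M \<in> carrier_mat n n" and X: "X \<in> carrier_mat n n" "M * X = 1\<^sub>m n"
 shows "mat_inv M = X"
 unfolding mat_inv_def
proof (rule the_equality)
 have XM: "X * M = 1\<^sub>m n" by (rule mat_mult_left_right_inverse[OF M X])
 show "X \<in> carrier_mat (dim_row M) (dim_row M) \<and> M * X = 1\<^sub>m (dim_row M) \<and> X * M = 1\<^sub>m (dim_row M)"
  using M X XM by auto
 fix Y assume "Y \<in> carrier_mat (dim_row M) (dim_row M) \<and> M * Y = 1\<^sub>m (dim_row M) \<and> Y * M = 1\<^sub>m (dim_row M)"
 then have Y: "Y \<in> carrier_mat n n" "Y * M = 1\<^sub>m n" using M by auto
 have "Y = Y * (M * X)" using X Y by simp
 also have "... = Y * M * X" by (rule assoc_mult_mat[symmetric, of _ n n _ n _ n]) (use M X Y in auto)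
 also have "... = X" using X Y by simp
 finally show "Y = X" .
qed

lemma vec_sub_carrier [simp]: "v \<in> carrier_vec n \<Longrightarrow> w \<in> carrier_vec n \<Longrightarrow> v - w \<in> carrier_vec n"
 by auto

lemma mat_vec_carrier [simp]: "A \<in> carrier_mat n m \<Longrightarrow> v \<in> carrier_vec m \<Longrightarrow> A *\<^sub>v v \<in> carrier_vec n"
 by auto

lemma ip_diff_left: "x \<in> carrier_vec n \<Longrightarrow> y \<in> carrier_vec n \<Longrightarrow> z \<in> carrier_vec n \<Longrightarrow> ip (x - y) z = ip x z - ip y z"
 by (rule minus_scalar_prod_distrib)

lemma ip_diff_right: "x \<in> carrier_vec n \<Longrightarrow> y \<in> carrier_vec n \<Longrightarrow> z \<in> carrier_vec n \<Longrightarrow> ip x (y - z) = ip x y - ip x z"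
 by (rule scalar_prod_minus_distrib)

lemma mat_vec_diff: "A \<in> carrier_mat n m \<Longrightarrow> v \<in> carrier_vec m \<Longrightarrow> w \<in> carrier_vec m \<Longrightarrow> A *\<^sub>v (v - w) = A *\<^sub>v v - A *\<^sub>v (w :: real vec)"
 by (rule mult_minus_distrib_mat_vec)

lemma symmetric_matI:
 fixes M :: "real mat"
 assumes M: "M \<in> carrier_mat n n"
  and s: "\<And>x y. x \<in> carrier_vec n \<Longrightarrow> y \<in> carrier_vec n \<Longrightarrow> ip x (M *\<^sub>v y) = ip y (M *\<^sub>v x)"
 shows "M\<^sup>T = M"
proof (rule eq_matI)
 have e: "ip (unit_vec n r) (M *\<^sub>v unit_vec n s) = M $$ (r, s)" if "r < n" "s < n" for r s
 proof -
  have "ip (unit_vec n r) (M *\<^sub>v unit_vec n s) = (M *\<^sub>v unit_vec n s) $ r"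
   using that M by (intro scalar_prod_left_unit) auto
  also have "... = M $$ (r, s)"
   using that by (subst mult_mat_vec_entry[OF M]) (auto simp: unit_vec_def if_distrib cong: if_cong)
  finally show ?thesis .
 qed
 fix r s assume "r < dim_row M" "s < dim_col M"
 then have rs: "r < n" "s < n" using M by auto
 have "M $$ (s, r) = M $$ (r, s)" using s[of "unit_vec n s" "unit_vec n r"] e rs by simp
 then show "M\<^sup>T $$ (r, s) = M $$ (r, s)" using rs M by simp
qed (use M in auto)

section \<open>The Nystrom error\<close>

text \<open>The Nystrom error is the Schur complement, hence the partial minimum of a quadratic form.\<close>
lemma nystrom_error:
 assumes A: "sym_psd n A" and O: "\<Omega> \<in> carrier_mat n m"
 defines "E \<equiv> A - nystrom A \<Omega>"
 shows "sym_psd n E"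
  and "x \<in> carrier_vec n \<Longrightarrow> z \<in> carrier_vec m \<Longrightarrow> ip x (E *\<^sub>v x) \<le> ip (x - \<Omega> *\<^sub>v z) (A *\<^sub>v (x - \<Omega> *\<^sub>v z))"
  and "x \<in> carrier_vec n \<Longrightarrow> \<exists>z\<in>carrier_vec m. ip x (E *\<^sub>v x) = ip (x - \<Omega> *\<^sub>v z) (A *\<^sub>v (x - \<Omega> *\<^sub>v z))"
proof -
 note Ac = sym_psdD(1)[OF A] and As = sym_psdD(2)[OF A]
 define M where "M = \<Omega>\<^sup>T * A * \<Omega>"
 define X where "X = pinv M"
 have OtA: "\<Omega>\<^sup>T * A \<in> carrier_mat m n" using O Ac by auto
 have M: "M \<in> carrier_mat m m" unfolding M_def using OtA O by auto
 have Mv: "M *\<^sub>v v = \<Omega>\<^sup>T *\<^sub>v (A *\<^sub>v (\<Omega> *\<^sub>v v))" if "v \<in> carrier_vec m" for v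
  unfolding M_def using that O Ac OtA
  by (simp add: assoc_mult_mat_vec[of _ m n _ m] assoc_mult_mat_vec[of _ m n _ n])
 have Asym: "ip x (A *\<^sub>v y) = ip y (A *\<^sub>v x)" if "x \<in> carrier_vec n" "y \<in> carrier_vec n" for x y
  using ip_mult_mat_vec[OF Ac that(2,1)] As ip_comm[of "A *\<^sub>v x" n y] that Ac by simp
 have Oip: "ip v (\<Omega>\<^sup>T *\<^sub>v y) = ip (\<Omega> *\<^sub>v v) y" if "v \<in> carrier_vec m" "y \<in> carrier_vec n" for v y
  using ip_mult_mat_vec[of "\<Omega>\<^sup>T" m n y v] that O by simp
 have Mip: "ip v (M *\<^sub>v w) = ip (\<Omega> *\<^sub>v v) (A *\<^sub>v (\<Omega> *\<^sub>v w))" if "v \<in> carrier_vec m" "w \<in> carrier_vec m" for v w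
  unfolding Mv[OF that(2)] using that O Ac by (intro Oip) auto
 have Ms: "M\<^sup>T = M"
  by (rule symmetric_matI[OF M]) (use Mip Asym O in auto)
 have Mpsd: "0 \<le> ip v (M *\<^sub>v v)" if "v \<in> carrier_vec m" for v
  unfolding Mip[OF that that] using sym_psdD(3)[OF A] that O by auto
 note P = symmetric_pinv[OF M Ms, folded X_def]
 have X: "X \<in> carrier_mat m m" using P(1) by (simp add: penrose_def)
 have Xsym: "ip v (X *\<^sub>v w) = ip w (X *\<^sub>v v)" if "v \<in> carrier_vec m" "w \<in> carrier_vec m" for v w
  using ip_mult_mat_vec[OF X that(2,1)] P(2) ip_comm[of "X *\<^sub>v v" m w] that X by simp
 define b where "b = (\<lambda>x. \<Omega>\<^sup>T *\<^sub>v (A *\<^sub>v x))"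
 have b: "b x \<in> carrier_vec m" if "x \<in> carrier_vec n" for x unfolding b_def using that O Ac by auto
 have nys: "nystrom A \<Omega> *\<^sub>v x = A *\<^sub>v (\<Omega> *\<^sub>v (X *\<^sub>v b x))" if x: "x \<in> carrier_vec n" for x
 proof -
  have c1: "A * \<Omega> \<in> carrier_mat n m" "A * \<Omega> * X \<in> carrier_mat n m" "A * \<Omega> * X * \<Omega>\<^sup>T \<in> carrier_mat n n"
   using Ac O X by auto
  show ?thesis
   unfolding nystrom_def M_def[symmetric] X_def[symmetric] b_def using x c1 Ac O X
   by (simp add: assoc_mult_mat_vec[of _ n n _ n] assoc_mult_mat_vec[of _ n m _ n] assoc_mult_mat_vec[of _ n m _ m] assoc_mult_mat_vec[of _ n n _ m])
 qed
 have nysc: "nystrom A \<Omega> \<in> carrier_mat n n" unfolding nystrom_def using Ac O X unfolding X_def M_def by auto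
 have E: "E \<in> carrier_mat n n" unfolding E_def using Ac nysc by auto
 have Ex: "E *\<^sub>v x = A *\<^sub>v x - A *\<^sub>v (\<Omega> *\<^sub>v (X *\<^sub>v b x))" if x: "x \<in> carrier_vec n" for x
  unfolding E_def using minus_mult_distrib_mat_vec[OF Ac nysc x] nys[OF x] by simp
 have Eip: "ip y (E *\<^sub>v x) = ip y (A *\<^sub>v x) - ip (b y) (X *\<^sub>v b x)" if x: "x \<in> carrier_vec n" and y: "y \<in> carrier_vec n" for x y
 proof -
  have Xb: "X *\<^sub>v b x \<in> carrier_vec m" using X b[OF x] by auto
  have "ip y (A *\<^sub>v (\<Omega> *\<^sub>v (X *\<^sub>v b x))) = ip (\<Omega> *\<^sub>v (X *\<^sub>v b x)) (A *\<^sub>v y)"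
   using O Xb y by (intro Asym) auto
  also have "... = ip (X *\<^sub>v b x) (b y)" using Oip[OF Xb, of "A *\<^sub>v y"] y Ac by (simp add: b_def)
  also have "... = ip (b y) (X *\<^sub>v b x)" using Xb b[OF y] by (intro ip_comm) auto
  finally show ?thesis unfolding Ex[OF x] using x y Ac O Xb by (subst ip_diff_right[of _ n]) auto
 qed
 have Es: "E\<^sup>T = E"
  by (rule symmetric_matI[OF E]) (use Eip Asym Xsym b in auto)
 \<comment> \<open>\<open>b x\<close> lies in the range of \<open>M\<close>: the residual
   \<open>c\<close> is annihilated by \<open>M\<close>, so \<open>A (\<Omega> c) = 0\<close> by
   \<open>psd_quad_zero\<close>; then \<open>c\<close> is orthogonal both to \<open>b x\<close> and
   to \<open>M (X (b x))\<close>, hence to itself.\<close>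
 have MXb: "M *\<^sub>v (X *\<^sub>v b x) = b x" if x: "x \<in> carrier_vec n" for x
 proof -
  define c where "c = b x - M *\<^sub>v (X *\<^sub>v b x)"
  have Xb: "X *\<^sub>v b x \<in> carrier_vec m" using X b[OF x] by auto
  have MXb: "M *\<^sub>v (X *\<^sub>v b x) \<in> carrier_vec m" using M Xb by auto
  have c: "c \<in> carrier_vec m" unfolding c_def using b[OF x] MXb by auto
  have "M * (M * X) = M"
  proof -
   have "(M * X * M)\<^sup>T = M\<^sup>T * (M * X)\<^sup>T"
    using M X by (intro transpose_mult[of _ m m _ m]) auto
   then show ?thesis using P(1) Ms by (simp add: penrose_def)
  qed
  then have "M *\<^sub>v (M *\<^sub>v (X *\<^sub>v b x)) = M *\<^sub>v b x"
   using M X b[OF x] by (metis assoc_mult_mat_vec square_mult_carrier)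
  then have Mc: "M *\<^sub>v c = 0\<^sub>v m"
   unfolding c_def using mat_vec_diff[OF M b[OF x] MXb] M b[OF x] by auto
  have "ip (\<Omega> *\<^sub>v c) (A *\<^sub>v (\<Omega> *\<^sub>v c)) = 0" using Mip[OF c c] Mc c by simp
  then have AOc: "A *\<^sub>v (\<Omega> *\<^sub>v c) = 0\<^sub>v n" using psd_quad_zero[OF A] O c by auto
  have "ip c (b x) = ip (\<Omega> *\<^sub>v c) (A *\<^sub>v x)" unfolding b_def using c x Ac by (intro Oip) auto
  also have "... = ip x (A *\<^sub>v (\<Omega> *\<^sub>v c))" using c x O by (intro Asym) auto
  also have "... = 0" using AOc x by simp
  finally have 1: "ip c (b x) = 0" .
  have "ip c (M *\<^sub>v (X *\<^sub>v b x)) = ip (M *\<^sub>v c) (X *\<^sub>v b x)" using ip_mult_mat_vec[OF M Xb c] Ms by simp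
  then have 2: "ip c (M *\<^sub>v (X *\<^sub>v b x)) = 0" using Mc Xb by simp
  have "ip c c = 0" using ip_diff_right[OF c b[OF x] MXb] 1 2 by (simp add: c_def)
  then have "c = 0\<^sub>v m" using ip_self_pos[OF c] by force
  show ?thesis
  proof (rule eq_vecI)
   fix i assume "i < dim_vec (b x)"
   then have i: "i < m" using b[OF x] by auto
   have "c $ i = 0" using \<open>c = 0\<^sub>v m\<close> i by simp
   moreover have "c $ i = b x $ i - (M *\<^sub>v (X *\<^sub>v b x)) $ i"
    unfolding c_def using i carrier_vecD[OF MXb] by (intro index_minus_vec(1)) simp
   ultimately show "(M *\<^sub>v (X *\<^sub>v b x)) $ i = b x $ i" by simp
  qed (use b[OF x] M in auto)
 qed
 have expand: "ip (x - \<Omega> *\<^sub>v z) (A *\<^sub>v (x - \<Omega> *\<^sub>v z)) = ip x (A *\<^sub>v x) - 2 * ip z (b x) + ip z (M *\<^sub>v z)"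
  if x: "x \<in> carrier_vec n" and z: "z \<in> carrier_vec m" for x z
 proof -
  have Oz: "\<Omega> *\<^sub>v z \<in> carrier_vec n" using O z by auto
  have "ip (x - \<Omega> *\<^sub>v z) (A *\<^sub>v (x - \<Omega> *\<^sub>v z)) = ip (x - \<Omega> *\<^sub>v z) (A *\<^sub>v x) - ip (x - \<Omega> *\<^sub>v z) (A *\<^sub>v (\<Omega> *\<^sub>v z))"
   unfolding mat_vec_diff[OF Ac x Oz] using Ac x Oz by (subst ip_diff_right[of _ n]) auto
  also have "... = (ip x (A *\<^sub>v x) - ip (\<Omega> *\<^sub>v z) (A *\<^sub>v x)) - (ip x (A *\<^sub>v (\<Omega> *\<^sub>v z)) - ip (\<Omega> *\<^sub>v z) (A *\<^sub>v (\<Omega> *\<^sub>v z)))"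
   using Ac x Oz by (subst (1 2) ip_diff_left[of _ n]) auto
  also have "ip x (A *\<^sub>v (\<Omega> *\<^sub>v z)) = ip (\<Omega> *\<^sub>v z) (A *\<^sub>v x)" by (rule Asym[OF x Oz])
  also have "ip (\<Omega> *\<^sub>v z) (A *\<^sub>v (\<Omega> *\<^sub>v z)) = ip z (M *\<^sub>v z)" by (rule Mip[OF z z, symmetric])
  also have "ip (\<Omega> *\<^sub>v z) (A *\<^sub>v x) = ip z (b x)" unfolding b_def using z x Ac by (intro Oip[symmetric]) auto
  finally show ?thesis by simp
 qed
 show le: "ip x (E *\<^sub>v x) \<le> ip (x - \<Omega> *\<^sub>v z) (A *\<^sub>v (x - \<Omega> *\<^sub>v z))"
  if x: "x \<in> carrier_vec n" and z: "z \<in> carrier_vec m" for x z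
 proof -
  \<comment> \<open>\<open>y\<close> solves the normal equations, so the gap between the form at
    \<open>z\<close> and the error is \<open>ip (z - y) (M (z - y))\<close>.\<close>
  define y where "y = X *\<^sub>v b x"
  have y: "y \<in> carrier_vec m" unfolding y_def using X b[OF x] by auto
  have My: "M *\<^sub>v y = b x" unfolding y_def by (rule MXb[OF x])
  have "0 \<le> ip (z - y) (M *\<^sub>v (z - y))" using Mpsd z y by auto
  also have "... = ip (z - y) (M *\<^sub>v z) - ip (z - y) (M *\<^sub>v y)"
   unfolding mat_vec_diff[OF M z y] using z y M by (subst ip_diff_right[of _ m]) auto
  also have "... = (ip z (M *\<^sub>v z) - ip y (M *\<^sub>v z)) - (ip z (b x) - ip y (b x))"
   unfolding My using z y M b[OF x] by (subst (1 2) ip_diff_left[of _ m]) auto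
  also have "ip y (M *\<^sub>v z) = ip z (b x)"
   using ip_mult_mat_vec[OF M z y] Ms My ip_comm[OF b[OF x] z] by simp
  also have "ip y (b x) = ip (b x) (X *\<^sub>v b x)" unfolding y_def[symmetric] by (rule ip_comm[OF y b[OF x]])
  finally show ?thesis unfolding expand[OF x z] Eip[OF x x] by simp
 qed
 show ex: "\<exists>z\<in>carrier_vec m. ip x (E *\<^sub>v x) = ip (x - \<Omega> *\<^sub>v z) (A *\<^sub>v (x - \<Omega> *\<^sub>v z))"
  if x: "x \<in> carrier_vec n" for x
 proof -
  have y: "X *\<^sub>v b x \<in> carrier_vec m" using X b[OF x] by auto
  show ?thesis
   by (rule bexI[OF _ y]) (simp add: expand[OF x y] Eip[OF x x] MXb[OF x] ip_comm[OF b[OF x] y])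
 qed
 have "0 \<le> ip x (E *\<^sub>v x)" if x: "x \<in> carrier_vec n" for x
 proof -
  obtain z where z: "z \<in> carrier_vec m" "ip x (E *\<^sub>v x) = ip (x - \<Omega> *\<^sub>v z) (A *\<^sub>v (x - \<Omega> *\<^sub>v z))"
   using ex[OF x] by auto
  have "x - \<Omega> *\<^sub>v z \<in> carrier_vec n" using x z O by auto
  then show ?thesis unfolding z(2) by (rule sym_psdD(3)[OF A])
 qed
 then show "sym_psd n E" using E Es by (simp add: sym_psd_def)
qed

section \<open>The error in the coordinates of the eigenbasis\<close>

definition frob2 :: "real mat \<Rightarrow> real" where
 "frob2 M = (\<Sum>i<dim_row M. \<Sum>j<dim_col M. (M $$ (i, j))^2)"

lemma frob2_nonneg: "0 \<le> frob2 M"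
 by (auto simp: frob2_def intro!: sum_nonneg)

lemma sum_split_at:
 fixes f :: "nat \<Rightarrow> real"
 assumes "k \<le> n"
 shows "(\<Sum>i<n. f i) = (\<Sum>i<k. f i) + (\<Sum>j<n-k. f (j + k))"
proof -
 have "{..<n} = {..<k} \<union> {k..<n}" using assms by auto
 then have "(\<Sum>i<n. f i) = (\<Sum>i<k. f i) + (\<Sum>i=k..<n. f i)"
  by (metis finite_atLeastLessThan finite_lessThan ivl_disj_int_one(2) sum.union_disjoint)
 also have "(\<Sum>i=k..<n. f i) = (\<Sum>j<n-k. f (j + k))"
  using assms by (intro sum.reindex_bij_witness[of _ "\<lambda>j. j + k" "\<lambda>i. i - k"]) auto
 finally show ?thesis .
qed

lemma trace_orthonormal:
 assumes w: "orthonormal_family n n w" and E: "E \<in> carrier_mat n n"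
 shows "(\<Sum>i<n. ip (w i) (E *\<^sub>v w i)) = (\<Sum>r<n. E $$ (r, r))"
proof -
 have wc: "w i \<in> carrier_vec n" if "i < n" for i using w that by (simp add: orthonormal_family_def)
 have "(\<Sum>i<n. ip (w i) (E *\<^sub>v w i)) = (\<Sum>i<n. \<Sum>r<n. \<Sum>s<n. E $$ (r, s) * (w i $ r * w i $ s))"
 proof (rule sum.cong[OF refl])
  fix i assume "i \<in> {..<n}"
  then have i: "w i \<in> carrier_vec n" using wc by simp
  have "E *\<^sub>v w i \<in> carrier_vec n" using E i by auto
  then show "ip (w i) (E *\<^sub>v w i) = (\<Sum>r<n. \<Sum>s<n. E $$ (r, s) * (w i $ r * w i $ s))"
   by (simp add: ip_sum[OF i] mult_mat_vec_entry[OF E i] sum_distrib_left mult_ac)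
 qed
 also have "... = (\<Sum>r<n. \<Sum>i<n. \<Sum>s<n. E $$ (r, s) * (w i $ r * w i $ s))"
  by (rule sum.swap)
 also have "... = (\<Sum>r<n. \<Sum>s<n. \<Sum>i<n. E $$ (r, s) * (w i $ r * w i $ s))"
  by (intro sum.cong refl sum.swap)
 also have "... = (\<Sum>r<n. \<Sum>s<n. E $$ (r, s) * (if r = s then 1 else 0))"
  by (intro sum.cong refl) (simp add: sum_distrib_left[symmetric] orthonormal_parseval(1)[OF w])
 also have "... = (\<Sum>r<n. E $$ (r, r))"
  by (intro sum.cong refl) (simp add: if_distrib cong: if_cong)
 finally show ?thesis .
qed

lemma orthonormal_mat_family:
 assumes U: "orthonormal_mat n U"
 shows "orthonormal_family n n (col U)"
 unfolding orthonormal_family_def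
proof (intro conjI allI impI)
 have c: "U \<in> carrier_mat n n" "U\<^sup>T * U = 1\<^sub>m n" using U by (auto simp: orthonormal_mat_def)
 fix i j assume ij: "i < n" "j < n"
 show "col U i \<in> carrier_vec n" using c by auto
 have "(U\<^sup>T * U) $$ (i, j) = ip (col U i) (col U j)" using c(1) ij by simp
 then show "ip (col U i) (col U j) = (if i = j then 1 else 0)" using c(2) ij by simp
qed

lemma eigenbasis_of_decomp:
 assumes U: "orthonormal_mat n U" and A: "A = U * mat_diag n \<sigma> * U\<^sup>T"
 shows "eigenbasis n A (col U) \<sigma>"
 unfolding eigenbasis_def
proof (intro conjI allI impI)
 show fam: "orthonormal_family n n (col U)" by (rule orthonormal_mat_family[OF U])
 have c: "U \<in> carrier_mat n n" "U\<^sup>T * U = 1\<^sub>m n" using U by (auto simp: orthonormal_mat_def)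
 fix i assume i: "i < n"
 have "A *\<^sub>v col U i = col (A * U) i" using c i A by (intro col_mult2[symmetric, of _ n n _ n]) auto
 also have "A * U = (U * mat_diag n \<sigma>) * (U\<^sup>T * U)"
  unfolding A using c by (intro assoc_mult_mat[of _ n n _ n _ n]) auto
 also have "... = U * mat_diag n \<sigma>" using c by simp
 also have "... = Matrix.mat n n (\<lambda>(r,s). U $$ (r,s) * \<sigma> s)" by (rule mat_diag_mult_right[OF c(1)])
 also have "col ... i = \<sigma> i \<cdot>\<^sub>v col U i" using c i by (intro eq_vecI) auto
 finally show "A *\<^sub>v col U i = \<sigma> i \<cdot>\<^sub>v col U i" .
qed

context
 fixes n k m A U \<sigma> \<Omega> N Y
 assumes A: "sym_psd n A" and kn: "k \<le> n" and U: "orthonormal_mat n U"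
  and Aeig: "A = U * mat_diag n \<sigma> * U\<^sup>T" and sig: "\<And>i. i < n \<Longrightarrow> 0 \<le> \<sigma> i"
  and O: "\<Omega> \<in> carrier_mat n m" and N: "N \<in> carrier_mat m k"
  and inv: "(U1 n k U)\<^sup>T * \<Omega> * N = 1\<^sub>m k"
  and Y: "Y = Sigma2_half n k \<sigma> * ((U2 n k U)\<^sup>T * \<Omega> * N)"
begin

text \<open>The trial vector is \<open>z = N a\<close>, where \<open>a\<close> holds the leading
  \<open>k\<close> coordinates of \<open>x\<close>. As \<open>N\<close> is a right inverse of
  \<open>U\<^sub>1\<^sup>T \<Omega>\<close>, subtracting \<open>\<Omega> z\<close> removes these
  coordinates completely; \<open>Y a\<close> is what it subtracts from the remaining ones after
  weighting by the square roots of the eigenvalues.\<close>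

lemma nystrom_error_coords:
 assumes x: "x \<in> carrier_vec n"
 defines "a \<equiv> Matrix.vec k (\<lambda>i. ip (col U i) x)"
 shows "ip x ((A - nystrom A \<Omega>) *\<^sub>v x) \<le> (\<Sum>j<n-k. (sqrt (\<sigma> (j + k)) * ip (col U (j + k)) x - (Y *\<^sub>v a) $ j)^2)"
proof -
 have Uc: "U \<in> carrier_mat n n" using U by (simp add: orthonormal_mat_def)
 have U1: "U1 n k U \<in> carrier_mat n k" and U2: "U2 n k U \<in> carrier_mat n (n - k)" by (simp_all add: U1_def U2_def)
 have a: "a \<in> carrier_vec k" by (simp add: a_def)
 have Na: "N *\<^sub>v a \<in> carrier_vec m" using N a by auto
 have ON: "\<Omega> *\<^sub>v (N *\<^sub>v a) \<in> carrier_vec n" using O Na by auto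
 define y where "y = x - \<Omega> *\<^sub>v (N *\<^sub>v a)"
 have y: "y \<in> carrier_vec n" unfolding y_def using x ON by auto
 have uc: "col U i \<in> carrier_vec n" for i using Uc by auto
 have c1: "ip (col U i) (\<Omega> *\<^sub>v (N *\<^sub>v a)) = a $ i" if i: "i < k" for i
 proof -
  have "ip (col U i) (\<Omega> *\<^sub>v (N *\<^sub>v a)) = ((U1 n k U)\<^sup>T *\<^sub>v (\<Omega> *\<^sub>v (N *\<^sub>v a))) $ i"
   using i kn Uc ip_sum[OF uc ON, of i] by (subst mult_mat_vec_entry[of _ k n, OF _ ON]) (auto simp: U1_def)
  also have "(U1 n k U)\<^sup>T *\<^sub>v (\<Omega> *\<^sub>v (N *\<^sub>v a)) = ((U1 n k U)\<^sup>T * \<Omega> * N) *\<^sub>v a"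
  proof -
   have "((U1 n k U)\<^sup>T * \<Omega> * N) *\<^sub>v a = ((U1 n k U)\<^sup>T * \<Omega>) *\<^sub>v (N *\<^sub>v a)"
    using U1 O N a by (intro assoc_mult_mat_vec[of _ k m _ k]) auto
   also have "... = (U1 n k U)\<^sup>T *\<^sub>v (\<Omega> *\<^sub>v (N *\<^sub>v a))"
    using U1 O Na by (intro assoc_mult_mat_vec[of _ k n _ m]) auto
   finally show ?thesis by (simp only:)
  qed
  also have "... = a" unfolding inv using a by simp
  finally show ?thesis .
 qed
 have c2: "sqrt (\<sigma> (j + k)) * ip (col U (j + k)) (\<Omega> *\<^sub>v (N *\<^sub>v a)) = (Y *\<^sub>v a) $ j" if j: "j < n - k" for j
 proof -
  let ?F = "(U2 n k U)\<^sup>T * \<Omega> * N"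
  have F: "?F \<in> carrier_mat (n - k) k" using U2 O N by auto
  have Fa: "?F *\<^sub>v a \<in> carrier_vec (n - k)" using F a by auto
  have "ip (col U (j + k)) (\<Omega> *\<^sub>v (N *\<^sub>v a)) = ((U2 n k U)\<^sup>T *\<^sub>v (\<Omega> *\<^sub>v (N *\<^sub>v a))) $ j"
   using j kn Uc ip_sum[OF uc ON, of "j + k"] by (subst mult_mat_vec_entry[of _ "n - k" n, OF _ ON]) (auto simp: U2_def)
  also have "(U2 n k U)\<^sup>T *\<^sub>v (\<Omega> *\<^sub>v (N *\<^sub>v a)) = ?F *\<^sub>v a"
  proof -
   have "?F *\<^sub>v a = ((U2 n k U)\<^sup>T * \<Omega>) *\<^sub>v (N *\<^sub>v a)"
    using U2 O N a by (intro assoc_mult_mat_vec[of _ "n - k" m _ k]) auto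
   also have "... = (U2 n k U)\<^sup>T *\<^sub>v (\<Omega> *\<^sub>v (N *\<^sub>v a))"
    using U2 O Na by (intro assoc_mult_mat_vec[of _ "n - k" n _ m]) auto
   finally show ?thesis by (simp only:)
  qed
  finally have 1: "ip (col U (j + k)) (\<Omega> *\<^sub>v (N *\<^sub>v a)) = (?F *\<^sub>v a) $ j" .
  have S: "Sigma2_half n k \<sigma> \<in> carrier_mat (n - k) (n - k)" by (simp add: Sigma2_half_def)
  have "(Y *\<^sub>v a) $ j = (Sigma2_half n k \<sigma> *\<^sub>v (?F *\<^sub>v a)) $ j"
   unfolding Y using S F a by (simp add: assoc_mult_mat_vec[of _ "n - k" "n - k" _ k])
  also have "... = (\<Sum>l<n-k. (if j = l then sqrt (\<sigma> (l + k)) else 0) * (?F *\<^sub>v a) $ l)"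
   using j by (subst mult_mat_vec_entry[OF S Fa j]) (auto simp: Sigma2_half_def mat_diag_def intro!: sum.cong)
  also have "... = sqrt (\<sigma> (j + k)) * (?F *\<^sub>v a) $ j"
   using j by (simp add: if_distrib[where f="\<lambda>c. c * _"] cong: if_cong)
  finally show ?thesis using 1 by simp
 qed
 note e = sym_psdD(1,2)[OF A] eigenbasis_of_decomp[OF U Aeig]
 have "ip x ((A - nystrom A \<Omega>) *\<^sub>v x) \<le> ip y (A *\<^sub>v y)"
  unfolding y_def by (rule nystrom_error(2)[OF A O x Na])
 also have "... = (\<Sum>i<n. \<sigma> i * (ip (col U i) y)^2)"
  unfolding eb_quad[OF e y y] by (simp add: power2_eq_square mult.assoc)
 also have "... = (\<Sum>i<k. \<sigma> i * (ip (col U i) y)^2) + (\<Sum>j<n-k. \<sigma> (j + k) * (ip (col U (j + k)) y)^2)"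
  by (rule sum_split_at[OF kn])
 also have "(\<Sum>i<k. \<sigma> i * (ip (col U i) y)^2) = 0"
 proof (rule sum.neutral, rule ballI)
  fix i assume "i \<in> {..<k}"
  then have i: "i < k" by simp
  then show "\<sigma> i * (ip (col U i) y)^2 = 0"
   unfolding y_def ip_diff_right[OF uc x ON] c1[OF i] by (simp add: a_def)
 qed
 also have "(\<Sum>j<n-k. \<sigma> (j + k) * (ip (col U (j + k)) y)^2) = (\<Sum>j<n-k. (sqrt (\<sigma> (j + k)) * ip (col U (j + k)) x - (Y *\<^sub>v a) $ j)^2)"
 proof (rule sum.cong[OF refl])
  fix j assume "j \<in> {..<n-k}"
  then have j: "j < n - k" by simp
  have "\<sigma> (j + k) * (ip (col U (j + k)) y)^2 = (sqrt (\<sigma> (j + k)) * ip (col U (j + k)) y)^2"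
   using sig[of "j + k"] j by (simp add: power_mult_distrib)
  also have "sqrt (\<sigma> (j + k)) * ip (col U (j + k)) y = sqrt (\<sigma> (j + k)) * ip (col U (j + k)) x - (Y *\<^sub>v a) $ j"
   unfolding y_def ip_diff_right[OF uc x ON] c2[OF j, symmetric] by (simp add: algebra_simps)
  finally show "\<sigma> (j + k) * (ip (col U (j + k)) y)^2 = (sqrt (\<sigma> (j + k)) * ip (col U (j + k)) x - (Y *\<^sub>v a) $ j)^2" .
 qed
 finally show ?thesis by simp
qed

lemma Y_carrier: "Y \<in> carrier_mat (n - k) k"
 unfolding Y using O N by (auto simp: Sigma2_half_def U2_def)

lemma Sigma2_quad:
 assumes v: "v \<in> carrier_vec (n - k)"
 shows "ip v (Sigma2 n k \<sigma> *\<^sub>v v) = (\<Sum>j<n-k. \<sigma> (j + k) * (v $ j)^2)"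
proof -
 have S: "Sigma2 n k \<sigma> \<in> carrier_mat (n - k) (n - k)" by (simp add: Sigma2_def)
 have Sv: "Sigma2 n k \<sigma> *\<^sub>v v \<in> carrier_vec (n - k)" using S v by auto
 have "(Sigma2 n k \<sigma> *\<^sub>v v) $ j = \<sigma> (j + k) * v $ j" if "j < n - k" for j
  using that by (subst mult_mat_vec_entry[OF S v]) (simp_all add: Sigma2_def mat_diag_def if_distrib[where f="\<lambda>c. c * _"] cong: if_cong)
 then show ?thesis unfolding ip_sum[OF v Sv] by (auto simp: power2_eq_square intro!: sum.cong)
qed

lemma Sigma2_psd: "sym_psd (n - k) (Sigma2 n k \<sigma>)"
proof -
 have S: "Sigma2 n k \<sigma> \<in> carrier_mat (n - k) (n - k)" by (simp add: Sigma2_def)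
 show ?thesis unfolding sym_psd_def
 proof (intro conjI ballI)
  fix v :: "real vec" assume v: "v \<in> carrier_vec (n - k)"
  show "0 \<le> ip v (Sigma2 n k \<sigma> *\<^sub>v v)" unfolding Sigma2_quad[OF v] using sig by (intro sum_nonneg) auto
 qed (use S in \<open>auto simp: Sigma2_def mat_diag_def\<close>)
qed

text \<open>The trace is taken over the eigenvectors of \<open>A\<close>. For a leading eigenvector
  only a column of \<open>Y\<close> remains, for a trailing one \<open>a = 0\<close> and only its
  eigenvalue remains, so no cross terms arise.\<close>

lemma nystrom_nuc_bound: "nuc_norm (A - nystrom A \<Omega>) \<le> nuc_norm (Sigma2 n k \<sigma>) + frob2 Y"
proof -
 let ?E = "A - nystrom A \<Omega>"
 have Epsd: "sym_psd n ?E" by (rule nystrom_error(1)[OF A O])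
 note fam = orthonormal_mat_family[OF U]
 have Yc: "Y \<in> carrier_mat (n - k) k" by (rule Y_carrier)
 have ii: "ip (col U i) (col U j) = (if i = j then 1 else 0)" if "i < n" "j < n" for i j
  using fam that by (simp add: orthonormal_family_def)
 have uc: "col U i \<in> carrier_vec n" if "i < n" for i using fam that by (simp add: orthonormal_family_def)
 have "nuc_norm ?E = (\<Sum>i<n. ip (col U i) (?E *\<^sub>v col U i))"
  unfolding nuc_norm_psd[OF Epsd] by (rule trace_orthonormal[OF fam sym_psdD(1)[OF Epsd], symmetric])
 also have "... = (\<Sum>i<k. ip (col U i) (?E *\<^sub>v col U i)) + (\<Sum>i<n-k. ip (col U (i + k)) (?E *\<^sub>v col U (i + k)))"
  by (rule sum_split_at[OF kn])
 also have "... \<le> (\<Sum>i<k. \<Sum>j<n-k. (Y $$ (j, i))^2) + (\<Sum>i<n-k. \<sigma> (i + k))"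
 proof (intro add_mono sum_mono)
  fix i assume "i \<in> {..<k}"
  then have i: "i < k" "i < n" using kn by auto
  have a: "Matrix.vec k (\<lambda>i'. ip (col U i') (col U i)) = unit_vec k i"
   using i kn by (intro eq_vecI) (auto simp: ii)
  have "ip (col U i) (?E *\<^sub>v col U i) \<le> (\<Sum>j<n-k. (sqrt (\<sigma> (j + k)) * ip (col U (j + k)) (col U i) - (Y *\<^sub>v unit_vec k i) $ j)^2)"
   using nystrom_error_coords[OF uc[OF i(2)]] unfolding a .
  also have "... = (\<Sum>j<n-k. (Y $$ (j, i))^2)"
  proof (rule sum.cong[OF refl])
   fix j assume "j \<in> {..<n-k}"
   then have j: "j < n - k" by simp
   have "(Y *\<^sub>v unit_vec k i) $ j = Y $$ (j, i)"
    using i j by (subst mult_mat_vec_entry[OF Yc]) (auto simp: unit_vec_def if_distrib cong: if_cong)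
   then show "(sqrt (\<sigma> (j + k)) * ip (col U (j + k)) (col U i) - (Y *\<^sub>v unit_vec k i) $ j)^2 = (Y $$ (j, i))^2"
    using i j by (simp add: ii)
  qed
  finally show "ip (col U i) (?E *\<^sub>v col U i) \<le> (\<Sum>j<n-k. (Y $$ (j, i))^2)" .
 next
  fix i assume "i \<in> {..<n-k}"
  then have i: "i < n - k" "i + k < n" by auto
  have a: "Matrix.vec k (\<lambda>i'. ip (col U i') (col U (i + k))) = 0\<^sub>v k"
   using i kn by (intro eq_vecI) (auto simp: ii)
  have "ip (col U (i + k)) (?E *\<^sub>v col U (i + k)) \<le> (\<Sum>j<n-k. (sqrt (\<sigma> (j + k)) * ip (col U (j + k)) (col U (i + k)) - (Y *\<^sub>v 0\<^sub>v k) $ j)^2)"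
   using nystrom_error_coords[OF uc[OF i(2)]] unfolding a .
  also have "... = (\<Sum>j<n-k. if i = j then \<sigma> (j + k) else 0)"
   using i Yc sig by (intro sum.cong) (auto simp: ii power_mult_distrib)
  also have "... = \<sigma> (i + k)" using i by simp
  finally show "ip (col U (i + k)) (?E *\<^sub>v col U (i + k)) \<le> \<sigma> (i + k)" .
 qed
 also have "(\<Sum>i<k. \<Sum>j<n-k. (Y $$ (j, i))^2) = frob2 Y" unfolding frob2_def using Yc by (subst sum.swap) simp
 also have "(\<Sum>i<n-k. \<sigma> (i + k)) = nuc_norm (Sigma2 n k \<sigma>)"
  unfolding nuc_norm_psd[OF Sigma2_psd] by (auto simp: Sigma2_def mat_diag_def intro!: sum.cong)
 finally show ?thesis by simp
qed

text \<open>Leading and trailing coordinates of \<open>x\<close> are orthogonal, so Cauchy-Schwarz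
  bounds the square of \<open>sqrt s * norm b + sqrt y2 * norm a\<close> by \<open>s + y2\<close>
  times the squared norm of \<open>x\<close>; the two contributions add without a constant.\<close>

lemma nystrom_spec_bound:
 assumes y2: "0 \<le> y2" and Yn: "\<And>a. a \<in> carrier_vec k \<Longrightarrow> ip (Y *\<^sub>v a) (Y *\<^sub>v a) \<le> y2 * ip a a"
 shows "spec_norm (A - nystrom A \<Omega>) \<le> spec_norm (Sigma2 n k \<sigma>) + y2"
proof -
 let ?E = "A - nystrom A \<Omega>"
 define s where "s = spec_norm (Sigma2 n k \<sigma>)"
 have s0: "0 \<le> s" unfolding s_def by (rule spec_norm_nonneg)
 have Epsd: "sym_psd n ?E" by (rule nystrom_error(1)[OF A O])
 note fam = orthonormal_mat_family[OF U]
 have Yc: "Y \<in> carrier_mat (n - k) k" by (rule Y_carrier)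
 have "ip x (?E *\<^sub>v x) \<le> (s + y2) * ip x x" if x: "x \<in> carrier_vec n" for x
 proof -
  define a where "a = Matrix.vec k (\<lambda>i. ip (col U i) x)"
  define b where "b = Matrix.vec (n - k) (\<lambda>j. ip (col U (j + k)) x)"
  have ac: "a \<in> carrier_vec k" and bc: "b \<in> carrier_vec (n - k)" by (simp_all add: a_def b_def)
  define p where "p = (\<lambda>j. sqrt (\<sigma> (j + k)) * b $ j)"
  define q where "q = (\<lambda>j. (Y *\<^sub>v a) $ j)"
  define P where "P = (\<Sum>j<n-k. (p j)^2)"
  define Q where "Q = (\<Sum>j<n-k. (q j)^2)"
  have P: "P \<le> s * ip b b"
  proof -
   have "P = ip b (Sigma2 n k \<sigma> *\<^sub>v b)"
    unfolding P_def p_def Sigma2_quad[OF bc] using sig by (intro sum.cong) (auto simp: power_mult_distrib)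
   also have "... \<le> s * ip b b" unfolding s_def by (rule spec_norm_psd_ge[OF Sigma2_psd bc])
   finally show ?thesis .
  qed
  have Ya: "Y *\<^sub>v a \<in> carrier_vec (n - k)" using Yc ac by auto
  have Q: "Q \<le> y2 * ip a a" using Yn[OF ac] unfolding ip_sum[OF Ya Ya] Q_def q_def by (simp add: power2_eq_square)
  have P0: "0 \<le> P" and Q0: "0 \<le> Q" unfolding P_def Q_def by (auto intro!: sum_nonneg)
  have a0: "0 \<le> ip a a" and b0: "0 \<le> ip b b" by (rule ip_self_nonneg)+
  have xx: "ip x x = ip a a + ip b b"
   unfolding orthonormal_parseval(3)[OF fam x] sum_split_at[OF kn] ip_sum[OF ac ac] ip_sum[OF bc bc]
   by (simp add: a_def b_def power2_eq_square)
  have "ip x (?E *\<^sub>v x) \<le> (\<Sum>j<n-k. (p j - q j)^2)"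
   using nystrom_error_coords[OF x] unfolding p_def q_def a_def b_def by simp
  also have "... = P + Q - 2 * (\<Sum>j<n-k. p j * q j)"
   unfolding P_def Q_def by (simp add: power2_diff sum.distrib sum_subtractf sum_distrib_left mult.assoc)
  also have "- (\<Sum>j<n-k. p j * q j) \<le> sqrt P * sqrt Q"
  proof -
   have "\<bar>\<Sum>j<n-k. p j * q j\<bar> \<le> sqrt P * sqrt Q"
    using L2_set_mult_ineq[where f=p and g=q and A="{..<n-k}"]
    by (intro order_trans[OF sum_abs]) (simp add: P_def Q_def L2_set_def abs_mult)
   then show ?thesis by linarith
  qed
  then have "P + Q - 2 * (\<Sum>j<n-k. p j * q j) \<le> P + Q + 2 * (sqrt P * sqrt Q)" by linarith
  also have "... = (sqrt P + sqrt Q)^2" using P0 Q0 by (simp add: power2_sum)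
  also have "... \<le> (sqrt s * sqrt (ip b b) + sqrt y2 * sqrt (ip a a))^2"
   using P Q P0 Q0 by (intro power_mono add_mono) (auto simp: real_sqrt_mult[symmetric])
  also have "... \<le> (s + y2) * (ip b b + ip a a)"
  proof -
   have "0 \<le> (sqrt s * sqrt (ip a a) - sqrt y2 * sqrt (ip b b))^2" by simp
   then show ?thesis using s0 y2 a0 b0
    by (simp add: power2_sum power2_diff power_mult_distrib algebra_simps)
  qed
  finally show ?thesis by (simp add: xx add.commute)
 qed
 then show ?thesis using spec_norm_psd_le[OF Epsd, of "s + y2"] s0 y2 unfolding s_def by simp
qed

end

section \<open>Norms of affine Gaussian images\<close>

text \<open>Completing the square turns the integrand into a multiple of the normal density with
  mean \<open>\<alpha> / c\<close> and variance \<open>1 / c\<close>, where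
  \<open>c = 1 - 2 * \<theta>\<close>.\<close>

lemma nn_integral_std_gauss_exp_quadratic:
 fixes \<alpha> \<theta> :: real
 assumes th: "\<theta> < 1/2"
 shows "(\<integral>\<^sup>+h. ennreal (exp (\<alpha> * h + \<theta> * h^2)) \<partial>std_gauss)
  = ennreal ((1 - 2 * \<theta>) powr (-1/2) * exp (\<alpha>^2 / (2 * (1 - 2 * \<theta>))))"
proof -
 define c where "c = 1 - 2 * \<theta>"
 have c: "c > 0" using th by (simp add: c_def)
 define s where "s = 1 / sqrt c"
 have s: "s > 0" using c by (simp add: s_def)
 have s2: "s^2 = 1 / c" using c by (simp add: s_def power_divide)
 have sp: "s = c powr (-1/2)"
 proof -
  have "c powr (-1/2) = 1 / c powr (1/2)" using powr_minus_divide[of c "1/2"] by simp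
  also have "c powr (1/2) = sqrt c" using c by (intro powr_half_sqrt) simp
  finally show ?thesis by (simp only: s_def)
 qed
 have eq: "std_normal_density h * exp (\<alpha> * h + \<theta> * h^2) = (s * exp (\<alpha>^2 / (2 * c))) * normal_density (\<alpha> / c) s h" for h
 proof -
  have e: "- h\<^sup>2 / 2 + (\<alpha> * h + \<theta> * h^2) = \<alpha>^2 / (2 * c) + - (h - \<alpha> / c)\<^sup>2 / (2 * s^2)"
  proof -
   have "c * (h - \<alpha> / c)^2 = (c * h - \<alpha>)^2 / c"
   proof -
    have "c * h - \<alpha> = c * (h - \<alpha> / c)" using c by (simp add: right_diff_distrib)
    then have "(c * h - \<alpha>)^2 = c * (c * (h - \<alpha> / c)^2)" by (simp only: power2_eq_square mult_ac)
    then show ?thesis using c by simp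
   qed
   also have "... = c * h^2 - 2 * (\<alpha> * h) + \<alpha>^2 / c"
   proof -
    have "(c * h - \<alpha>)^2 = c * (c * h^2 - 2 * (\<alpha> * h)) + \<alpha>^2"
     by (simp add: power2_eq_square algebra_simps)
    then show ?thesis using c by (simp add: add_divide_distrib)
   qed
   finally have "c * (h - \<alpha> / c)^2 / 2 = c * h^2 / 2 - \<alpha> * h + \<alpha>^2 / (2 * c)" by simp
   moreover have "(h - \<alpha> / c)^2 / (2 * s^2) = c * (h - \<alpha> / c)^2 / 2" using c by (simp add: s2)
   ultimately have q: "(h - \<alpha> / c)^2 / (2 * s^2) = c * h^2 / 2 - \<alpha> * h + \<alpha>^2 / (2 * c)" by simp
   have "- (h - \<alpha> / c)\<^sup>2 / (2 * s^2) = - (c * h^2 / 2 - \<alpha> * h + \<alpha>^2 / (2 * c))"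
    unfolding q[symmetric] by simp
   then show ?thesis by (simp add: c_def algebra_simps diff_divide_distrib add_divide_distrib)
  qed
  have "sqrt (2 * pi * s^2) = sqrt (2 * pi) * sqrt (s^2)" by (rule real_sqrt_mult)
  then have "sqrt (2 * pi * s^2) = sqrt (2 * pi) * s" using s by simp
  then have "(s * exp (\<alpha>^2 / (2 * c))) * normal_density (\<alpha> / c) s h
   = (1 / sqrt (2 * pi)) * (exp (\<alpha>^2 / (2 * c)) * exp (- (h - \<alpha> / c)\<^sup>2 / (2 * s^2)))"
   using s by (simp add: normal_density_def)
  also have "... = (1 / sqrt (2 * pi)) * exp (- h\<^sup>2 / 2 + (\<alpha> * h + \<theta> * h^2))"
   by (simp only: e exp_add)
  also have "... = std_normal_density h * exp (\<alpha> * h + \<theta> * h^2)"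
   by (simp only: std_normal_density_def exp_add mult.assoc)
  finally show ?thesis by simp
 qed
 have one: "(\<integral>\<^sup>+h. ennreal (normal_density (\<alpha> / c) s h) \<partial>lborel) = 1"
  using prob_space.emeasure_space_1[OF prob_space_normal_density[OF s, of "\<alpha> / c"]]
  by (simp add: emeasure_density)
 have "(\<integral>\<^sup>+h. ennreal (exp (\<alpha> * h + \<theta> * h^2)) \<partial>std_gauss)
  = (\<integral>\<^sup>+h. ennreal (std_normal_density h) * ennreal (exp (\<alpha> * h + \<theta> * h^2)) \<partial>lborel)"
  by (rule nn_integral_density) auto
 also have "... = (\<integral>\<^sup>+h. ennreal (s * exp (\<alpha>^2 / (2 * c))) * ennreal (normal_density (\<alpha> / c) s h) \<partial>lborel)"
  using s by (intro nn_integral_cong) (simp add: ennreal_mult''[symmetric] ennreal_mult'[symmetric] eq)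
 also have "... = ennreal (s * exp (\<alpha>^2 / (2 * c)))"
  by (subst nn_integral_cmult) (auto simp: one)
 finally show ?thesis by (simp add: sp c_def)
qed

text \<open>Convexity of \<open>exp\<close> between \<open>0\<close> and \<open>ln x\<close>, that
  is, the weighted inequality of arithmetic and geometric means. It serves both to compare powers
  with explicit constants and to interpolate between moments.\<close>

lemma one_minus_powr_bernoulli:
 fixes x t :: real
 assumes "0 < x" "0 \<le> t" "t \<le> 1"
 shows "x powr t \<le> 1 - t + t * x"
proof -
 have "exp ((1 - t) *\<^sub>R 0 + t *\<^sub>R ln x) \<le> (1 - t) * exp 0 + t * exp (ln x)"
  using assms by (intro convex_onD[OF exp_convex]) auto
 then show ?thesis using assms by (simp add: powr_def)
qed

text \<open>In an eigenbasis of \<open>T\<^sup>T T\<close> the exponent splits into independent scalar quadratics.\<close>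
lemma nn_integral_gauss_exp_affine_sq_nat:
 fixes T :: "'j \<Rightarrow> nat \<Rightarrow> real" and b :: "'j \<Rightarrow> real"
 assumes fJ: "finite J" and M: "M > 0" and lam: "0 \<le> \<mu>" "2 * \<mu> * M < 1"
  and op: "\<And>x. (\<Sum>j\<in>J. (\<Sum>i<n. T j i * x i)^2) \<le> M * (\<Sum>i<n. (x i)^2)"
 shows "(\<integral>\<^sup>+x. ennreal (exp (\<mu> * (\<Sum>j\<in>J. (b j + (\<Sum>i<n. T j i * x i))^2))) \<partial>gauss {..<n})
  \<le> ennreal ((1 - 2 * \<mu> * M) powr (- ((\<Sum>j\<in>J. \<Sum>i<n. (T j i)^2) / M) / 2) * exp (\<mu> * (\<Sum>j\<in>J. (b j)^2) / (1 - 2 * \<mu> * M)))"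
proof -
 define P where "P = Matrix.mat n n (\<lambda>(r,s). \<Sum>j\<in>J. T j r * T j s)"
 have P: "P \<in> carrier_mat n n" by (simp add: P_def)
 have Pe: "P $$ (r, s) = (\<Sum>j\<in>J. T j r * T j s)" if "r < n" "s < n" for r s using that by (simp add: P_def)
 have Ps: "P\<^sup>T = P" by (rule eq_matI) (auto simp: P_def mult.commute)
 obtain w l where eb: "eigenbasis n P w l" using symmetric_mat_eigenbasis[OF P Ps] by auto
 note e = P Ps eb
 note fam = eb_orth[OF e]
 have wc: "w a \<in> carrier_vec n" if "a < n" for a using eb_carrier[OF e that] .
 define Q where "Q = (\<lambda>a i. w a $ i)"
 define t where "t = (\<lambda>x j. \<Sum>i<n. T j i * x i :: real)"
 have Qo: "orthonormal_on {..<n} {..<n} Q"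
  unfolding orthonormal_on_def Q_def
 proof (intro ballI)
  fix a a' assume "a \<in> {..<n}" "a' \<in> {..<n}"
  then have "a < n" "a' < n" by auto
  then show "(\<Sum>i<n. w a $ i * w a' $ i) = (if a = a' then 1 else 0)"
   using fam ip_sum[OF wc wc, of a a'] by (simp add: orthonormal_family_def)
 qed
 \<comment> \<open>\<open>c a\<close> is the inner product of \<open>b\<close> with the image of the
   eigenvector \<open>Q a\<close>; by \<open>tQ\<close>, \<open>l a\<close> is the squared norm of
   that image.\<close>
 define c where "c = (\<lambda>a. \<Sum>j\<in>J. b j * t (Q a) j)"
 define \<beta> where "\<beta> = (\<Sum>j\<in>J. (b j)^2)"
 define F where "F = (\<lambda>h. \<beta> + (\<Sum>a<n. 2 * c a * h a + l a * (h a)^2))"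
 have rep: "(\<Sum>j\<in>J. (b j + t x j)^2) = F (\<lambda>a\<in>{..<n}. \<Sum>i<n. Q a i * x i)" for x
 proof -
  define v where "v = Matrix.vec n x"
  have v: "v \<in> carrier_vec n" by (simp add: v_def)
  have vx: "v $ r = x r" if "r < n" for r using that by (simp add: v_def)
  have h: "(\<Sum>i<n. Q a i * x i) = ip (w a) v" if "a < n" for a
   using that unfolding ip_sum[OF wc[OF that] v] by (simp add: Q_def v_def)
  have xs: "x i = (\<Sum>a<n. ip (w a) v * Q a i)" if "i < n" for i
   using orthonormal_parseval(2)[OF fam v that] that by (simp add: v_def Q_def)
  have "(\<Sum>j\<in>J. b j * t x j) = (\<Sum>j\<in>J. b j * (\<Sum>i<n. T j i * (\<Sum>a<n. ip (w a) v * Q a i)))"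
   unfolding t_def by (intro sum.cong refl arg_cong[where f="\<lambda>z. _ * z"]) (use xs in auto)
  also have "... = (\<Sum>j\<in>J. \<Sum>a<n. \<Sum>i<n. ip (w a) v * (b j * (T j i * Q a i)))"
   unfolding sum_distrib_left by (rule sum.cong[OF refl], subst sum.swap) (simp add: mult_ac)
  also have "... = (\<Sum>a<n. \<Sum>j\<in>J. \<Sum>i<n. ip (w a) v * (b j * (T j i * Q a i)))" by (rule sum.swap)
  also have "... = (\<Sum>a<n. c a * ip (w a) v)"
   unfolding c_def t_def by (simp add: sum_distrib_left sum_distrib_right mult_ac)
  finally have 1: "(\<Sum>j\<in>J. b j * t x j) = (\<Sum>a<n. c a * ip (w a) v)" .
  have Pv: "P *\<^sub>v v \<in> carrier_vec n" using P v by auto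
  have "(\<Sum>j\<in>J. (t x j)^2) = (\<Sum>j\<in>J. \<Sum>r<n. \<Sum>s<n. x r * (T j r * T j s * x s))"
   unfolding t_def power2_eq_square sum_product by (simp add: mult_ac)
  also have "... = (\<Sum>r<n. \<Sum>j\<in>J. \<Sum>s<n. x r * (T j r * T j s * x s))" by (rule sum.swap)
  also have "... = (\<Sum>r<n. \<Sum>s<n. \<Sum>j\<in>J. x r * (T j r * T j s * x s))" by (intro sum.cong refl sum.swap)
  also have "... = ip v (P *\<^sub>v v)"
   unfolding ip_sum[OF v Pv] by (simp add: mult_mat_vec_entry[OF P v] Pe vx sum_distrib_left sum_distrib_right)
  also have "... = (\<Sum>a<n. l a * (ip (w a) v)^2)"
   unfolding eb_quad[OF e v v] by (simp add: power2_eq_square mult.assoc)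
  finally have 2: "(\<Sum>j\<in>J. (t x j)^2) = (\<Sum>a<n. l a * (ip (w a) v)^2)" .
  have "(\<Sum>j\<in>J. (b j + t x j)^2) = \<beta> + 2 * (\<Sum>j\<in>J. b j * t x j) + (\<Sum>j\<in>J. (t x j)^2)"
   unfolding \<beta>_def by (simp add: power2_sum sum.distrib sum_distrib_left mult.assoc)
  also have "... = \<beta> + (\<Sum>a<n. 2 * c a * ip (w a) v + l a * (ip (w a) v)^2)"
   unfolding 1 2 by (simp add: sum.distrib sum_distrib_left mult.assoc)
  finally show ?thesis unfolding F_def using h by simp
 qed
 have tQ: "(\<Sum>j\<in>J. (t (Q a) j)^2) = l a" if a: "a < n" for a
 proof -
  have v: "Matrix.vec n (Q a) = w a" using wc[OF a] by (intro eq_vecI) (auto simp: Q_def)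
  have Pv: "P *\<^sub>v w a \<in> carrier_vec n" using P wc[OF a] by auto
  have "(\<Sum>j\<in>J. (t (Q a) j)^2) = (\<Sum>j\<in>J. \<Sum>r<n. \<Sum>s<n. Q a r * (T j r * T j s * Q a s))"
   unfolding t_def power2_eq_square sum_product by (simp add: mult_ac)
  also have "... = (\<Sum>r<n. \<Sum>j\<in>J. \<Sum>s<n. Q a r * (T j r * T j s * Q a s))" by (rule sum.swap)
  also have "... = (\<Sum>r<n. \<Sum>s<n. \<Sum>j\<in>J. Q a r * (T j r * T j s * Q a s))" by (intro sum.cong refl sum.swap)
  also have "... = ip (w a) (P *\<^sub>v w a)"
   unfolding ip_sum[OF wc[OF a] Pv] by (simp add: mult_mat_vec_entry[OF P wc[OF a]] Pe Q_def sum_distrib_left sum_distrib_right)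
  also have "... = l a"
   using eb_coord[OF e a wc[OF a]] fam a by (simp add: orthonormal_family_def)
  finally show ?thesis .
 qed
 have Q1: "(\<Sum>i<n. (Q a i)^2) = 1" if "a < n" for a
  using Qo that by (auto simp: orthonormal_on_def power2_eq_square)
 have l0: "0 \<le> l a" if "a < n" for a unfolding tQ[OF that, symmetric] by (intro sum_nonneg) auto
 have lM: "l a \<le> M" if "a < n" for a
  using op[of "Q a"] unfolding tQ[OF that, unfolded t_def] Q1[OF that] by simp
 have tr: "(\<Sum>a<n. l a) = (\<Sum>j\<in>J. \<Sum>i<n. (T j i)^2)"
 proof -
  have "(\<Sum>a<n. l a) = (\<Sum>a<n. ip (w a) (P *\<^sub>v w a))"
   using eb_coord[OF e _ wc] fam by (intro sum.cong) (auto simp: orthonormal_family_def)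
  also have "... = (\<Sum>r<n. P $$ (r, r))"
  proof -
   have "(\<Sum>a<n. ip (w a) (P *\<^sub>v w a)) = (\<Sum>a<n. l a * ip (w a) (w a))"
    using eb_coord[OF e _ wc] by (intro sum.cong) auto
   also have "... = (\<Sum>a<n. \<Sum>r<n. l a * w a $ r * w a $ r)"
    by (intro sum.cong refl) (simp add: ip_sum[OF wc wc] sum_distrib_left mult_ac)
   also have "... = (\<Sum>r<n. P $$ (r, r))" by (subst sum.swap) (simp add: eb_entry[OF e])
   finally show ?thesis .
  qed
  also have "... = (\<Sum>r<n. \<Sum>j\<in>J. (T j r)^2)" by (simp add: P_def power2_eq_square)
  also have "... = (\<Sum>j\<in>J. \<Sum>i<n. (T j i)^2)" by (rule sum.swap)
  finally show ?thesis .
 qed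
 have cz: "c a = 0" if a: "a < n" "l a = 0" for a
 proof -
  have "\<forall>j\<in>J. (t (Q a) j)^2 = 0" using tQ[OF a(1)] a(2) sum_nonneg_eq_0_iff[OF fJ, of "\<lambda>j. (t (Q a) j)^2"] by simp
  then show ?thesis by (simp add: c_def)
 qed
 text \<open>Bessel's inequality, from nonnegativity of the quadratic at its minimiser.\<close>
 have bessel: "(\<Sum>a<n. (c a)^2 / l a) \<le> \<beta>"
 proof -
  define h where "h = (\<lambda>a. - c a / l a)"
  define x where "x = (\<lambda>i. \<Sum>a<n. h a * Q a i)"
  have "(\<Sum>i<n. Q a i * x i) = h a" if a: "a < n" for a
  proof -
   have "(\<Sum>i<n. Q a i * x i) = (\<Sum>a'<n. h a' * (\<Sum>i<n. Q a i * Q a' i))"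
    unfolding x_def sum_distrib_left by (subst sum.swap) (simp add: mult_ac)
   also have "... = (\<Sum>a'<n. if a = a' then h a' else 0)"
    using Qo a by (intro sum.cong) (auto simp: orthonormal_on_def)
   finally show ?thesis using a by simp
  qed
  then have "(\<Sum>j\<in>J. (b j + t x j)^2) = \<beta> + (\<Sum>a<n. 2 * c a * h a + l a * (h a)^2)"
   unfolding rep F_def by simp
  also have "(\<Sum>a<n. 2 * c a * h a + l a * (h a)^2) = - (\<Sum>a<n. (c a)^2 / l a)"
   unfolding sum_negf[symmetric]
  proof (intro sum.cong refl)
   fix a assume "a \<in> {..<n}"
   show "2 * c a * h a + l a * (h a)^2 = - ((c a)^2 / l a)"
    by (cases "l a = 0") (auto simp: h_def power2_eq_square field_simps)
  qed
  finally show ?thesis using sum_nonneg[of J "\<lambda>j. (b j + t x j)^2"] by simp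
 qed
 let ?L = "1 - 2 * \<mu> * M"
 have L: "?L > 0" using lam by simp
 have ll: "2 * \<mu> * l a < 1" if "a < n" for a
  using mult_left_mono[OF lM[OF that], of "2 * \<mu>"] lam by simp
 have Fm: "F \<in> borel_measurable (PiM {..<n} (\<lambda>_. borel))" unfolding F_def by measurable
 have "(\<integral>\<^sup>+x. ennreal (exp (\<mu> * (\<Sum>j\<in>J. (b j + (\<Sum>i<n. T j i * x i))^2))) \<partial>gauss {..<n})
  = (\<integral>\<^sup>+x. ennreal (exp (\<mu> * F (\<lambda>a\<in>{..<n}. \<Sum>i<n. Q a i * x i))) \<partial>gauss {..<n})"
  using rep unfolding t_def by simp
 also have "... = (\<integral>\<^sup>+h. ennreal (exp (\<mu> * F h)) \<partial>gauss {..<n})"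
  by (rule nn_integral_gauss_orthonormal[OF _ _ Qo]) (use Fm in auto)
 also have "... = (\<integral>\<^sup>+h. ennreal (exp (\<mu> * \<beta>)) * (\<Prod>a<n. ennreal (exp (2 * \<mu> * c a * h a + \<mu> * l a * (h a)^2))) \<partial>gauss {..<n})"
 proof (rule nn_integral_cong)
  fix h :: "nat \<Rightarrow> real"
  have "\<mu> * F h = \<mu> * \<beta> + (\<Sum>a<n. 2 * \<mu> * c a * h a + \<mu> * l a * (h a)^2)"
   unfolding F_def by (simp add: distrib_left sum_distrib_left mult_ac)
  then have "exp (\<mu> * F h) = exp (\<mu> * \<beta>) * (\<Prod>a<n. exp (2 * \<mu> * c a * h a + \<mu> * l a * (h a)^2))"
   by (simp add: exp_add exp_sum)
  then show "ennreal (exp (\<mu> * F h)) = ennreal (exp (\<mu> * \<beta>)) * (\<Prod>a<n. ennreal (exp (2 * \<mu> * c a * h a + \<mu> * l a * (h a)^2)))"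
   by (simp add: ennreal_mult' prod_ennreal)
 qed
 also have "... = ennreal (exp (\<mu> * \<beta>)) * (\<integral>\<^sup>+h. (\<Prod>a<n. ennreal (exp (2 * \<mu> * c a * h a + \<mu> * l a * (h a)^2))) \<partial>gauss {..<n})"
  by (rule nn_integral_cmult) measurable
 also have "(\<integral>\<^sup>+h. (\<Prod>a<n. ennreal (exp (2 * \<mu> * c a * h a + \<mu> * l a * (h a)^2))) \<partial>gauss {..<n})
  = (\<Prod>a<n. \<integral>\<^sup>+z. ennreal (exp (2 * \<mu> * c a * z + \<mu> * l a * z^2)) \<partial>std_gauss)"
  unfolding gauss_def by (rule gaussP.product_nn_integral_prod) auto
 finally have X: "(\<integral>\<^sup>+x. ennreal (exp (\<mu> * (\<Sum>j\<in>J. (b j + (\<Sum>i<n. T j i * x i))^2))) \<partial>gauss {..<n})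
  = ennreal (exp (\<mu> * \<beta>)) * (\<Prod>a<n. \<integral>\<^sup>+z. ennreal (exp (2 * \<mu> * c a * z + \<mu> * l a * z^2)) \<partial>std_gauss)" .
 have "(\<Prod>a<n. \<integral>\<^sup>+z. ennreal (exp (2 * \<mu> * c a * z + \<mu> * l a * z^2)) \<partial>std_gauss)
  \<le> (\<Prod>a<n. ennreal (?L powr (- (l a / M) / 2) * exp (2 * \<mu>^2 * M / ?L * ((c a)^2 / l a))))"
 proof (rule prod_mono_ennreal)
  fix a assume "a \<in> {..<n}"
  then have a: "a < n" by simp
  have la: "1 - 2 * \<mu> * l a > 0" using ll[OF a] by simp
  have eq: "(\<integral>\<^sup>+z. ennreal (exp (2 * \<mu> * c a * z + \<mu> * l a * z^2)) \<partial>std_gauss)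
   = ennreal ((1 - 2 * \<mu> * l a) powr (-1/2) * exp ((2 * \<mu> * c a)^2 / (2 * (1 - 2 * \<mu> * l a))))"
   using nn_integral_std_gauss_exp_quadratic[of "\<mu> * l a" "2 * \<mu> * c a"] ll[OF a] by (simp add: mult.assoc)
  \<comment> \<open>Bernoulli with exponent \<open>l a / M\<close> replaces each determinant factor
    by a power of the worst one; the exponents then add up to the trace divided by \<open>M\<close>,
    independently of the individual eigenvalues.\<close>
  have p: "(1 - 2 * \<mu> * l a) powr (-1/2) \<le> ?L powr (- (l a / M) / 2)"
  proof -
   have "?L powr (l a / M) \<le> 1 - l a / M + l a / M * ?L"
    using L l0[OF a] lM[OF a] M by (intro one_minus_powr_bernoulli) auto
   also have "... = 1 - 2 * \<mu> * l a" using M by (simp add: field_simps)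
   finally have "(1 - 2 * \<mu> * l a) powr (-1/2) \<le> (?L powr (l a / M)) powr (-1/2)"
    using L by (intro powr_mono2') auto
   then show ?thesis by (simp add: powr_powr)
  qed
  \<comment> \<open>\<open>l / (1 - 2 * \<mu> * l)\<close> increases with \<open>l\<close>, so the
    eigenvalue may be replaced by \<open>M\<close>. The quotient by \<open>l a\<close> prepares
    Bessel's inequality; \<open>c a\<close> vanishes when \<open>l a\<close> does.\<close>
  have q: "(2 * \<mu> * c a)^2 / (2 * (1 - 2 * \<mu> * l a)) \<le> 2 * \<mu>^2 * M / ?L * ((c a)^2 / l a)"
  proof (cases "l a = 0")
   case True
   then show ?thesis using cz[OF a] by simp
  next
   case False
   then have lp: "l a > 0" using l0[OF a] by simp
   have "l a / (1 - 2 * \<mu> * l a) \<le> M / ?L"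
    using lM[OF a] la L lam by (simp add: field_simps)
   then have "2 * \<mu>^2 * ((c a)^2 / l a) * (l a / (1 - 2 * \<mu> * l a)) \<le> 2 * \<mu>^2 * ((c a)^2 / l a) * (M / ?L)"
    using lp by (intro mult_left_mono) auto
   moreover have "2 * \<mu>^2 * ((c a)^2 / l a) * (l a / (1 - 2 * \<mu> * l a)) = (2 * \<mu> * c a)^2 / (2 * (1 - 2 * \<mu> * l a))"
    using lp la by (simp add: power_mult_distrib field_simps)
   ultimately show ?thesis by (simp add: mult_ac)
  qed
  show "(\<integral>\<^sup>+z. ennreal (exp (2 * \<mu> * c a * z + \<mu> * l a * z^2)) \<partial>std_gauss)
   \<le> ennreal (?L powr (- (l a / M) / 2) * exp (2 * \<mu>^2 * M / ?L * ((c a)^2 / l a)))"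
   unfolding eq using p q by (intro ennreal_leI mult_mono) auto
 qed
 also have "... = ennreal (?L powr (- (\<Sum>a<n. l a) / M / 2) * exp (2 * \<mu>^2 * M / ?L * (\<Sum>a<n. (c a)^2 / l a)))"
 proof -
  have s1: "(\<Sum>a<n. - (l a / M) / 2) = - (\<Sum>a<n. l a) / M / 2"
   by (simp only: sum_negf sum_divide_distrib[symmetric] minus_divide_left)
  have 1: "(\<Prod>a<n. ?L powr (- (l a / M) / 2)) = ?L powr (- (\<Sum>a<n. l a) / M / 2)"
   unfolding s1[symmetric] using L by (intro powr_sum[symmetric]) auto
  have 2: "(\<Prod>a<n. exp (2 * \<mu>^2 * M / ?L * ((c a)^2 / l a))) = exp (2 * \<mu>^2 * M / ?L * (\<Sum>a<n. (c a)^2 / l a))"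
   by (simp only: exp_sum[OF finite_lessThan, symmetric] sum_distrib_left[symmetric])
  have "(\<Prod>a<n. ennreal (?L powr (- (l a / M) / 2) * exp (2 * \<mu>^2 * M / ?L * ((c a)^2 / l a))))
   = ennreal (\<Prod>a<n. ?L powr (- (l a / M) / 2) * exp (2 * \<mu>^2 * M / ?L * ((c a)^2 / l a)))"
   by (rule prod_ennreal) simp
  then show ?thesis by (simp only: prod.distrib 1 2)
 qed
 also have "... \<le> ennreal (?L powr (- (\<Sum>a<n. l a) / M / 2) * exp (2 * \<mu>^2 * M / ?L * \<beta>))"
 proof -
  have "2 * \<mu>^2 * M / ?L * (\<Sum>a<n. (c a)^2 / l a) \<le> 2 * \<mu>^2 * M / ?L * \<beta>"
   using bessel L M by (intro mult_left_mono) auto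
  then show ?thesis by (intro ennreal_leI mult_left_mono) auto
 qed
 finally have "(\<integral>\<^sup>+x. ennreal (exp (\<mu> * (\<Sum>j\<in>J. (b j + (\<Sum>i<n. T j i * x i))^2))) \<partial>gauss {..<n})
  \<le> ennreal (exp (\<mu> * \<beta>)) * ennreal (?L powr (- (\<Sum>a<n. l a) / M / 2) * exp (2 * \<mu>^2 * M / ?L * \<beta>))"
  unfolding X by (rule mult_left_mono) simp
 moreover have "ennreal (exp (\<mu> * \<beta>)) * ennreal (?L powr (- (\<Sum>a<n. l a) / M / 2) * exp (2 * \<mu>^2 * M / ?L * \<beta>))
  = ennreal (exp (\<mu> * \<beta>) * (?L powr (- (\<Sum>a<n. l a) / M / 2) * exp (2 * \<mu>^2 * M / ?L * \<beta>)))"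
  by (rule ennreal_mult'[symmetric]) simp
 moreover have "exp (\<mu> * \<beta>) * (?L powr (- (\<Sum>a<n. l a) / M / 2) * exp (2 * \<mu>^2 * M / ?L * \<beta>))
  = ?L powr (- ((\<Sum>j\<in>J. \<Sum>i<n. (T j i)^2) / M) / 2) * exp (\<mu> * \<beta> / ?L)"
 proof -
  \<comment> \<open>The constant term and the Bessel term recombine because
    \<open>?L + 2 * \<mu> * M = 1\<close>.\<close>
  have "\<mu> * \<beta> + 2 * \<mu>^2 * M / ?L * \<beta> = \<mu> * \<beta> / ?L"
   using L by (simp add: field_simps power2_eq_square)
  then have "exp (\<mu> * \<beta> / ?L) = exp (\<mu> * \<beta>) * exp (2 * \<mu>^2 * M / ?L * \<beta>)"
   using exp_add[of "\<mu> * \<beta>" "2 * \<mu>^2 * M / ?L * \<beta>"] by (simp only:)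
  then show ?thesis by (simp only: tr minus_divide_left mult_ac)
 qed
 ultimately show ?thesis by (simp only: \<beta>_def)
qed

lemma nn_integral_gauss_exp_affine_sq:
 fixes T :: "'j \<Rightarrow> 'i \<Rightarrow> real" and b :: "'j \<Rightarrow> real"
 assumes fI: "finite I" and fJ: "finite J" and M: "M > 0" and lam: "0 \<le> \<mu>" "2 * \<mu> * M < 1"
  and op: "\<And>x. (\<Sum>j\<in>J. (\<Sum>i\<in>I. T j i * x i)^2) \<le> M * (\<Sum>i\<in>I. (x i)^2)"
 shows "(\<integral>\<^sup>+x. ennreal (exp (\<mu> * (\<Sum>j\<in>J. (b j + (\<Sum>i\<in>I. T j i * x i))^2))) \<partial>gauss I)
  \<le> ennreal ((1 - 2 * \<mu> * M) powr (- ((\<Sum>j\<in>J. \<Sum>i\<in>I. (T j i)^2) / M) / 2) * exp (\<mu> * (\<Sum>j\<in>J. (b j)^2) / (1 - 2 * \<mu> * M)))"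
proof -
 obtain e where "bij_betw e {0..<card I} I" using ex_bij_betw_nat_finite[OF fI] by blast
 then have e: "bij_betw e {..<card I} I" by (simp add: atLeast0LessThan)
 have re: "(\<Sum>a<card I. f (e a)) = (\<Sum>i\<in>I. f i)" for f :: "'i \<Rightarrow> real"
  by (rule sum.reindex_bij_betw[OF e])
 have op': "(\<Sum>j\<in>J. (\<Sum>a<card I. T j (e a) * x a)^2) \<le> M * (\<Sum>a<card I. (x a)^2)" for x
 proof -
  define y where "y = (\<lambda>i. x (inv_into {..<card I} e i))"
  have y: "y (e a) = x a" if "a < card I" for a
   using e that by (simp add: y_def bij_betw_def inv_into_f_f)
  have "(\<Sum>a<card I. T j (e a) * x a) = (\<Sum>i\<in>I. T j i * y i)" for j
   unfolding re[symmetric] by (intro sum.cong) (auto simp: y)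
  moreover have "(\<Sum>a<card I. (x a)^2) = (\<Sum>i\<in>I. (y i)^2)"
   unfolding re[symmetric] by (intro sum.cong) (auto simp: y)
  ultimately show ?thesis using op[of y] by simp
 qed
 define G where "G = (\<lambda>y. ennreal (exp (\<mu> * (\<Sum>j\<in>J. (b j + (\<Sum>a<card I. T j (e a) * y a))^2))))"
 have Gm: "G \<in> borel_measurable (PiM {..<card I} (\<lambda>_. borel))" unfolding G_def by measurable
 have "(\<integral>\<^sup>+x. ennreal (exp (\<mu> * (\<Sum>j\<in>J. (b j + (\<Sum>i\<in>I. T j i * x i))^2))) \<partial>gauss I)
  = (\<integral>\<^sup>+x. G (\<lambda>a\<in>{..<card I}. x (e a)) \<partial>gauss I)"
 proof (rule nn_integral_cong)
  fix x :: "'i \<Rightarrow> real"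
  have "(\<Sum>a<card I. T j (e a) * (\<lambda>a\<in>{..<card I}. x (e a)) a) = (\<Sum>i\<in>I. T j i * x i)" for j
   unfolding re[symmetric] by (intro sum.cong) auto
  then show "ennreal (exp (\<mu> * (\<Sum>j\<in>J. (b j + (\<Sum>i\<in>I. T j i * x i))^2))) = G (\<lambda>a\<in>{..<card I}. x (e a))"
   unfolding G_def by (simp only:)
 qed
 also have "... = (\<integral>\<^sup>+y. G y \<partial>gauss {..<card I})"
  by (rule nn_integral_gauss_reindex[OF fI _ _ _ Gm]) (use e in \<open>auto simp: bij_betw_def\<close>)
 also have "... \<le> ennreal ((1 - 2 * \<mu> * M) powr (- ((\<Sum>j\<in>J. \<Sum>a<card I. (T j (e a))^2) / M) / 2) * exp (\<mu> * (\<Sum>j\<in>J. (b j)^2) / (1 - 2 * \<mu> * M)))"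
  unfolding G_def by (rule nn_integral_gauss_exp_affine_sq_nat[OF fJ M lam op'])
 also have "(\<Sum>j\<in>J. \<Sum>a<card I. (T j (e a))^2) = (\<Sum>j\<in>J. \<Sum>i\<in>I. (T j i)^2)"
  by (intro sum.cong refl re)
 finally show ?thesis .
qed

text \<open>This is Gaussian concentration for a function with Lipschitz constant
  \<open>sqrt M\<close> and mean at most \<open>sqrt (\<beta> + \<rho>)\<close>, obtained by the
  Chernoff method so that the rate \<open>exp (- u\<^sup>2 / 2)\<close> carries no extra
  factor.\<close>

lemma gauss_affine_norm_tail:
 fixes T :: "'j \<Rightarrow> 'i \<Rightarrow> real" and b :: "'j \<Rightarrow> real"
 assumes fI: "finite I" and fJ: "finite J" and M: "M > 0" and u: "0 \<le> u"
  and op: "\<And>x. (\<Sum>j\<in>J. (\<Sum>i\<in>I. T j i * x i)^2) \<le> M * (\<Sum>i\<in>I. (x i)^2)"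
 defines "\<rho> \<equiv> \<Sum>j\<in>J. \<Sum>i\<in>I. (T j i)^2" and "\<beta> \<equiv> \<Sum>j\<in>J. (b j)^2"
 shows "emeasure (gauss I) {x \<in> space (gauss I). (sqrt (\<beta> + \<rho>) + u * sqrt M)^2 < (\<Sum>j\<in>J. (b j + (\<Sum>i\<in>I. T j i * x i))^2)}
  \<le> ennreal (exp (- u\<^sup>2 / 2))"
proof -
 let ?Z = "\<lambda>x. \<Sum>j\<in>J. (b j + (\<Sum>i\<in>I. T j i * x i))^2"
 define a where "a = sqrt (\<beta> + \<rho>)"
 have r0: "0 \<le> \<rho>" and b0: "0 \<le> \<beta>" unfolding \<rho>_def \<beta>_def by (auto intro!: sum_nonneg)
 have a2: "a^2 = \<beta> + \<rho>" and a0: "0 \<le> a" using r0 b0 by (auto simp: a_def)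
 have s: "sqrt M > 0" "(sqrt M)^2 = M" using M by auto
 have Zm: "?Z \<in> borel_measurable (PiM I (\<lambda>_. borel))" by measurable
 \<comment> \<open>The Chernoff parameter needs \<open>a > 0\<close> for a finite exponential moment
   and \<open>u > 0\<close> to be positive; the degenerate cases have an empty event or a trivial
   bound.\<close>
 consider "a = 0" | "u = 0" | "a > 0" "u > 0" using a0 u by fastforce
 then show ?thesis
 proof cases
  case 1
  then have "\<rho> = 0" "\<beta> = 0" using a2 r0 b0 by auto
  have T0: "T j i = 0" if "j \<in> J" "i \<in> I" for i j
  proof -
   have "\<forall>j\<in>J. (\<Sum>i\<in>I. (T j i)^2) = 0"
    using \<open>\<rho> = 0\<close> fJ unfolding \<rho>_def by (subst (asm) sum_nonneg_eq_0_iff) (auto intro!: sum_nonneg)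
   then have "\<forall>i\<in>I. (T j i)^2 = 0" using that fI by (simp add: sum_nonneg_eq_0_iff)
   then show ?thesis using that by simp
  qed
  have "\<forall>j\<in>J. (b j)^2 = 0" using \<open>\<beta> = 0\<close> fJ unfolding \<beta>_def by (simp add: sum_nonneg_eq_0_iff)
  then have "?Z x = 0" for x using T0 by simp
  then have "{x \<in> space (gauss I). (sqrt (\<beta> + \<rho>) + u * sqrt M)^2 < ?Z x} = {}" by (auto simp: not_less)
  then show ?thesis by (simp only: emeasure_empty) simp
 next
  case 2
  then show ?thesis using prob_space.emeasure_le_1[OF prob_space_gauss[of I]] by simp
 next
  case 3
  define S where "S = sqrt M"
  have S: "S > 0" "M = S * S" using M by (auto simp: S_def)
  define w where "w = a + u * S"
  have uS: "u * S > 0" using 3 S by simp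
  have w: "w > a" "w > 0" using uS 3(1) by (auto simp: w_def)
  \<comment> \<open>With this parameter \<open>1 - 2 * \<mu> * M\<close> is exactly
    \<open>a / w\<close>, and once \<open>ln (w / a)\<close> is replaced by its tangent the exponent
    collapses to \<open>\<mu> * w * (a - w) = - u\<^sup>2 / 2\<close>.\<close>
  define \<mu> where "\<mu> = u / (2 * S * w)"
  have mu: "\<mu> > 0" using 3 S w by (simp add: \<mu>_def)
  have "2 * \<mu> * M = u * S / w" using S(1) w(2) by (simp add: \<mu>_def S(2))
  moreover have "1 - u * S / w = (w - u * S) / w" using w by (simp add: diff_divide_distrib)
  ultimately have L: "1 - 2 * \<mu> * M = a / w" by (simp add: w_def)
  have aw: "0 < a / w" using 3 w by simp
  have lt: "2 * \<mu> * M < 1" using L aw by linarith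
  define E where "E = (a / w) powr (- (\<rho> / M) / 2) * exp (\<mu> * \<beta> / (a / w))"
  have int: "(\<integral>\<^sup>+x. ennreal (exp (\<mu> * ?Z x)) \<partial>gauss I) \<le> ennreal E"
   using nn_integral_gauss_exp_affine_sq[OF fI fJ M _ lt op, of b] mu
   unfolding E_def L \<rho>_def[symmetric] \<beta>_def[symmetric] by simp
  have Ele: "E \<le> exp (\<mu> * a * w)"
  proof -
   have "ln (w / a) \<le> w / a - 1" using w 3 by (intro ln_le_minus_one) simp
   also have "... = (2 * \<mu> * M) * (w / a)"
   proof -
    have "2 * \<mu> * M = 1 - a / w" using L by linarith
    then show ?thesis using w 3 by (simp add: field_simps)
   qed
   finally have l: "ln (w / a) \<le> (2 * \<mu> * M) * (w / a)" .
   have "(a / w) powr (- (\<rho> / M) / 2) = exp ((\<rho> / M) / 2 * ln (w / a))"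
   proof -
    have "ln (a / w) = - ln (w / a)" using w 3 by (simp add: ln_div)
    moreover have "a / w \<noteq> 0" using less_imp_neq[OF aw] by (rule not_sym)
    ultimately show ?thesis unfolding powr_def by (simp only: if_False mult_minus_left mult_minus_right minus_divide_left[symmetric] minus_minus)
   qed
   also have "... \<le> exp ((\<rho> / M) / 2 * ((2 * \<mu> * M) * (w / a)))"
    using l r0 M by (simp only: exp_le_cancel_iff) (intro mult_left_mono, auto)
   also have "(\<rho> / M) / 2 * ((2 * \<mu> * M) * (w / a)) = \<mu> * \<rho> * w / a" using M by simp
   finally have "E \<le> exp (\<mu> * \<rho> * w / a) * exp (\<mu> * \<beta> / (a / w))"
    unfolding E_def by (intro mult_right_mono) auto
   also have "... = exp (\<mu> * \<rho> * w / a + \<mu> * \<beta> / (a / w))" by (simp only: exp_add)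
   also have "\<mu> * \<rho> * w / a + \<mu> * \<beta> / (a / w) = \<mu> * w * (\<beta> + \<rho>) / a"
    by (simp add: add_divide_distrib distrib_left mult_ac)
   also have "... = \<mu> * a * w" unfolding a2[symmetric] using 3 by (simp add: power2_eq_square)
   finally show ?thesis .
  qed
  have "emeasure (gauss I) {x \<in> space (gauss I). w^2 < ?Z x}
   \<le> emeasure (gauss I) ({x \<in> space (gauss I). 1 \<le> ennreal (exp (- \<mu> * w^2)) * ennreal (exp (\<mu> * ?Z x))})"
  proof (rule emeasure_mono)
   show "{x \<in> space (gauss I). w^2 < ?Z x} \<subseteq> {x \<in> space (gauss I). 1 \<le> ennreal (exp (- \<mu> * w^2)) * ennreal (exp (\<mu> * ?Z x))}"
   proof (intro subsetI, clarify)
    fix x assume "w^2 < ?Z x"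
    then have "0 \<le> - \<mu> * w^2 + \<mu> * ?Z x" using mu by simp
    then have "1 \<le> exp (- \<mu> * w^2 + \<mu> * ?Z x)" by simp
    then show "1 \<le> ennreal (exp (- \<mu> * w^2)) * ennreal (exp (\<mu> * ?Z x))"
     unfolding exp_add by (simp only: ennreal_mult'[symmetric] exp_ge_zero) simp
   qed
  qed measurable
  also have "... \<le> ennreal (exp (- \<mu> * w^2)) * (\<integral>\<^sup>+x. ennreal (exp (\<mu> * ?Z x)) * indicator (space (gauss I)) x \<partial>gauss I)"
   by (rule order_trans[OF _ nn_integral_Markov_inequality]) (auto intro!: emeasure_mono)
  also have "(\<integral>\<^sup>+x. ennreal (exp (\<mu> * ?Z x)) * indicator (space (gauss I)) x \<partial>gauss I) = (\<integral>\<^sup>+x. ennreal (exp (\<mu> * ?Z x)) \<partial>gauss I)"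
   by (rule nn_integral_cong) simp
  also have "ennreal (exp (- \<mu> * w^2)) * ... \<le> ennreal (exp (- \<mu> * w^2)) * ennreal (exp (\<mu> * a * w))"
   using int Ele by (intro mult_left_mono order_trans[OF int] ennreal_leI) auto
  also have "... = ennreal (exp (- \<mu> * w^2) * exp (\<mu> * a * w))" by (rule ennreal_mult'[symmetric]) simp
  also have "exp (- \<mu> * w^2) * exp (\<mu> * a * w) = exp (- u\<^sup>2 / 2)"
  proof -
   have "- \<mu> * w^2 + \<mu> * a * w = - \<mu> * w * (w - a)" by (simp add: power2_eq_square algebra_simps)
   also have "... = - \<mu> * w * (u * S)" by (simp add: w_def)
   also have "... = - u\<^sup>2 / 2" using S(1) w(2) by (simp add: \<mu>_def power2_eq_square)
   finally show ?thesis by (simp only: exp_add[symmetric])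
  qed
  finally show ?thesis unfolding w_def a_def S_def .
 qed
qed

text \<open>The right side minus the left side decreases to zero at infinity; its derivative is
  nonpositive because \<open>ln (1 + x) - ln x\<close> is at least \<open>1 / (x + 1/2)\<close>. The
  midpoint \<open>x + 1/2\<close> is used for the next moment bound and for the growth of
  \<open>gmom\<close>.\<close>

lemma entropy_tangent_bound:
 fixes x :: real
 assumes "x > 0"
 shows "(1 + x) * ln (1 + x) - x * ln x \<le> 1 + ln (x + 1/2)"
proof -
 define f where "f = (\<lambda>x::real. 1 + ln (x + 1/2) - (1 + x) * ln (1 + x) + x * ln x)"
 have mono: "f y \<le> f z" if "0 < z" "z \<le> y" for y z
 proof (rule DERIV_nonpos_imp_nonincreasing[OF that(2)])
  fix x assume x: "z \<le> x" "x \<le> y"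
  then have x0: "x > 0" using that by simp
  then have n: "x \<noteq> 0" "1 + x \<noteq> 0" "x + 1/2 \<noteq> 0" by auto
  have "(f has_real_derivative (1 / (x + 1/2) - (ln (1 + x) - ln x))) (at x)"
   unfolding f_def using x0 n by (auto intro!: derivative_eq_intros)
  moreover have "1 / (x + 1/2) - (ln (1 + x) - ln x) \<le> 0"
   using ln_inverse_approx_ge[of x "1 + x"] x0 by (simp add: field_simps)
  ultimately show "\<exists>D. DERIV f x :> D \<and> D \<le> 0" by blast
 qed
 have "(f \<longlongrightarrow> 0) at_top" unfolding f_def by real_asymp
 then have "0 \<le> f x"
  by (rule tendsto_upperbound) (use mono assms in \<open>auto simp: eventually_at_top_linorder intro!: exI[of _ x]\<close>)
 then show ?thesis by (simp add: f_def)
qed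

text \<open>A power is dominated by its exponential tangent, and the exponential moment is evaluated
  at the optimal parameter. The result is an entropy expression in
  \<open>\<rho> / (2 * a * M)\<close>, which \<open>entropy_tangent_bound\<close> simplifies. Here
  \<open>\<rho>\<close> is the mean of the squared norm, and \<open>a * M\<close> is the growth
  permitted by the largest direction.\<close>

lemma gauss_linear_norm_moment:
 fixes T :: "'j \<Rightarrow> 'i \<Rightarrow> real"
 assumes fI: "finite I" and fJ: "finite J" and M: "M > 0" and a: "a > 0"
  and op: "\<And>x. (\<Sum>j\<in>J. (\<Sum>i\<in>I. T j i * x i)^2) \<le> M * (\<Sum>i\<in>I. (x i)^2)"
 defines "\<rho> \<equiv> \<Sum>j\<in>J. \<Sum>i\<in>I. (T j i)^2"
 shows "(\<integral>\<^sup>+x. ennreal ((\<Sum>j\<in>J. (\<Sum>i\<in>I. T j i * x i)^2) powr a) \<partial>gauss I) \<le> ennreal ((\<rho> + a * M) powr a)"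
proof -
 let ?Z = "\<lambda>x. \<Sum>j\<in>J. (\<Sum>i\<in>I. T j i * x i)^2"
 have r0: "0 \<le> \<rho>" unfolding \<rho>_def by (auto intro!: sum_nonneg)
 have Z0: "0 \<le> ?Z x" for x by (intro sum_nonneg) auto
 show ?thesis
 proof (cases "\<rho> = 0")
  case True
  have T0: "T j i = 0" if "j \<in> J" "i \<in> I" for i j
  proof -
   have "\<forall>j\<in>J. (\<Sum>i\<in>I. (T j i)^2) = 0"
    using True fJ unfolding \<rho>_def by (subst (asm) sum_nonneg_eq_0_iff) (auto intro!: sum_nonneg)
   then have "\<forall>i\<in>I. (T j i)^2 = 0" using that fI by (simp add: sum_nonneg_eq_0_iff)
   then show ?thesis using that by simp
  qed
  then have "?Z x = 0" for x by simp
  then show ?thesis by simp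
 next
  case False
  then have r: "\<rho> > 0" using r0 by simp
  \<comment> \<open>\<open>\<mu> = a / s\<close> minimises \<open>\<mu> powr (- a)\<close> times the
    bound on the exponential moment; this is the reason for \<open>s\<close>.\<close>
  define s where "s = \<rho> + 2 * a * M"
  have s: "s > 0" using r a M by (simp add: s_def add_pos_pos)
  define \<mu> where "\<mu> = a / s"
  have mu: "\<mu> > 0" using a s by (simp add: \<mu>_def)
  have L: "1 - 2 * \<mu> * M = \<rho> / s" using s by (simp add: \<mu>_def s_def field_simps)
  have rs: "\<rho> / s > 0" using r s by simp
  have lt: "2 * \<mu> * M < 1" using L rs by linarith
  have int: "(\<integral>\<^sup>+x. ennreal (exp (\<mu> * ?Z x)) \<partial>gauss I) \<le> ennreal ((\<rho> / s) powr (- (\<rho> / M) / 2))"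
   using nn_integral_gauss_exp_affine_sq[OF fI fJ M _ lt op, of "\<lambda>_. 0"] mu
   unfolding L \<rho>_def[symmetric] by simp
  have pw: "?Z x powr a \<le> s powr a * exp (- a) * exp (\<mu> * ?Z x)" for x
  proof (cases "?Z x = 0")
   case True
   then show ?thesis by simp
  next
   case False
   then have Z: "?Z x > 0" using Z0[of x] by simp
   define y where "y = ?Z x / s"
   have y: "y > 0" using Z s by (simp add: y_def)
   have "ln y \<le> y - 1" by (rule ln_le_minus_one[OF y])
   then have "a * ln y \<le> a * (y - 1)" using a by (intro mult_left_mono) auto
   then have "y powr a \<le> exp (a * (y - 1))" using y by (simp add: powr_def)
   also have "a * (y - 1) = - a + \<mu> * ?Z x" by (simp add: y_def \<mu>_def algebra_simps)
   finally have "y powr a \<le> exp (- a) * exp (\<mu> * ?Z x)" by (simp only: exp_add)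
   then have "s powr a * y powr a \<le> s powr a * (exp (- a) * exp (\<mu> * ?Z x))"
    by (intro mult_left_mono) auto
   moreover have "s powr a * y powr a = ?Z x powr a"
    using s y by (subst powr_mult[symmetric]) (auto simp: y_def)
   ultimately show ?thesis by (simp add: mult.assoc)
  qed
  have "(\<integral>\<^sup>+x. ennreal (?Z x powr a) \<partial>gauss I) \<le> (\<integral>\<^sup>+x. ennreal (s powr a * exp (- a)) * ennreal (exp (\<mu> * ?Z x)) \<partial>gauss I)"
   using pw by (intro nn_integral_mono) (simp add: ennreal_mult'[symmetric] ennreal_leI)
  also have "... = ennreal (s powr a * exp (- a)) * (\<integral>\<^sup>+x. ennreal (exp (\<mu> * ?Z x)) \<partial>gauss I)"
   by (rule nn_integral_cmult) measurable
  also have "... \<le> ennreal (s powr a * exp (- a)) * ennreal ((\<rho> / s) powr (- (\<rho> / M) / 2))"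
   by (intro mult_left_mono int) simp
  also have "... = ennreal (s powr a * exp (- a) * (\<rho> / s) powr (- (\<rho> / M) / 2))"
   by (rule ennreal_mult'[symmetric]) simp
  also have "... \<le> ennreal ((\<rho> + a * M) powr a)"
  proof (rule ennreal_leI)
   define x where "x = \<rho> / (2 * a * M)"
   have x: "x > 0" using r a M by (simp add: x_def)
   have aM: "2 * a * M > 0" using a M by simp
   have sx: "s = 2 * a * M * (1 + x)" using a M by (simp add: s_def x_def distrib_left)
   have rx: "\<rho> = 2 * a * M * x" using a M by (simp add: x_def)
   have tx: "\<rho> + a * M = 2 * a * M * (x + 1/2)" unfolding rx by (simp add: algebra_simps)
   have lns: "ln s = ln (2 * a * M) + ln (1 + x)" unfolding sx using aM x by (intro ln_mult_pos) auto
   have lnr: "ln \<rho> = ln (2 * a * M) + ln x" unfolding rx using aM x by (intro ln_mult_pos) auto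
   have lnt: "ln (\<rho> + a * M) = ln (2 * a * M) + ln (x + 1/2)" unfolding tx using aM x by (intro ln_mult_pos) auto
   have "s powr a * exp (- a) * (\<rho> / s) powr (- (\<rho> / M) / 2) = exp (a * ln s + - a + (- (\<rho> / M) / 2) * ln (\<rho> / s))"
    unfolding exp_add using s r by (simp add: powr_def)
   also have "a * ln s + - a + (- (\<rho> / M) / 2) * ln (\<rho> / s) = a * (ln s - 1 + x * (ln s - ln \<rho>))"
   proof -
    have "ln (\<rho> / s) = ln \<rho> - ln s" using r s by (simp add: ln_div)
    moreover have "- (\<rho> / M) / 2 = - (a * x)" using a M by (simp add: rx)
    ultimately show ?thesis by (simp only:) (simp add: algebra_simps)
   qed
   also have "... \<le> a * ln (\<rho> + a * M)"
   proof (rule mult_left_mono)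
    have "ln s - 1 + x * (ln s - ln \<rho>) = ln (2 * a * M) - 1 + ((1 + x) * ln (1 + x) - x * ln x)"
     unfolding lns lnr by (simp add: algebra_simps)
    also have "... \<le> ln (2 * a * M) + ln (x + 1/2)" using entropy_tangent_bound[OF x] by linarith
    finally show "ln s - 1 + x * (ln s - ln \<rho>) \<le> ln (\<rho> + a * M)" unfolding lnt .
   qed (use a in simp)
   finally have "s powr a * exp (- a) * (\<rho> / s) powr (- (\<rho> / M) / 2) \<le> exp (a * ln (\<rho> + a * M))" by simp
   moreover have "\<rho> + a * M > 0" using r a M by (simp add: add_pos_pos)
   ultimately show "s powr a * exp (- a) * (\<rho> / s) powr (- (\<rho> / M) / 2) \<le> (\<rho> + a * M) powr a"
    by (simp add: powr_def)
  qed
  finally show ?thesis .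
 qed
qed

section \<open>Moments of the Gaussian right inverse\<close>

definition meas_mat :: "'a measure \<Rightarrow> nat \<Rightarrow> nat \<Rightarrow> ('a \<Rightarrow> real mat) \<Rightarrow> bool" where
 "meas_mat M a b F \<longleftrightarrow> (\<forall>\<omega>. F \<omega> \<in> carrier_mat a b) \<and> (\<forall>i<a. \<forall>j<b. (\<lambda>\<omega>. F \<omega> $$ (i, j)) \<in> borel_measurable M)"

lemma meas_matD:
 assumes "meas_mat M a b F"
 shows "F \<omega> \<in> carrier_mat a b" "i < a \<Longrightarrow> j < b \<Longrightarrow> (\<lambda>\<omega>. F \<omega> $$ (i, j)) \<in> borel_measurable M"
 using assms by (auto simp: meas_mat_def)

lemma meas_mat_mult:
 assumes F: "meas_mat M a b F" and G: "meas_mat M b c G"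
 shows "meas_mat M a c (\<lambda>\<omega>. F \<omega> * G \<omega>)"
 unfolding meas_mat_def
proof (intro conjI allI impI)
 show "F \<omega> * G \<omega> \<in> carrier_mat a c" for \<omega>
  by (rule mult_carrier_mat[OF meas_matD(1)[OF F] meas_matD(1)[OF G]])
 fix i j assume ij: "i < a" "j < c"
 have "(\<lambda>\<omega>. (F \<omega> * G \<omega>) $$ (i, j)) = (\<lambda>\<omega>. \<Sum>l<b. F \<omega> $$ (i, l) * G \<omega> $$ (l, j))"
  using mult_mat_entry[OF meas_matD(1)[OF F] meas_matD(1)[OF G] ij] by simp
 also have "... \<in> borel_measurable M"
  using meas_matD(2)[OF F ij(1)] meas_matD(2)[OF G _ ij(2)] by (intro borel_measurable_sum borel_measurable_times) auto
 finally show "(\<lambda>\<omega>. (F \<omega> * G \<omega>) $$ (i, j)) \<in> borel_measurable M" .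
qed

lemma meas_mat_transpose:
 assumes F: "meas_mat M a b F"
 shows "meas_mat M b a (\<lambda>\<omega>. (F \<omega>)\<^sup>T)"
 unfolding meas_mat_def
proof (intro conjI allI impI)
 show "(F \<omega>)\<^sup>T \<in> carrier_mat b a" for \<omega> using meas_matD(1)[OF F] by auto
 fix i j assume ij: "i < b" "j < a"
 have "(\<lambda>\<omega>. (F \<omega>)\<^sup>T $$ (i, j)) = (\<lambda>\<omega>. F \<omega> $$ (j, i))"
  using ij carrier_matD[OF meas_matD(1)[OF F]] by (intro ext index_transpose_mat(1)) auto
 then show "(\<lambda>\<omega>. (F \<omega>)\<^sup>T $$ (i, j)) \<in> borel_measurable M" using meas_matD(2)[OF F ij(2,1)] by simp
qed

lemma meas_mat_smult:
 assumes F: "meas_mat M a b F" and c: "c \<in> borel_measurable M"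
 shows "meas_mat M a b (\<lambda>\<omega>. c \<omega> \<cdot>\<^sub>m F \<omega>)"
 unfolding meas_mat_def
proof (intro conjI allI impI)
 show "c \<omega> \<cdot>\<^sub>m F \<omega> \<in> carrier_mat a b" for \<omega> using meas_matD(1)[OF F] by auto
 fix i j assume ij: "i < a" "j < b"
 have "(\<lambda>\<omega>. (c \<omega> \<cdot>\<^sub>m F \<omega>) $$ (i, j)) = (\<lambda>\<omega>. c \<omega> * F \<omega> $$ (i, j))"
  using ij carrier_matD[OF meas_matD(1)[OF F]] by (intro ext index_smult_mat(1)) auto
 then show "(\<lambda>\<omega>. (c \<omega> \<cdot>\<^sub>m F \<omega>) $$ (i, j)) \<in> borel_measurable M"
  using meas_matD(2)[OF F ij] c by simp
qed

lemma meas_mat_det: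
 assumes F: "meas_mat M n n F"
 shows "(\<lambda>\<omega>. Determinant.det (F \<omega>)) \<in> borel_measurable M"
proof -
 have "(\<lambda>\<omega>. Determinant.det (F \<omega>)) = (\<lambda>\<omega>. \<Sum>p\<in>{p. p permutes {0..<n}}. signof p * (\<Prod>i=0..<n. F \<omega> $$ (i, p i)))"
  using Determinant.det_def'[OF meas_matD(1)[OF F]] by simp
 also have "... \<in> borel_measurable M"
 proof (intro borel_measurable_sum borel_measurable_times borel_measurable_prod)
  fix p i assume "p \<in> {p. p permutes {0..<n}}" "i \<in> {0..<n}"
  then have "i < n" "p i < n" using permutes_in_image[of p "{0..<n}" i] by auto
  then show "(\<lambda>\<omega>. F \<omega> $$ (i, p i)) \<in> borel_measurable M" by (rule meas_matD(2)[OF F])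
 qed simp
 finally show ?thesis .
qed

lemma meas_mat_adj:
 assumes F: "meas_mat M n n F"
 shows "meas_mat M n n (\<lambda>\<omega>. adj_mat (F \<omega>))"
 unfolding meas_mat_def
proof (intro conjI allI impI)
 note dims = carrier_matD[OF meas_matD(1)[OF F]]
 show "adj_mat (F \<omega>) \<in> carrier_mat n n" for \<omega> by (rule adj_mat(1)[OF meas_matD(1)[OF F]])
 fix i j assume ij: "i < n" "j < n"
 have "(\<lambda>\<omega>. adj_mat (F \<omega>) $$ (i, j)) = (\<lambda>\<omega>. (- 1) ^ (j + i) * Determinant.det (mat_delete (F \<omega>) j i))"
  using ij dims by (intro ext) (simp add: adj_mat_def cofactor_def)
 moreover have "meas_mat M (n - 1) (n - 1) (\<lambda>\<omega>. mat_delete (F \<omega>) j i)"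
  unfolding meas_mat_def mat_delete_def
  using ij dims meas_matD(2)[OF F] by (auto simp: dims)
 ultimately show "(\<lambda>\<omega>. adj_mat (F \<omega>) $$ (i, j)) \<in> borel_measurable M"
  using meas_mat_det[of M "n - 1"] by simp
qed

lemma meas_mat_to_mat:
 assumes "{0..<a} \<times> {0..<b} \<subseteq> I"
 shows "meas_mat (PiM I (\<lambda>_. borel)) a b (to_mat a b)"
 unfolding meas_mat_def to_mat_def using assms
 by (auto intro!: measurable_component_singleton)

text \<open>The pseudoinverse of a matrix of full row rank, written with Cramer's rule and hence a
  measurable rational function of the entries. Where the Gram determinant is zero the convention
  \<open>1 / 0 = 0\<close> makes it the zero matrix.\<close>

definition right_inv :: "real mat \<Rightarrow> real mat" where
 "right_inv G = G\<^sup>T * ((1 / Determinant.det (G * G\<^sup>T)) \<cdot>\<^sub>m adj_mat (G * G\<^sup>T))"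

abbreviation gram_det :: "real mat \<Rightarrow> real" where
 "gram_det G \<equiv> Determinant.det (G * G\<^sup>T)"

lemma right_inv_carrier:
 assumes "G \<in> carrier_mat k m"
 shows "right_inv G \<in> carrier_mat m k"
 using adj_mat(1)[of "G * G\<^sup>T" k] assms by (auto simp: right_inv_def)

lemma right_inv:
 assumes G: "G \<in> carrier_mat k m" and det: "gram_det G \<noteq> 0"
 shows "G * right_inv G = 1\<^sub>m k"
proof -
 let ?W = "G * G\<^sup>T"
 have W: "?W \<in> carrier_mat k k" using G by auto
 have A: "adj_mat ?W \<in> carrier_mat k k" by (rule adj_mat(1)[OF W])
 have "G * right_inv G = ?W * ((1 / Determinant.det ?W) \<cdot>\<^sub>m adj_mat ?W)"
  unfolding right_inv_def using G A by (intro assoc_mult_mat[symmetric, of _ k m _ k _ k]) auto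
 also have "... = (1 / Determinant.det ?W) \<cdot>\<^sub>m (?W * adj_mat ?W)"
  by (rule mult_smult_distrib[OF W A])
 also have "... = 1\<^sub>m k" unfolding adj_mat(2)[OF W] using det by (intro eq_matI) auto
 finally show ?thesis .
qed

lemma meas_mat_right_inv:
 assumes G: "meas_mat M k m G"
 shows "meas_mat M m k (\<lambda>\<omega>. right_inv (G \<omega>))"
proof -
 note W = meas_mat_mult[OF G meas_mat_transpose[OF G]]
 have "(\<lambda>\<omega>. 1 / gram_det (G \<omega>)) \<in> borel_measurable M"
  using meas_mat_det[OF W] by measurable
 then show ?thesis
  unfolding right_inv_def
  by (intro meas_mat_mult[OF meas_mat_transpose[OF G] meas_mat_smult[OF meas_mat_adj[OF W]]])
qed

section \<open>Least-norm solutions and almost sure full rank\<close>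

lemma ip_Cauchy_Schwarz:
 assumes "v \<in> carrier_vec m" "w \<in> carrier_vec m"
 shows "(ip v w)^2 \<le> ip v v * ip w w"
 unfolding ip_sum[OF assms] ip_sum[OF assms(1,1)] ip_sum[OF assms(2,2)]
 using Cauchy_Schwarz_ineq_sum[of "\<lambda>i. v $ i" "\<lambda>i. w $ i" "{..<m}"] by (simp add: power2_eq_square)

text \<open>\<open>right_inv G *\<^sub>v v\<close> lies in the row space of \<open>G\<close> and is
  therefore the least-norm solution of \<open>G z = v\<close>. The scalar \<open>\<alpha>\<close>
  permits a competitor that only hits the line of \<open>v\<close>. The bounds on the random inverse
  come from such competitors.\<close>

lemma right_inv_minimal:
 assumes G: "G \<in> carrier_mat k m" and det: "gram_det G \<noteq> 0"
  and v: "v \<in> carrier_vec k" and h: "h \<in> carrier_vec m" and Gh: "G *\<^sub>v h = \<alpha> \<cdot>\<^sub>v v"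
 shows "\<alpha>^2 * ip (right_inv G *\<^sub>v v) (right_inv G *\<^sub>v v) \<le> ip h h"
proof -
 let ?W = "G * G\<^sup>T"
 define B where "B = (1 / Determinant.det ?W) \<cdot>\<^sub>m adj_mat ?W"
 have W: "?W \<in> carrier_mat k k" using G by auto
 have B: "B \<in> carrier_mat k k" using adj_mat(1)[OF W] by (simp add: B_def)
 define y where "y = B *\<^sub>v v"
 define z where "z = right_inv G *\<^sub>v v"
 have y: "y \<in> carrier_vec k" unfolding y_def using B v by auto
 have z: "z = G\<^sup>T *\<^sub>v y"
  unfolding z_def y_def right_inv_def B_def[symmetric] using G B v by (intro assoc_mult_mat_vec[of _ m k _ k]) auto
 have zc: "z \<in> carrier_vec m" unfolding z using G y by auto
 have Gz: "G *\<^sub>v z = v"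
 proof -
  have "G *\<^sub>v z = (G * right_inv G) *\<^sub>v v"
   unfolding z_def using G right_inv_carrier[OF G] v by (intro assoc_mult_mat_vec[symmetric, of _ k m _ k]) auto
  then show ?thesis using right_inv[OF G det] v by simp
 qed
 have zip: "ip z x = ip y (G *\<^sub>v x)" if "x \<in> carrier_vec m" for x
  using ip_mult_mat_vec[OF G that y] z by simp
 have zz: "ip z z = ip y v" using zip[OF zc] Gz by simp
 have "ip z h = \<alpha> * ip z z" unfolding zz using zip[OF h] Gh y v by simp
 then have "(\<alpha> * ip z z)^2 \<le> ip z z * ip h h" using ip_Cauchy_Schwarz[OF zc h] by simp
 then have *: "ip z z * (\<alpha>^2 * ip z z) \<le> ip z z * ip h h" by (simp add: power2_eq_square mult_ac)
 show ?thesis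
 proof (cases "ip z z = 0")
  case True
  then show ?thesis using ip_self_nonneg[of h] unfolding z_def by simp
 next
  case False
  then have "ip z z > 0" using ip_self_nonneg[of z] by linarith
  then show ?thesis using * unfolding z_def by (simp add: mult_le_cancel_left)
 qed
qed

text \<open>A countable dense set of test vectors; indexing by rational lists makes countability
  immediate.\<close>

definition rat_vecs :: "nat \<Rightarrow> real vec set" where
 "rat_vecs m = (\<lambda>xs. Matrix.vec m (\<lambda>c. real_of_rat (xs ! c))) ` (UNIV :: rat list set)"

lemma countable_rat_vecs: "countable (rat_vecs m)"
 unfolding rat_vecs_def by auto

lemma rat_vecs_carrier: "h \<in> rat_vecs m \<Longrightarrow> h \<in> carrier_vec m"
 by (auto simp: rat_vecs_def)

lemma rat_vecs_approx:
 assumes "h \<in> carrier_vec m"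
 shows "\<exists>s. (\<forall>N. s N \<in> rat_vecs m) \<and> (\<forall>c<m. (\<lambda>N. s N $ c) \<longlonglongrightarrow> h $ c)"
proof -
 have "\<exists>r::rat. \<bar>real_of_rat r - x\<bar> < 1 / real (Suc N)" for x :: real and N
 proof -
  have "x < x + 1 / real (Suc N)" by simp
  then obtain r where "x < real_of_rat r" "real_of_rat r < x + 1 / real (Suc N)" using of_rat_dense by blast
  then show ?thesis by (intro exI[of _ r]) auto
 qed
 then obtain r :: "real \<Rightarrow> nat \<Rightarrow> rat" where r: "\<And>x N. \<bar>real_of_rat (r x N) - x\<bar> < 1 / real (Suc N)" by metis
 define s where "s = (\<lambda>N. Matrix.vec m (\<lambda>c. real_of_rat (map (\<lambda>c. r (h $ c) N) [0..<m] ! c)))"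
 have "s N \<in> rat_vecs m" for N unfolding s_def rat_vecs_def by blast
 moreover have "(\<lambda>N. s N $ c) \<longlonglongrightarrow> h $ c" if "c < m" for c
 proof -
  have "norm (real_of_rat (r (h $ c) N) - h $ c) \<le> inverse (real (Suc N))" for N
   using less_imp_le[OF r[of "h $ c" N]] by (simp add: divide_inverse)
  then have "(\<lambda>N. real_of_rat (r (h $ c) N) - h $ c) \<longlonglongrightarrow> 0"
   by (intro Lim_null_comparison[OF _ LIMSEQ_inverse_real_of_nat] always_eventually allI)
  then have "(\<lambda>N. real_of_rat (r (h $ c) N)) \<longlonglongrightarrow> h $ c" by (rule LIM_zero_cancel)
  then show ?thesis using that by (simp add: s_def)
 qed
 ultimately show ?thesis by blast
qed

abbreviation gdet :: "nat \<Rightarrow> nat \<Rightarrow> (nat \<times> nat \<Rightarrow> real) \<Rightarrow> real" where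
 "gdet k m g \<equiv> gram_det (to_mat k m g)"

abbreviation full_rk :: "nat \<Rightarrow> nat \<Rightarrow> (nat \<times> nat \<Rightarrow> real) \<Rightarrow> ennreal" where
 "full_rk k m g \<equiv> indicator {g. gdet k m g \<noteq> 0} g"

abbreviation low_rk :: "nat \<Rightarrow> nat \<Rightarrow> (nat \<times> nat \<Rightarrow> real) \<Rightarrow> ennreal" where
 "low_rk k m g \<equiv> indicator {g. gdet k m g = 0} g"

text \<open>Conditioning on the rows outside \<open>A\<close>: a bound that holds for every choice
  of these rows survives integration, because the measure has mass one.\<close>

lemma nn_integral_gauss_rows_le:
 fixes K C :: "nat set"
 assumes K: "finite K" and C: "finite C" and A: "A \<subseteq> K"
  and F: "F \<in> borel_measurable (PiM (K \<times> C) (\<lambda>_. borel))"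
  and le: "\<And>x. (\<integral>\<^sup>+y. F (merge ((K - A) \<times> C) (A \<times> C) (x, y)) \<partial>gauss (A \<times> C)) \<le> c"
 shows "(\<integral>\<^sup>+g. F g \<partial>gauss (K \<times> C)) \<le> c"
proof -
 have un: "K \<times> C = (K - A) \<times> C \<union> A \<times> C" using A by auto
 have fin: "finite ((K - A) \<times> C)" "finite (A \<times> C)" using K C finite_subset[OF A K] by auto
 have "(\<integral>\<^sup>+g. F g \<partial>gauss (K \<times> C)) = (\<integral>\<^sup>+x. (\<integral>\<^sup>+y. F (merge ((K - A) \<times> C) (A \<times> C) (x, y)) \<partial>gauss (A \<times> C)) \<partial>gauss ((K - A) \<times> C))"
  unfolding un by (rule nn_integral_gauss_fold[OF fin]) (use F un in auto)
 also have "... \<le> (\<integral>\<^sup>+x. c \<partial>gauss ((K - A) \<times> C))" by (intro nn_integral_mono le)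
 also have "... = c" by (rule nn_integral_gauss_const)
 finally show ?thesis .
qed

lemma to_mat_carrier [simp]: "to_mat k m g \<in> carrier_mat k m"
 by (simp add: to_mat_def)

lemma to_mat_dim [simp]: "dim_row (to_mat k m g) = k" "dim_col (to_mat k m g) = m"
 by (simp_all add: to_mat_def)

lemma to_mat_mult_vec:
 "h \<in> carrier_vec m \<Longrightarrow> r < k \<Longrightarrow> (to_mat k m g *\<^sub>v h) $ r = (\<Sum>c<m. g (r, c) * h $ c)"
 by (subst mult_mat_vec_entry[of _ k m]) (auto simp: to_mat_def)

lemma orthonormal_to_rows:
 fixes x :: "nat \<times> nat \<Rightarrow> real"
 assumes B: "finite B" and d: "card B + d \<le> m"
 obtains w where "orthonormal_family m d w" "\<And>r l. r \<in> B \<Longrightarrow> l < d \<Longrightarrow> (\<Sum>c<m. x (r, c) * w l $ c) = 0"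
proof -
 obtain e where e: "bij_betw e {0..<card B} B" using ex_bij_betw_nat_finite[OF B] by blast
 define R where "R = Matrix.mat (card B) m (\<lambda>(r, c). x (e r, c))"
 have R: "R \<in> carrier_mat (card B) m" by (simp add: R_def)
 obtain w where w: "orthonormal_family m d w" "\<forall>i<d. R *\<^sub>v w i = 0\<^sub>v (card B)"
  using orthonormal_in_kernel[OF R d] by blast
 have "(\<Sum>c<m. x (r, c) * w l $ c) = 0" if r: "r \<in> B" and l: "l < d" for r l
 proof -
  obtain a where a: "a < card B" "e a = r" using e r by (force simp: bij_betw_def)
  have wc: "w l \<in> carrier_vec m" using w(1) l by (simp add: orthonormal_family_def)
  have "(\<Sum>c<m. x (r, c) * w l $ c) = (R *\<^sub>v w l) $ a"
   using a by (subst mult_mat_vec_entry[OF R wc]) (auto simp: R_def)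
  then show ?thesis using w(2) l a by simp
 qed
 then show ?thesis using that w(1) by blast
qed

lemma family_ip:
 assumes "orthonormal_family m d w" "l < d" "l' < d"
 shows "(\<Sum>c<m. w l $ c * w l' $ c) = (if l = l' then 1 else 0)"
 using assms ip_sum[of "w l" m "w l'"] by (simp add: orthonormal_family_def)

definition fam_comb :: "nat \<Rightarrow> nat \<Rightarrow> (nat \<Rightarrow> real vec) \<Rightarrow> (nat \<Rightarrow> real) \<Rightarrow> real vec" where
 "fam_comb m d w \<eta> = Matrix.vec m (\<lambda>c. \<Sum>l<d. \<eta> l * w l $ c)"

lemma fam_comb_carrier [simp]: "fam_comb m d w \<eta> \<in> carrier_vec m"
 by (simp add: fam_comb_def)

lemma fam_comb_dot: "(\<Sum>c<m. x c * fam_comb m d w \<eta> $ c) = (\<Sum>l<d. \<eta> l * (\<Sum>c<m. x c * w l $ c))"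
proof -
 have "(\<Sum>c<m. x c * fam_comb m d w \<eta> $ c) = (\<Sum>c<m. \<Sum>l<d. \<eta> l * (x c * w l $ c))"
  by (simp add: fam_comb_def sum_distrib_left mult_ac)
 also have "... = (\<Sum>l<d. \<Sum>c<m. \<eta> l * (x c * w l $ c))" by (rule sum.swap)
 finally show ?thesis by (simp add: sum_distrib_left)
qed

lemma fam_comb_ip:
 assumes w: "orthonormal_family m d w"
 shows "ip (fam_comb m d w \<eta>) (fam_comb m d w \<eta>) = (\<Sum>l<d. (\<eta> l)^2)"
proof -
 have "ip (fam_comb m d w \<eta>) (fam_comb m d w \<eta>) = (\<Sum>l<d. \<eta> l * (\<Sum>c<m. fam_comb m d w \<eta> $ c * w l $ c))"
  unfolding ip_sum[OF fam_comb_carrier fam_comb_carrier] by (rule fam_comb_dot)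
 also have "... = (\<Sum>l<d. \<eta> l * \<eta> l)"
 proof (intro sum.cong refl arg_cong[where f="\<lambda>z. _ * z"])
  fix l assume "l \<in> {..<d}"
  then have l: "l < d" by simp
  have "(\<Sum>c<m. fam_comb m d w \<eta> $ c * w l $ c) = (\<Sum>l'<d. \<eta> l' * (\<Sum>c<m. w l $ c * w l' $ c))"
   using fam_comb_dot[of "\<lambda>c. w l $ c"] by (simp add: mult.commute)
  also have "... = (\<Sum>l'<d. if l = l' then \<eta> l' else 0)"
   using family_ip[OF w l] by (intro sum.cong) auto
  finally show "(\<Sum>c<m. fam_comb m d w \<eta> $ c * w l $ c) = \<eta> l" using l by simp
 qed
 finally show ?thesis by (simp add: power2_eq_square)
qed

lemma sum_row: "(\<Sum>q\<in>{i} \<times> {0..<m}. f q) = (\<Sum>c<m. f (i, c))" for f :: "nat \<times> nat \<Rightarrow> real"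
 by (rule sum.reindex_bij_witness[of _ "\<lambda>c. (i, c)" snd]) auto

text \<open>The event that the unit vector \<open>i\<close> has positive distance from the range of
  the matrix. With rational test vectors and a discrete distance it is a countable combination of
  measurable conditions, and it replaces a study of the zero set of the Gram determinant.\<close>

definition far_from_range :: "nat \<Rightarrow> nat \<Rightarrow> nat \<Rightarrow> (nat \<times> nat \<Rightarrow> real) set" where
 "far_from_range k m i = {g \<in> space (gaussm k m). \<exists>N::nat. \<forall>h\<in>rat_vecs m.
  1 / real (Suc N) \<le> (\<Sum>r<k. ((\<Sum>c<m. g (r, c) * h $ c) - (if r = i then 1 else 0))^2)}"

lemma ball_rat_vecs: "(\<forall>h\<in>rat_vecs m. P h) \<longleftrightarrow> (\<forall>xs::rat list. P (Matrix.vec m (\<lambda>c. real_of_rat (xs ! c))))"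
 by (auto simp: rat_vecs_def)

lemma far_from_range_sets: "far_from_range k m i \<in> sets (gaussm k m)"
proof -
 have "Measurable.pred (gaussm k m) (\<lambda>g. 1 / real (Suc N) \<le> (\<Sum>r<k. ((\<Sum>c<m. g (r, c) * h $ c) - (if r = i then 1 else 0))^2))" for N h
 proof -
  have "(\<lambda>g. \<Sum>r<k. ((\<Sum>c<m. g (r, c) * h $ c) - (if r = i then 1 else 0))^2) \<in> borel_measurable (gaussm k m)"
   by (intro borel_measurable_sum borel_measurable_power borel_measurable_diff borel_measurable_times borel_measurable_const)
    (auto simp: sets_gauss cong: measurable_cong_sets intro!: measurable_component_singleton)
  then show ?thesis by measurable
 qed
 then have "Measurable.pred (gaussm k m) (\<lambda>g. \<exists>N::nat. \<forall>h\<in>rat_vecs m.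
  1 / real (Suc N) \<le> (\<Sum>r<k. ((\<Sum>c<m. g (r, c) * h $ c) - (if r = i then 1 else 0))^2))"
  unfolding ball_rat_vecs by (intro pred_intros_countable)
 then show ?thesis unfolding far_from_range_def pred_def .
qed

text \<open>Given the other \<open>k - 1 < m\<close> rows there is a unit vector \<open>w 0\<close>
  orthogonal to them, and its product with row \<open>i\<close> is standard normal, hence nonzero
  almost surely. Then a multiple of \<open>w 0\<close> is mapped exactly to the unit vector
  \<open>i\<close>, and its rational approximations leave no positive distance.\<close>

lemma emeasure_far_from_range:
 assumes i: "i < k" and km: "k \<le> m"
 shows "emeasure (gaussm k m) (far_from_range k m i) = 0"
proof -
 let ?K = "{0..<k}" and ?C = "{0..<m}"
 let ?U = "far_from_range k m i"
 have Um: "(indicator ?U :: _ \<Rightarrow> ennreal) \<in> borel_measurable (PiM (?K \<times> ?C) (\<lambda>_. borel))"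
  using far_from_range_sets sets_gauss by (intro borel_measurable_indicator) blast
 have "(\<integral>\<^sup>+g. indicator ?U g \<partial>gauss (?K \<times> ?C)) \<le> 0"
 proof (rule nn_integral_gauss_rows_le[of ?K ?C "{i}", OF _ _ _ Um])
  fix x :: "nat \<times> nat \<Rightarrow> real"
  let ?B = "?K - {i}"
  have "card ?B + 1 \<le> m" using i km by simp
  then obtain w where w: "orthonormal_family m 1 w" "\<And>r l. r \<in> ?B \<Longrightarrow> l < 1 \<Longrightarrow> (\<Sum>c<m. x (r, c) * w l $ c) = 0"
   using orthonormal_to_rows[of ?B 1 m x] by blast
  have wc: "w 0 \<in> carrier_vec m" using w(1) by (simp add: orthonormal_family_def)
  define \<gamma> where "\<gamma> = (\<lambda>y. \<Sum>q\<in>{i} \<times> ?C. w 0 $ snd q * y q)"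
  have le: "indicator ?U (merge (?B \<times> ?C) ({i} \<times> ?C) (x, y)) \<le> (indicator {0} (\<gamma> y) :: ennreal)" for y
  proof (cases "\<gamma> y = 0")
   case False
   let ?g = "merge (?B \<times> ?C) ({i} \<times> ?C) (x, y)"
   have g1: "?g (r, c) = x (r, c)" if "r \<in> ?B" "c < m" for r c using that by (simp add: merge_def)
   have g2: "?g (i, c) = y (i, c)" if "c < m" for c using that by (simp add: merge_def)
   define h where "h = Matrix.vec m (\<lambda>c. w 0 $ c / \<gamma> y)"
   have h: "h \<in> carrier_vec m" by (simp add: h_def)
   have gh: "(\<Sum>c<m. ?g (r, c) * h $ c) = (if r = i then 1 else 0)" if "r < k" for r
   proof (cases "r = i")
    case True
    have "(\<Sum>c<m. ?g (r, c) * h $ c) = (\<Sum>c<m. w 0 $ c * y (i, c)) / \<gamma> y"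
     unfolding True by (simp add: g2 h_def sum_divide_distrib mult.commute)
    also have "(\<Sum>c<m. w 0 $ c * y (i, c)) = \<gamma> y" unfolding \<gamma>_def sum_row by simp
    finally show ?thesis using False True by simp
   next
    case r: False
    have "(\<Sum>c<m. ?g (r, c) * h $ c) = (\<Sum>c<m. x (r, c) * w 0 $ c) / \<gamma> y"
     using r that by (simp add: g1 h_def sum_divide_distrib)
    then show ?thesis using w(2)[of r 0] r that by simp
   qed
   have "?g \<notin> ?U"
   proof
    assume "?g \<in> ?U"
    then obtain N where N: "\<And>h. h \<in> rat_vecs m \<Longrightarrow> 1 / real (Suc N) \<le> (\<Sum>r<k. ((\<Sum>c<m. ?g (r, c) * h $ c) - (if r = i then 1 else 0))^2)"
     by (auto simp: far_from_range_def)
    obtain s where s: "\<And>N. s N \<in> rat_vecs m" "\<And>c. c < m \<Longrightarrow> (\<lambda>N. s N $ c) \<longlonglongrightarrow> h $ c"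
     using rat_vecs_approx[OF h] by blast
    have "(\<lambda>N. \<Sum>r<k. ((\<Sum>c<m. ?g (r, c) * s N $ c) - (if r = i then 1 else 0))^2)
     \<longlonglongrightarrow> (\<Sum>r<k. ((\<Sum>c<m. ?g (r, c) * h $ c) - (if r = i then 1 else 0))^2)"
     by (intro tendsto_sum tendsto_power tendsto_diff tendsto_mult tendsto_const s(2)) auto
    also have "(\<Sum>r<k. ((\<Sum>c<m. ?g (r, c) * h $ c) - (if r = i then 1 else 0))^2) = 0"
     by (intro sum.neutral) (auto simp: gh)
    finally have "1 / real (Suc N) \<le> 0" by (rule LIMSEQ_le_const) (use N s(1) in auto)
    then show False by simp
   qed
   then show ?thesis by simp
  qed (simp add: indicator_def)
  have "(\<integral>\<^sup>+y. indicator ?U (merge (?B \<times> ?C) ({i} \<times> ?C) (x, y)) \<partial>gauss ({i} \<times> ?C)) \<le> (\<integral>\<^sup>+y. indicator {0} (\<gamma> y) \<partial>gauss ({i} \<times> ?C))"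
   by (intro nn_integral_mono le)
  also have "... = (\<integral>\<^sup>+z. indicator {0} (1 * z) \<partial>std_gauss)"
   unfolding \<gamma>_def
  proof (rule nn_integral_gauss_linear)
   show "(\<Sum>q\<in>{i} \<times> {0..<m}. (w 0 $ snd q)^2) = 1^2"
    unfolding sum_row using family_ip[OF w(1), of 0 0] by (simp add: power2_eq_square)
  qed auto
  also have "... = emeasure std_gauss {0}" by simp
  also have "... = 0"
   by (subst emeasure_density) (auto intro!: nn_integral_zero' AE_mp[OF AE_lborel_singleton[of 0]])
  finally show "(\<integral>\<^sup>+y. indicator ?U (merge (?B \<times> ?C) ({i} \<times> ?C) (x, y)) \<partial>gauss ({i} \<times> ?C)) \<le> 0" .
 qed (use i in auto)
 then show ?thesis using far_from_range_sets by simp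
qed

text \<open>A singular Gram matrix yields a nonzero \<open>y\<close> orthogonal to the range. For
  any \<open>i\<close> with \<open>y $ i\<close> nonzero, Cauchy-Schwarz keeps the unit vector
  \<open>i\<close> at squared distance at least \<open>(y $ i)^2 / ip y y\<close> from the
  range.\<close>

lemma gram_det_zero_far:
 assumes g: "g \<in> space (gaussm k m)" and z: "gdet k m g = 0"
 shows "\<exists>i<k. g \<in> far_from_range k m i"
proof -
 let ?G = "to_mat k m g"
 have W: "?G * transpose_mat ?G \<in> carrier_mat k k" by auto
 obtain y where y: "y \<in> carrier_vec k" "y \<noteq> 0\<^sub>v k" "(?G * transpose_mat ?G) *\<^sub>v y = 0\<^sub>v k"
  using z det_0_iff_vec_prod_zero_field[OF W] by auto
 have Gt: "transpose_mat ?G *\<^sub>v y \<in> carrier_vec m"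
  by (rule mult_mat_vec_carrier[of _ m k]) (use y in auto)
 have "ip (transpose_mat ?G *\<^sub>v y) (transpose_mat ?G *\<^sub>v y) = ip y (?G *\<^sub>v (transpose_mat ?G *\<^sub>v y))"
  using ip_mult_mat_vec[of ?G k m "transpose_mat ?G *\<^sub>v y" y] y Gt by simp
 also have "?G *\<^sub>v (transpose_mat ?G *\<^sub>v y) = 0\<^sub>v k"
  using y by (subst assoc_mult_mat_vec[symmetric, of _ k m _ k]) auto
 finally have "transpose_mat ?G *\<^sub>v y = 0\<^sub>v m" using ip_self_pos[OF Gt] y by force
 then have yG: "ip y (?G *\<^sub>v h) = 0" if "h \<in> carrier_vec m" for h
  using ip_mult_mat_vec[of ?G k m h y] y that by simp
 obtain i where i: "i < k" "y $ i \<noteq> 0" using y by (metis carrier_vecD eq_vecI index_zero_vec)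
 have yy: "ip y y > 0" using ip_self_pos y by blast
 define e where "e = (y $ i)^2 / ip y y"
 have e: "e > 0" using i yy by (simp add: e_def)
 obtain N where N: "1 / real (Suc N) < e" using e nat_approx_posE by blast
 have "1 / real (Suc N) \<le> (\<Sum>r<k. ((\<Sum>c<m. g (r, c) * h $ c) - (if r = i then 1 else 0))^2)" if h: "h \<in> rat_vecs m" for h
 proof -
  have hc: "h \<in> carrier_vec m" by (rule rat_vecs_carrier[OF h])
  define v where "v = Matrix.vec k (\<lambda>r. (\<Sum>c<m. g (r, c) * h $ c) - (if r = i then 1 else 0))"
  have v: "v \<in> carrier_vec k" by (simp add: v_def)
  have Gh: "?G *\<^sub>v h \<in> carrier_vec k" by (rule mult_mat_vec_carrier[OF to_mat_carrier hc])
  have "ip y v = ip y (?G *\<^sub>v h) - (\<Sum>r<k. y $ r * (if r = i then 1 else 0))"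
   unfolding ip_sum[OF y(1) v] ip_sum[OF y(1) Gh]
   by (simp add: v_def to_mat_mult_vec[OF hc] right_diff_distrib sum_subtractf del: index_mult_mat_vec)
  also have "... = - y $ i" using yG[OF hc] i by (simp add: if_distrib cong: if_cong)
  finally have "(y $ i)^2 \<le> ip y y * ip v v" using ip_Cauchy_Schwarz[OF y(1) v] by simp
  then have "e \<le> ip v v" using yy by (simp add: e_def field_simps)
  also have "ip v v = (\<Sum>r<k. ((\<Sum>c<m. g (r, c) * h $ c) - (if r = i then 1 else 0))^2)"
   unfolding ip_sum[OF v v] by (simp add: v_def power2_eq_square)
  finally show ?thesis using N by linarith
 qed
 then show ?thesis using i g unfolding far_from_range_def by blast
qed

lemma AE_gram_det:
 assumes "k \<le> m"
 shows "AE g in gaussm k m. gdet k m g \<noteq> 0"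
proof -
 have "AE g in gaussm k m. \<forall>i\<in>{..<k}. g \<notin> far_from_range k m i"
  using assms emeasure_far_from_range far_from_range_sets
  by (intro AE_finite_allI AE_not_in null_setsI) auto
 then show ?thesis
  by (rule AE_mp) (auto intro!: AE_I2 dest: gram_det_zero_far)
qed

section \<open>Inverse moments along a fixed vector\<close>

abbreviation rinv :: "nat \<Rightarrow> nat \<Rightarrow> (nat \<times> nat \<Rightarrow> real) \<Rightarrow> real mat" where
 "rinv k m g \<equiv> right_inv (to_mat k m g)"

definition sqn :: "real vec \<Rightarrow> real" where
 "sqn v = ip v v"

lemma sqn_nonneg: "0 \<le> sqn v"
 unfolding sqn_def by (rule ip_self_nonneg)

lemma borel_measurable_gram_det:
 "(\<lambda>g. gdet k m g) \<in> borel_measurable (borelm k m)"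
 by (intro meas_mat_det[of _ k] meas_mat_mult[of _ k m] meas_mat_transpose meas_mat_to_mat) auto

lemma borel_measurable_gram_indicator:
 "(\<lambda>g. full_rk k m g) \<in> borel_measurable (borelm k m)"
 using borel_measurable_gram_det[of k m] by (intro borel_measurable_indicator') measurable

lemma meas_mat_rinv: "meas_mat (borelm k m) m k (rinv k m)"
 by (intro meas_mat_right_inv meas_mat_to_mat) auto

lemma rinv_carrier [simp]: "rinv k m g \<in> carrier_mat m k"
 by (rule right_inv_carrier) simp

lemma borel_measurable_sqn_rinv:
 assumes v: "v \<in> carrier_vec k"
 shows "(\<lambda>g. sqn (rinv k m g *\<^sub>v v)) \<in> borel_measurable (borelm k m)"
proof -
 have c: "rinv k m g *\<^sub>v v \<in> carrier_vec m" for g by (rule mult_mat_vec_carrier[OF rinv_carrier v])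
 have "(\<lambda>g. sqn (rinv k m g *\<^sub>v v)) = (\<lambda>g. \<Sum>c<m. (\<Sum>j<k. rinv k m g $$ (c, j) * v $ j) * (\<Sum>j<k. rinv k m g $$ (c, j) * v $ j))"
  unfolding sqn_def ip_sum[OF c c] by (simp add: mult_mat_vec_entry[OF rinv_carrier v] del: index_mult_mat_vec)
 also have "... \<in> borel_measurable (borelm k m)"
  using meas_matD(2)[OF meas_mat_rinv]
  by (intro borel_measurable_sum borel_measurable_times borel_measurable_const) auto
 finally show ?thesis .
qed

text \<open>The value at zero is infinite because the real quotient would be \<open>0\<close> there
  for positive \<open>p\<close> and not an upper bound.\<close>

definition pole_power :: "nat \<Rightarrow> real \<Rightarrow> ennreal" where
 "pole_power p r = (if r = 0 then \<infinity> else ennreal (1 / r ^ p))"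

lemma borel_measurable_pole_power [measurable]: "pole_power p \<in> borel_measurable borel"
 unfolding pole_power_def by measurable

text \<open>With \<open>p + 1\<close> coordinates the radial weight \<open>\<bar>z\<bar> ^ p\<close>
  cancels the pole exactly; one more inverse power of the norm would not be integrable.\<close>

lemma nn_integral_pole_power:
 assumes I: "finite I" "card I = p + 1" and p: "p \<ge> 1"
 shows "ennreal (gmom p) * (\<integral>\<^sup>+x. pole_power p (sqrt (\<Sum>i\<in>I. (x i)^2)) \<partial>gauss I) \<le> 1"
proof -
 have "I \<noteq> {}" using I by auto
 then have "ennreal (gmom p) * (\<integral>\<^sup>+x. pole_power p (sqrt (\<Sum>i\<in>I. (x i)^2)) \<partial>gauss I)
  = (\<integral>\<^sup>+z. pole_power p \<bar>z\<bar> * ennreal (\<bar>z\<bar> ^ p) \<partial>std_gauss)"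
  using nn_integral_gauss_radial[OF I(1), of "pole_power p"] I(2) by simp
 also have "... \<le> (\<integral>\<^sup>+z. 1 \<partial>std_gauss)"
 proof (rule nn_integral_mono)
  fix z :: real
  show "pole_power p \<bar>z\<bar> * ennreal (\<bar>z\<bar> ^ p) \<le> 1"
   using p by (auto simp: pole_power_def zero_power ennreal_mult'[symmetric])
 qed
 also have "... = 1" using std_gauss.emeasure_space_1 by simp
 finally show ?thesis .
qed

lemma nn_integral_row_pushforward:
 fixes i :: nat
 assumes w: "orthonormal_family m d w" and F: "F \<in> borel_measurable (PiM {..<d} (\<lambda>_. borel))"
 shows "(\<integral>\<^sup>+y. F (\<lambda>l\<in>{..<d}. \<Sum>c<m. w l $ c * y (i, c)) \<partial>gauss ({i} \<times> {0..<m})) = (\<integral>\<^sup>+x. F x \<partial>gauss {..<d})"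
proof -
 define Q where "Q = (\<lambda>l (q :: nat \<times> nat). w l $ snd q)"
 have "orthonormal_on {..<d} ({i} \<times> {0..<m}) Q"
  unfolding orthonormal_on_def sum_row Q_def using family_ip[OF w] by auto
 from nn_integral_gauss_orthonormal[OF _ _ this F]
 have "(\<integral>\<^sup>+y. F (\<lambda>l\<in>{..<d}. \<Sum>q\<in>{i} \<times> {0..<m}. Q l q * y q) \<partial>gauss ({i} \<times> {0..<m})) = (\<integral>\<^sup>+x. F x \<partial>gauss {..<d})"
  by simp
 then show ?thesis unfolding sum_row Q_def by simp
qed

lemma orthonormal_family_extend:
 assumes k: "0 < k" and v: "v \<in> carrier_vec k" "ip v v = s * s" and s: "s \<noteq> 0"
 obtains b where "orthonormal_family k k b" "b 0 = (1 / s) \<cdot>\<^sub>v v"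
proof -
 define R where "R = Matrix.mat 1 k (\<lambda>(i, j). v $ j)"
 have R: "R \<in> carrier_mat 1 k" by (simp add: R_def)
 obtain c where c: "orthonormal_family k (k - 1) c" "\<forall>i<k-1. R *\<^sub>v c i = 0\<^sub>v 1"
  using orthonormal_in_kernel[OF R, of "k - 1"] k by auto
 have cc: "c i \<in> carrier_vec k" if "i < k - 1" for i using c(1) that by (simp add: orthonormal_family_def)
 have vc: "ip v (c i) = 0" if i: "i < k - 1" for i
 proof -
  have "ip v (c i) = (R *\<^sub>v c i) $ 0"
   unfolding ip_sum[OF v(1) cc[OF i]] by (subst mult_mat_vec_entry[OF R cc[OF i]]) (auto simp: R_def)
  then show ?thesis using c(2) i by simp
 qed
 define b where "b = (\<lambda>i. if i = 0 then (1 / s) \<cdot>\<^sub>v v else c (i - 1))"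
 have "orthonormal_family k k b"
  unfolding orthonormal_family_def
 proof (intro conjI allI impI)
  fix i assume "i < k" then show "b i \<in> carrier_vec k" using v cc[of "i - 1"] by (auto simp: b_def)
 next
  fix i j assume ij: "i < k" "j < k"
  show "ip (b i) (b j) = (if i = j then 1 else 0)"
  proof (cases "i = 0 \<or> j = 0")
   case True
   have "ip (c i') v = 0" if "i' < k - 1" for i' using vc[OF that] ip_comm[OF v(1) cc[OF that]] by simp
   then show ?thesis using True ij v vc[of "j - 1"] cc[of "j - 1"] cc[of "i - 1"] s by (auto simp: b_def)
  next
   case False
   then have "i - 1 < k - 1" "j - 1 < k - 1" "i - 1 = j - 1 \<longleftrightarrow> i = j" using ij by auto
   then show ?thesis using False c(1) by (simp add: b_def orthonormal_family_def)
  qed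
 qed
 then show ?thesis using that by (simp add: b_def)
qed


text \<open>After rotating \<open>v\<close> to the first coordinate, only the part of the first row that is orthogonal to
 the other rows matters.\<close>
lemma nn_integral_rinv_vec:
 assumes k: "0 < k" and p: "1 \<le> p" and m: "m = k + p" and v: "v \<in> carrier_vec k"
 shows "ennreal (gmom p) * (\<integral>\<^sup>+g. full_rk k m g * ennreal (sqrt (sqn (rinv k m g *\<^sub>v v)) ^ p) \<partial>gaussm k m)
  \<le> ennreal (sqrt (sqn v) ^ p)"
proof (cases "v = 0\<^sub>v k")
 case True
 have "rinv k m g *\<^sub>v 0\<^sub>v k = 0\<^sub>v m" for g by (rule eq_vecI) (auto simp: carrier_matD[OF rinv_carrier])
 then show ?thesis using True p by (simp add: sqn_def zero_power)
next
 case False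
 let ?K = "{0..<k}" and ?C = "{0..<m}"
 let ?I = "?K \<times> ?C"
 define s where "s = sqrt (sqn v)"
 have ss: "s > 0" "s * s = ip v v" using ip_self_pos[OF v False] by (auto simp: s_def sqn_def)
 define F where "F = (\<lambda>g. full_rk k m g * ennreal (sqrt (sqn (rinv k m g *\<^sub>v v)) ^ p))"
 have Fm: "F \<in> borel_measurable (PiM ?I (\<lambda>_. borel))"
 proof -
  show ?thesis unfolding F_def using borel_measurable_gram_indicator[of k m] borel_measurable_sqn_rinv[OF v, of m] by measurable
 qed
 obtain b where b: "orthonormal_family k k b" "b 0 = (1 / s) \<cdot>\<^sub>v v"
  using orthonormal_family_extend[OF k v ss(2)[symmetric]] ss(1) by auto
 \<comment> \<open>\<open>Q\<close> acts on the row index alone: the matrix is \<open>B X\<close>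
   with Gaussian \<open>X\<close> and the columns of \<open>B\<close> given by \<open>b\<close>.
   Since the first column is \<open>v / s\<close>, it is enough to find \<open>h\<close> with
   \<open>X h\<close> proportional to the first unit vector.\<close>
 define Q where "Q = (\<lambda>(i' :: nat, c' :: nat) (i :: nat, c :: nat). if c = c' then b i $ i' else (0::real))"
 have Qsum: "(\<Sum>q\<in>?I. Q (i', c') q * f q) = (\<Sum>i<k. b i $ i' * f (i, c'))" if "c' < m" for i' c' and f :: "nat \<times> nat \<Rightarrow> real"
 proof -
  have "(\<Sum>q\<in>?I. Q (i', c') q * f q) = (\<Sum>i\<in>?K. \<Sum>c\<in>?C. Q (i', c') (i, c) * f (i, c))"
   by (simp add: sum.cartesian_product)
  also have "... = (\<Sum>i\<in>?K. \<Sum>c\<in>?C. if c = c' then b i $ i' * f (i, c) else 0)"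
   by (intro sum.cong) (auto simp: Q_def)
  also have "... = (\<Sum>i\<in>?K. b i $ i' * f (i, c'))" using that by simp
  finally show ?thesis by (simp add: atLeast0LessThan)
 qed
 have Qo: "orthonormal_on ?I ?I Q"
  unfolding orthonormal_on_def
 proof (intro ballI)
  fix q q' assume q: "q \<in> ?I" "q' \<in> ?I"
  obtain i' c' i'' c'' where qq: "q = (i', c')" "q' = (i'', c'')" by (cases q, cases q')
  have "(\<Sum>i\<in>?I. Q q i * Q q' i) = (\<Sum>i<k. b i $ i' * Q (i'', c'') (i, c'))"
   unfolding qq using q qq by (intro Qsum) auto
  also have "... = (if c' = c'' then \<Sum>i<k. b i $ i' * b i $ i'' else 0)" by (simp add: Q_def)
  also have "... = (if q = q' then 1 else 0)"
   using orthonormal_parseval(1)[OF b(1), of i' i''] q qq by auto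
  finally show "(\<Sum>i\<in>?I. Q q i * Q q' i) = (if q = q' then 1 else 0)" .
 qed
 define L where "L = (\<lambda>x. \<lambda>q\<in>?I. \<Sum>q'\<in>?I. Q q q' * x q')"
 have eq: "(\<integral>\<^sup>+g. F g \<partial>gauss ?I) = (\<integral>\<^sup>+x. F (L x) \<partial>gauss ?I)"
  unfolding L_def by (rule nn_integral_gauss_orthonormal[OF _ _ Qo Fm, symmetric]) auto
 have Lm: "(\<lambda>x. F (L x)) \<in> borel_measurable (PiM ?I (\<lambda>_. borel))"
  unfolding L_def by (rule measurable_compose[OF _ Fm]) measurable
 define A where "A = (\<integral>\<^sup>+x. pole_power p (sqrt (\<Sum>l<p+1. (x l)^2)) \<partial>gauss {..<p+1})"
 have "(\<integral>\<^sup>+x. F (L x) \<partial>gauss ?I) \<le> ennreal (s ^ p) * A"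
 proof (rule nn_integral_gauss_rows_le[of ?K ?C "{0}", OF _ _ _ Lm])
  fix x :: "nat \<times> nat \<Rightarrow> real"
  let ?B = "?K - {0}"
  \<comment> \<open>The \<open>k - 1\<close> remaining rows leave \<open>p + 1\<close> free
    directions in dimension \<open>k + p\<close>, which is the number of degrees of freedom in the
    final radial integral.\<close>
  have "card ?B + (p + 1) \<le> m" using k m by simp
  then obtain w where w: "orthonormal_family m (p + 1) w" "\<And>r l. r \<in> ?B \<Longrightarrow> l < p + 1 \<Longrightarrow> (\<Sum>c<m. x (r, c) * w l $ c) = 0"
   using orthonormal_to_rows[of ?B "p + 1" m x] by blast
  define \<gamma> where "\<gamma> = (\<lambda>y. \<lambda>l\<in>{..<p+1}. \<Sum>c<m. w l $ c * y (0::nat, c) :: real)"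
  have le: "F (L (merge (?B \<times> ?C) ({0} \<times> ?C) (x, y))) \<le> ennreal (s ^ p) * pole_power p (sqrt (\<Sum>l<p+1. (\<gamma> y l)^2))" for y
  proof -
   let ?x = "merge (?B \<times> ?C) ({0} \<times> ?C) (x, y)"
   let ?G = "to_mat k m (L ?x)"
   define \<Gamma> where "\<Gamma> = (\<Sum>l<p+1. (\<gamma> y l)^2)"
   have G0: "\<Gamma> \<ge> 0" unfolding \<Gamma>_def by (intro sum_nonneg) auto
   consider "\<Gamma> = 0" | "gram_det ?G = 0" | "\<Gamma> > 0" "gram_det ?G \<noteq> 0" using G0 by fastforce
   then show ?thesis
   proof cases
    case 1
    have "ennreal (s ^ p) * \<infinity> = \<infinity>" using ss by (simp add: ennreal_mult_top)
    then show ?thesis unfolding \<Gamma>_def[symmetric] 1 by (simp add: pole_power_def)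
   next
    case 2
    then show ?thesis by (simp add: F_def)
   next
    case 3
    \<comment> \<open>\<open>h\<close> is the projection of the first row of \<open>X\<close> onto
      the free directions, so \<open>X h\<close> is \<open>\<Gamma>\<close> times the first unit
      vector and \<open>ip h h = \<Gamma>\<close>; \<open>right_inv_minimal\<close> then gives
      \<open>s^2 / \<Gamma>\<close>.\<close>
    define h where "h = fam_comb m (p + 1) w (\<gamma> y)"
    have h: "h \<in> carrier_vec m" by (simp add: h_def)
    have xh: "(\<Sum>c<m. ?x (i, c) * h $ c) = (if i = 0 then \<Gamma> else 0)" if i: "i < k" for i
    proof (cases "i = 0")
     case True
     have "(\<Sum>c<m. ?x (i, c) * h $ c) = (\<Sum>l<p+1. \<gamma> y l * (\<Sum>c<m. y (0, c) * w l $ c))"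
      unfolding h_def fam_comb_dot True using k by (simp add: merge_def)
     also have "... = \<Gamma>" unfolding \<Gamma>_def by (intro sum.cong) (auto simp: \<gamma>_def power2_eq_square mult.commute)
     finally show ?thesis using True by simp
    next
     case False
     have "(\<Sum>c<m. ?x (i, c) * h $ c) = (\<Sum>l<p+1. \<gamma> y l * (\<Sum>c<m. x (i, c) * w l $ c))"
      unfolding h_def fam_comb_dot using False i by (simp add: merge_def)
     then show ?thesis using w(2)[of i] False i by simp
    qed
    have Gh: "?G *\<^sub>v h = (\<Gamma> / s) \<cdot>\<^sub>v v"
    proof (rule eq_vecI)
     fix i' assume "i' < dim_vec ((\<Gamma> / s) \<cdot>\<^sub>v v)"
     then have i': "i' < k" using v by simp
     have "(?G *\<^sub>v h) $ i' = (\<Sum>c<m. (\<Sum>i<k. b i $ i' * ?x (i, c)) * h $ c)"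
      unfolding to_mat_mult_vec[OF h i'] using i' by (intro sum.cong refl) (simp add: L_def Qsum)
     also have "... = (\<Sum>c<m. \<Sum>i<k. b i $ i' * (?x (i, c) * h $ c))"
      by (simp add: sum_distrib_right mult.assoc)
     also have "... = (\<Sum>i<k. b i $ i' * (\<Sum>c<m. ?x (i, c) * h $ c))"
      by (subst sum.swap) (simp add: sum_distrib_left)
     also have "... = (\<Sum>i<k. if i = 0 then b i $ i' * \<Gamma> else 0)" by (intro sum.cong) (auto simp: xh)
     also have "... = b 0 $ i' * \<Gamma>" using k by simp
     also have "... = ((\<Gamma> / s) \<cdot>\<^sub>v v) $ i'" using i' v by (simp add: b(2))
     finally show "(?G *\<^sub>v h) $ i' = ((\<Gamma> / s) \<cdot>\<^sub>v v) $ i'" .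
    qed (use v in simp)
    have "(\<Gamma> / s)^2 * sqn (rinv k m (L ?x) *\<^sub>v v) \<le> ip h h"
     unfolding sqn_def by (rule right_inv_minimal[OF to_mat_carrier 3(2) v h Gh])
    also have "ip h h = \<Gamma>" unfolding h_def \<Gamma>_def by (rule fam_comb_ip[OF w(1)])
    finally have "\<Gamma> * (\<Gamma> / s^2 * sqn (rinv k m (L ?x) *\<^sub>v v)) \<le> \<Gamma> * 1"
     by (simp add: power_divide power2_eq_square)
    then have "\<Gamma> / s^2 * sqn (rinv k m (L ?x) *\<^sub>v v) \<le> 1"
     using 3(1) by (rule mult_left_le_imp_le)
    then have "sqn (rinv k m (L ?x) *\<^sub>v v) \<le> s^2 / \<Gamma>"
     using 3(1) ss(1) by (simp add: field_simps)
    then have "sqrt (sqn (rinv k m (L ?x) *\<^sub>v v)) \<le> s / sqrt \<Gamma>"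
     using ss(1) 3(1) by (metis less_eq_real_def real_sqrt_abs real_sqrt_divide real_sqrt_le_mono abs_of_pos)
    then have "sqrt (sqn (rinv k m (L ?x) *\<^sub>v v)) ^ p \<le> (s / sqrt \<Gamma>) ^ p"
     by (intro power_mono) (auto simp: sqn_nonneg)
    also have "... = s ^ p * (1 / sqrt \<Gamma> ^ p)" by (simp add: power_divide)
    finally have "ennreal (sqrt (sqn (rinv k m (L ?x) *\<^sub>v v)) ^ p) \<le> ennreal (s ^ p) * ennreal (1 / sqrt \<Gamma> ^ p)"
     using ss(1) by (subst ennreal_mult'[symmetric]) (auto intro!: ennreal_leI)
    then show ?thesis using 3 unfolding \<Gamma>_def[symmetric] F_def pole_power_def by simp
   qed
  qed
  have "(\<integral>\<^sup>+y. F (L (merge (?B \<times> ?C) ({0} \<times> ?C) (x, y))) \<partial>gauss ({0} \<times> ?C))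
   \<le> (\<integral>\<^sup>+y. ennreal (s ^ p) * pole_power p (sqrt (\<Sum>l<p+1. (\<gamma> y l)^2)) \<partial>gauss ({0} \<times> ?C))"
   by (intro nn_integral_mono le)
  also have "... = (\<integral>\<^sup>+y. ennreal (s ^ p) * pole_power p (sqrt (\<Sum>l<p+1. (y l)^2)) \<partial>gauss {..<p+1})"
   unfolding \<gamma>_def by (rule nn_integral_row_pushforward[OF w(1)]) measurable
  also have "... = ennreal (s ^ p) * A" unfolding A_def
   by (rule nn_integral_cmult) (simp add: sets_gauss cong: measurable_cong_sets)
  finally show "(\<integral>\<^sup>+y. F (L (merge (?B \<times> ?C) ({0} \<times> ?C) (x, y))) \<partial>gauss ({0} \<times> ?C)) \<le> ennreal (s ^ p) * A" .
 qed (use k in auto)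
 then have "ennreal (gmom p) * (\<integral>\<^sup>+g. F g \<partial>gauss ?I) \<le> ennreal (gmom p) * (ennreal (s ^ p) * A)"
  unfolding eq by (rule mult_left_mono) simp
 also have "... = ennreal (s ^ p) * (ennreal (gmom p) * A)" by (simp only: mult_ac)
 also have "... \<le> ennreal (s ^ p) * 1"
  unfolding A_def using nn_integral_pole_power[of "{..<p+1}" p] p by (intro mult_left_mono) auto
 finally show ?thesis unfolding F_def s_def by simp
qed

section \<open>Inverse moments of pairs of columns\<close>

lemma ennreal_mult_left_cancel_le: "0 < c \<Longrightarrow> ennreal c * x \<le> ennreal c * y \<Longrightarrow> x \<le> y"
 by (subst (asm) ennreal_mult_le_mult_iff) auto

text \<open>Along the directions \<open>w\<close>, which are orthogonal to the remaining rows, only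
  the components \<open>a\<close> and \<open>b\<close> of the rows \<open>i\<close> and
  \<open>j\<close> survive. The competitor is \<open>a\<close> minus its projection onto
  \<open>b\<close>; its squared norm and its product with row \<open>i\<close> are both
  \<open>(A * B - D^2) / B\<close>, so the reciprocal bounds the column.\<close>

lemma rinv_pair_column:
 fixes g :: "nat \<times> nat \<Rightarrow> real"
 assumes w: "orthonormal_family m d w" and ij: "i < k" "j < k" "i \<noteq> j"
  and a: "\<And>l. l < d \<Longrightarrow> (\<Sum>c<m. g (i, c) * w l $ c) = a l"
  and b: "\<And>l. l < d \<Longrightarrow> (\<Sum>c<m. g (j, c) * w l $ c) = b l"
  and z: "\<And>r l. r < k \<Longrightarrow> r \<noteq> i \<Longrightarrow> r \<noteq> j \<Longrightarrow> l < d \<Longrightarrow> (\<Sum>c<m. g (r, c) * w l $ c) = 0"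
  and det: "gdet k m g \<noteq> 0"
 defines "A \<equiv> \<Sum>l<d. (a l)^2" and "B \<equiv> \<Sum>l<d. (b l)^2" and "D \<equiv> \<Sum>l<d. a l * b l"
 assumes nz: "A * B - D^2 > 0"
 shows "sqn (rinv k m g *\<^sub>v unit_vec k i) \<le> B / (A * B - D^2)"
proof -
 have B0: "B \<ge> 0" "A \<ge> 0" unfolding A_def B_def by (auto intro!: sum_nonneg)
 have B: "B > 0"
 proof (rule ccontr)
  assume "\<not> B > 0" then have "B = 0" using B0 by simp
  then show False using nz by simp
 qed
 define \<eta> where "\<eta> = (\<lambda>l. a l - D / B * b l)"
 define h where "h = fam_comb m d w \<eta>"
 define \<alpha> where "\<alpha> = (A * B - D^2) / B"
 have \<alpha>: "\<alpha> > 0" using nz B by (simp add: \<alpha>_def)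
 have h: "h \<in> carrier_vec m" by (simp add: h_def)
 have ea: "(\<Sum>l<d. \<eta> l * a l) = \<alpha>"
 proof -
  have "(\<Sum>l<d. \<eta> l * a l) = (\<Sum>l<d. (a l)^2 - D / B * (a l * b l))"
   by (intro sum.cong) (auto simp: \<eta>_def algebra_simps power2_eq_square)
  also have "... = A - D / B * D" by (simp add: sum_subtractf sum_distrib_left A_def D_def)
  also have "... = \<alpha>" using B by (simp add: \<alpha>_def field_simps power2_eq_square)
  finally show ?thesis .
 qed
 have eb: "(\<Sum>l<d. \<eta> l * b l) = 0"
 proof -
  have "(\<Sum>l<d. \<eta> l * b l) = (\<Sum>l<d. a l * b l - D / B * (b l)^2)"
   by (intro sum.cong) (auto simp: \<eta>_def algebra_simps power2_eq_square)
  also have "... = D - D / B * B" by (simp add: sum_subtractf sum_distrib_left B_def D_def)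
  finally show ?thesis using B by simp
 qed
 have ee: "(\<Sum>l<d. (\<eta> l)^2) = \<alpha>"
 proof -
  have "(\<Sum>l<d. (\<eta> l)^2) = (\<Sum>l<d. \<eta> l * a l - D / B * (\<eta> l * b l))"
   by (intro sum.cong) (auto simp: \<eta>_def algebra_simps power2_eq_square)
  also have "... = \<alpha> - D / B * 0" unfolding sum_subtractf ea sum_distrib_left[symmetric] eb ..
  finally show ?thesis by simp
 qed
 have Gh: "to_mat k m g *\<^sub>v h = \<alpha> \<cdot>\<^sub>v unit_vec k i"
 proof (rule eq_vecI)
  fix r assume "r < dim_vec (\<alpha> \<cdot>\<^sub>v unit_vec k i)"
  then have r: "r < k" by simp
  have "(to_mat k m g *\<^sub>v h) $ r = (\<Sum>l<d. \<eta> l * (\<Sum>c<m. g (r, c) * w l $ c))"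
   unfolding to_mat_mult_vec[OF h r] unfolding h_def by (rule fam_comb_dot)
  also have "... = (if r = i then \<alpha> else 0)"
   using a b z[OF r] ea eb ij by (cases "r = i"; cases "r = j") auto
  finally show "(to_mat k m g *\<^sub>v h) $ r = (\<alpha> \<cdot>\<^sub>v unit_vec k i) $ r" using r ij(1) by (simp del: index_mult_mat_vec)
 qed simp
 have "\<alpha>^2 * sqn (rinv k m g *\<^sub>v unit_vec k i) \<le> ip h h"
  unfolding sqn_def by (rule right_inv_minimal[OF to_mat_carrier det _ h Gh]) simp
 also have "ip h h = \<alpha>" unfolding h_def ee[symmetric] by (rule fam_comb_ip[OF w])
 finally have "\<alpha> * (\<alpha> * sqn (rinv k m g *\<^sub>v unit_vec k i)) \<le> \<alpha> * 1" by (simp add: power2_eq_square)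
 then have "\<alpha> * sqn (rinv k m g *\<^sub>v unit_vec k i) \<le> 1" using \<alpha> by (rule mult_left_le_imp_le)
 then have "sqn (rinv k m g *\<^sub>v unit_vec k i) \<le> 1 / \<alpha>" using \<alpha> by (simp add: field_simps)
 then show ?thesis by (simp add: \<alpha>_def)
qed

text \<open>A moment of order \<open>p\<close> of the length \<open>s\<close> extended by two
  independent normal coordinates. When \<open>s\<close> is itself a two-dimensional Gaussian radius,
  it averages to a radial moment in dimension four.\<close>

definition pair_int :: "nat \<Rightarrow> real \<Rightarrow> ennreal" where
 "pair_int p s = (\<integral>\<^sup>+z. (\<integral>\<^sup>+c. ennreal (sqrt (s^2 + z^2 + c^2) ^ p) \<partial>std_gauss) \<partial>std_gauss)"

lemma borel_measurable_pair_int [measurable]: "pair_int p \<in> borel_measurable borel"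
 unfolding pair_int_def by measurable

text \<open>The argument is a reciprocal quantity, typically the trace of the inverse of a two by
  two Gram matrix. In the singular case the real quotient is \<open>0\<close>, which is why
  nonpositive arguments are sent to infinity.\<close>

definition inv_power :: "nat \<Rightarrow> real \<Rightarrow> ennreal" where
 "inv_power p r = (if r \<le> 0 then \<infinity> else ennreal (sqrt r ^ p))"

text \<open>The radial weights in dimensions \<open>p + 2\<close> and \<open>2\<close> differ by
  \<open>r ^ p\<close>; this trade removes an inverse power of order \<open>p\<close>.\<close>

lemma gauss_radial_change_dim:
 assumes I: "finite I" "card I = p + 2" and f: "f \<in> borel_measurable borel"
 shows "ennreal (gmom (p + 1)) * (\<integral>\<^sup>+x. f (sqrt (\<Sum>i\<in>I. (x i)^2)) \<partial>gauss I)
  = ennreal (gmom 1) * (\<integral>\<^sup>+x. f (sqrt (\<Sum>i\<in>{..<2::nat}. (x i)^2)) * ennreal (sqrt (\<Sum>i\<in>{..<2}. (x i)^2) ^ p) \<partial>gauss {..<2})"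
proof -
 have "I \<noteq> {}" using I by auto
 then have "ennreal (gmom (p + 1)) * (\<integral>\<^sup>+x. f (sqrt (\<Sum>i\<in>I. (x i)^2)) \<partial>gauss I)
  = (\<integral>\<^sup>+z. f \<bar>z\<bar> * ennreal (\<bar>z\<bar> ^ (p + 1)) \<partial>std_gauss)"
  using nn_integral_gauss_radial[OF I(1) _ f] I(2) by simp
 also have "... = (\<integral>\<^sup>+z. f \<bar>z\<bar> * ennreal (\<bar>z\<bar> ^ p) * ennreal (\<bar>z\<bar> ^ 1) \<partial>std_gauss)"
  by (intro nn_integral_cong) (simp add: ennreal_mult' mult.assoc mult.commute[of "ennreal \<bar>_\<bar>"])
 also have "... = ennreal (gmom 1) * (\<integral>\<^sup>+x. f (sqrt (\<Sum>i\<in>{..<2::nat}. (x i)^2)) * ennreal (sqrt (\<Sum>i\<in>{..<2}. (x i)^2) ^ p) \<partial>gauss {..<2})"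
  using nn_integral_gauss_radial[of "{..<2::nat}" "\<lambda>r. f r * ennreal (r ^ p)"] f by (auto simp: lessThan_empty_iff)
 finally show ?thesis .
qed

text \<open>With the first axis along \<open>x\<close>, the Gram determinant is \<open>s^2\<close>
  times the squared length of the remaining \<open>p + 1\<close> coordinates of \<open>y\<close>.
  Their radial weight cancels the pole and leaves one normal variable \<open>c\<close>, while the
  coordinate \<open>z\<close> along \<open>x\<close> survives in the numerator.\<close>

lemma pair_inner:
 fixes x :: "nat \<Rightarrow> real"
 assumes p: "1 \<le> p" and x: "(\<Sum>l<p+2. (x l)^2) = s^2" "s > 0"
 shows "ennreal (gmom p) * (\<integral>\<^sup>+y. inv_power p ((s^2 + (\<Sum>l<p+2. (y l)^2)) / (s^2 * (\<Sum>l<p+2. (y l)^2) - (\<Sum>l<p+2. x l * y l)^2)) \<partial>gauss {..<p+2})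
  \<le> pair_int p s * inv_power p (1 / s^2)"
proof -
 let ?d = "p + 2"
 define v where "v = Matrix.vec ?d x"
 have v: "v \<in> carrier_vec ?d" "ip v v = s * s"
  using x(1) by (simp_all add: v_def ip_sum[of _ ?d] power2_eq_square)
 obtain b where b: "orthonormal_family ?d ?d b" "b 0 = (1 / s) \<cdot>\<^sub>v v"
  using orthonormal_family_extend[OF _ v] x(2) by force
 define F where "F = (\<lambda>y :: nat \<Rightarrow> real. inv_power p ((s^2 + (\<Sum>l<?d. (y l)^2)) / (s^2 * (\<Sum>l<?d. (y l)^2) - s^2 * (y 0)^2)))"
 have Fm: "F \<in> borel_measurable (PiM {..<?d} (\<lambda>_. borel))"
  unfolding F_def inv_power_def by measurable
 define L where "L = (\<lambda>y. \<lambda>j\<in>{..<?d}. \<Sum>l\<in>{..<?d}. b j $ l * y l :: real)"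
 have bc: "b j \<in> carrier_vec ?d" if "j < ?d" for j using b(1) that by (simp add: orthonormal_family_def)
 have L: "L y j = ip (b j) (Matrix.vec ?d y)" if "j < ?d" for y j
  using that bc[OF that] by (simp add: L_def ip_sum[of _ ?d])
 have L2: "(\<Sum>l<?d. (L y l)^2) = (\<Sum>l<?d. (y l)^2)" for y
 proof -
  have "(\<Sum>l<?d. (L y l)^2) = (\<Sum>l<?d. (ip (b l) (Matrix.vec ?d y))^2)" by (intro sum.cong) (auto simp: L)
  also have "... = ip (Matrix.vec ?d y) (Matrix.vec ?d y)" by (rule orthonormal_parseval(3)[OF b(1), symmetric]) simp
  finally show ?thesis by (simp add: ip_sum[of _ ?d] power2_eq_square)
 qed
 have L0: "s * L y 0 = (\<Sum>l<?d. x l * y l)" for y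
  using x(2) v(1) by (simp add: L b(2)) (simp add: v_def ip_sum[of _ ?d])
 have "(\<integral>\<^sup>+y. inv_power p ((s^2 + (\<Sum>l<?d. (y l)^2)) / (s^2 * (\<Sum>l<?d. (y l)^2) - (\<Sum>l<?d. x l * y l)^2)) \<partial>gauss {..<?d})
  = (\<integral>\<^sup>+y. F (L y) \<partial>gauss {..<?d})"
  unfolding F_def L2 L0[symmetric] by (simp add: power_mult_distrib)
 also have "... = (\<integral>\<^sup>+y. F y \<partial>gauss {..<?d})" unfolding L_def
  by (rule nn_integral_gauss_orthonormal[OF _ _ _ Fm]) (use family_ip[OF b(1)] in \<open>auto simp: orthonormal_on_def\<close>)
 also have "... = (\<integral>\<^sup>+y. F y \<partial>gauss ({0} \<union> {1..<?d}))" by (intro arg_cong2[where f=nn_integral] arg_cong[where f=gauss]) auto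
 also have "... = (\<integral>\<^sup>+z. (\<integral>\<^sup>+w. F (merge {0} {1..<?d} (z, w)) \<partial>gauss {1..<?d}) \<partial>gauss {0::nat})"
 proof (rule nn_integral_gauss_fold)
  have "{0} \<union> {1..<?d} = {..<?d}" by auto
  then show "F \<in> borel_measurable (PiM ({0} \<union> {1..<?d}) (\<lambda>_. borel))" using Fm by simp
 qed auto
 also have "... = (\<integral>\<^sup>+z. (\<integral>\<^sup>+w. inv_power p ((s^2 + (z 0)^2 + (sqrt (\<Sum>l\<in>{1..<?d}. (w l)^2))^2) / (s^2 * (sqrt (\<Sum>l\<in>{1..<?d}. (w l)^2))^2)) \<partial>gauss {1..<?d}) \<partial>gauss {0::nat})"
 proof -
  have "F (merge {0} {1..<?d} (z, w)) = inv_power p ((s^2 + (z 0)^2 + (sqrt (\<Sum>l\<in>{1..<?d}. (w l)^2))^2) / (s^2 * (sqrt (\<Sum>l\<in>{1..<?d}. (w l)^2))^2))" for z w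
  proof -
   have "(\<Sum>l<?d. (merge {0} {1..<?d} (z, w) l)^2) = (z 0)^2 + (\<Sum>l\<in>{1..<?d}. (w l)^2)"
    by (simp add: lessThan_atLeast0 sum.atLeast_Suc_lessThan merge_def)
   moreover have "(sqrt (\<Sum>l\<in>{1..<?d}. (w l)^2))^2 = (\<Sum>l\<in>{1..<?d}. (w l)^2)" by (simp add: sum_nonneg)
   ultimately show ?thesis unfolding F_def by (simp add: merge_def algebra_simps)
  qed
  then show ?thesis by (simp only:)
 qed
 also have "... = (\<integral>\<^sup>+z. (\<integral>\<^sup>+w. inv_power p ((s^2 + z^2 + (sqrt (\<Sum>l\<in>{1..<?d}. (w l)^2))^2) / (s^2 * (sqrt (\<Sum>l\<in>{1..<?d}. (w l)^2))^2)) \<partial>gauss {1..<?d}) \<partial>std_gauss)"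
 proof (rule nn_integral_gauss_singleton)
  have "(\<lambda>(z, w). inv_power p ((s^2 + z^2 + (sqrt (\<Sum>l\<in>{1..<?d}. (w l)^2))^2) / (s^2 * (sqrt (\<Sum>l\<in>{1..<?d}. (w l)^2))^2))) \<in> borel_measurable (borel \<Otimes>\<^sub>M gauss {1..<?d})"
   unfolding inv_power_def by measurable
  then show "(\<lambda>z. \<integral>\<^sup>+w. inv_power p ((s^2 + z^2 + (sqrt (\<Sum>l\<in>{1..<?d}. (w l)^2))^2) / (s^2 * (sqrt (\<Sum>l\<in>{1..<?d}. (w l)^2))^2)) \<partial>gauss {1..<?d}) \<in> borel_measurable borel"
   by (intro borel_measurable_nn_integral_gauss) (simp add: case_prod_beta')
 qed
 finally have eq: "(\<integral>\<^sup>+y. inv_power p ((s^2 + (\<Sum>l<?d. (y l)^2)) / (s^2 * (\<Sum>l<?d. (y l)^2) - (\<Sum>l<?d. x l * y l)^2)) \<partial>gauss {..<?d}) = ..." .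
 define \<Phi> where "\<Phi> = (\<lambda>z c. inv_power p ((s^2 + z^2 + c^2) / (s^2 * c^2)))"
 have \<Phi>m [measurable]: "\<Phi> z \<in> borel_measurable borel" for z unfolding \<Phi>_def inv_power_def by measurable
 have in_le: "ennreal (gmom p) * (\<integral>\<^sup>+w. \<Phi> z (sqrt (\<Sum>l\<in>{1..<?d}. (w l)^2)) \<partial>gauss {1..<?d})
  \<le> (\<integral>\<^sup>+c. ennreal (sqrt (s^2 + z^2 + c^2) ^ p) \<partial>std_gauss) * inv_power p (1 / s^2)" for z
 proof -
  have "ennreal (gmom p) * (\<integral>\<^sup>+w. \<Phi> z (sqrt (\<Sum>l\<in>{1..<?d}. (w l)^2)) \<partial>gauss {1..<?d})
   = (\<integral>\<^sup>+c. \<Phi> z \<bar>c\<bar> * ennreal (\<bar>c\<bar> ^ p) \<partial>std_gauss)"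
   using nn_integral_gauss_radial[of "{1..<?d}" "\<Phi> z"] by simp
  also have "... \<le> (\<integral>\<^sup>+c. ennreal (sqrt (s^2 + z^2 + c^2) ^ p) * inv_power p (1 / s^2) \<partial>std_gauss)"
  proof (rule nn_integral_mono)
   fix c :: real
   show "\<Phi> z \<bar>c\<bar> * ennreal (\<bar>c\<bar> ^ p) \<le> ennreal (sqrt (s^2 + z^2 + c^2) ^ p) * inv_power p (1 / s^2)"
   proof (cases "c = 0")
    case True then show ?thesis using p by (simp add: zero_power)
   next
    case False
    have pos: "s^2 + z^2 + c^2 > 0" using x(2) by (simp add: add_pos_nonneg)
    have "(s^2 + z^2 + c^2) / (s^2 * c^2) > 0" using pos x(2) False by simp
    then have "\<Phi> z \<bar>c\<bar> * ennreal (\<bar>c\<bar> ^ p) = ennreal (sqrt ((s^2 + z^2 + c^2) / (s^2 * c^2)) ^ p * \<bar>c\<bar> ^ p)"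
     unfolding \<Phi>_def inv_power_def by (simp add: ennreal_mult' not_le)
    also have "sqrt ((s^2 + z^2 + c^2) / (s^2 * c^2)) ^ p * \<bar>c\<bar> ^ p = sqrt (s^2 + z^2 + c^2) ^ p * sqrt (1 / s^2) ^ p"
     using False x(2) by (simp add: real_sqrt_divide real_sqrt_mult power_divide power_mult_distrib)
    also have "ennreal ... = ennreal (sqrt (s^2 + z^2 + c^2) ^ p) * inv_power p (1 / s^2)"
     using x(2) unfolding inv_power_def by (simp add: ennreal_mult'')
    finally show ?thesis by simp
   qed
  qed
  also have "... = (\<integral>\<^sup>+c. ennreal (sqrt (s^2 + z^2 + c^2) ^ p) \<partial>std_gauss) * inv_power p (1 / s^2)"
   by (rule nn_integral_multc) measurable
  finally show ?thesis .
 qed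
 have zm: "(\<lambda>z. \<integral>\<^sup>+w. \<Phi> z (sqrt (\<Sum>l\<in>{1..<?d}. (w l)^2)) \<partial>gauss {1..<?d}) \<in> borel_measurable std_gauss"
 proof -
  have "(\<lambda>(z, w). \<Phi> z (sqrt (\<Sum>l\<in>{1..<?d}. (w l)^2))) \<in> borel_measurable (borel \<Otimes>\<^sub>M gauss {1..<?d})"
   unfolding \<Phi>_def inv_power_def by measurable
  then have "(\<lambda>z. \<integral>\<^sup>+w. \<Phi> z (sqrt (\<Sum>l\<in>{1..<?d}. (w l)^2)) \<partial>gauss {1..<?d}) \<in> borel_measurable borel"
   by (intro borel_measurable_nn_integral_gauss) (simp add: case_prod_beta')
  then show ?thesis by measurable
 qed
 have "ennreal (gmom p) * (\<integral>\<^sup>+z. (\<integral>\<^sup>+w. \<Phi> z (sqrt (\<Sum>l\<in>{1..<?d}. (w l)^2)) \<partial>gauss {1..<?d}) \<partial>std_gauss)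
  = (\<integral>\<^sup>+z. ennreal (gmom p) * (\<integral>\<^sup>+w. \<Phi> z (sqrt (\<Sum>l\<in>{1..<?d}. (w l)^2)) \<partial>gauss {1..<?d}) \<partial>std_gauss)"
  by (rule nn_integral_cmult[OF zm, symmetric])
 also have "... \<le> (\<integral>\<^sup>+z. (\<integral>\<^sup>+c. ennreal (sqrt (s^2 + z^2 + c^2) ^ p) \<partial>std_gauss) * inv_power p (1 / s^2) \<partial>std_gauss)"
  by (rule nn_integral_mono) (rule in_le)
 also have "... = pair_int p s * inv_power p (1 / s^2)" unfolding pair_int_def
  by (rule nn_integral_multc) measurable
 finally show ?thesis unfolding eq \<Phi>_def .
qed

text \<open>\<open>gauss_radial_change_dim\<close> cancels the inverse power of the length of
  \<open>x\<close> and leaves that length in dimension two. Together with the two normal coordinates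
  inside \<open>pair_int\<close> this is a radial moment in dimension four.\<close>

lemma pair_outer:
 assumes p: "1 \<le> p"
 shows "ennreal (gmom (p + 1)) * (\<integral>\<^sup>+x. pair_int p (sqrt (\<Sum>l<p+2. (x l)^2)) * inv_power p (1 / (\<Sum>l<p+2. (x l)^2)) \<partial>gauss {..<p+2})
  \<le> ennreal (gmom 1) * (\<integral>\<^sup>+x. ennreal (sqrt (\<Sum>l<4::nat. (x l)^2) ^ p) \<partial>gauss {..<4::nat})"
proof -
 let ?d = "p + 2"
 define f where "f = (\<lambda>r. pair_int p r * inv_power p (1 / r^2))"
 have f [measurable]: "f \<in> borel_measurable borel" unfolding f_def inv_power_def by measurable
 have "(\<integral>\<^sup>+x. pair_int p (sqrt (\<Sum>l<?d. (x l)^2)) * inv_power p (1 / (\<Sum>l<?d. (x l)^2)) \<partial>gauss {..<?d})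
  = (\<integral>\<^sup>+x. f (sqrt (\<Sum>l\<in>{..<?d}. (x l)^2)) \<partial>gauss {..<?d})"
  unfolding f_def by (simp add: sum_nonneg)
 then have "ennreal (gmom (p + 1)) * (\<integral>\<^sup>+x. pair_int p (sqrt (\<Sum>l<?d. (x l)^2)) * inv_power p (1 / (\<Sum>l<?d. (x l)^2)) \<partial>gauss {..<?d})
  = ennreal (gmom 1) * (\<integral>\<^sup>+x. f (sqrt (\<Sum>i\<in>{..<2::nat}. (x i)^2)) * ennreal (sqrt (\<Sum>i\<in>{..<2}. (x i)^2) ^ p) \<partial>gauss {..<2})"
  using gauss_radial_change_dim[of "{..<?d}" p f] f by simp
 also have "... \<le> ennreal (gmom 1) * (\<integral>\<^sup>+x. pair_int p (sqrt (\<Sum>i\<in>{..<2::nat}. (x i)^2)) \<partial>gauss {..<2})"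
 proof (intro mult_left_mono nn_integral_mono)
  fix x :: "nat \<Rightarrow> real"
  define r where "r = sqrt (\<Sum>i<2. (x i)^2)"
  have r: "r \<ge> 0" unfolding r_def by (simp add: sum_nonneg)
  have "f r * ennreal (r ^ p) \<le> pair_int p r"
  proof (cases "r = 0")
   case True then show ?thesis using p by (simp add: zero_power)
  next
   case False
   have "inv_power p (1 / r^2) * ennreal (r ^ p) = ennreal (sqrt (1 / r^2) ^ p * r ^ p)"
    using False r by (simp add: inv_power_def ennreal_mult')
   also have "sqrt (1 / r^2) ^ p * r ^ p = 1" using False r by (simp add: real_sqrt_divide power_divide)
   finally show ?thesis unfolding f_def by (simp add: mult.assoc)
  qed
  then show "f (sqrt (\<Sum>i\<in>{..<2}. (x i)^2)) * ennreal (sqrt (\<Sum>i\<in>{..<2}. (x i)^2) ^ p) \<le> pair_int p (sqrt (\<Sum>i\<in>{..<2}. (x i)^2))"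
   unfolding r_def .
 qed simp
 also have "(\<integral>\<^sup>+x. pair_int p (sqrt (\<Sum>i\<in>{..<2::nat}. (x i)^2)) \<partial>gauss {..<2}) = (\<integral>\<^sup>+x. ennreal (sqrt (\<Sum>l<4::nat. (x l)^2) ^ p) \<partial>gauss {..<4::nat})"
 proof -
  have s4: "{..<4::nat} = {..<2} \<union> ({2} \<union> {3})" by auto
  define F where "F = (\<lambda>x :: nat \<Rightarrow> real. ennreal (sqrt (\<Sum>l<4::nat. (x l)^2) ^ p))"
  have Fm: "F \<in> borel_measurable (PiM ({..<2} \<union> ({2} \<union> {3})) (\<lambda>_. borel))" unfolding F_def s4[symmetric] by measurable
  have sum4: "(\<Sum>l<4::nat. (x l)^2) = x 0 ^ 2 + x 1 ^ 2 + x 2 ^ 2 + x 3 ^ 2" for x :: "nat \<Rightarrow> real"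
   by (simp add: eval_nat_numeral)
  have "(\<integral>\<^sup>+x. F x \<partial>gauss {..<4::nat}) = (\<integral>\<^sup>+x. (\<integral>\<^sup>+y. F (merge {..<2} ({2} \<union> {3}) (x, y)) \<partial>gauss ({2} \<union> {3})) \<partial>gauss {..<2})"
   unfolding s4 by (rule nn_integral_gauss_fold[OF _ _ _ Fm]) auto
  also have "... = (\<integral>\<^sup>+x. pair_int p (sqrt (\<Sum>i\<in>{..<2::nat}. (x i)^2)) \<partial>gauss {..<2})"
  proof (rule nn_integral_cong)
   fix x :: "nat \<Rightarrow> real"
   define s where "s = x 0 ^ 2 + x 1 ^ 2"
   define G where "G = (\<lambda>y :: nat \<Rightarrow> real. ennreal (sqrt (s + (y 2)^2 + (y 3)^2) ^ p))"
   have Gm: "G \<in> borel_measurable (PiM ({2} \<union> {3}) (\<lambda>_. borel))" unfolding G_def by measurable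
   have s: "s = (sqrt (\<Sum>i\<in>{..<2::nat}. (x i)^2))^2" by (simp add: s_def eval_nat_numeral)
   have "(\<integral>\<^sup>+y. F (merge {..<2} ({2} \<union> {3}) (x, y)) \<partial>gauss ({2} \<union> {3})) = (\<integral>\<^sup>+y. G y \<partial>gauss ({2} \<union> {3}))"
    unfolding F_def G_def sum4 s_def by (simp add: merge_def)
   also have "... = (\<integral>\<^sup>+y. (\<integral>\<^sup>+y'. G (merge {2} {3} (y, y')) \<partial>gauss {3::nat}) \<partial>gauss {2::nat})"
    by (rule nn_integral_gauss_fold[OF _ _ _ Gm]) auto
   also have "... = (\<integral>\<^sup>+y. (\<integral>\<^sup>+y'. ennreal (sqrt (s + (y 2)^2 + (y' 3)^2) ^ p) \<partial>gauss {3::nat}) \<partial>gauss {2::nat})"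
    unfolding G_def by (simp add: merge_def)
   also have "... = (\<integral>\<^sup>+y. (\<integral>\<^sup>+c. ennreal (sqrt (s + (y 2)^2 + c^2) ^ p) \<partial>std_gauss) \<partial>gauss {2::nat})"
    by (intro nn_integral_cong nn_integral_gauss_singleton) measurable
   also have "... = (\<integral>\<^sup>+z. (\<integral>\<^sup>+c. ennreal (sqrt (s + z^2 + c^2) ^ p) \<partial>std_gauss) \<partial>std_gauss)"
    by (rule nn_integral_gauss_singleton) measurable
   finally show "(\<integral>\<^sup>+y. F (merge {..<2} ({2} \<union> {3}) (x, y)) \<partial>gauss ({2} \<union> {3})) = pair_int p (sqrt (\<Sum>i\<in>{..<2::nat}. (x i)^2))"
    unfolding pair_int_def s .
  qed
  finally show ?thesis unfolding F_def by (rule sym)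
 qed
 finally show ?thesis .
qed

text \<open>The chain of radial formulas ends with
  \<open>gmom 1 * gmom (p + 3) / (gmom 3 * gmom (p + 1))\<close>, which the recursion reduces to
  \<open>(p + 2) / 2\<close>. This linear growth is the gain over single columns, for which the
  triangle inequality would give \<open>2 powr (p / 2)\<close>.\<close>

lemma pair_total:
 assumes p: "1 \<le> p"
 shows "ennreal (gmom p) * (\<integral>\<^sup>+x. (\<integral>\<^sup>+y. inv_power p (((\<Sum>l<p+2. (x l)^2) + (\<Sum>l<p+2. (y l)^2)) / ((\<Sum>l<p+2. (x l)^2) * (\<Sum>l<p+2. (y l)^2) - (\<Sum>l<p+2. x l * y l)^2)) \<partial>gauss {..<p+2}) \<partial>gauss {..<p+2})
  \<le> ennreal (real p / 2 + 1)"
proof -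
 let ?d = "p + 2"
 define J where "J = (\<lambda>x. \<integral>\<^sup>+y. inv_power p (((\<Sum>l<?d. (x l)^2) + (\<Sum>l<?d. (y l)^2)) / ((\<Sum>l<?d. (x l)^2) * (\<Sum>l<?d. (y l)^2) - (\<Sum>l<?d. x l * y l)^2)) \<partial>gauss {..<?d})"
 have Jm: "J \<in> borel_measurable (gauss {..<?d})"
 proof -
  have "(\<lambda>(x, y). inv_power p (((\<Sum>l<?d. (x l)^2) + (\<Sum>l<?d. (y l)^2)) / ((\<Sum>l<?d. (x l)^2) * (\<Sum>l<?d. (y l)^2) - (\<Sum>l<?d. x l * y l)^2))) \<in> borel_measurable (gauss {..<?d} \<Otimes>\<^sub>M gauss {..<?d})"
   unfolding inv_power_def by measurable
  then show ?thesis unfolding J_def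
   by (intro borel_measurable_nn_integral_gauss) (simp add: case_prod_beta')
 qed
 have J: "ennreal (gmom p) * J x \<le> pair_int p (sqrt (\<Sum>l<?d. (x l)^2)) * inv_power p (1 / (\<Sum>l<?d. (x l)^2))" for x
 proof (cases "(\<Sum>l<?d. (x l)^2) = 0")
  case True
  \<comment> \<open>For \<open>x = 0\<close> the right side has to be infinite, so
    \<open>pair_int p 0\<close> must not vanish.\<close>
  have "ennreal (gmom p) = (\<integral>\<^sup>+z. (\<integral>\<^sup>+c. ennreal (\<bar>c\<bar> ^ p) \<partial>std_gauss) \<partial>std_gauss)"
   using std_gauss.emeasure_space_1 by (simp add: nn_integral_gmom)
  also have "... \<le> pair_int p 0" unfolding pair_int_def
  proof (intro nn_integral_mono ennreal_leI power_mono)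
   fix z c :: real
   show "\<bar>c\<bar> \<le> sqrt (0^2 + z^2 + c^2)" using real_sqrt_le_mono[of "c^2" "z^2 + c^2"] by simp
  qed simp
  finally have "pair_int p 0 \<noteq> 0" using gmom_pos[of p] by auto
  then show ?thesis unfolding True by (simp add: inv_power_def ennreal_mult_top)
 next
  case False
  define s where "s = sqrt (\<Sum>l<?d. (x l)^2)"
  have n0: "(\<Sum>l<?d. (x l)^2) \<ge> 0" by (intro sum_nonneg) auto
  have s: "(\<Sum>l<?d. (x l)^2) = s^2" "s > 0" using n0 False by (auto simp: s_def)
  show ?thesis using pair_inner[OF p s] s(2) unfolding J_def s(1) by simp
 qed
 have g: "gmom 3 = 2 * gmom 1" "gmom (p + 3) = (real p + 2) * gmom (p + 1)"
  using gmom_Suc_Suc[of 1] gmom_Suc_Suc[of "p + 1"] by (simp_all add: eval_nat_numeral)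
 have "ennreal (gmom 3) * (ennreal (gmom (p + 1)) * (ennreal (gmom p) * (\<integral>\<^sup>+x. J x \<partial>gauss {..<?d})))
  = ennreal (gmom 3) * (ennreal (gmom (p + 1)) * (\<integral>\<^sup>+x. ennreal (gmom p) * J x \<partial>gauss {..<?d}))"
  using nn_integral_cmult[OF Jm] by simp
 also have "... \<le> ennreal (gmom 3) * (ennreal (gmom (p + 1)) * (\<integral>\<^sup>+x. pair_int p (sqrt (\<Sum>l<p+2. (x l)^2)) * inv_power p (1 / (\<Sum>l<p+2. (x l)^2)) \<partial>gauss {..<p+2}))"
  by (intro mult_left_mono nn_integral_mono J) auto
 also have "... \<le> ennreal (gmom 3) * (ennreal (gmom 1) * (\<integral>\<^sup>+x. ennreal (sqrt (\<Sum>l<4::nat. (x l)^2) ^ p) \<partial>gauss {..<4::nat}))"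
  by (intro mult_left_mono pair_outer[OF p]) auto
 also have "... = ennreal (gmom 1) * (ennreal (gmom 3) * (\<integral>\<^sup>+x. ennreal (sqrt (\<Sum>l\<in>{..<4::nat}. (x l)^2) ^ p) \<partial>gauss {..<4::nat}))"
  by (rule mult.left_commute)
 also have "ennreal (gmom 3) * (\<integral>\<^sup>+x. ennreal (sqrt (\<Sum>l\<in>{..<4::nat}. (x l)^2) ^ p) \<partial>gauss {..<4::nat})
  = (\<integral>\<^sup>+z. ennreal (\<bar>z\<bar> ^ p) * ennreal (\<bar>z\<bar> ^ 3) \<partial>std_gauss)"
  using nn_integral_gauss_radial[of "{..<4::nat}" "\<lambda>r. ennreal (r ^ p)"] by (auto simp: lessThan_empty_iff)
 also have "... = (\<integral>\<^sup>+z. ennreal (\<bar>z\<bar> ^ (p + 3)) \<partial>std_gauss)"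
  by (intro nn_integral_cong) (simp add: power_add ennreal_mult')
 also have "... = ennreal (gmom (p + 3))" by (rule nn_integral_gmom)
 finally have le: "ennreal (gmom 3) * (ennreal (gmom (p + 1)) * (ennreal (gmom p) * (\<integral>\<^sup>+x. J x \<partial>gauss {..<?d})))
  \<le> ennreal (gmom 1) * ennreal (gmom (p + 3))" .
 have pos: "0 < gmom 3 * gmom (p + 1)" using gmom_pos by simp
 have "ennreal (gmom 3 * gmom (p + 1)) * (ennreal (gmom p) * (\<integral>\<^sup>+x. J x \<partial>gauss {..<?d}))
   = ennreal (gmom 3) * (ennreal (gmom (p + 1)) * (ennreal (gmom p) * (\<integral>\<^sup>+x. J x \<partial>gauss {..<?d})))"
  using gmom_pos[of 3] by (simp add: ennreal_mult' mult.assoc)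
 moreover have "ennreal (gmom 1) * ennreal (gmom (p + 3)) = ennreal (gmom 3 * gmom (p + 1)) * ennreal (real p / 2 + 1)"
 proof -
  have "gmom 1 * gmom (p + 3) = gmom 3 * gmom (p + 1) * (real p / 2 + 1)" unfolding g by (simp add: algebra_simps)
  then show ?thesis
   by (simp only: ennreal_mult'[OF less_imp_le[OF gmom_pos], symmetric] ennreal_mult'[OF less_imp_le[OF pos], symmetric])
 qed
 ultimately have "ennreal (gmom 3 * gmom (p + 1)) * (ennreal (gmom p) * (\<integral>\<^sup>+x. J x \<partial>gauss {..<?d})) \<le> ennreal (gmom 3 * gmom (p + 1)) * ennreal (real p / 2 + 1)"
  using le by simp
 then have "ennreal (gmom p) * (\<integral>\<^sup>+x. J x \<partial>gauss {..<?d}) \<le> ennreal (real p / 2 + 1)"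
  by (rule ennreal_mult_left_cancel_le[OF pos])
 then show ?thesis unfolding J_def .
qed

text \<open>Conditionally on the other \<open>k - 2\<close> rows, the components of rows
  \<open>i\<close> and \<open>j\<close> in \<open>p + 2\<close> free directions are independent
  Gaussian vectors. The two bounds of \<open>rinv_pair_column\<close> add up to the trace of the
  inverse of their Gram matrix, which is the argument of \<open>inv_power\<close> in
  \<open>pair_total\<close>.\<close>

lemma nn_integral_rinv_pair:
 assumes ij: "i < k" "j < k" "i \<noteq> j" and p: "1 \<le> p" and m: "m = k + p"
 shows "ennreal (gmom p) * (\<integral>\<^sup>+g. full_rk k m g
   * ennreal (sqrt (sqn (rinv k m g *\<^sub>v unit_vec k i) + sqn (rinv k m g *\<^sub>v unit_vec k j)) ^ p) \<partial>gaussm k m)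
  \<le> ennreal (real p / 2 + 1)"
proof -
 let ?K = "{0..<k}" and ?C = "{0..<m}"
 let ?I = "?K \<times> ?C" and ?A = "{i, j}"
 let ?B = "?K - ?A" and ?d = "p + 2"
 define F where "F = (\<lambda>g. full_rk k m g
  * ennreal (sqrt (sqn (rinv k m g *\<^sub>v unit_vec k i) + sqn (rinv k m g *\<^sub>v unit_vec k j)) ^ p))"
 have Fm: "F \<in> borel_measurable (PiM ?I (\<lambda>_. borel))"
 proof -
  have "(\<lambda>g. sqn (rinv k m g *\<^sub>v unit_vec k i)) \<in> borel_measurable (PiM ?I (\<lambda>_. borel))"
   "(\<lambda>g. sqn (rinv k m g *\<^sub>v unit_vec k j)) \<in> borel_measurable (PiM ?I (\<lambda>_. borel))"
   by (rule borel_measurable_sqn_rinv, simp)+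
  then show ?thesis unfolding F_def using borel_measurable_gram_indicator[of k m] by measurable
 qed
 define H where "H = (\<lambda>x y. inv_power p (((\<Sum>l<?d. (x l)^2) + (\<Sum>l<?d. (y l)^2)) / ((\<Sum>l<?d. (x l)^2) * (\<Sum>l<?d. (y l)^2) - (\<Sum>l<?d. x l * y l)^2)))"
 define J where "J = (\<integral>\<^sup>+x. (\<integral>\<^sup>+y. H x y \<partial>gauss {..<?d}) \<partial>gauss {..<?d})"
 have "(\<integral>\<^sup>+g. F g \<partial>gauss ?I) \<le> J"
 proof (rule nn_integral_gauss_rows_le[of ?K ?C ?A, OF _ _ _ Fm])
  fix x :: "nat \<times> nat \<Rightarrow> real"
  have "card ?B + ?d \<le> m" using ij m by (simp add: card_Diff_subset)
  then obtain w where w: "orthonormal_family m ?d w" "\<And>r l. r \<in> ?B \<Longrightarrow> l < ?d \<Longrightarrow> (\<Sum>c<m. x (r, c) * w l $ c) = 0"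
   using orthonormal_to_rows[of ?B ?d m x] by blast
  define \<gamma> where "\<gamma> = (\<lambda>(r::nat) y. \<lambda>l\<in>{..<?d}. \<Sum>c<m. w l $ c * y (r, c) :: real)"
  have le: "F (merge (?B \<times> ?C) (?A \<times> ?C) (x, merge ({i} \<times> ?C) ({j} \<times> ?C) (y, y'))) \<le> H (\<gamma> i y) (\<gamma> j y')" for y y'
  proof -
   let ?g = "merge (?B \<times> ?C) (?A \<times> ?C) (x, merge ({i} \<times> ?C) ({j} \<times> ?C) (y, y'))"
   define S T D where "S = (\<Sum>l<?d. (\<gamma> i y l)^2)" and "T = (\<Sum>l<?d. (\<gamma> j y' l)^2)" and "D = (\<Sum>l<?d. \<gamma> i y l * \<gamma> j y' l)"
   have cs: "S * T - D^2 \<ge> 0"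
    using Cauchy_Schwarz_ineq_sum[of "\<gamma> i y" "\<gamma> j y'" "{..<?d}"] by (simp add: S_def T_def D_def)
   have ST: "S \<ge> 0" "T \<ge> 0" unfolding S_def T_def by (intro sum_nonneg; simp)+
   have Hd: "H (\<gamma> i y) (\<gamma> j y') = inv_power p ((S + T) / (S * T - D^2))"
    unfolding H_def S_def T_def D_def ..
   consider "S * T - D^2 = 0" | "gram_det (to_mat k m ?g) = 0" | "S * T - D^2 > 0" "gram_det (to_mat k m ?g) \<noteq> 0" using cs by fastforce
   then show ?thesis
   proof cases
    case 1
    then show ?thesis unfolding Hd by (simp add: inv_power_def)
   next
    case 2
    then show ?thesis by (simp add: F_def)
   next
    case 3
    have gi: "(\<Sum>c<m. ?g (i, c) * w l $ c) = \<gamma> i y l" if "l < ?d" for l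
    proof -
     have "(\<Sum>c<m. ?g (i, c) * w l $ c) = (\<Sum>c<m. w l $ c * y (i, c))"
      by (intro sum.cong) (auto simp: merge_def)
     then show ?thesis using that by (simp add: \<gamma>_def)
    qed
    have gj: "(\<Sum>c<m. ?g (j, c) * w l $ c) = \<gamma> j y' l" if "l < ?d" for l
    proof -
     have "(\<Sum>c<m. ?g (j, c) * w l $ c) = (\<Sum>c<m. w l $ c * y' (j, c))"
      using ij(3) by (intro sum.cong) (auto simp: merge_def)
     then show ?thesis using that by (simp add: \<gamma>_def)
    qed
    have gr: "(\<Sum>c<m. ?g (r, c) * w l $ c) = 0" if "r < k" "r \<noteq> i" "r \<noteq> j" "l < ?d" for r l
    proof -
     have "(\<Sum>c<m. ?g (r, c) * w l $ c) = (\<Sum>c<m. x (r, c) * w l $ c)"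
      using that by (intro sum.cong) (auto simp: merge_def)
     then show ?thesis using w(2)[of r l] that by simp
    qed
    have "sqn (rinv k m ?g *\<^sub>v unit_vec k i) \<le> T / (S * T - D^2)"
     unfolding S_def T_def D_def
     by (rule rinv_pair_column[OF w(1) ij gi gj gr 3(2)]) (use 3(1) in \<open>auto simp only: S_def T_def D_def\<close>)
    moreover have "sqn (rinv k m ?g *\<^sub>v unit_vec k j) \<le> S / (T * S - (\<Sum>l<?d. \<gamma> j y' l * \<gamma> i y l)^2)"
     unfolding S_def T_def
     by (rule rinv_pair_column[OF w(1) ij(2,1) ij(3)[symmetric] gj gi gr 3(2)])
      (use 3(1) in \<open>auto simp only: S_def T_def D_def mult.commute\<close>)
    moreover have "T * S - (\<Sum>l<?d. \<gamma> j y' l * \<gamma> i y l)^2 = S * T - D^2" by (simp only: D_def mult.commute)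
    ultimately have s: "sqn (rinv k m ?g *\<^sub>v unit_vec k i) + sqn (rinv k m ?g *\<^sub>v unit_vec k j) \<le> (S + T) / (S * T - D^2)"
     by (simp only: add_divide_distrib)
    have "S + T \<noteq> 0" using ST 3(1) by (auto simp: add_nonneg_eq_0_iff)
    then have "(S + T) / (S * T - D^2) > 0" using ST 3(1) by simp
    then have "H (\<gamma> i y) (\<gamma> j y') = ennreal (sqrt ((S + T) / (S * T - D^2)) ^ p)" unfolding Hd inv_power_def by simp
    moreover have "sqrt (sqn (rinv k m ?g *\<^sub>v unit_vec k i) + sqn (rinv k m ?g *\<^sub>v unit_vec k j)) ^ p \<le> sqrt ((S + T) / (S * T - D^2)) ^ p"
     using s by (intro power_mono real_sqrt_le_mono) (auto simp: sqn_nonneg)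
    ultimately show ?thesis unfolding F_def using 3 by (auto intro: ennreal_leI)
   qed
  qed
  define G where "G = (\<lambda>y. F (merge (?B \<times> ?C) (?A \<times> ?C) (x, y)))"
  have AC: "?A \<times> ?C = ({i} \<times> ?C) \<union> ({j} \<times> ?C)" by auto
  have KC: "?K \<times> ?C = ?B \<times> ?C \<union> ?A \<times> ?C" using ij by auto
  have Gm: "G \<in> borel_measurable (PiM (({i} \<times> ?C) \<union> ({j} \<times> ?C)) (\<lambda>_. borel))"
  proof -
   have "(\<lambda>y. merge (?B \<times> ?C) (?A \<times> ?C) (x, y)) \<in> measurable (PiM (?A \<times> ?C) (\<lambda>_. borel)) (PiM (?K \<times> ?C) (\<lambda>_. borel))"
   proof (rule measurable_PiM_single')
    fix q assume "q \<in> ?K \<times> ?C"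
    then show "(\<lambda>y. merge (?B \<times> ?C) (?A \<times> ?C) (x, y) q) \<in> borel_measurable (PiM (?A \<times> ?C) (\<lambda>_. borel))"
     unfolding KC by (cases "q \<in> ?B \<times> ?C") (auto simp: merge_def)
   next
    show "(\<lambda>y q. merge (?B \<times> ?C) (?A \<times> ?C) (x, y) q) \<in> space (PiM (?A \<times> ?C) (\<lambda>_. borel)) \<rightarrow> (\<Pi>\<^sub>E q\<in>?K \<times> ?C. space borel)"
     unfolding KC by (auto simp: space_PiM merge_def PiE_def extensional_def)
   qed
   then show ?thesis unfolding G_def AC[symmetric] by (rule measurable_compose[OF _ Fm])
  qed
  have Hm: "(\<lambda>z. H (fst z) (snd z)) \<in> borel_measurable (gauss {..<?d} \<Otimes>\<^sub>M gauss {..<?d})"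
   unfolding H_def inv_power_def by measurable
  have Hm2: "H z \<in> borel_measurable (PiM {..<?d} (\<lambda>_. borel))" for z
   unfolding H_def inv_power_def by measurable
  have Hm1: "(\<lambda>z. \<integral>\<^sup>+z'. H z z' \<partial>gauss {..<?d}) \<in> borel_measurable (PiM {..<?d} (\<lambda>_. borel))"
  proof -
   have "(\<lambda>z. \<integral>\<^sup>+z'. H z z' \<partial>gauss {..<?d}) \<in> borel_measurable (gauss {..<?d})"
    using Hm by (intro borel_measurable_nn_integral_gauss) (simp add: case_prod_beta')
   then show ?thesis by (simp add: sets_gauss cong: measurable_cong_sets)
  qed
  have "(\<integral>\<^sup>+y. F (merge (?B \<times> ?C) (?A \<times> ?C) (x, y)) \<partial>gauss (?A \<times> ?C)) = (\<integral>\<^sup>+y. G y \<partial>gauss (({i} \<times> ?C) \<union> ({j} \<times> ?C)))"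
   unfolding G_def AC ..
  also have "... = (\<integral>\<^sup>+y. (\<integral>\<^sup>+y'. G (merge ({i} \<times> ?C) ({j} \<times> ?C) (y, y')) \<partial>gauss ({j} \<times> ?C)) \<partial>gauss ({i} \<times> ?C))"
   by (rule nn_integral_gauss_fold[OF _ _ _ Gm]) (use ij in auto)
  also have "... \<le> (\<integral>\<^sup>+y. (\<integral>\<^sup>+y'. H (\<gamma> i y) (\<gamma> j y') \<partial>gauss ({j} \<times> ?C)) \<partial>gauss ({i} \<times> ?C))"
   unfolding G_def by (intro nn_integral_mono le)
  also have "... = (\<integral>\<^sup>+y. (\<integral>\<^sup>+z'. H (\<gamma> i y) z' \<partial>gauss {..<?d}) \<partial>gauss ({i} \<times> ?C))"
   unfolding \<gamma>_def by (intro nn_integral_cong nn_integral_row_pushforward[OF w(1) Hm2])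
  also have "... = J"
   unfolding \<gamma>_def J_def by (rule nn_integral_row_pushforward[OF w(1) Hm1])
  finally show "(\<integral>\<^sup>+y. F (merge (?B \<times> ?C) (?A \<times> ?C) (x, y)) \<partial>gauss (?A \<times> ?C)) \<le> J" .
 qed (use ij in auto)
 then have "ennreal (gmom p) * (\<integral>\<^sup>+g. F g \<partial>gauss ?I) \<le> ennreal (gmom p) * J" by (rule mult_left_mono) simp
 also have "... \<le> ennreal (real p / 2 + 1)" unfolding J_def H_def by (rule pair_total[OF p])
 finally show ?thesis unfolding F_def .
qed

section \<open>Moment of the Frobenius norm of the right inverse\<close>

lemma sum_power_mean:
 fixes t :: "nat \<Rightarrow> real"
 assumes k: "0 < k" and t: "\<And>i. i < k \<Longrightarrow> 0 < t i" and q: "1 \<le> q"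
 shows "(\<Sum>i<k. t i) powr q \<le> real k powr (q - 1) * (\<Sum>i<k. t i powr q)"
proof -
 have "(\<Sum>i<k. (1 / real k) *\<^sub>R t i) powr q \<le> (\<Sum>i<k. (1 / real k) * t i powr q)"
  using k t by (intro convex_on_sum[OF _ _ powr_convex[OF q]]) auto
 also have "(\<Sum>i<k. (1 / real k) *\<^sub>R t i) = (\<Sum>i<k. t i) / real k" by (simp add: sum_divide_distrib)
 also have "((\<Sum>i<k. t i) / real k) powr q = (\<Sum>i<k. t i) powr q / real k powr q"
  by (rule powr_divide)
 also have "(\<Sum>i<k. (1 / real k) * t i powr q) = (\<Sum>i<k. t i powr q) / real k" by (simp add: sum_divide_distrib)
 finally have "(\<Sum>i<k. t i) powr q \<le> real k powr q * ((\<Sum>i<k. t i powr q) / real k)"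
  using k by (simp add: field_simps)
 also have "... = real k powr (q - 1) * (\<Sum>i<k. t i powr q)" using k by (simp add: powr_diff)
 finally show ?thesis .
qed

lemma frob2_columns:
 assumes N: "N \<in> carrier_mat m k"
 shows "frob2 N = (\<Sum>i<k. sqn (N *\<^sub>v unit_vec k i))"
proof -
 have "sqn (N *\<^sub>v unit_vec k i) = (\<Sum>c<m. (N $$ (c, i))^2)" if i: "i < k" for i
 proof -
  have c: "N *\<^sub>v unit_vec k i \<in> carrier_vec m" using N by (rule mult_mat_vec_carrier) simp
  have "(N *\<^sub>v unit_vec k i) $ c = N $$ (c, i)" if "c < m" for c
  proof -
   have "(N *\<^sub>v unit_vec k i) $ c = (\<Sum>j<k. N $$ (c, j) * (if j = i then 1 else 0))"
    using that i by (subst mult_mat_vec_entry[OF N]) (auto intro!: sum.cong)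
   then show ?thesis using i by (simp add: if_distrib cong: if_cong)
  qed
  then show ?thesis unfolding sqn_def ip_sum[OF c c] by (simp add: power2_eq_square)
 qed
 then have "(\<Sum>i<k. sqn (N *\<^sub>v unit_vec k i)) = (\<Sum>i<k. \<Sum>c<m. (N $$ (c, i))^2)" by simp
 also have "... = frob2 N" unfolding frob2_def using N by (subst sum.swap) auto
 finally show ?thesis ..
qed

text \<open>A column of a right inverse cannot vanish. Strict positivity is what the convexity of
  \<open>powr\<close> in \<open>sum_power_mean\<close> asks for.\<close>

lemma sqn_rinv_unit_pos:
 assumes i: "i < k" and det: "gdet k m g \<noteq> 0"
 shows "0 < sqn (rinv k m g *\<^sub>v unit_vec k i)"
proof (rule ccontr)
 have c: "rinv k m g *\<^sub>v unit_vec k i \<in> carrier_vec m" by (rule mult_mat_vec_carrier[OF rinv_carrier]) simp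
 assume "\<not> 0 < sqn (rinv k m g *\<^sub>v unit_vec k i)"
 then have z: "rinv k m g *\<^sub>v unit_vec k i = 0\<^sub>v m" using ip_self_pos[OF c] unfolding sqn_def by blast
 have "unit_vec k i = (to_mat k m g * rinv k m g) *\<^sub>v unit_vec k i"
  unfolding right_inv[OF to_mat_carrier det] by simp
 also have "... = to_mat k m g *\<^sub>v (rinv k m g *\<^sub>v unit_vec k i)"
  by (rule assoc_mult_mat_vec[OF to_mat_carrier rinv_carrier]) simp
 also have "... = 0\<^sub>v k" unfolding z by (rule eq_vecI) auto
 finally have "unit_vec k i $ i = (0\<^sub>v k :: real vec) $ i" by simp
 then show False using i by simp
qed

text \<open>Averaging over cyclically adjacent pairs of columns gains a factor \<open>2\<close> over single columns.\<close>
lemma nn_integral_frob2_rinv: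
 assumes k: "2 \<le> k" and p: "2 \<le> p" and m: "m = k + p"
 shows "ennreal (gmom p) * (\<integral>\<^sup>+g. full_rk k m g
   * ennreal (frob2 (rinv k m g) powr (real p / 2)) \<partial>gaussm k m)
  \<le> ennreal ((real k / 2) powr (real p / 2) * (real p / 2 + 1))"
proof -
 let ?I = "{0..<k} \<times> {0..<m}" and ?q = "real p / 2"
 define \<chi> where "\<chi> = (\<lambda>g. full_rk k m g)"
 define s where "s = (\<lambda>i g. sqn (rinv k m g *\<^sub>v unit_vec k i))"
 \<comment> \<open>The cyclic successor; \<open>2 <= k\<close> ensures that the two columns of a
   pair are distinct. Counted over all pairs every column occurs twice, which gives the factor
   \<open>2\<close> in \<open>fr\<close>.\<close>
 define c where "c = (\<lambda>i. Suc i mod k)"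
 have c: "c i < k" "i < k \<Longrightarrow> c i \<noteq> i" for i
  using k mod_less_divisor[of k "Suc i"] by (simp_all add: c_def) (auto simp: mod_Suc)
 have bij: "bij_betw c {..<k} {..<k}"
 proof (rule bij_betwI[of _ _ _ "\<lambda>i. (i + k - 1) mod k"])
  show "(c i + k - 1) mod k = i" if "i \<in> {..<k}" for i using that k by (auto simp: c_def mod_Suc)
  show "c ((i + k - 1) mod k) = i" if "i \<in> {..<k}" for i
   using that k by (cases "i = 0") (auto simp: c_def mod_Suc mod_if)
 qed (use k in \<open>auto simp: c_def\<close>)
 have s0: "s i g \<ge> 0" for i g unfolding s_def by (rule sqn_nonneg)
 have fr: "2 * frob2 (rinv k m g) = (\<Sum>i<k. s i g + s (c i) g)" for g
 proof -
  have "(\<Sum>i<k. s (c i) g) = (\<Sum>i<k. s i g)" by (rule sum.reindex_bij_betw[OF bij])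
  then show ?thesis unfolding frob2_columns[OF rinv_carrier] s_def by (simp add: sum.distrib)
 qed
 have sm: "(\<lambda>g. s i g) \<in> borel_measurable (PiM ?I (\<lambda>_. borel))" for i
  unfolding s_def by (rule borel_measurable_sqn_rinv) simp
 have \<chi>m: "\<chi> \<in> borel_measurable (PiM ?I (\<lambda>_. borel))"
  unfolding \<chi>_def by (rule borel_measurable_gram_indicator)
 have tm: "(\<lambda>g. \<chi> g * ennreal (sqrt (s i g + s j g) ^ p)) \<in> borel_measurable (gauss ?I)" for i j
  using sm[of i] sm[of j] \<chi>m by (simp add: sets_gauss cong: measurable_cong_sets)
 \<comment> \<open>\<open>2 powr ?q\<close> undoes the double counting;
   \<open>real k powr (?q - 1)\<close> comes from the power mean over \<open>k\<close>
   pairs.\<close>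
 define C where "C = real k powr (?q - 1) / 2 powr ?q"
 have C: "C \<ge> 0" by (simp add: C_def)
 have pt: "\<chi> g * ennreal (frob2 (rinv k m g) powr ?q) \<le> ennreal C * (\<Sum>i<k. \<chi> g * ennreal (sqrt (s i g + s (c i) g) ^ p))" for g
 proof (cases "gdet k m g = 0")
  case True then show ?thesis by (simp add: \<chi>_def)
 next
  case False
  have pos: "s i g > 0" if "i < k" for i unfolding s_def by (rule sqn_rinv_unit_pos[OF that False])
  have "2 powr ?q * frob2 (rinv k m g) powr ?q = (2 * frob2 (rinv k m g)) powr ?q"
   by (simp add: powr_mult frob2_nonneg)
  also have "... \<le> real k powr (?q - 1) * (\<Sum>i<k. (s i g + s (c i) g) powr ?q)"
   unfolding fr using k p pos c by (intro sum_power_mean) (auto intro!: add_pos_pos)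
  also have "(\<Sum>i<k. (s i g + s (c i) g) powr ?q) = (\<Sum>i<k. sqrt (s i g + s (c i) g) ^ p)"
  proof (intro sum.cong refl)
   fix i assume "i \<in> {..<k}"
   then have "s i g + s (c i) g > 0" using pos[of i] s0[of "c i" g] by auto
   then show "(s i g + s (c i) g) powr ?q = sqrt (s i g + s (c i) g) ^ p"
    by (simp add: powr_half_sqrt[symmetric] powr_powr flip: powr_realpow)
  qed
  finally have "frob2 (rinv k m g) powr ?q \<le> C * (\<Sum>i<k. sqrt (s i g + s (c i) g) ^ p)"
   by (simp add: C_def field_simps)
  then have "ennreal (frob2 (rinv k m g) powr ?q) \<le> ennreal (C * (\<Sum>i<k. sqrt (s i g + s (c i) g) ^ p))"
   by (rule ennreal_leI)
  also have "... = ennreal C * (\<Sum>i<k. ennreal (sqrt (s i g + s (c i) g) ^ p))"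
   using s0 by (simp add: ennreal_mult'[OF C] sum_ennreal)
  finally show ?thesis using False by (simp add: \<chi>_def)
 qed
 have "(\<integral>\<^sup>+g. \<chi> g * ennreal (frob2 (rinv k m g) powr ?q) \<partial>gauss ?I)
  \<le> (\<integral>\<^sup>+g. ennreal C * (\<Sum>i<k. \<chi> g * ennreal (sqrt (s i g + s (c i) g) ^ p)) \<partial>gauss ?I)"
  by (rule nn_integral_mono) (rule pt)
 also have "... = ennreal C * (\<integral>\<^sup>+g. (\<Sum>i<k. \<chi> g * ennreal (sqrt (s i g + s (c i) g) ^ p)) \<partial>gauss ?I)"
  using tm by (intro nn_integral_cmult borel_measurable_sum)
 also have "(\<integral>\<^sup>+g. (\<Sum>i<k. \<chi> g * ennreal (sqrt (s i g + s (c i) g) ^ p)) \<partial>gauss ?I)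
  = (\<Sum>i<k. \<integral>\<^sup>+g. \<chi> g * ennreal (sqrt (s i g + s (c i) g) ^ p) \<partial>gauss ?I)"
  using tm by (rule nn_integral_sum)
 finally have "ennreal (gmom p) * (\<integral>\<^sup>+g. \<chi> g * ennreal (frob2 (rinv k m g) powr ?q) \<partial>gauss ?I)
  \<le> ennreal (gmom p) * (ennreal C * (\<Sum>i<k. \<integral>\<^sup>+g. \<chi> g * ennreal (sqrt (s i g + s (c i) g) ^ p) \<partial>gauss ?I))"
  by (rule mult_left_mono) simp
 also have "... = ennreal C * (\<Sum>i<k. ennreal (gmom p) * (\<integral>\<^sup>+g. \<chi> g * ennreal (sqrt (s i g + s (c i) g) ^ p) \<partial>gauss ?I))"
  unfolding sum_distrib_left[symmetric] by (rule mult.left_commute)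
 also have "... \<le> ennreal C * (\<Sum>i<k. ennreal (?q + 1))"
 proof (intro mult_left_mono sum_mono)
  fix i assume "i \<in> {..<k}"
  then show "ennreal (gmom p) * (\<integral>\<^sup>+g. \<chi> g * ennreal (sqrt (s i g + s (c i) g) ^ p) \<partial>gauss ?I) \<le> ennreal (?q + 1)"
   unfolding \<chi>_def s_def using c[of i] p m by (intro nn_integral_rinv_pair) auto
 qed simp
 also have "(\<Sum>i<k. ennreal (?q + 1)) = ennreal (real k * (?q + 1))" by (subst sum_ennreal) auto
 also have "ennreal C * ennreal (real k * (?q + 1)) = ennreal (C * (real k * (?q + 1)))" by (rule ennreal_mult'[OF C, symmetric])
 also have "C * (real k * (?q + 1)) = (real k / 2) powr ?q * (?q + 1)"
  using k by (simp add: C_def powr_divide powr_diff)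
 finally show ?thesis unfolding \<chi>_def .
qed

section \<open>Tail bounds\<close>

lemma sqrt_power_powr:
 assumes "0 \<le> x" "0 < \<nu>"
 shows "sqrt x ^ \<nu> = x powr (real \<nu> / 2)"
proof (cases "x = 0")
 case True then show ?thesis using assms by (simp add: zero_power)
next
 case False then show ?thesis using assms by (simp add: powr_half_sqrt[symmetric] powr_powr flip: powr_realpow)
qed

lemma square_powr_half:
 assumes "0 \<le> x" "0 < p"
 shows "(x^2) powr (real p / 2) = x ^ p"
 using sqrt_power_powr[of "x^2" p] assms by simp

lemma e_bounds: "27182 / 10000 < exp (1::real)" "exp (1::real) < 27183 / 10000"
proof -
 have "inverse (2 ^ 32) = (1 / 4294967296 :: real)" by simp
 then have "\<bar>exp 1 - 5837465777 / 2147483648\<bar> \<le> (1 / 4294967296 :: real)" using e_approx_32 by (simp only:)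
 then show "27182 / 10000 < exp (1::real)" "exp (1::real) < 27183 / 10000" by linarith+
qed

text \<open>Machin's formula with \<open>arctan x <= x\<close> and the second arctangent
  dropped.\<close>

lemma pi_le_16_5: "pi \<le> 16 / 5"
proof -
 have "arctan (1 / 5) \<le> 1 / 5" by (rule arctan_le_self) simp
 moreover have "0 \<le> arctan (1 / 239)" by simp
 ultimately show ?thesis using machin by linarith
qed

text \<open>The right side is the old lower bound times the factor by which \<open>gmom\<close>
  grows from \<open>x\<close> to \<open>x + 2\<close>. Taking logarithms at \<open>q = x / 2\<close>
  leaves \<open>entropy_tangent_bound\<close>.\<close>

lemma gmom_lower_step:
 fixes x :: real
 assumes x: "x > 0"
 shows "((x + 2) / exp 1) powr ((x + 2) / 2) \<le> (x + 1) * (x / exp 1) powr (x / 2)"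
proof -
 define q where "q = x / 2"
 have q: "q > 0" "x = 2 * q" using x by (auto simp: q_def)
 have l: "ln (y / exp 1) = ln y - 1" if "y > 0" for y :: real using that by (simp add: ln_div)
 have "((x + 2) / exp 1) powr ((x + 2) / 2) = exp ((q + 1) * (ln (2 * (1 + q)) - 1))"
 proof -
  have "(x + 2) / 2 = q + 1" "x + 2 = 2 * (1 + q)" using q by auto
  then show ?thesis using q(1) by (simp only: powr_def l) (simp add: add_pos_pos)
 qed
 also have "... \<le> exp (ln (2 * (q + 1/2)) + q * (ln (2 * q) - 1))"
 proof -
  have lm: "ln (2 * y) = ln 2 + ln y" if "y > 0" for y :: real using that by (rule ln_mult_pos[rotated]) simp
  have "(q + 1) * (ln (2 * (1 + q)) - 1) = (1 + q) * ln (1 + q) + (q + 1) * ln 2 - (q + 1)"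
   using lm[of "1 + q"] q by (simp only:) (simp add: algebra_simps)
  also have "... \<le> q * ln q + 1 + ln (q + 1/2) + (q + 1) * ln 2 - (q + 1)"
   using entropy_tangent_bound[OF q(1)] by linarith
  also have "... = ln (2 * (q + 1/2)) + q * (ln (2 * q) - 1)"
  proof -
   have "ln (2 * (q + 1/2)) = ln 2 + ln (q + 1/2)" by (rule lm) (use q in simp)
   moreover have "ln (2 * q) = ln 2 + ln q" by (rule lm[OF q(1)])
   ultimately show ?thesis by (simp only:) (simp add: algebra_simps)
  qed
  finally show ?thesis by simp
 qed
 also have "... = (x + 1) * (x / exp 1) powr (x / 2)"
  using q by (simp add: exp_add powr_def l)
 finally show ?thesis .
qed

text \<open>The quotient of \<open>gmom p\<close> by the power on the left is nondecreasing in steps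
  of two and tends to \<open>sqrt 2\<close>; its smallest value, about \<open>1.385\<close> at
  \<open>p = 4\<close>, leaves room for \<open>27 / 20\<close>.\<close>

lemma gmom_lower:
 assumes "4 \<le> p"
 shows "27 / 20 * (real p / exp 1) powr (real p / 2) \<le> gmom p"
 using assms
proof (induction p rule: less_induct)
 case (less p)
 consider "p = 4" | "p = 5" | "p \<ge> 6" using less.prems by linarith
 then show ?case
 proof cases
  case 1
  have g: "gmom 4 = 3" by (simp add: gmom_def fact_numeral)
  have "(4 / exp 1) powr 2 = (16::real) / (exp 1)^2" by (simp add: power_divide)
  moreover have "(exp (1::real))^2 \<ge> (27182/10000)^2" using e_bounds by (intro power_mono) auto
  ultimately show ?thesis using 1 g by (simp add: field_simps)
 next
  case 2
  have g: "gmom 5 = 8 * sqrt (2 / pi)" by (simp add: gmom_def fact_numeral)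
  have "sqrt (5 / 8) \<le> sqrt (2 / pi)" using pi_le_16_5 pi_gt_zero by (intro real_sqrt_le_mono) (simp add: field_simps)
  moreover have "27 / 20 * (5 / exp 1) powr (5 / 2) \<le> 8 * sqrt (5 / 8 :: real)"
  proof -
   define y where "y = (5 / exp 1) powr (5 / 2 :: real)"
   have "y^2 = (5 / exp 1) powr 5" unfolding y_def power2_eq_square powr_add[symmetric] by simp
   also have "... = (5 / exp 1) ^ 5" by (simp add: powr_numeral)
   also have "... \<le> (5 / (27182/10000)) ^ 5"
    using e_bounds by (intro power_mono divide_left_mono) auto
   also have "... \<le> 21.1" by (simp add: power_divide)
   finally have y: "y^2 \<le> 21.1" .
   have "27 / 20 * y \<le> sqrt 40"
   proof (rule real_le_rsqrt)
    show "(27 / 20 * y)^2 \<le> 40" using y unfolding power_mult_distrib by (simp add: power2_eq_square)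
   qed
   moreover have "sqrt 40 = 8 * sqrt (5 / 8)" by (rule real_sqrt_unique) (simp_all add: power_mult_distrib)
   ultimately show ?thesis unfolding y_def by simp
  qed
  ultimately have "27 / 20 * (5 / exp 1) powr (5 / 2) \<le> 8 * sqrt (2 / pi)" by linarith
  then show ?thesis unfolding 2 g by simp
 next
  case 3
  define r where "r = p - 2"
  have r: "r < p" "4 \<le> r" "p = r + 2" using 3 by (auto simp: r_def)
  have "27 / 20 * (real p / exp 1) powr (real p / 2) \<le> 27 / 20 * ((real r + 1) * (real r / exp 1) powr (real r / 2))"
   using gmom_lower_step[of "real r"] r by (intro mult_left_mono) (auto simp: add.commute)
  also have "... = (real r + 1) * (27 / 20 * (real r / exp 1) powr (real r / 2))" by simp
  also have "... \<le> (real r + 1) * gmom r" using less.IH[OF r(1,2)] by (intro mult_left_mono) auto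
  also have "... = gmom p" unfolding r(3) by (rule gmom_Suc_Suc[symmetric])
  finally show ?thesis .
 qed
qed

lemma gmom_lower':
 assumes "4 \<le> p"
 shows "(real p / exp 1) powr (real p / 2) \<le> gmom p"
 using gmom_lower[OF assms] powr_ge_zero[of "real p / exp 1" "real p / 2"] by linarith

text \<open>The thresholds contain \<open>p + 1\<close> where the lower bound on \<open>gmom\<close>
  contains \<open>p\<close>; to the power \<open>p\<close> this mismatch costs at most
  \<open>e\<close>.\<close>

lemma one_plus_inverse_power:
 assumes "0 < p"
 shows "((real p + 1) / real p) ^ p \<le> exp 1"
proof -
 have "((real p + 1) / real p) ^ p = (1 + 1 / real p) ^ p" using assms by (simp add: add_divide_distrib)
 also have "... \<le> exp (1 / real p) ^ p" by (intro power_mono exp_ge_add_one_self) simp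
 also have "... = exp 1" using assms by (simp add: exp_of_nat_mult[symmetric])
 finally show ?thesis .
qed

text \<open>The left sides are the coefficients of \<open>t powr (- real p)\<close> that arise in
  \<open>nuclear_tail\<close> at weight \<open>y = z / 2\<close>: one from a large Frobenius norm,
  one from a large operator norm. \<open>gmom p\<close> is replaced by \<open>gmom_lower\<close>;
  \<open>12217 / 10000\<close> exceeds \<open>sqrt e\<close> divided by \<open>27 / 20\<close>, and
  \<open>1000 / 3645\<close> is half of \<open>400 / 729\<close>.\<close>

lemma nuclear_constants:
 assumes p: "4 \<le> p" and z: "0 < z" "z < 2"
 defines "q \<equiv> real p / 2"
 shows "((real p + 1) / 6) powr q * (q + 1) / gmom p * (1 / (z / 2)) powr q
   \<le> 12217 / 10000 * ((q + 1) * (exp 1 / 3) powr q * (1 / z) powr q)"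
  and "((real p + 1)^2 / (exp 1)^2) powr q / (gmom p)^2 * (1 / (2 * (1 - z / 2))) powr q / (2 * q * exp 1)
   \<le> 1000 / (3645 * q) * (1 / (2 - z)) powr q"
proof -
 have q: "q \<ge> 2" "real p = 2 * q" using p by (auto simp: q_def)
 define P where "P = (real p / exp 1) powr q"
 have P: "P > 0" "27 / 20 * P \<le> gmom p" using p gmom_lower[OF p] by (auto simp: P_def q_def)
 define h where "h = ((real p + 1) / real p) powr q"
 have h0: "h \<ge> 0" by (simp add: h_def)
 have h2: "h^2 \<le> exp 1"
 proof -
  have "h^2 = ((real p + 1) / real p) powr real p"
   unfolding h_def q_def power2_eq_square powr_add[symmetric] by simp
  also have "... = ((real p + 1) / real p) ^ p" using p by (intro powr_realpow) auto
  finally show ?thesis using one_plus_inverse_power[of p] p by simp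
 qed
 have h1: "h \<le> 16488 / 10000"
 proof (rule power2_le_imp_le)
  show "h^2 \<le> (16488 / 10000)^2" using h2 e_bounds(2) by (simp add: power2_eq_square)
 qed simp
 have p1: "((real p + 1) / exp 1) powr q = P * h" unfolding P_def h_def using p by (simp flip: powr_mult)
 show "((real p + 1) / 6) powr q * (q + 1) / gmom p * (1 / (z / 2)) powr q
   \<le> 12217 / 10000 * ((q + 1) * (exp 1 / 3) powr q * (1 / z) powr q)"
 proof -
  have "((real p + 1) / 6) powr q * (1 / (z / 2)) powr q = ((real p + 1) / exp 1) powr q * ((exp 1 / 3) powr q * (1 / z) powr q)"
  proof -
   have "(real p + 1) / 6 * (1 / (z / 2)) = (real p + 1) / exp 1 * (exp 1 / 3 * (1 / z))" using z by (simp add: field_simps)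
   then show ?thesis unfolding powr_mult[symmetric] by (rule arg_cong)
  qed
  then have "((real p + 1) / 6) powr q * (q + 1) / gmom p * (1 / (z / 2)) powr q
    = P * h / gmom p * ((q + 1) * (exp 1 / 3) powr q * (1 / z) powr q)"
   unfolding p1 by (simp add: mult_ac)
  also have "... \<le> 12217 / 10000 * ((q + 1) * (exp 1 / 3) powr q * (1 / z) powr q)"
  proof (rule mult_right_mono)
   have "P * h \<le> P * (16488 / 10000)" using P h1 by (intro mult_left_mono) auto
   also have "... \<le> 12217 / 10000 * (27 / 20 * P)" using P by simp
   also have "... \<le> 12217 / 10000 * gmom p" using P by simp
   finally show "P * h / gmom p \<le> 12217 / 10000" using gmom_pos[of p] by (simp add: divide_le_eq)
  qed (use q in simp)
  finally show ?thesis .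
 qed
 show "((real p + 1)^2 / (exp 1)^2) powr q / (gmom p)^2 * (1 / (2 * (1 - z / 2))) powr q / (2 * q * exp 1)
   \<le> 1000 / (3645 * q) * (1 / (2 - z)) powr q"
 proof -
  have "((real p + 1)^2 / (exp 1)^2) powr q = (((real p + 1) / exp 1) powr q)^2"
   unfolding power2_eq_square times_divide_times_eq[symmetric] powr_mult ..
  then have e: "((real p + 1)^2 / (exp 1)^2) powr q / (gmom p)^2 = (P^2 / (gmom p)^2) * h^2" unfolding p1 by (simp add: power_mult_distrib)
  have "(27 / 20 * P)^2 \<le> (gmom p)^2" using P by (intro power_mono) auto
  then have "P^2 / (gmom p)^2 \<le> 400 / 729" using gmom_pos[of p] by (simp add: power_mult_distrib power_divide field_simps)
  then have "((real p + 1)^2 / (exp 1)^2) powr q / (gmom p)^2 \<le> 400 / 729 * exp 1"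
   unfolding e using h2 by (intro mult_mono) auto
  then have "((real p + 1)^2 / (exp 1)^2) powr q / (gmom p)^2 / (2 * q * exp 1) \<le> 400 / 729 * exp 1 / (2 * q * exp 1)"
   using q by (intro divide_right_mono) auto
  also have "... = 1000 / (3645 * q)" using q by (simp add: field_simps)
  finally have "((real p + 1)^2 / (exp 1)^2) powr q / (gmom p)^2 / (2 * q * exp 1) * (1 / (2 - z)) powr q
   \<le> 1000 / (3645 * q) * (1 / (2 - z)) powr q" by (rule mult_right_mono) simp
  then show ?thesis by (simp add: algebra_simps)
 qed
qed

text \<open>A larger \<open>y\<close> helps the Frobenius coefficient and hurts the operator
  coefficient. Below \<open>p = 10\<close> the single weight \<open>7 / 10\<close> passes a
  numerical check; from there on \<open>1 / 2 + 1 / q\<close> keeps both powers bounded, and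
  \<open>(q + 1) * (e / 3) powr q\<close> stays bounded because \<open>e < 3\<close>. The lower
  limit \<open>1 / 2\<close> on \<open>y\<close> preserves the coefficient \<open>2\<close> of
  \<open>delta_k\<close>.\<close>

lemma nuclear_split_point:
 assumes p: "4 \<le> p"
 defines "q \<equiv> real p / 2"
 shows "\<exists>y. 1 / 2 \<le> y \<and> y < 1 \<and> ((real p + 1) / 6) powr q * (q + 1) / gmom p * (1 / y) powr q
  + ((real p + 1)^2 / (exp 1)^2) powr q / (gmom p)^2 * (1 / (2 * (1 - y))) powr q / (2 * q * exp 1) \<le> 2"
proof -
 have q: "q \<ge> 2" "real p = 2 * q" using p by (auto simp: q_def)
 note C = nuclear_constants[OF p, folded q_def]
 show ?thesis
 proof (cases "p < 10")
  case True
  have "(exp 1 / 3) powr q * (1 / (7/5)) powr q = (exp 1 / (21/5)) powr q" by (simp flip: powr_mult)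
  also have "... \<le> ((805/1000)^2) powr q"
   using e_bounds q by (intro powr_mono2) (auto simp: power2_eq_square)
  also have "... = (805/1000) ^ p" unfolding q_def using p by (intro square_powr_half) auto
  finally have a: "(exp 1 / 3) powr q * (1 / (7/5)) powr q \<le> (805/1000) ^ p" .
  have "(1 / (2 - 7/5)) powr q \<le> ((12911/10000)^2) powr q"
   using q by (intro powr_mono2) (auto simp: power2_eq_square)
  also have "... = (12911/10000) ^ p" unfolding q_def using p by (intro square_powr_half) auto
  finally have b: "(1 / (2 - 7/5)) powr q \<le> (12911/10000) ^ p" .
  have "12217 / 10000 * ((q + 1) * (exp 1 / 3) powr q * (1 / (7/5)) powr q) + 1000 / (3645 * q) * (1 / (2 - 7/5)) powr q
   \<le> 12217 / 10000 * ((q + 1) * (805/1000) ^ p) + 1000 / (3645 * q) * (12911/10000) ^ p"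
   unfolding mult.assoc using a b q by (intro add_mono mult_left_mono) auto
  also have "... \<le> 2"
  proof -
   have "p = 4 \<or> p = 5 \<or> p = 6 \<or> p = 7 \<or> p = 8 \<or> p = 9" using True p by auto
   then show ?thesis unfolding q_def by (elim disjE) (simp_all add: power_divide)
  qed
  finally show ?thesis using C(1)[of "7/5"] C(2)[of "7/5"]
   by (intro exI[of _ "(7/5) / 2"]) simp
 next
  case False
  then have q5: "q \<ge> 5" by (simp add: q_def)
  \<comment> \<open>\<open>z powr q\<close> and \<open>(2 - z) powr q\<close> converge as
    \<open>q\<close> grows, and Bernoulli with exponent \<open>5 / q\<close> bounds both from below
    by their values at \<open>q = 5\<close>.\<close>
  define z where "z = 1 + 2 / q"
  have z: "1 < z" "z \<le> 7/5" "2 - z = 1 - 2 / q" using q5 by (auto simp: z_def field_simps)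
  have t: "0 \<le> 5 / q" "5 / q \<le> 1" using q5 by auto
  have "(7/5) powr (5 / q) \<le> 1 - 5 / q + 5 / q * (7/5)" by (rule one_minus_powr_bernoulli) (use t in auto)
  then have "((7/5) powr (5 / q)) powr q \<le> z powr q" using q by (intro powr_mono2) (auto simp: z_def)
  then have "(7/5) ^ 5 \<le> z powr q" using q5 by (simp add: powr_powr flip: powr_numeral)
  then have a: "(1 / z) powr q \<le> (5/7) ^ 5" using z by (simp add: powr_divide field_simps)
  have "(3/5) powr (5 / q) \<le> 1 - 5 / q + 5 / q * (3/5)" by (rule one_minus_powr_bernoulli) (use t in auto)
  then have "((3/5) powr (5 / q)) powr q \<le> (1 - 2 / q) powr q" using q by (intro powr_mono2) auto
  then have "(3/5) ^ 5 \<le> (2 - z) powr q" unfolding z(3) using q5 by (simp add: powr_powr flip: powr_numeral)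
  then have b: "(1 / (2 - z)) powr q \<le> (5/3) ^ 5" using z(1,2) by (simp add: powr_divide field_simps)
  have ln3: "ln 3 \<ge> (1098/1000 :: real)"
  proof -
   have "ln (3::real) \<ge> (\<Sum>k<5. 2 * ((3 - 1) / (3 + 1)) ^ (2 * k + 1) / of_nat (2 * k + 1))"
    using ln_approx_bounds[of 3 5] by simp
   moreover have "(\<Sum>k<5. 2 * ((3 - 1) / (3 + 1)) ^ (2 * k + 1) / of_nat (2 * k + 1)) \<ge> (1098/1000 :: real)"
    by (simp add: eval_nat_numeral)
   ultimately show ?thesis by linarith
  qed
  have c: "(q + 1) * (exp 1 / 3) powr q \<le> 5365 / 1000"
  proof -
   \<comment> \<open>\<open>98 / 1000\<close> bounds \<open>ln 3 - 1\<close> from below; the linear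
     factor \<open>q + 1\<close> is absorbed by \<open>y <= exp (y - 1)\<close>.\<close>
   define y where "y = 98/1000 * (q + 1)"
   have "ln (exp 1 / 3) = 1 - ln (3::real)" by (simp add: ln_div)
   then have "(exp 1 / 3) powr q = exp (q * (1 - ln 3))" by (simp add: powr_def)
   also have "... \<le> exp (- (902/1000) + - (y - 1))"
   proof -
    have "q * (1 - ln 3) \<le> q * (- 98/1000)" using ln3 q by (intro mult_left_mono) auto
    also have "q * (- 98/1000) = - (902/1000) + - (y - 1)" by (simp add: y_def field_simps)
    finally show ?thesis by (rule exp_le_cancel_iff[THEN iffD2])
   qed
   finally have e: "(exp 1 / 3) powr q \<le> exp (- (902/1000)) * exp (- (y - 1))" by (simp only: exp_add)
   have "(q + 1) * (exp 1 / 3) powr q = 1000/98 * (y * (exp 1 / 3) powr q)" by (simp add: y_def)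
   also have "... \<le> 1000/98 * (exp (y - 1) * (exp (- (902/1000)) * exp (- (y - 1))))"
    using e exp_ge_add_one_self[of "y - 1"] q by (intro mult_left_mono mult_mono) auto
   also have "... = 1000/98 * exp (- (902/1000))" by (simp flip: exp_add)
   also have "... \<le> 1000/98 * (1 / (1902/1000))"
    using exp_ge_add_one_self[of "902/1000 :: real"] by (simp add: exp_minus field_simps)
   also have "... \<le> 5365 / 1000" by simp
   finally show ?thesis .
  qed
  have "12217 / 10000 * ((q + 1) * (exp 1 / 3) powr q * (1 / z) powr q) \<le> 12217 / 10000 * (5365 / 1000 * (5/7) ^ 5)"
   using a c q by (intro mult_left_mono mult_mono) auto
  moreover have "1000 / (3645 * q) * (1 / (2 - z)) powr q \<le> 1000 / (3645 * 5) * (5/3) ^ 5"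
   using b q5 by (intro mult_mono divide_left_mono) auto
  moreover have "12217 / 10000 * (5365 / 1000 * (5/7) ^ 5) + 1000 / (3645 * 5) * (5/3) ^ 5 \<le> (2::real)"
   by (simp add: power_divide)
  ultimately have "12217 / 10000 * ((q + 1) * (exp 1 / 3) powr q * (1 / z) powr q) + 1000 / (3645 * q) * (1 / (2 - z)) powr q \<le> 2"
   by linarith
  moreover have "0 < z" "z < 2" using z by auto
  ultimately have "((real p + 1) / 6) powr q * (q + 1) / gmom p * (1 / (z / 2)) powr q
   + ((real p + 1)^2 / (exp 1)^2) powr q / (gmom p)^2 * (1 / (2 * (1 - z / 2))) powr q / (2 * q * exp 1) \<le> 2"
   using C(1)[of z] C(2)[of z] by linarith
  then show ?thesis using z(1,2) by (intro exI[of _ "z / 2"]) auto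
 qed
qed

section \<open>Operator norms from Gaussian moments\<close>

lemma op_transpose:
 fixes T :: "nat \<Rightarrow> nat \<Rightarrow> real"
 assumes s: "0 \<le> s" and op: "\<And>x. (\<Sum>j<b. (\<Sum>i<k. T j i * x i)^2) \<le> s * (\<Sum>i<k. (x i)^2)"
 shows "(\<Sum>i<k. (\<Sum>j<b. T j i * y j)^2) \<le> s * (\<Sum>j<b. (y j)^2)"
proof -
 define v where "v = (\<lambda>i. \<Sum>j<b. T j i * y j)"
 define V where "V = (\<Sum>i<k. (v i)^2)"
 define X where "X = (\<Sum>j<b. (y j)^2)"
 have V: "V \<ge> 0" "X \<ge> 0" by (auto simp: V_def X_def sum_nonneg)
 have "V = (\<Sum>i<k. \<Sum>j<b. y j * (T j i * v i))"
  unfolding V_def by (intro sum.cong refl) (simp add: power2_eq_square v_def sum_distrib_right mult_ac)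
 also have "... = (\<Sum>j<b. y j * (\<Sum>i<k. T j i * v i))" by (subst sum.swap) (simp add: sum_distrib_left)
 finally have "V^2 \<le> X * (\<Sum>j<b. (\<Sum>i<k. T j i * v i)^2)"
  unfolding X_def using Cauchy_Schwarz_ineq_sum[of y "\<lambda>j. \<Sum>i<k. T j i * v i" "{..<b}"] by simp
 also have "... \<le> X * (s * V)" unfolding V_def by (intro mult_left_mono op V)
 finally have *: "V * V \<le> V * (s * X)" by (simp add: power2_eq_square mult_ac)
 show ?thesis
 proof (cases "V = 0")
  case True
  have "0 \<le> s * X" using s V by simp
  then show ?thesis using True unfolding V_def X_def v_def by simp
 next
  case False then show ?thesis using * V unfolding V_def X_def v_def by (simp add: mult_le_cancel_left)
 qed
qed

text \<open>Testing against a fixed \<open>y\<close> gives the normal variable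
  \<open>ip (T\<^sup>T y) x\<close>, whose moment of order \<open>\<nu>\<close> is
  \<open>gmom \<nu>\<close> times a power of its standard deviation. Cauchy-Schwarz bounds the
  variable by the norm of \<open>y\<close> times that of \<open>T x\<close>, so one moment of the
  image controls the operator norm, uniformly in \<open>y\<close> and without a net.\<close>

lemma op_from_moment:
 fixes T :: "nat \<Rightarrow> nat \<Rightarrow> real"
 assumes \<nu>: "1 \<le> \<nu>" and s: "0 \<le> s"
  and mom: "(\<integral>\<^sup>+x. ennreal (sqrt (\<Sum>j<b. (\<Sum>i<k. T j i * x i)^2) ^ \<nu>) \<partial>gauss {..<k}) \<le> ennreal (gmom \<nu> * s ^ \<nu>)"
 shows "(\<Sum>i<k. (\<Sum>j<b. T j i * y j)^2) \<le> s^2 * (\<Sum>j<b. (y j)^2)"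
  and "(\<Sum>j<b. (\<Sum>i<k. T j i * x i)^2) \<le> s^2 * (\<Sum>i<k. (x i)^2)"
proof -
 show adj: "(\<Sum>i<k. (\<Sum>j<b. T j i * y j)^2) \<le> s^2 * (\<Sum>j<b. (y j)^2)" for y
 proof -
  define a where "a = sqrt (\<Sum>j<b. (y j)^2)"
  define c where "c = (\<lambda>i. \<Sum>j<b. T j i * y j)"
  define \<tau> where "\<tau> = sqrt (\<Sum>i<k. (c i)^2)"
  have a: "a \<ge> 0" "a^2 = (\<Sum>j<b. (y j)^2)" by (auto simp: a_def sum_nonneg)
  have \<tau>: "\<tau> \<ge> 0" "\<tau>^2 = (\<Sum>i<k. (c i)^2)" by (auto simp: \<tau>_def sum_nonneg)
  have pt: "\<bar>\<Sum>i<k. c i * x i\<bar> ^ \<nu> \<le> a ^ \<nu> * sqrt (\<Sum>j<b. (\<Sum>i<k. T j i * x i)^2) ^ \<nu>" for x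
  proof -
   define v where "v = (\<lambda>j. \<Sum>i<k. T j i * x i)"
   have "(\<Sum>i<k. c i * x i) = (\<Sum>i<k. \<Sum>j<b. y j * (T j i * x i))"
    unfolding c_def sum_distrib_right by (simp add: mult_ac)
   also have "... = (\<Sum>j<b. y j * v j)" unfolding v_def by (subst sum.swap) (simp add: sum_distrib_left)
   finally have e: "(\<Sum>i<k. c i * x i) = (\<Sum>j<b. y j * v j)" .
   have "(\<Sum>j<b. y j * v j)^2 \<le> (\<Sum>j<b. (y j)^2) * (\<Sum>j<b. (v j)^2)" by (rule Cauchy_Schwarz_ineq_sum)
   then have "\<bar>\<Sum>j<b. y j * v j\<bar> \<le> sqrt ((\<Sum>j<b. (y j)^2) * (\<Sum>j<b. (v j)^2))"
    by (metis real_sqrt_abs real_sqrt_le_mono)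
   then have "\<bar>\<Sum>i<k. c i * x i\<bar> \<le> a * sqrt (\<Sum>j<b. (v j)^2)" unfolding e a_def by (simp add: real_sqrt_mult)
   then have "\<bar>\<Sum>i<k. c i * x i\<bar> ^ \<nu> \<le> (a * sqrt (\<Sum>j<b. (v j)^2)) ^ \<nu>" by (intro power_mono) auto
   then show ?thesis unfolding v_def by (simp only: power_mult_distrib)
  qed
  have "ennreal (\<tau> ^ \<nu>) * ennreal (gmom \<nu>) = (\<integral>\<^sup>+z. ennreal (\<tau> ^ \<nu>) * ennreal (\<bar>z\<bar> ^ \<nu>) \<partial>std_gauss)"
   by (subst nn_integral_cmult) (auto simp: nn_integral_gmom)
  also have "... = (\<integral>\<^sup>+z. ennreal (\<bar>\<tau> * z\<bar> ^ \<nu>) \<partial>std_gauss)"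
   using \<tau>(1) by (intro nn_integral_cong) (simp add: abs_mult power_mult_distrib ennreal_mult')
  also have "... = (\<integral>\<^sup>+x. ennreal (\<bar>\<Sum>i<k. c i * x i\<bar> ^ \<nu>) \<partial>gauss {..<k})"
   using \<tau> by (intro nn_integral_gauss_linear[symmetric]) auto
  also have "... \<le> (\<integral>\<^sup>+x. ennreal (a ^ \<nu>) * ennreal (sqrt (\<Sum>j<b. (\<Sum>i<k. T j i * x i)^2) ^ \<nu>) \<partial>gauss {..<k})"
   using pt a(1) by (intro nn_integral_mono) (simp add: ennreal_mult'[symmetric] ennreal_leI)
  also have "... = ennreal (a ^ \<nu>) * (\<integral>\<^sup>+x. ennreal (sqrt (\<Sum>j<b. (\<Sum>i<k. T j i * x i)^2) ^ \<nu>) \<partial>gauss {..<k})"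
   by (rule nn_integral_cmult) measurable
  also have "... \<le> ennreal (a ^ \<nu>) * ennreal (gmom \<nu> * s ^ \<nu>)" by (rule mult_left_mono[OF mom]) simp
  finally have "ennreal (\<tau> ^ \<nu> * gmom \<nu>) \<le> ennreal (a ^ \<nu> * (gmom \<nu> * s ^ \<nu>))"
   using a(1) \<tau>(1) by (simp add: ennreal_mult')
  then have "\<tau> ^ \<nu> * gmom \<nu> \<le> a ^ \<nu> * (gmom \<nu> * s ^ \<nu>)"
   using a(1) s less_imp_le[OF gmom_pos[of \<nu>]] by (subst (asm) ennreal_le_iff) auto
  then have "gmom \<nu> * \<tau> ^ \<nu> \<le> gmom \<nu> * (s * a) ^ \<nu>" by (simp add: power_mult_distrib mult_ac)
  then have "\<tau> ^ \<nu> \<le> (s * a) ^ \<nu>" using gmom_pos[of \<nu>] by simp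
  then have "\<tau> \<le> s * a" using \<nu> s a(1) power_le_imp_le_base[of \<tau> "\<nu> - 1" "s * a"] by auto
  then have "\<tau>^2 \<le> (s * a)^2" using \<tau>(1) by (intro power_mono) auto
  then show ?thesis unfolding power_mult_distrib \<tau>(2) a(2) c_def .
 qed
 show "(\<Sum>j<b. (\<Sum>i<k. T j i * x i)^2) \<le> s^2 * (\<Sum>i<k. (x i)^2)"
  by (rule op_transpose[OF _ adj]) simp
qed

text \<open>Jensen's inequality from order \<open>p\<close> down to \<open>\<nu>\<close>, proved
  with the tangent of the power function at \<open>l ^ p\<close>. The inverse moments are computed
  only at order \<open>p\<close>.\<close>

lemma nn_integral_power_le_of_moment:
 assumes M: "prob_space M" and f[measurable]: "f \<in> borel_measurable M" and f0: "\<And>x. 0 \<le> f x"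
  and np: "\<nu> \<le> p" "0 < p" and lam: "0 < l"
  and mom: "(\<integral>\<^sup>+x. ennreal (f x ^ p) \<partial>M) \<le> ennreal (l ^ p)"
 shows "(\<integral>\<^sup>+x. ennreal (f x powr real \<nu>) \<partial>M) \<le> ennreal (l ^ \<nu>)"
proof -
 interpret prob_space M by fact
 define t where "t = real \<nu> / real p"
 have t: "0 \<le> t" "t \<le> 1" using np by (auto simp: t_def)
 have pt: "f x powr real \<nu> \<le> l ^ \<nu> * (1 - t) + l ^ \<nu> * t / l ^ p * f x ^ p" for x
 proof (cases "f x = 0")
  case True then show ?thesis using t lam np by (simp add: zero_power)
 next
  case False
  then have fx: "f x > 0" using f0[of x] by simp
  have "((f x / l) ^ p) powr t \<le> 1 - t + t * (f x / l) ^ p"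
   using fx lam t by (intro one_minus_powr_bernoulli) auto
  moreover have "((f x / l) ^ p) powr t = f x powr real \<nu> / l ^ \<nu>"
   using fx lam np by (simp add: t_def powr_divide powr_powr flip: powr_realpow)
  ultimately have "f x powr real \<nu> \<le> l ^ \<nu> * (1 - t + t * (f x / l) ^ p)"
   using lam by (simp add: divide_le_eq mult.commute)
  then show ?thesis using lam by (simp add: power_divide algebra_simps)
 qed
 have "(\<integral>\<^sup>+x. ennreal (f x powr real \<nu>) \<partial>M) \<le> (\<integral>\<^sup>+x. ennreal (l ^ \<nu> * (1 - t)) + ennreal (l ^ \<nu> * t / l ^ p) * ennreal (f x ^ p) \<partial>M)"
 proof (rule nn_integral_mono)
  fix x
  have "ennreal (f x powr real \<nu>) \<le> ennreal (l ^ \<nu> * (1 - t) + l ^ \<nu> * t / l ^ p * f x ^ p)" by (rule ennreal_leI[OF pt])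
  also have "... = ennreal (l ^ \<nu> * (1 - t)) + ennreal (l ^ \<nu> * t / l ^ p * f x ^ p)"
   using t lam f0[of x] by (intro ennreal_plus) auto
  also have "ennreal (l ^ \<nu> * t / l ^ p * f x ^ p) = ennreal (l ^ \<nu> * t / l ^ p) * ennreal (f x ^ p)"
   using t lam by (intro ennreal_mult') auto
  finally show "ennreal (f x powr real \<nu>) \<le> ennreal (l ^ \<nu> * (1 - t)) + ennreal (l ^ \<nu> * t / l ^ p) * ennreal (f x ^ p)" .
 qed
 also have "... = ennreal (l ^ \<nu> * (1 - t)) + ennreal (l ^ \<nu> * t / l ^ p) * (\<integral>\<^sup>+x. ennreal (f x ^ p) \<partial>M)"
  by (subst nn_integral_add) (auto simp: nn_integral_cmult emeasure_space_1)
 also have "... \<le> ennreal (l ^ \<nu> * (1 - t)) + ennreal (l ^ \<nu> * t / l ^ p) * ennreal (l ^ p)"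
  by (intro add_left_mono mult_left_mono mom) auto
 also have "... = ennreal (l ^ \<nu> * (1 - t) + l ^ \<nu> * t)"
  using t lam by (simp add: ennreal_mult'[symmetric] ennreal_plus[symmetric] del: ennreal_plus)
 also have "l ^ \<nu> * (1 - t) + l ^ \<nu> * t = l ^ \<nu>" by (simp add: algebra_simps)
 finally show ?thesis .
qed

section \<open>Tail of the spectral norm\<close>

lemma nn_integral_gauss_swap:
 assumes f: "(\<lambda>z. f (fst z) (snd z)) \<in> borel_measurable (gauss I \<Otimes>\<^sub>M gauss J)"
 shows "(\<integral>\<^sup>+x. (\<integral>\<^sup>+y. f x y \<partial>gauss J) \<partial>gauss I) = (\<integral>\<^sup>+y. (\<integral>\<^sup>+x. f x y \<partial>gauss I) \<partial>gauss J)"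
proof -
 interpret pair_sigma_finite "gauss I" "gauss J"
  unfolding pair_sigma_finite_def by (intro conjI prob_space_imp_sigma_finite prob_space_gauss)
 show ?thesis using Fubini'[of f] f by (simp add: case_prod_beta')
qed

lemma gauss_norm_moment:
 assumes "0 < \<nu>"
 shows "(\<integral>\<^sup>+x. ennreal (sqrt (\<Sum>i<k. (x i)^2) ^ \<nu>) \<partial>gauss {..<k}) \<le> ennreal ((real k + real \<nu> / 2) powr (real \<nu> / 2))"
proof -
 define T where "T = (\<lambda>j i :: nat. if i = j then 1 else 0 :: real)"
 have T: "(\<Sum>i<k. T j i * x i) = x j" if "j < k" for j and x :: "nat \<Rightarrow> real" using that by (simp add: T_def if_distrib[where f="\<lambda>c. c * _"] cong: if_cong)
 have T2: "(\<Sum>j<k. (\<Sum>i<k. T j i * x i)^2) = (\<Sum>i<k. (x i)^2)" for x :: "nat \<Rightarrow> real" using T by simp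
 have hs: "(\<Sum>j<k. \<Sum>i<k. (T j i)^2) = real k" by (simp add: T_def if_distrib[where f="\<lambda>c. c^2"] cong: if_cong)
 have "(\<integral>\<^sup>+x. ennreal (sqrt (\<Sum>i<k. (x i)^2) ^ \<nu>) \<partial>gauss {..<k}) = (\<integral>\<^sup>+x. ennreal ((\<Sum>i<k. (x i)^2) powr (real \<nu> / 2)) \<partial>gauss {..<k})"
  using assms by (intro nn_integral_cong arg_cong[where f=ennreal] sqrt_power_powr) (auto intro: sum_nonneg)
 also have "... \<le> ennreal ((real k + real \<nu> / 2 * 1) powr (real \<nu> / 2))"
  using gauss_linear_norm_moment[of "{..<k}" "{..<k}" 1 "real \<nu> / 2" T] assms unfolding T2 hs by simp
 finally show ?thesis by simp
qed

text \<open>The squared norm of \<open>D H y\<close>, with \<open>H\<close> given by the point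
  \<open>h\<close> of the product space; the sum form avoids matrices inside integrals.\<close>

definition dhn2 :: "real mat \<Rightarrow> nat \<Rightarrow> nat \<Rightarrow> nat \<Rightarrow> (nat \<Rightarrow> real) \<Rightarrow> (nat \<times> nat \<Rightarrow> real) \<Rightarrow> real" where
 "dhn2 D b b' m y h = (\<Sum>j<b. (\<Sum>i<b'. D $$ (j, i) * (\<Sum>c<m. h (i, c) * y c))^2)"

lemma dhn2_nonneg: "0 \<le> dhn2 D b b' m y h"
 unfolding dhn2_def by (intro sum_nonneg) auto

lemma sum_pairs: "(\<Sum>q\<in>{0..<b} \<times> {0..<m}. f q) = (\<Sum>i<b. \<Sum>c<m. f (i, c))" for f :: "nat \<times> nat \<Rightarrow> real"
 by (simp add: sum.cartesian_product lessThan_atLeast0 case_prod_beta')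

text \<open>As a linear map of \<open>h\<close>, the vector \<open>D H y\<close> has squared
  Hilbert-Schmidt norm \<open>\<rho>\<close> and squared operator norm at most \<open>M\<close>,
  both multiplied by the squared norm of \<open>y\<close>, so
  \<open>gauss_linear_norm_moment\<close> applies.\<close>

lemma nn_integral_dhn2:
 assumes opD: "\<And>y. (\<Sum>j<b. (\<Sum>i<b'. D $$ (j, i) * y i)^2) \<le> M * (\<Sum>i<b'. (y i)^2)"
  and M: "0 < M" and a: "0 < a"
 defines "\<rho> \<equiv> \<Sum>j<b. \<Sum>i<b'. (D $$ (j, i))^2"
 shows "(\<integral>\<^sup>+h. ennreal (dhn2 D b b' m y h powr a) \<partial>gaussm b' m)
  \<le> ennreal ((\<rho> + a * M) powr a * (\<Sum>c<m. (y c)^2) powr a)"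
proof (cases "(\<Sum>c<m. (y c)^2) = 0")
 case True
 then have "y c = 0" if "c < m" for c using that by (simp add: sum_nonneg_eq_0_iff)
 then have "dhn2 D b b' m y h = 0" for h by (simp add: dhn2_def)
 then show ?thesis using a by simp
next
 case False
 define Y where "Y = (\<Sum>c<m. (y c)^2)"
 have "Y \<ge> 0" unfolding Y_def by (intro sum_nonneg) auto
 then have Y: "Y > 0" using False by (simp add: Y_def)
 define T where "T = (\<lambda>j q. D $$ (j, fst q) * y (snd q))"
 have e: "(\<Sum>j<b. (\<Sum>q\<in>{0..<b'} \<times> {0..<m}. T j q * h q)^2) = dhn2 D b b' m y h" for h
  unfolding sum_pairs dhn2_def T_def by (simp add: sum_distrib_left mult_ac)
 have hs: "(\<Sum>j<b. \<Sum>q\<in>{0..<b'} \<times> {0..<m}. (T j q)^2) = \<rho> * Y"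
 proof -
  have "\<rho> * Y = (\<Sum>j<b. \<Sum>i<b'. (D $$ (j, i))^2 * Y)" by (simp add: \<rho>_def sum_distrib_right)
  then show ?thesis unfolding sum_pairs T_def Y_def sum_distrib_left by (simp add: power_mult_distrib)
 qed
 have op: "(\<Sum>j<b. (\<Sum>q\<in>{0..<b'} \<times> {0..<m}. T j q * h q)^2) \<le> M * Y * (\<Sum>q\<in>{0..<b'} \<times> {0..<m}. (h q)^2)" for h
 proof -
  have "(\<Sum>i<b'. (\<Sum>c<m. h (i, c) * y c)^2) \<le> (\<Sum>i<b'. (\<Sum>c<m. (h (i, c))^2) * Y)"
   unfolding Y_def by (intro sum_mono Cauchy_Schwarz_ineq_sum)
  also have "... = Y * (\<Sum>q\<in>{0..<b'} \<times> {0..<m}. (h q)^2)" unfolding sum_pairs sum_distrib_right[symmetric] by (rule mult.commute)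
  finally have "M * (\<Sum>i<b'. (\<Sum>c<m. h (i, c) * y c)^2) \<le> M * (Y * (\<Sum>q\<in>{0..<b'} \<times> {0..<m}. (h q)^2))"
   using M by (intro mult_left_mono) auto
  then show ?thesis unfolding e dhn2_def using opD[of "\<lambda>i. \<Sum>c<m. h (i, c) * y c"] by (simp add: mult.assoc)
 qed
 have "(\<integral>\<^sup>+h. ennreal (dhn2 D b b' m y h powr a) \<partial>gaussm b' m) \<le> ennreal ((\<rho> * Y + a * (M * Y)) powr a)"
  using gauss_linear_norm_moment[of "{0..<b'} \<times> {0..<m}" "{..<b}" "M * Y" a T, OF _ _ _ a op] M Y unfolding e hs by simp
 also have "\<rho> * Y + a * (M * Y) = (\<rho> + a * M) * Y" by (simp add: algebra_simps)
 also have "((\<rho> + a * M) * Y) powr a = (\<rho> + a * M) powr a * Y powr a" by (rule powr_mult)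
 finally show ?thesis unfolding Y_def .
qed

definition rinv_apply :: "nat \<Rightarrow> nat \<Rightarrow> (nat \<times> nat \<Rightarrow> real) \<Rightarrow> (nat \<Rightarrow> real) \<Rightarrow> nat \<Rightarrow> real" where
 "rinv_apply k m g v c = (\<Sum>a<k. rinv k m g $$ (c, a) * v a)"

abbreviation rinv_sqn :: "nat \<Rightarrow> nat \<Rightarrow> (nat \<times> nat \<Rightarrow> real) \<Rightarrow> (nat \<Rightarrow> real) \<Rightarrow> real" where
 "rinv_sqn k m g v \<equiv> \<Sum>c<m. (rinv_apply k m g v c)^2"

lemma rinv_apply_sqn: "rinv_sqn k m g v = sqn (rinv k m g *\<^sub>v Matrix.vec k v)"
proof -
 have c: "rinv k m g *\<^sub>v Matrix.vec k v \<in> carrier_vec m" by (rule mult_mat_vec_carrier[OF rinv_carrier]) simp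
 have "(rinv k m g *\<^sub>v Matrix.vec k v) $ c = rinv_apply k m g v c" if "c < m" for c
  unfolding rinv_apply_def using that by (subst mult_mat_vec_entry[OF rinv_carrier]) auto
 then show ?thesis unfolding sqn_def ip_sum[OF c c] by (simp add: power2_eq_square)
qed

lemma measurable_rinv_apply:
 assumes "c < m"
 shows "(\<lambda>z. rinv_apply k m (fst z) (snd z) c) \<in> borel_measurable (gaussm k m \<Otimes>\<^sub>M gauss {..<k})"
 unfolding rinv_apply_def
proof (intro borel_measurable_sum borel_measurable_times)
 fix a assume a: "a \<in> {..<k}"
 have "(\<lambda>g. rinv k m g $$ (c, a)) \<in> borel_measurable (gaussm k m)"
  using meas_matD(2)[OF meas_mat_rinv assms, of a k] a by (simp add: sets_gauss cong: measurable_cong_sets)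
 then show "(\<lambda>z. rinv k m (fst z) $$ (c, a)) \<in> borel_measurable (gaussm k m \<Otimes>\<^sub>M gauss {..<k})"
  by (rule measurable_compose[OF measurable_fst])
 have "(\<lambda>v. v a) \<in> borel_measurable (gauss {..<k})"
  using a by (simp add: sets_gauss cong: measurable_cong_sets)
 then show "(\<lambda>z. snd z a) \<in> borel_measurable (gaussm k m \<Otimes>\<^sub>M gauss {..<k})"
  by (rule measurable_compose[OF measurable_snd])
qed

lemma measurable_gram_indicator:
 "(\<lambda>g. full_rk k m g) \<in> borel_measurable (gaussm k m)"
 using borel_measurable_gram_indicator[of k m] by (simp add: sets_gauss cong: measurable_cong_sets)

text \<open>The Gaussian vector \<open>v\<close> is integrated last: for fixed \<open>v\<close> the
  moment of order \<open>p\<close> is known from \<open>nn_integral_rinv_vec\<close> and lowered to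
  order \<open>\<nu>\<close>, which leaves a moment of the norm of \<open>v\<close>.\<close>

lemma nn_integral_rinv_moment:
 assumes k: "0 < k" and p: "1 \<le> p" and \<nu>: "1 \<le> \<nu>" "\<nu> \<le> p" and m: "m = k + p"
 shows "(\<integral>\<^sup>+g. full_rk k m g *
   (\<integral>\<^sup>+v. ennreal (sqrt (rinv_sqn k m g v) ^ \<nu>) \<partial>gauss {..<k}) \<partial>gaussm k m)
  \<le> ennreal ((real k + real \<nu> / 2) powr (real \<nu> / 2) / gmom p powr (real \<nu> / real p))"
proof -
 let ?G = "gaussm k m"
 define \<chi> where "\<chi> = (\<lambda>g. full_rk k m g)"
 define f where "f = (\<lambda>g v. if gdet k m g \<noteq> 0 then sqrt (rinv_sqn k m g v) else 0)"
 have f0: "f g v \<ge> 0" for g v by (auto simp: f_def intro: sum_nonneg)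
 have sqm: "(\<lambda>z. sqrt (\<Sum>c<m. (rinv_apply k m (fst z) (snd z) c)^2)) \<in> borel_measurable (?G \<Otimes>\<^sub>M gauss {..<k})"
  using measurable_rinv_apply by measurable
 have \<chi>m: "\<chi> \<in> borel_measurable ?G" unfolding \<chi>_def by (rule measurable_gram_indicator)
 have fe: "\<chi> g * ennreal (sqrt (rinv_sqn k m g v) ^ \<nu>) = ennreal (f g v powr real \<nu>)" for g v
 proof -
  have pw: "x ^ \<nu> = x powr real \<nu>" if "x \<ge> 0" for x :: real
   using that \<nu> by (cases "x = 0") (auto simp: zero_power powr_realpow)
  then show ?thesis unfolding \<chi>_def f_def by (auto simp: pw sum_nonneg)
 qed
 have swapm: "(\<lambda>z. ennreal (f (fst z) (snd z) powr real \<nu>)) \<in> borel_measurable (?G \<Otimes>\<^sub>M gauss {..<k})"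
  unfolding fe[symmetric] using sqm measurable_compose[OF measurable_fst \<chi>m, of "gauss {..<k}"] by measurable
 have fm: "(\<lambda>g. f g v) \<in> borel_measurable ?G" for v
 proof -
  have "(\<lambda>g. sqn (rinv k m g *\<^sub>v Matrix.vec k v)) \<in> borel_measurable ?G"
   using borel_measurable_sqn_rinv[of "Matrix.vec k v" k m] by (simp add: sets_gauss cong: measurable_cong_sets)
  moreover have "Measurable.pred ?G (\<lambda>g. gdet k m g \<noteq> 0)"
   using borel_measurable_gram_det[of k m] unfolding measurable_cong_sets[OF sets_gauss refl] by measurable
  ultimately show ?thesis unfolding f_def rinv_apply_sqn by measurable
 qed
 have in_le: "(\<integral>\<^sup>+g. ennreal (f g v powr real \<nu>) \<partial>?G) \<le> ennreal (1 / gmom p powr (real \<nu> / real p)) * ennreal (sqrt (\<Sum>i<k. (v i)^2) ^ \<nu>)" for v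
 proof (cases "(\<Sum>i<k. (v i)^2) = 0")
  case True
  then have "v i = 0" if "i < k" for i using that by (simp add: sum_nonneg_eq_0_iff)
  then have "f g v = 0" for g by (simp add: f_def rinv_apply_def)
  then show ?thesis by simp
 next
  case False
  define s where "s = sqrt (\<Sum>i<k. (v i)^2)"
  have "(\<Sum>i<k. (v i)^2) > 0" using False by (simp add: less_le sum_nonneg)
  then have s: "s > 0" by (simp add: s_def)
  have s2: "s = sqrt (sqn (Matrix.vec k v))" by (simp add: s_def sqn_def ip_sum[of _ k] power2_eq_square)
  define l where "l = s / gmom p powr (1 / real p)"
  have l: "l > 0" using s gmom_pos[of p] by (simp add: l_def)
  have lp: "l ^ j = s ^ j / gmom p powr (real j / real p)" for j
   using gmom_pos[of p] by (simp add: l_def power_divide powr_power)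
  have e: "ennreal (f g v ^ p) = \<chi> g * ennreal (sqrt (sqn (rinv k m g *\<^sub>v Matrix.vec k v)) ^ p)" for g
   using p by (auto simp: f_def \<chi>_def rinv_apply_sqn zero_power)
  have "ennreal (gmom p) * (\<integral>\<^sup>+g. ennreal (f g v ^ p) \<partial>?G) \<le> ennreal (s ^ p)"
   unfolding e \<chi>_def s2 by (rule nn_integral_rinv_vec[OF k p m]) simp
  also have "... = ennreal (gmom p) * ennreal (l ^ p)"
   using s p gmom_pos[of p] unfolding lp by (simp add: ennreal_mult'[symmetric])
  finally have "(\<integral>\<^sup>+g. ennreal (f g v ^ p) \<partial>?G) \<le> ennreal (l ^ p)" by (rule ennreal_mult_left_cancel_le[OF gmom_pos])
  then have "(\<integral>\<^sup>+g. ennreal (f g v powr real \<nu>) \<partial>?G) \<le> ennreal (l ^ \<nu>)"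
   using p \<nu> l fm f0 by (intro nn_integral_power_le_of_moment[of ?G "\<lambda>g. f g v" \<nu> p l] prob_space_gauss) auto
  also have "... = ennreal (1 / gmom p powr (real \<nu> / real p)) * ennreal (s ^ \<nu>)"
   using s unfolding lp by (simp add: ennreal_mult'[symmetric])
  finally show ?thesis unfolding s_def .
 qed
 have "(\<integral>\<^sup>+g. \<chi> g * (\<integral>\<^sup>+v. ennreal (sqrt (rinv_sqn k m g v) ^ \<nu>) \<partial>gauss {..<k}) \<partial>?G)
  = (\<integral>\<^sup>+g. (\<integral>\<^sup>+v. ennreal (f g v powr real \<nu>) \<partial>gauss {..<k}) \<partial>?G)"
 proof (rule nn_integral_cong)
  fix g assume g: "g \<in> space ?G"
  have "(\<lambda>v. sqrt (rinv_sqn k m g v)) \<in> borel_measurable (gauss {..<k})"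
   unfolding rinv_apply_def by measurable
  then have "\<chi> g * (\<integral>\<^sup>+v. ennreal (sqrt (rinv_sqn k m g v) ^ \<nu>) \<partial>gauss {..<k})
   = (\<integral>\<^sup>+v. \<chi> g * ennreal (sqrt (rinv_sqn k m g v) ^ \<nu>) \<partial>gauss {..<k})"
   by (intro nn_integral_cmult[symmetric] measurable_compose[OF _ measurable_ennreal] borel_measurable_power)
  then show "\<chi> g * (\<integral>\<^sup>+v. ennreal (sqrt (rinv_sqn k m g v) ^ \<nu>) \<partial>gauss {..<k})
   = (\<integral>\<^sup>+v. ennreal (f g v powr real \<nu>) \<partial>gauss {..<k})" by (simp only: fe)
 qed
 also have "... = (\<integral>\<^sup>+v. (\<integral>\<^sup>+g. ennreal (f g v powr real \<nu>) \<partial>?G) \<partial>gauss {..<k})"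
  by (rule nn_integral_gauss_swap[OF swapm])
 also have "... \<le> (\<integral>\<^sup>+v. ennreal (1 / gmom p powr (real \<nu> / real p)) * ennreal (sqrt (\<Sum>i<k. (v i)^2) ^ \<nu>) \<partial>gauss {..<k})"
  by (intro nn_integral_mono in_le)
 also have "... = ennreal (1 / gmom p powr (real \<nu> / real p)) * (\<integral>\<^sup>+v. ennreal (sqrt (\<Sum>i<k. (v i)^2) ^ \<nu>) \<partial>gauss {..<k})"
  by (rule nn_integral_cmult) measurable
 also have "... \<le> ennreal (1 / gmom p powr (real \<nu> / real p)) * ennreal ((real k + real \<nu> / 2) powr (real \<nu> / 2))"
  using \<nu> by (intro mult_left_mono gauss_norm_moment) auto
 also have "... = ennreal ((real k + real \<nu> / 2) powr (real \<nu> / 2) / gmom p powr (real \<nu> / real p))"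
  by (simp add: ennreal_mult'[symmetric])
 finally show ?thesis unfolding \<chi>_def .
qed

text \<open>Let \<open>y\<close> be the image of \<open>v\<close> under the right inverse. For fixed
  \<open>g\<close> and \<open>v\<close> the vector \<open>D H y\<close> is Gaussian in
  \<open>h\<close>; integrating \<open>h\<close> first leaves the norm of \<open>y\<close>, which
  \<open>nn_integral_rinv_moment\<close> handles. The three independent sources contribute
  \<open>\<rho> + a * M\<close>, \<open>real k + a\<close> and the power of
  \<open>gmom p\<close>.\<close>

lemma spectral_moment:
 assumes k: "0 < k" and p: "1 \<le> p" and \<nu>: "1 \<le> \<nu>" "\<nu> \<le> p" and m: "m = k + p"
  and opD: "\<And>y. (\<Sum>j<b. (\<Sum>i<b'. D $$ (j, i) * y i)^2) \<le> M * (\<Sum>i<b'. (y i)^2)" and M: "0 < M"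
 defines "\<rho> \<equiv> \<Sum>j<b. \<Sum>i<b'. (D $$ (j, i))^2" and "a \<equiv> real \<nu> / 2"
 shows "(\<integral>\<^sup>+g. (\<integral>\<^sup>+h. full_rk k m g *
   (\<integral>\<^sup>+v. ennreal (sqrt (dhn2 D b b' m (rinv_apply k m g v) h) ^ \<nu>) \<partial>gauss {..<k}) \<partial>gaussm b' m) \<partial>gaussm k m)
  \<le> ennreal (((\<rho> + a * M) * (real k + a)) powr a / gmom p powr (real \<nu> / real p))"
proof -
 let ?G = "gaussm k m" and ?H = "gaussm b' m" and ?V = "gauss {..<k}"
 let ?\<chi> = "\<lambda>g. full_rk k m g"
 have a: "a > 0" using \<nu> by (simp add: a_def)
 have r0: "\<rho> \<ge> 0" unfolding \<rho>_def by (intro sum_nonneg) auto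
 have hm: "(\<lambda>h. h (i, c)) \<in> borel_measurable ?H" if "i < b'" "c < m" for i c
  using that by (simp add: sets_gauss cong: measurable_cong_sets)
 have ram: "(\<lambda>v. rinv_apply k m g v c) \<in> borel_measurable ?V" for g c
  unfolding rinv_apply_def by measurable
 have jm: "(\<lambda>z. ennreal (sqrt (dhn2 D b b' m (rinv_apply k m g (snd z)) (fst z)) ^ \<nu>)) \<in> borel_measurable (?H \<Otimes>\<^sub>M ?V)" for g
  unfolding dhn2_def
  by (intro measurable_compose[OF _ measurable_ennreal] borel_measurable_power measurable_compose[OF _ borel_measurable_sqrt] borel_measurable_sum
    borel_measurable_times borel_measurable_const measurable_compose[OF measurable_fst hm] measurable_compose[OF measurable_snd ram]) auto
 have inner: "(\<integral>\<^sup>+h. (\<integral>\<^sup>+v. ennreal (sqrt (dhn2 D b b' m (rinv_apply k m g v) h) ^ \<nu>) \<partial>?V) \<partial>?H)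
  \<le> ennreal ((\<rho> + a * M) powr a) * (\<integral>\<^sup>+v. ennreal (sqrt (rinv_sqn k m g v) ^ \<nu>) \<partial>?V)" for g
 proof -
  have "(\<integral>\<^sup>+h. (\<integral>\<^sup>+v. ennreal (sqrt (dhn2 D b b' m (rinv_apply k m g v) h) ^ \<nu>) \<partial>?V) \<partial>?H)
   = (\<integral>\<^sup>+v. (\<integral>\<^sup>+h. ennreal (sqrt (dhn2 D b b' m (rinv_apply k m g v) h) ^ \<nu>) \<partial>?H) \<partial>?V)"
   by (rule nn_integral_gauss_swap[OF jm])
  also have "... \<le> (\<integral>\<^sup>+v. ennreal ((\<rho> + a * M) powr a) * ennreal (sqrt (rinv_sqn k m g v) ^ \<nu>) \<partial>?V)"
  proof (rule nn_integral_mono)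
   fix v
   have "(\<integral>\<^sup>+h. ennreal (sqrt (dhn2 D b b' m (rinv_apply k m g v) h) ^ \<nu>) \<partial>?H)
    = (\<integral>\<^sup>+h. ennreal (dhn2 D b b' m (rinv_apply k m g v) h powr a) \<partial>?H)"
    unfolding a_def using \<nu> by (intro nn_integral_cong arg_cong[where f=ennreal] sqrt_power_powr dhn2_nonneg) auto
   also have "... \<le> ennreal ((\<rho> + a * M) powr a * rinv_sqn k m g v powr a)"
    unfolding \<rho>_def by (rule nn_integral_dhn2[OF opD M a])
   also have "... = ennreal ((\<rho> + a * M) powr a) * ennreal (sqrt (rinv_sqn k m g v) ^ \<nu>)"
    unfolding a_def using \<nu> by (subst sqrt_power_powr) (auto simp: ennreal_mult' sum_nonneg)
   finally show "(\<integral>\<^sup>+h. ennreal (sqrt (dhn2 D b b' m (rinv_apply k m g v) h) ^ \<nu>) \<partial>?H)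
    \<le> ennreal ((\<rho> + a * M) powr a) * ennreal (sqrt (rinv_sqn k m g v) ^ \<nu>)" .
  qed
  also have "... = ennreal ((\<rho> + a * M) powr a) * (\<integral>\<^sup>+v. ennreal (sqrt (rinv_sqn k m g v) ^ \<nu>) \<partial>?V)"
   using ram by (intro nn_integral_cmult measurable_compose[OF _ measurable_ennreal] borel_measurable_power measurable_compose[OF _ borel_measurable_sqrt] borel_measurable_sum)
  finally show ?thesis .
 qed
 have vm: "(\<lambda>h. \<integral>\<^sup>+v. ennreal (sqrt (dhn2 D b b' m (rinv_apply k m g v) h) ^ \<nu>) \<partial>?V) \<in> borel_measurable ?H" for g
  using jm[of g] by (intro borel_measurable_nn_integral_gauss) (simp add: case_prod_beta')
 have gm: "(\<lambda>g. ?\<chi> g * (\<integral>\<^sup>+v. ennreal (sqrt (rinv_sqn k m g v) ^ \<nu>) \<partial>?V)) \<in> borel_measurable ?G"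
 proof (rule borel_measurable_times_ennreal[OF measurable_gram_indicator])
  have "(\<lambda>z. ennreal (sqrt (\<Sum>c<m. (rinv_apply k m (fst z) (snd z) c)^2) ^ \<nu>)) \<in> borel_measurable (?G \<Otimes>\<^sub>M ?V)"
   using measurable_rinv_apply by measurable
  then show "(\<lambda>g. \<integral>\<^sup>+v. ennreal (sqrt (rinv_sqn k m g v) ^ \<nu>) \<partial>?V) \<in> borel_measurable ?G"
   by (intro borel_measurable_nn_integral_gauss) (simp add: case_prod_beta')
 qed
 have "(\<integral>\<^sup>+g. (\<integral>\<^sup>+h. ?\<chi> g * (\<integral>\<^sup>+v. ennreal (sqrt (dhn2 D b b' m (rinv_apply k m g v) h) ^ \<nu>) \<partial>?V) \<partial>?H) \<partial>?G)
  \<le> (\<integral>\<^sup>+g. ennreal ((\<rho> + a * M) powr a) * (?\<chi> g * (\<integral>\<^sup>+v. ennreal (sqrt (rinv_sqn k m g v) ^ \<nu>) \<partial>?V)) \<partial>?G)"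
 proof (rule nn_integral_mono)
  fix g
  have "(\<integral>\<^sup>+h. ?\<chi> g * (\<integral>\<^sup>+v. ennreal (sqrt (dhn2 D b b' m (rinv_apply k m g v) h) ^ \<nu>) \<partial>?V) \<partial>?H)
   = ?\<chi> g * (\<integral>\<^sup>+h. (\<integral>\<^sup>+v. ennreal (sqrt (dhn2 D b b' m (rinv_apply k m g v) h) ^ \<nu>) \<partial>?V) \<partial>?H)"
   by (rule nn_integral_cmult[OF vm])
  also have "... \<le> ?\<chi> g * (ennreal ((\<rho> + a * M) powr a) * (\<integral>\<^sup>+v. ennreal (sqrt (rinv_sqn k m g v) ^ \<nu>) \<partial>?V))"
   by (intro mult_left_mono inner) auto
  also have "... = ennreal ((\<rho> + a * M) powr a) * (?\<chi> g * (\<integral>\<^sup>+v. ennreal (sqrt (rinv_sqn k m g v) ^ \<nu>) \<partial>?V))"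
   by (rule mult.left_commute)
  finally show "(\<integral>\<^sup>+h. ?\<chi> g * (\<integral>\<^sup>+v. ennreal (sqrt (dhn2 D b b' m (rinv_apply k m g v) h) ^ \<nu>) \<partial>?V) \<partial>?H)
   \<le> ennreal ((\<rho> + a * M) powr a) * (?\<chi> g * (\<integral>\<^sup>+v. ennreal (sqrt (rinv_sqn k m g v) ^ \<nu>) \<partial>?V))" .
 qed
 also have "... = ennreal ((\<rho> + a * M) powr a) * (\<integral>\<^sup>+g. ?\<chi> g * (\<integral>\<^sup>+v. ennreal (sqrt (rinv_sqn k m g v) ^ \<nu>) \<partial>?V) \<partial>?G)"
  by (rule nn_integral_cmult[OF gm])
 also have "... \<le> ennreal ((\<rho> + a * M) powr a) * ennreal ((real k + real \<nu> / 2) powr (real \<nu> / 2) / gmom p powr (real \<nu> / real p))"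
  by (intro mult_left_mono nn_integral_rinv_moment[OF k p \<nu> m]) auto
 also have "... = ennreal (((\<rho> + a * M) * (real k + a)) powr a / gmom p powr (real \<nu> / real p))"
  by (simp add: ennreal_mult'[symmetric] powr_mult a_def)
 finally show ?thesis .
qed

lemma nn_integral_gram_null:
 assumes km: "k \<le> m"
 shows "(\<integral>\<^sup>+g. low_rk k m g \<partial>gaussm k m) = 0"
proof -
 have "AE g in gaussm k m. low_rk k m g = (0::ennreal)"
  using AE_gram_det[OF km] by (auto elim!: eventually_mono)
 then have "(\<integral>\<^sup>+g. low_rk k m g \<partial>gaussm k m)
  = (\<integral>\<^sup>+g. 0 \<partial>gaussm k m)" by (rule nn_integral_cong_AE)
 then show ?thesis by simp
qed

text \<open>Markov's inequality for the conditional moment \<open>Y\<close>: if \<open>Y g h\<close>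
  is small, \<open>op_from_moment\<close> bounds the operator norm and \<open>F\<close> vanishes.
  \<open>F\<close> stands for the indicator of failure and enters only through \<open>F <= 1\<close>
  and its zeros.\<close>

lemma spectral_tail_moment:
 fixes F :: "(nat \<times> nat \<Rightarrow> real) \<Rightarrow> (nat \<times> nat \<Rightarrow> real) \<Rightarrow> ennreal"
 assumes k: "0 < k" and p: "1 \<le> p" and \<nu>: "1 \<le> \<nu>" "\<nu> \<le> p" and m: "m = k + p"
  and opD: "\<And>y. (\<Sum>j<b. (\<Sum>i<b'. D $$ (j, i) * y i)^2) \<le> M * (\<Sum>i<b'. (y i)^2)" and M: "0 < M"
  and F1: "\<And>g h. F g h \<le> 1" and s: "0 < s"
  and F0: "\<And>g h. gdet k m g \<noteq> 0 \<Longrightarrow>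
   (\<And>v. dhn2 D b b' m (rinv_apply k m g v) h \<le> s * (\<Sum>i<k. (v i)^2)) \<Longrightarrow> F g h = 0"
 defines "\<rho> \<equiv> \<Sum>j<b. \<Sum>i<b'. (D $$ (j, i))^2" and "a \<equiv> real \<nu> / 2"
 shows "(\<integral>\<^sup>+g. (\<integral>\<^sup>+h. F g h \<partial>gaussm b' m) \<partial>gaussm k m)
  \<le> ennreal (((\<rho> + a * M) * (real k + a) / s) powr a / (gmom \<nu> * gmom p powr (real \<nu> / real p)))"
proof -
 let ?G = "gaussm k m" and ?H = "gaussm b' m" and ?V = "gauss {..<k}"
 let ?\<chi> = "\<lambda>g. full_rk k m g"
 let ?Z = "\<lambda>g. low_rk k m g"
 define Y where "Y = (\<lambda>g h. \<integral>\<^sup>+v. ennreal (sqrt (dhn2 D b b' m (rinv_apply k m g v) h) ^ \<nu>) \<partial>?V)"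
 \<comment> \<open>The moment level at which \<open>op_from_moment\<close> yields exactly the
   squared operator bound \<open>s\<close>.\<close>
 define c where "c = gmom \<nu> * sqrt s ^ \<nu>"
 have c: "c > 0" using gmom_pos s by (simp add: c_def)
 have pt: "ennreal c * F g h \<le> ennreal c * ?Z g + ?\<chi> g * Y g h" for g h
 proof (cases "gdet k m g = 0")
  case True
  have "ennreal c * F g h \<le> ennreal c * 1" by (intro mult_left_mono F1) simp
  then show ?thesis using True by simp
 next
  case False
  show ?thesis
  proof (cases "Y g h \<le> ennreal c")
   case le: True
   define T where "T = (\<lambda>j a. \<Sum>i<b'. D $$ (j, i) * (\<Sum>c<m. h (i, c) * rinv k m g $$ (c, a)))"
   have T: "dhn2 D b b' m (rinv_apply k m g v) h = (\<Sum>j<b. (\<Sum>a<k. T j a * v a)^2)" for v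
   proof -
    have "(\<Sum>i<b'. D $$ (j, i) * (\<Sum>c<m. h (i, c) * rinv_apply k m g v c)) = (\<Sum>a<k. T j a * v a)" for j
    proof -
     have "(\<Sum>c<m. h (i, c) * rinv_apply k m g v c) = (\<Sum>a<k. (\<Sum>c<m. h (i, c) * rinv k m g $$ (c, a)) * v a)" for i
      unfolding rinv_apply_def sum_distrib_left sum_distrib_right by (subst sum.swap) (simp add: mult.assoc)
     then have "(\<Sum>i<b'. D $$ (j, i) * (\<Sum>c<m. h (i, c) * rinv_apply k m g v c))
      = (\<Sum>i<b'. \<Sum>a<k. D $$ (j, i) * ((\<Sum>c<m. h (i, c) * rinv k m g $$ (c, a)) * v a))" by (simp add: sum_distrib_left)
     also have "... = (\<Sum>a<k. \<Sum>i<b'. D $$ (j, i) * ((\<Sum>c<m. h (i, c) * rinv k m g $$ (c, a)) * v a))" by (rule sum.swap)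
     also have "... = (\<Sum>a<k. T j a * v a)" unfolding T_def by (simp only: sum_distrib_right mult.assoc)
     finally show ?thesis .
    qed
    then show ?thesis unfolding dhn2_def by simp
   qed
   have "(\<integral>\<^sup>+x. ennreal (sqrt (\<Sum>j<b. (\<Sum>i<k. T j i * x i)^2) ^ \<nu>) \<partial>gauss {..<k}) \<le> ennreal (gmom \<nu> * sqrt s ^ \<nu>)"
    using le unfolding Y_def T c_def .
   from op_from_moment(2)[OF \<nu>(1) _ this]
   have "dhn2 D b b' m (rinv_apply k m g v) h \<le> s * (\<Sum>i<k. (v i)^2)" for v unfolding T using s by simp
   then show ?thesis using F0[OF False] by simp
  next
   case gt: False
   have "ennreal c * F g h \<le> ennreal c * 1" by (intro mult_left_mono F1) simp
   also have "... \<le> Y g h" using gt by simp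
   finally show ?thesis using False by simp
  qed
 qed
 have gm: "?Z \<in> borel_measurable ?G"
 proof -
  have "?Z g = 1 - ?\<chi> g" for g by (simp add: indicator_def)
  then show ?thesis using measurable_gram_indicator[of k m] by simp
 qed
 have hm: "(\<lambda>h. h (i, c)) \<in> borel_measurable ?H" if "i < b'" "c < m" for i c
  using that by (simp add: sets_gauss cong: measurable_cong_sets)
 have ram: "(\<lambda>z. rinv_apply k m (fst (fst z)) (snd z) c) \<in> borel_measurable ((?G \<Otimes>\<^sub>M ?H) \<Otimes>\<^sub>M ?V)" if "c < m" for c
  by (rule measurable_compose[OF _ measurable_rinv_apply[OF that], of "\<lambda>z. (fst (fst z), snd z)", simplified]) measurable
 have jm: "(\<lambda>z. ennreal (sqrt (dhn2 D b b' m (rinv_apply k m (fst (fst z)) (snd z)) (snd (fst z))) ^ \<nu>)) \<in> borel_measurable ((?G \<Otimes>\<^sub>M ?H) \<Otimes>\<^sub>M ?V)"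
  unfolding dhn2_def
  by (intro measurable_compose[OF _ measurable_ennreal] borel_measurable_power measurable_compose[OF _ borel_measurable_sqrt] borel_measurable_sum
    borel_measurable_times borel_measurable_const measurable_compose[OF measurable_compose[OF measurable_fst measurable_snd] hm] ram) auto
 have Ym: "(\<lambda>z. Y (fst z) (snd z)) \<in> borel_measurable (?G \<Otimes>\<^sub>M ?H)"
  unfolding Y_def using jm
  by (intro borel_measurable_nn_integral_gauss) (simp add: case_prod_beta')
 have cYm: "(\<lambda>z. ?\<chi> (fst z) * Y (fst z) (snd z)) \<in> borel_measurable (?G \<Otimes>\<^sub>M ?H)"
  using Ym measurable_compose[OF measurable_fst measurable_gram_indicator] by measurable
 have "(\<integral>\<^sup>+g. (\<integral>\<^sup>+h. F g h \<partial>?H) \<partial>?G) \<le> ennreal (1 / c) * ennreal (((\<rho> + a * M) * (real k + a)) powr a / gmom p powr (real \<nu> / real p))"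
 proof -
  have km: "k \<le> m" using m by simp
  have F_le: "F g h \<le> ?Z g + ennreal (1 / c) * (?\<chi> g * Y g h)" for g h
  proof -
   have cc: "ennreal (1 / c) * ennreal c = 1" using c by (simp add: ennreal_mult'[symmetric])
   have cx: "ennreal (1 / c) * (ennreal c * x) = x" for x
    unfolding mult.assoc[symmetric] cc by (rule mult_1)
   have "F g h = ennreal (1 / c) * (ennreal c * F g h)" by (rule cx[symmetric])
   also have "... \<le> ennreal (1 / c) * (ennreal c * ?Z g + ?\<chi> g * Y g h)"
    by (rule mult_left_mono[OF pt]) simp
   also have "... = ?Z g + ennreal (1 / c) * (?\<chi> g * Y g h)"
    unfolding distrib_left cx ..
   finally show ?thesis .
  qed
  have hY: "(\<lambda>h. ?\<chi> g * Y g h) \<in> borel_measurable ?H" if "g \<in> space ?G" for g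
   using measurable_compose[OF measurable_Pair1'[OF that] cYm] unfolding fst_conv snd_conv .
  have gY: "(\<lambda>g. \<integral>\<^sup>+h. ?\<chi> g * Y g h \<partial>?H) \<in> borel_measurable ?G"
   using cYm by (intro borel_measurable_nn_integral_gauss) (simp add: case_prod_beta')
  have "(\<integral>\<^sup>+g. (\<integral>\<^sup>+h. F g h \<partial>?H) \<partial>?G) \<le> (\<integral>\<^sup>+g. (\<integral>\<^sup>+h. ?Z g + ennreal (1 / c) * (?\<chi> g * Y g h) \<partial>?H) \<partial>?G)"
   by (intro nn_integral_mono F_le)
  also have "... = (\<integral>\<^sup>+g. ?Z g + ennreal (1 / c) * (\<integral>\<^sup>+h. ?\<chi> g * Y g h \<partial>?H) \<partial>?G)"
  proof (rule nn_integral_cong)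
   fix g assume g: "g \<in> space ?G"
   have "(\<integral>\<^sup>+h. ?Z g + ennreal (1 / c) * (?\<chi> g * Y g h) \<partial>?H) = (\<integral>\<^sup>+h. ?Z g \<partial>?H) + (\<integral>\<^sup>+h. ennreal (1 / c) * (?\<chi> g * Y g h) \<partial>?H)"
    by (rule nn_integral_add[OF borel_measurable_const borel_measurable_times_ennreal[OF borel_measurable_const hY[OF g]]])
   then show "(\<integral>\<^sup>+h. ?Z g + ennreal (1 / c) * (?\<chi> g * Y g h) \<partial>?H) = ?Z g + ennreal (1 / c) * (\<integral>\<^sup>+h. ?\<chi> g * Y g h \<partial>?H)"
    by (simp only: nn_integral_gauss_const nn_integral_cmult[OF hY[OF g]])
  qed
  also have "... = (\<integral>\<^sup>+g. ?Z g \<partial>?G) + (\<integral>\<^sup>+g. ennreal (1 / c) * (\<integral>\<^sup>+h. ?\<chi> g * Y g h \<partial>?H) \<partial>?G)"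
   by (rule nn_integral_add[OF gm borel_measurable_times_ennreal[OF borel_measurable_const gY]])
  also have "... = 0 + ennreal (1 / c) * (\<integral>\<^sup>+g. (\<integral>\<^sup>+h. ?\<chi> g * Y g h \<partial>?H) \<partial>?G)"
   unfolding nn_integral_gram_null[OF km] nn_integral_cmult[OF gY] ..
  also have "... \<le> 0 + ennreal (1 / c) * ennreal (((\<rho> + a * M) * (real k + a)) powr a / gmom p powr (real \<nu> / real p))"
   unfolding Y_def \<rho>_def a_def by (intro add_left_mono mult_left_mono spectral_moment[OF k p \<nu> m opD M]) auto
  finally show ?thesis by simp
 qed
 also have "... = ennreal (((\<rho> + a * M) * (real k + a) / s) powr a / (gmom \<nu> * gmom p powr (real \<nu> / real p)))"
 proof -
  have "sqrt s ^ \<nu> = s powr a" unfolding a_def using s \<nu> by (intro sqrt_power_powr) auto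
  then show ?thesis using s c gmom_pos[of p] gmom_pos[of \<nu>] unfolding c_def by (simp add: ennreal_mult'[symmetric] powr_divide mult_ac)
 qed
 finally show ?thesis .
qed

lemma exp_neg_quarter: "778 / 1000 \<le> exp (- (1 / 4) :: real)"
proof -
 have "(778 / 1000) ^ 4 * exp 1 \<le> (1 :: real)" using e_bounds by (simp add: power_divide)
 then have "(778 / 1000) ^ 4 \<le> exp (- (1 / 4) :: real) ^ 4" by (simp add: exp_minus field_simps flip: exp_of_nat_mult)
 then show ?thesis by (rule power_le_imp_le_base[of _ 3, simplified]) simp
qed

text \<open>In \<open>spectral_tail\<close>, \<open>n\<close> is the order of the moment,
  \<open>r\<close> is \<open>\<rho> / M\<close> and \<open>w = u^2 + r\<close>. The left side
  compares the moment bound with the threshold; the right side is the product of the two Stirling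
  bounds with a spare factor \<open>exp (- (1 / 4))\<close>, whose power \<open>n / 2\<close> is at
  most \<open>exp (- u\<^sup>2 / 2)\<close> because \<open>n >= 4 * u^2\<close>.\<close>

lemma spectral_rate_small:
 fixes k p w n :: real
 assumes k: "2 \<le> k" and p: "4 \<le> p" and w: "1 \<le> w" and n: "4 * w \<le> n" "n \<le> 4 * w + 1"
  and r: "0 \<le> r" "r \<le> w - 1"
 shows "(r + n / 2) * (k + n / 2) / (3 * (3 * k / (p + 1) + (exp 1)^2 * (k + p) / (p + 1)^2 * w)) \<le> exp (- (1 / 4)) * (n * p / (exp 1)^2)"
proof -
 define E where "E = (exp (1::real))^2"
 have E: "7388 / 1000 \<le> E" "E \<le> 739 / 100"
 proof -
  have "(27182 / 10000)^2 \<le> E" "E \<le> (27183 / 10000)^2" unfolding E_def using e_bounds by (intro power_mono; simp)+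
  then show "7388 / 1000 \<le> E" "E \<le> 739 / 100" by (auto simp: power2_eq_square)
 qed
 define d where "d = 3 * k / (p + 1) + E * (k + p) / (p + 1)^2 * w"
 define Q where "Q = 3 * k * p / (p + 1) + E * p * (k + p) / (p + 1)^2 * w"
 \<comment> \<open>\<open>p >= 4\<close> gives \<open>24 / 10 * k\<close> for the first summand and
   \<open>7 * w\<close> for the second, while \<open>n / 2 <= 2 * w + 1 / 2\<close>. The factor
   \<open>2375 / 1000\<close> is just large enough for
   \<open>3 / 4 * e^2 <= 3 * (778 / 1000) * (2375 / 1000)\<close>.\<close>
 have main: "2375 / 1000 * (k + n / 2) \<le> Q"
 proof -
  have "24 / 10 * (p + 1) \<le> 3 * p" using p by simp
  then have "24 / 10 \<le> 3 * p / (p + 1)" using p by (simp add: pos_le_divide_eq)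
  then have a: "24 / 10 * k \<le> 3 * k * p / (p + 1)" using k mult_right_mono[of "24 / 10" "3 * p / (p + 1)" k] by (simp add: mult_ac)
  have "96 / 100 * (p + 1)^2 \<le> p * (2 + p)" using mult_mono[of 4 p 4 p] p by (simp add: power2_eq_square algebra_simps)
  also have "... \<le> p * (k + p)" using k p by (intro mult_left_mono) auto
  finally have "96 / 100 \<le> p * (k + p) / (p + 1)^2" using p by (simp add: pos_le_divide_eq)
  then have "7388 / 1000 * (96 / 100) \<le> E * (p * (k + p) / (p + 1)^2)" using E by (intro mult_mono) auto
  then have "7388 / 1000 * (96 / 100) * w \<le> E * (p * (k + p) / (p + 1)^2) * w" using w by (intro mult_right_mono) auto
  moreover have "E * (p * (k + p) / (p + 1)^2) = E * p * (k + p) / (p + 1)^2" by (simp add: mult.assoc)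
  ultimately have "7 * w \<le> E * p * (k + p) / (p + 1)^2 * w" using w by (simp only:)
  then show ?thesis using a n w k unfolding Q_def by simp
 qed
 have "(r + n / 2) * (k + n / 2) * E \<le> 3 / 4 * n * (k + n / 2) * E"
  using n r k w E by (intro mult_right_mono) auto
 also have "... = n * (k + n / 2) * (3 / 4 * E)" by simp
 also have "... \<le> n * (k + n / 2) * (3 * (778 / 1000) * (2375 / 1000))"
  using n k w E by (intro mult_left_mono) auto
 also have "... = 3 * n * (778 / 1000) * (2375 / 1000 * (k + n / 2))" by simp
 also have "... \<le> 3 * n * exp (- (1 / 4)) * Q"
  using n w k main exp_neg_quarter by (intro mult_mono) auto
 finally have fin: "(r + n / 2) * (k + n / 2) * E \<le> 3 * n * exp (- (1 / 4)) * Q" .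
 have Qd: "Q = p * d"
 proof -
  have "E * p * (k + p) / (p + 1)^2 * w = p * (E * (k + p) / (p + 1)^2 * w)" by simp
  moreover have "3 * k * p / (p + 1) = p * (3 * k / (p + 1))" by simp
  moreover have "p * d = p * (3 * k / (p + 1)) + p * (E * (k + p) / (p + 1)^2 * w)" unfolding d_def by (rule distrib_left)
  ultimately show ?thesis unfolding Q_def by (simp only:)
 qed
 have d: "d > 0" unfolding d_def using k p w E by (intro add_pos_pos mult_pos_pos divide_pos_pos) auto
 have "(r + n / 2) * (k + n / 2) * E \<le> 3 * n * exp (- (1 / 4)) * (p * d)" using fin unfolding Qd .
 then have "(r + n / 2) * (k + n / 2) \<le> 3 * n * exp (- (1 / 4)) * (p * d) / E"
  using E by (simp add: pos_le_divide_eq)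
 also have "... = exp (- (1 / 4)) * (n * p / E) * (3 * d)" by simp
 finally have "(r + n / 2) * (k + n / 2) / (3 * d) \<le> exp (- (1 / 4)) * (n * p / E)"
  by (rule mult_imp_div_pos_le[rotated]) (use d in simp)
 then show ?thesis unfolding E_def d_def .
qed

lemma gmom_powr_lower:
 assumes p: "4 \<le> p"
 shows "(real p / exp 1) powr (real \<nu> / 2) \<le> gmom p powr (real \<nu> / real p)"
proof -
 have "((real p / exp 1) powr (real p / 2)) powr (real \<nu> / real p) \<le> gmom p powr (real \<nu> / real p)"
  using gmom_lower'[OF p] by (intro powr_mono2) auto
 then show ?thesis using p by (simp add: powr_powr)
qed

text \<open>Put \<open>w = u^2 + \<rho> / M\<close>. A moment of order about \<open>4 * w\<close>
  would decay like \<open>exp (- u\<^sup>2 / 2)\<close>, but order \<open>p\<close> is the limit. If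
  the desired order is admissible, the failure probability is charged to the Gaussian term;
  otherwise \<open>p < 4 * w\<close> makes the threshold so large that order \<open>p\<close> fits
  into \<open>2 * t powr (- real p)\<close>. The factor \<open>3\<close> is what the split in the
  final proof leaves of the coefficient \<open>4\<close>.\<close>

lemma spectral_tail:
 fixes F :: "(nat \<times> nat \<Rightarrow> real) \<Rightarrow> (nat \<times> nat \<Rightarrow> real) \<Rightarrow> ennreal" and u t :: real
 assumes k: "2 \<le> k" and p: "4 \<le> p" and m: "m = k + p" and u: "1 \<le> u" and t: "1 \<le> t"
  and opD: "\<And>y. (\<Sum>j<b. (\<Sum>i<b'. D $$ (j, i) * y i)^2) \<le> M * (\<Sum>i<b'. (y i)^2)" and M: "0 < M"
 defines "\<rho> \<equiv> \<Sum>j<b. \<Sum>i<b'. (D $$ (j, i))^2"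
  and "d1 \<equiv> 3 * real k / (real p + 1)" and "d2 \<equiv> exp 2 * (real k + real p) / (real p + 1)^2"
 assumes F1: "\<And>g h. F g h \<le> 1"
  and F0: "\<And>g h. gdet k m g \<noteq> 0 \<Longrightarrow>
   (\<And>v. dhn2 D b b' m (rinv_apply k m g v) h \<le> 3 * t^2 * (d1 * M + d2 * u^2 * M + d2 * \<rho>) * (\<Sum>i<k. (v i)^2)) \<Longrightarrow> F g h = 0"
 shows "(\<integral>\<^sup>+g. (\<integral>\<^sup>+h. F g h \<partial>gaussm b' m) \<partial>gaussm k m)
  \<le> ennreal (2 * t powr (- real p) + exp (- u\<^sup>2 / 2))"
proof -
 let ?J = "\<integral>\<^sup>+g. (\<integral>\<^sup>+h. F g h \<partial>gaussm b' m) \<partial>gaussm k m"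
 have e2: "exp 2 = (exp (1::real))^2" by (simp flip: exp_of_nat_mult)
 \<comment> \<open>When \<open>M\<close> is the squared operator norm of \<open>D\<close>, as in the
   application, \<open>r\<close> is its stable rank.\<close>
 define r where "r = \<rho> / M"
 define w where "w = u^2 + r"
 have r0: "r \<ge> 0" unfolding r_def \<rho>_def using M by (intro divide_nonneg_pos sum_nonneg) auto
 have u2: "u^2 \<ge> 1" using u by simp
 have w1: "w \<ge> 1" "r \<le> w - 1" "u^2 \<le> w" using r0 u2 by (auto simp: w_def)
 have rM: "\<rho> = r * M" using M by (simp add: r_def)
 define d where "d = d1 + d2 * w"
 have d2: "d2 > 0" using k by (simp add: d2_def add_pos_pos)
 have d1: "d1 > 0" using k by (simp add: d1_def)
 have d: "d > 0" "d2 * w \<le> d" using d1 d2 w1 by (auto simp: d_def intro!: add_pos_pos)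
 define s where "s = 3 * t^2 * (d1 * M + d2 * u^2 * M + d2 * \<rho>)"
 have s: "s = 3 * t^2 * M * d" unfolding s_def rM d_def w_def by (simp add: algebra_simps)
 have s0: "s > 0" unfolding s using t M d by simp
 have ratio: "(\<rho> + a * M) * (real k + a) / s = (r + a) * (real k + a) / (3 * d) / t^2" for a
 proof -
  have "(\<rho> + a * M) * (real k + a) = M * ((r + a) * (real k + a))" unfolding rM by (simp add: algebra_simps)
  then show ?thesis using M by (simp only: s) simp
 qed
 have bound: "?J \<le> ennreal (((r + real \<nu> / 2) * (real k + real \<nu> / 2) / (3 * d) / t^2) powr (real \<nu> / 2) / (gmom \<nu> * gmom p powr (real \<nu> / real p)))"
  if \<nu>: "1 \<le> \<nu>" "\<nu> \<le> p" for \<nu>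
  unfolding ratio[symmetric] \<rho>_def
  by (rule spectral_tail_moment[OF _ _ \<nu> m opD M F1 s0 F0]) (use k p in \<open>auto simp: s_def\<close>)
 define \<nu> where "\<nu> = nat \<lceil>4 * w\<rceil>"
 have \<nu>: "4 * w \<le> real \<nu>" "real \<nu> \<le> 4 * w + 1" using w1 by (auto simp: \<nu>_def)
 have \<nu>4: "4 \<le> \<nu>" using \<nu>(1) w1 by linarith
 show ?thesis
 proof (cases "\<nu> \<le> p")
  case True
  define a where "a = real \<nu> / 2"
  have a: "a > 0" "2 * u^2 \<le> a" using \<nu> w1 \<nu>4 by (auto simp: a_def)
  define R where "R = (r + a) * (real k + a) / (3 * d)"
  have R0: "R \<ge> 0" using r0 a d by (simp add: R_def)
  have R: "R \<le> exp (- (1 / 4)) * (real \<nu> * real p / (exp 1)^2)"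
   unfolding R_def a_def d_def d1_def d2_def e2
   by (rule spectral_rate_small) (use k p w1 \<nu> r0 in auto)
  have "R / t^2 \<le> R / 1" using R0 t by (intro divide_left_mono) auto
  then have "(R / t^2) powr a \<le> (exp (- (1 / 4)) * (real \<nu> * real p / (exp 1)^2)) powr a"
   using R R0 a by (intro powr_mono2) auto
  also have "... = exp (- (a / 4)) * ((real \<nu> / exp 1) powr a * (real p / exp 1) powr a)"
  proof -
   have "real \<nu> * real p / (exp 1)^2 = (real \<nu> / exp 1) * (real p / exp 1)" by (simp add: power2_eq_square)
   then show ?thesis by (simp only: powr_mult exp_powr_real) simp
  qed
  also have "... \<le> exp (- (a / 4)) * (gmom \<nu> * gmom p powr (real \<nu> / real p))"
   unfolding a_def using gmom_lower'[OF \<nu>4] gmom_powr_lower[OF p, of \<nu>] less_imp_le[OF gmom_pos]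
   by (intro mult_left_mono mult_mono) auto
  finally have "(R / t^2) powr a / (gmom \<nu> * gmom p powr (real \<nu> / real p)) \<le> exp (- (a / 4))"
   using gmom_pos[of \<nu>] gmom_pos[of p] by (intro mult_imp_div_pos_le) auto
  also have "... \<le> exp (- u\<^sup>2 / 2)" using a by simp
  also have "... \<le> 2 * t powr (- real p) + exp (- u\<^sup>2 / 2)" by simp
  finally have fin: "(R / t^2) powr a / (gmom \<nu> * gmom p powr (real \<nu> / real p)) \<le> 2 * t powr (- real p) + exp (- u\<^sup>2 / 2)" .
  show ?thesis
   by (rule order_trans[OF bound ennreal_leI[OF fin[unfolded R_def a_def]]]) (use True \<nu>4 in auto)
 next
  case False
  define q where "q = real p / 2"
  have pq: "real p = 2 * q" "q \<ge> 2" using p by (auto simp: q_def)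
  have "real p < 4 * w"
  proof (rule ccontr)
   assume "\<not> real p < 4 * w"
   then have "\<lceil>4 * w\<rceil> \<le> int p" by (intro ceiling_le) auto
   then have "\<nu> \<le> p" unfolding \<nu>_def by (simp only: nat_le_iff)
   then show False using False by simp
  qed
  \<comment> \<open>\<open>q < 2 * w\<close> and \<open>r <= w\<close>; the factor
    \<open>3 * w\<close> then cancels against \<open>3 * (d2 * w)\<close> in the threshold.\<close>
  then have rq: "r + q \<le> 3 * w" using w1 by (simp add: q_def)
  have "(r + q) * (real k + q) / (3 * d) \<le> 3 * w * (real k + real p) / (3 * (d2 * w))"
   using rq r0 pq d d2 w1 by (intro frac_le mult_mono) auto
  also have "... = (real k + real p) / d2" using w1 by simp
  also have "... = ((real p + 1) / exp 1)^2" unfolding d2_def e2 using k by (simp add: power_divide)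
  finally have R: "(r + q) * (real k + q) / (3 * d) \<le> ((real p + 1) / exp 1)^2" .
  have "((r + q) * (real k + q) / (3 * d) / t^2) powr q \<le> (((real p + 1) / exp 1)^2 / t^2) powr q"
   using R r0 pq d t by (intro powr_mono2 divide_right_mono) auto
  also have "... = (((real p + 1) / exp 1) / t)\<^sup>2 powr q" by (simp only: power_divide)
  also have "... = (((real p + 1) / exp 1) / t) ^ p" unfolding q_def using p t by (intro square_powr_half) auto
  also have "... = ((real p + 1) / real p) ^ p * (real p / exp 1) ^ p * t powr (- real p)"
  proof -
   have "((real p + 1) / exp 1) / t = ((real p + 1) / real p) * (real p / exp 1) * inverse t" using p by (simp add: divide_inverse)
   moreover have "t powr (- real p) = inverse t ^ p" using t by (simp add: powr_minus powr_realpow power_inverse)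
   ultimately show ?thesis by (simp only: power_mult_distrib)
  qed
  finally have N: "((r + q) * (real k + q) / (3 * d) / t^2) powr q
   \<le> ((real p + 1) / real p) ^ p * (real p / exp 1) ^ p * t powr (- real p)" .
  have g2: "729 / 400 * (real p / exp 1) ^ p \<le> gmom p * gmom p"
  proof -
   have "(27 / 20 * (real p / exp 1) powr (real p / 2)) * (27 / 20 * (real p / exp 1) powr (real p / 2)) \<le> gmom p * gmom p"
    using gmom_lower[OF p] less_imp_le[OF gmom_pos[of p]] by (intro mult_mono) auto
   moreover have "(real p / exp 1) powr (real p / 2) * (real p / exp 1) powr (real p / 2) = (real p / exp 1) ^ p"
    using p by (simp add: powr_realpow flip: powr_add)
   ultimately show ?thesis by (simp add: mult_ac)
  qed
  \<comment> \<open>Here the factor \<open>2\<close> of the failure probability is used: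
    \<open>e\<close> is below \<open>2 * (27 / 20)^2 = 729 / 200\<close>.\<close>
  have "((real p + 1) / real p) ^ p * (real p / exp 1) ^ p \<le> 2 * (gmom p * gmom p)"
  proof -
   have "((real p + 1) / real p) ^ p * (real p / exp 1) ^ p \<le> (27183 / 10000) * (real p / exp 1) ^ p"
    using one_plus_inverse_power[of p] e_bounds(2) p by (intro mult_right_mono) auto
   also have "... \<le> 2 * (729 / 400 * (real p / exp 1) ^ p)" by simp
   also have "... \<le> 2 * (gmom p * gmom p)" using g2 by simp
   finally show ?thesis .
  qed
  then have "((real p + 1) / real p) ^ p * (real p / exp 1) ^ p * t powr (- real p) \<le> 2 * (gmom p * gmom p) * t powr (- real p)"
   by (intro mult_right_mono) auto
  then have "((r + q) * (real k + q) / (3 * d) / t^2) powr q \<le> (2 * t powr (- real p)) * (gmom p * gmom p)"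
   using N by (simp add: mult_ac)
  then have "((r + q) * (real k + q) / (3 * d) / t^2) powr q / (gmom p * gmom p powr (real p / real p)) \<le> 2 * t powr (- real p)"
   using gmom_pos[of p] p by (simp add: pos_divide_le_eq)
  also have "... \<le> 2 * t powr (- real p) + exp (- u\<^sup>2 / 2)" by simp
  finally have fin: "((r + q) * (real k + q) / (3 * d) / t^2) powr q / (gmom p * gmom p powr (real p / real p)) \<le> 2 * t powr (- real p) + exp (- u\<^sup>2 / 2)" .
  show ?thesis
   by (rule order_trans[OF bound ennreal_leI[OF fin[unfolded q_def]]]) (use p in auto)
 qed
qed

text \<open>If \<open>X\<close> is the squared operator norm relative to its threshold, the
  conditional tail is \<open>exp (- (v / X))\<close>. Values \<open>X > 1\<close> are paid for by a
  power of \<open>X\<close>, to be integrated later, and the main term \<open>exp (- v)\<close>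
  keeps coefficient one. The loss is at most \<open>(X - 1) / e\<close> because
  \<open>z * exp (- z)\<close> never exceeds \<open>1 / e\<close>.\<close>

lemma exp_inverse_tradeoff:
 fixes v X q :: real
 assumes v: "0 \<le> v" and X: "0 < X" and q: "2 \<le> q"
 shows "exp (- (v / X)) \<le> exp (- v) + X powr q / (2 * q * exp 1)"
proof (cases "X \<le> 1")
 case True
 then have "v \<le> v / X" using v X by (simp add: pos_le_divide_eq mult_left_le)
 then have "exp (- (v / X)) \<le> exp (- v)" by simp
 moreover have "0 \<le> X powr q / (2 * q * exp 1)" using q by simp
 ultimately show ?thesis by linarith
next
 case False
 then have X1: "X > 1" by simp
 define z where "z = v / X"
 have z: "z \<ge> 0" "v = z * X" using v X by (auto simp: z_def)
 have "exp (- z) * (1 - exp (- (z * (X - 1)))) \<le> exp (- z) * (z * (X - 1))"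
  using exp_ge_add_one_self[of "- (z * (X - 1))"] by (intro mult_left_mono) auto
 also have "... = (z * exp (- z)) * (X - 1)" by simp
 also have "... \<le> (1 / exp 1) * (X - 1)"
 proof (rule mult_right_mono)
  have "z \<le> exp (z - 1)" using exp_ge_add_one_self[of "z - 1"] by simp
  then have "z * exp (- z) \<le> exp (z - 1) * exp (- z)" by (rule mult_right_mono) simp
  also have "... = 1 / exp 1" by (simp add: exp_diff exp_minus field_simps)
  finally show "z * exp (- z) \<le> 1 / exp 1" .
 qed (use X1 in simp)
 also have "... \<le> (1 / exp 1) * (X powr q / (2 * q))"
 proof (rule mult_left_mono)
  \<comment> \<open>tangent of \<open>X powr q\<close> at \<open>q / (q - 1)\<close>, where \<open>(X - 1) / X powr q\<close> is maximal\<close>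
  define c where "c = q / (q - 1)"
  have c: "c > 1" using q by (simp add: c_def)
  have lin: "X - 1 \<le> (1 / q) * c powr (1 - q) * X powr q"
  proof -
   have "((X / c) powr q) powr (1 / q) \<le> 1 - 1 / q + 1 / q * (X / c) powr q"
    using q X c by (intro one_minus_powr_bernoulli) auto
   then have "X / c \<le> 1 - 1 / q + 1 / q * (X / c) powr q" using X c q by (simp add: powr_powr)
   then have "c * (X / c) \<le> c * (1 - 1 / q + 1 / q * (X / c) powr q)" using c by (intro mult_left_mono) auto
   moreover have "c * (1 - 1 / q) = 1" using q by (simp add: c_def field_simps)
   ultimately have "X \<le> 1 + c * (1 / q * (X / c) powr q)" using c by (simp add: distrib_left)
   moreover have "c * (1 / q * (X / c) powr q) = (1 / q) * c powr (1 - q) * X powr q"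
    using c X by (simp add: powr_divide powr_diff)
   ultimately show ?thesis by linarith
  qed
  \<comment> \<open>\<open>c = 1 + 1 / (q - 1)\<close>, and \<open>(1 + 1 / x) powr x\<close> is at
    least \<open>2\<close> for \<open>x >= 1\<close>, by Bernoulli with exponent
    \<open>1 / x\<close>.\<close>
  have "2 \<le> c powr (q - 1)"
  proof -
   have t: "0 \<le> 1 / (q - 1)" "1 / (q - 1) \<le> 1" using q by auto
   have "2 powr (1 / (q - 1)) \<le> 1 - 1 / (q - 1) + 1 / (q - 1) * 2" by (rule one_minus_powr_bernoulli) (use t in auto)
   also have "... = 1 + 1 / (q - 1)" by simp
   also have "... = c" using q by (simp add: c_def divide_simps)
   finally have "(2 powr (1 / (q - 1))) powr (q - 1) \<le> c powr (q - 1)" using q by (intro powr_mono2) auto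
   then show ?thesis using q by (simp add: powr_powr)
  qed
  then have "c powr (1 - q) * 2 \<le> c powr (1 - q) * c powr (q - 1)" by (rule mult_left_mono) simp
  also have "... = 1" using c by (simp flip: powr_add)
  finally have "c powr (1 - q) \<le> 1 / 2" by simp
  then have "(1 / q) * c powr (1 - q) * X powr q \<le> (1 / q) * (1 / 2) * X powr q"
   using q by (intro mult_right_mono mult_left_mono) auto
  then show "X - 1 \<le> X powr q / (2 * q)" using lin by simp
 qed simp
 finally have "exp (- z) - exp (- z) * exp (- (z * (X - 1))) \<le> X powr q / (2 * q * exp 1)" by (simp add: algebra_simps)
 moreover have "exp (- z) * exp (- (z * (X - 1))) = exp (- v)" unfolding z(2) by (simp add: algebra_simps flip: exp_add)
 ultimately show ?thesis unfolding z_def[symmetric] by linarith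
qed

section \<open>Tail of the nuclear norm, first for a fixed right inverse\<close>

lemma square_add_le_weighted:
 fixes a b y :: real
 assumes y: "0 < y" "y < 1"
 shows "(a + b)^2 \<le> a^2 / y + b^2 / (1 - y)"
proof -
 have "a^2 / y + b^2 / (1 - y) - (a + b)^2 = ((1 - y) * a - y * b)^2 / (y * (1 - y))"
  using y by (simp add: field_simps power2_eq_square)
 moreover have "0 \<le> ((1 - y) * a - y * b)^2 / (y * (1 - y))" using y by simp
 ultimately show ?thesis by linarith
qed

text \<open>For a fixed right inverse, \<open>B + D H N\<close> is affine in \<open>h\<close>, so
  \<open>gauss_affine_norm_tail\<close> applies in the Frobenius norm. The square of its threshold
  is then split with the weight \<open>y\<close>.\<close>

lemma nuclear_conditional_tail:
 fixes F :: "(nat \<times> nat \<Rightarrow> real) \<Rightarrow> ennreal" and N :: "nat \<Rightarrow> nat \<Rightarrow> real" and B :: "nat \<Rightarrow> nat \<Rightarrow> real"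
 assumes opD: "\<And>y. (\<Sum>j<b. (\<Sum>i<b'. D $$ (j, i) * y i)^2) \<le> M * (\<Sum>i<b'. (y i)^2)" and M: "0 < M" and s: "0 < s"
  and opN: "\<And>y. (\<Sum>a<k. (\<Sum>c<m. N c a * y c)^2) \<le> s * (\<Sum>c<m. (y c)^2)"
  and y: "0 < y" "y < 1" and u: "0 \<le> u"
 defines "\<rho> \<equiv> \<Sum>j<b. \<Sum>i<b'. (D $$ (j, i))^2" and "\<beta> \<equiv> \<Sum>j<b. \<Sum>a<k. (B j a)^2" and "f \<equiv> \<Sum>c<m. \<Sum>a<k. (N c a)^2"
 assumes F1: "\<And>h. F h \<le> 1"
  and F0: "\<And>h. (\<Sum>j<b. \<Sum>a<k. (B j a + (\<Sum>i<b'. D $$ (j, i) * (\<Sum>c<m. h (i, c) * N c a)))^2) \<le> (\<beta> + \<rho> * f) / y + u^2 * (M * s) / (1 - y) \<Longrightarrow> F h = 0"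
 shows "(\<integral>\<^sup>+h. F h \<partial>gaussm b' m) \<le> ennreal (exp (- u\<^sup>2 / 2))"
proof -
 let ?H = "gaussm b' m" and ?I = "{0..<b'} \<times> {0..<m}"
 \<comment> \<open>The Kronecker product of \<open>D\<close> and the transpose of \<open>N\<close>:
   its squared Frobenius norm is \<open>\<rho> * f\<close> and its squared operator norm at most
   \<open>M * s\<close>.\<close>
 define T where "T = (\<lambda>(j, a) (i, c). D $$ (j, i) * N c a)"
 define J where "J = {0..<b} \<times> {0..<k}"
 have eq: "(\<Sum>q\<in>?I. T (j, a) q * h q) = (\<Sum>i<b'. D $$ (j, i) * (\<Sum>c<m. h (i, c) * N c a))" for j a h
  unfolding sum_pairs T_def by (simp add: sum_distrib_left mult_ac)
 have hs: "(\<Sum>q\<in>J. \<Sum>q'\<in>?I. (T q q')^2) = \<rho> * f"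
 proof -
  have "(\<Sum>q\<in>J. \<Sum>q'\<in>?I. (T q q')^2) = (\<Sum>j<b. \<Sum>a<k. \<Sum>i<b'. \<Sum>c<m. (D $$ (j, i))^2 * (N c a)^2)"
   unfolding J_def sum_pairs T_def by (simp add: power_mult_distrib)
  also have "... = (\<Sum>j<b. \<Sum>i<b'. (D $$ (j, i))^2 * (\<Sum>a<k. \<Sum>c<m. (N c a)^2))"
  proof (rule sum.cong[OF refl])
   fix j
   have "(\<Sum>a<k. \<Sum>i<b'. \<Sum>c<m. (D $$ (j, i))^2 * (N c a)^2) = (\<Sum>i<b'. \<Sum>a<k. \<Sum>c<m. (D $$ (j, i))^2 * (N c a)^2)"
    by (rule sum.swap)
   then show "(\<Sum>a<k. \<Sum>i<b'. \<Sum>c<m. (D $$ (j, i))^2 * (N c a)^2) = (\<Sum>i<b'. (D $$ (j, i))^2 * (\<Sum>a<k. \<Sum>c<m. (N c a)^2))"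
    by (simp only: sum_distrib_left)
  qed
  also have "(\<Sum>a<k. \<Sum>c<m. (N c a)^2) = f" unfolding f_def by (rule sum.swap)
  finally show ?thesis unfolding \<rho>_def by (simp only: sum_distrib_right)
 qed
 have op: "(\<Sum>q\<in>J. (\<Sum>q'\<in>?I. T q q' * h q')^2) \<le> M * s * (\<Sum>q\<in>?I. (h q)^2)" for h
 proof -
  have "(\<Sum>q\<in>J. (\<Sum>q'\<in>?I. T q q' * h q')^2) = (\<Sum>a<k. \<Sum>j<b. (\<Sum>i<b'. D $$ (j, i) * (\<Sum>c<m. h (i, c) * N c a))^2)"
   unfolding J_def sum_pairs[of _ b k] eq by (rule sum.swap)
  also have "... \<le> (\<Sum>a<k. M * (\<Sum>i<b'. (\<Sum>c<m. h (i, c) * N c a)^2))" by (intro sum_mono opD)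
  also have "... = M * (\<Sum>i<b'. \<Sum>a<k. (\<Sum>c<m. h (i, c) * N c a)^2)"
   unfolding sum_distrib_left[symmetric] by (subst sum.swap) simp
  also have "... \<le> M * (\<Sum>i<b'. s * (\<Sum>c<m. (h (i, c))^2))"
   using opN[of "\<lambda>c. h (_, c)"] M by (intro mult_left_mono sum_mono) (auto simp: mult.commute)
  also have "... = M * s * (\<Sum>q\<in>?I. (h q)^2)" unfolding sum_pairs by (simp add: sum_distrib_left mult.assoc)
  finally show ?thesis .
 qed
 define bb where "bb = (\<lambda>(j, a). B j a)"
 have beta: "(\<Sum>q\<in>J. (bb q)^2) = \<beta>" unfolding J_def sum_pairs bb_def \<beta>_def by simp
 have f0: "f \<ge> 0" "\<beta> \<ge> 0" "\<rho> \<ge> 0" unfolding f_def \<beta>_def \<rho>_def by (intro sum_nonneg; simp)+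
 define E where "E = {h \<in> space ?H. (sqrt (\<beta> + \<rho> * f) + u * sqrt (M * s))^2 < (\<Sum>q\<in>J. (bb q + (\<Sum>q'\<in>?I. T q q' * h q'))^2)}"
 have tail: "emeasure ?H E \<le> ennreal (exp (- u\<^sup>2 / 2))"
  unfolding E_def hs[symmetric] beta[symmetric]
  by (rule gauss_affine_norm_tail[OF _ _ _ u op]) (use M s in \<open>auto simp: J_def\<close>)
 have Em: "E \<in> sets ?H"
 proof -
  have "(\<lambda>h. \<Sum>q\<in>J. (bb q + (\<Sum>q'\<in>?I. T q q' * h q'))^2) \<in> borel_measurable ?H"
   by (intro borel_measurable_sum borel_measurable_power borel_measurable_add borel_measurable_times borel_measurable_const)
    (auto simp: sets_gauss cong: measurable_cong_sets intro!: measurable_component_singleton)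
  then show ?thesis unfolding E_def by measurable
 qed
 have "F h \<le> indicator E h" if h: "h \<in> space ?H" for h
 proof (cases "h \<in> E")
  case True then show ?thesis using F1 by simp
 next
  case False
  have "(\<Sum>j<b. \<Sum>a<k. (B j a + (\<Sum>i<b'. D $$ (j, i) * (\<Sum>c<m. h (i, c) * N c a)))^2) = (\<Sum>q\<in>J. (bb q + (\<Sum>q'\<in>?I. T q q' * h q'))^2)"
   unfolding J_def sum_pairs[of _ b k] eq bb_def by simp
  also have "... \<le> (sqrt (\<beta> + \<rho> * f) + u * sqrt (M * s))^2" using False h by (simp add: E_def)
  also have "... \<le> (sqrt (\<beta> + \<rho> * f))^2 / y + (u * sqrt (M * s))^2 / (1 - y)" by (rule square_add_le_weighted[OF y])
  also have "... = (\<beta> + \<rho> * f) / y + u^2 * (M * s) / (1 - y)"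
   using f0 M s by (simp add: power_mult_distrib)
  finally show ?thesis using F0 by simp
 qed
 then have "(\<integral>\<^sup>+h. F h \<partial>?H) \<le> (\<integral>\<^sup>+h. indicator E h \<partial>?H)" by (intro nn_integral_mono)
 also have "... = emeasure ?H E" using Em by simp
 finally show ?thesis using tail by (rule order_trans)
qed

lemma frob2_rinv: "frob2 (rinv k m g) = (\<Sum>c<m. \<Sum>a<k. (rinv k m g $$ (c, a))^2)"
 unfolding frob2_def using carrier_matD[OF rinv_carrier[of k m g]] by simp

text \<open>At full rank, a large Frobenius norm is charged to the power \<open>q\<close> of
  \<open>frob2\<close>, and an infinite \<open>S g\<close> leaves nothing to prove. Otherwise the
  conditional tail holds at a level depending on the operator bound \<open>s0\<close>, and
  \<open>exp_inverse_tradeoff\<close> converts that level into \<open>exp (- v)\<close> plus a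
  multiple of \<open>S g\<close>. Integration leaves at most the left side of \<open>ysum\<close> as
  the coefficient of \<open>t powr (- real p)\<close>.\<close>

lemma nuclear_tail:
 fixes F :: "(nat \<times> nat \<Rightarrow> real) \<Rightarrow> (nat \<times> nat \<Rightarrow> real) \<Rightarrow> ennreal" and u t :: real and L B :: "nat \<Rightarrow> nat \<Rightarrow> real"
 assumes k: "2 \<le> k" and p: "4 \<le> p" and m: "m = k + p" and u: "1 \<le> u" and t: "1 \<le> t"
  and opD: "\<And>y. (\<Sum>j<b. (\<Sum>i<b'. D $$ (j, i) * y i)^2) \<le> M * (\<Sum>i<b'. (y i)^2)" and M: "0 < M"
  and opL: "\<And>y. (\<Sum>a<k. (\<Sum>a'<k. L a' a * y a')^2) \<le> \<kappa> * (\<Sum>a<k. (y a)^2)" and \<kappa>: "0 < \<kappa>"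
 defines "\<rho> \<equiv> \<Sum>j<b. \<Sum>i<b'. (D $$ (j, i))^2" and "\<beta> \<equiv> \<Sum>j<b. \<Sum>a<k. (B j a)^2"
  and "d1 \<equiv> 3 * real k / (real p + 1)" and "d2 \<equiv> exp 2 * (real k + real p) / (real p + 1)^2"
  and "N \<equiv> \<lambda>g c a. \<Sum>a'<k. rinv k m g $$ (c, a') * L a' a"
 assumes F1: "\<And>g h. F g h \<le> 1"
  and F0: "\<And>g h. gdet k m g \<noteq> 0 \<Longrightarrow>
   (\<Sum>j<b. \<Sum>a<k. (B j a + (\<Sum>i<b'. D $$ (j, i) * (\<Sum>c<m. h (i, c) * N g c a)))^2)
    \<le> 2 * \<beta> + d1 * t^2 * \<kappa> * \<rho> + 2 * d2 * t^2 * u^2 * \<kappa> * M \<Longrightarrow> F g h = 0"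
 shows "(\<integral>\<^sup>+g. (\<integral>\<^sup>+h. F g h \<partial>gaussm b' m) \<partial>gaussm k m)
  \<le> ennreal (2 * t powr (- real p) + exp (- u\<^sup>2 / 2))"
proof -
 let ?G = "gaussm k m" and ?H = "gaussm b' m" and ?V = "gauss {..<k}"
 let ?\<chi> = "\<lambda>g. full_rk k m g"
 let ?Z = "\<lambda>g. low_rk k m g"
 define q where "q = real p / 2"
 have q: "q \<ge> 2" "real p = 2 * q" using p by (auto simp: q_def)
 have e2: "exp 2 = (exp (1::real))^2" by (simp flip: exp_of_nat_mult)
 have d1: "d1 > 0" and d2: "d2 > 0" using k p by (auto simp: d1_def d2_def add_pos_pos)
 have nn: "\<rho> \<ge> 0" "\<beta> \<ge> 0" unfolding \<rho>_def \<beta>_def by (intro sum_nonneg; simp)+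
 \<comment> \<open>The weight is determined by \<open>p\<close> alone and chosen before
   \<open>g\<close>; \<open>1 / 2 <= y\<close> keeps \<open>\<beta> / y\<close> below
   \<open>2 * \<beta>\<close>.\<close>
 obtain y where y: "1 / 2 \<le> y" "y < 1"
  and ysum: "((real p + 1) / 6) powr q * (q + 1) / gmom p * (1 / y) powr q
   + ((real p + 1)^2 / (exp 1)^2) powr q / (gmom p)^2 * (1 / (2 * (1 - y))) powr q / (2 * q * exp 1) \<le> 2"
  using nuclear_split_point[OF p] unfolding q_def by blast
 have yy: "0 < y" using y by simp
 \<comment> \<open>\<open>\<tau>\<close> and \<open>\<omega>\<close> are squared Frobenius and
   operator thresholds; their factors \<open>y\<close> and \<open>1 - y\<close> cancel the
   denominators of the weighted split, which leaves exactly \<open>d1\<close> and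
   \<open>2 * d2\<close>.\<close>
 define \<tau> where "\<tau> = y * d1 * t^2"
 define \<omega> where "\<omega> = 2 * (1 - y) * d2 * t^2"
 have \<tau>: "\<tau> > 0" and \<omega>: "\<omega> > 0" using y yy d1 d2 t by (auto simp: \<tau>_def \<omega>_def)
 \<comment> \<open>\<open>S g\<close> is a Gaussian moment of the right inverse and stands in for
   its operator norm to the power \<open>p\<close>, up to the factor \<open>gmom p\<close>; being an
   integral, it can be averaged over \<open>g\<close>.\<close>
 define S where "S = (\<lambda>g. \<integral>\<^sup>+v. ennreal (sqrt (rinv_sqn k m g v) ^ p) \<partial>?V)"
 define v where "v = u^2 / 2"
 define C1 where "C1 = 1 / \<tau> powr q"
 define C2 where "C2 = 1 / (gmom p * \<omega> powr q * (2 * q * exp 1))"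
 have C: "C1 \<ge> 0" "C2 > 0" using q \<omega> gmom_pos[of p] by (auto simp: C1_def C2_def)
 have pt: "(\<integral>\<^sup>+h. F g h \<partial>?H) \<le> ?Z g + (ennreal C1 * (?\<chi> g * ennreal (frob2 (rinv k m g) powr q)) + (ennreal (exp (- v)) + ennreal C2 * (?\<chi> g * S g)))" for g
 proof -
  have triv: "(\<integral>\<^sup>+h. F g h \<partial>?H) \<le> 1"
  proof -
   have "(\<integral>\<^sup>+h. F g h \<partial>?H) \<le> (\<integral>\<^sup>+h. 1 \<partial>?H)" by (intro nn_integral_mono F1)
   then show ?thesis by (simp only: nn_integral_gauss_const)
  qed
  show ?thesis
  proof (cases "gdet k m g = 0")
   case True
   then show ?thesis using triv by (simp add: add_increasing2)
  next
   case det: False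
   define f2 where "f2 = frob2 (rinv k m g)"
   have f20: "f2 \<ge> 0" unfolding f2_def by (rule frob2_nonneg)
   show ?thesis
   proof (cases "f2 > \<tau>")
    case True
    have "\<tau> powr q \<le> f2 powr q" using True \<tau> q by (intro powr_mono2) auto
    then have "1 \<le> C1 * f2 powr q" using \<tau> by (simp add: C1_def pos_le_divide_eq)
    then have "ennreal 1 \<le> ennreal (C1 * f2 powr q)" by (rule ennreal_leI)
    then have "1 \<le> ennreal C1 * ennreal (f2 powr q)" using C by (simp add: ennreal_mult')
    then have "(\<integral>\<^sup>+h. F g h \<partial>?H) \<le> ennreal C1 * ennreal (f2 powr q)" using triv by (rule order_trans[rotated])
    also have "... \<le> ennreal C1 * ennreal (f2 powr q) + (ennreal (exp (- v)) + ennreal C2 * S g)" by simp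
    finally show ?thesis using det by (simp add: f2_def)
   next
    case f2: False
    show ?thesis
    proof (cases "S g = \<infinity>")
     case True
     then show ?thesis using det C by (simp add: ennreal_mult_top)
    next
     case False
     \<comment> \<open>Chosen so that \<open>S g\<close> equals \<open>gmom p * s0 ^ p\<close>, the
       moment condition of \<open>op_from_moment\<close>.\<close>
     define s0 where "s0 = root p (enn2real (S g) / gmom p)"
     have s0: "s0 \<ge> 0" unfolding s0_def by (intro real_root_ge_zero) (simp add: less_imp_le[OF gmom_pos])
     have "s0 ^ p = enn2real (S g) / gmom p" unfolding s0_def using p gmom_pos[of p] by (intro real_root_pow_pos2) auto
     then have s0p: "gmom p * s0 ^ p = enn2real (S g)" using gmom_pos[of p] by simp
     have Ss: "S g = ennreal (gmom p * s0 ^ p)" unfolding s0p using False by (simp add: less_top)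
     have mom: "(\<integral>\<^sup>+x. ennreal (sqrt (\<Sum>c<m. (\<Sum>a<k. rinv k m g $$ (c, a) * x a)^2) ^ p) \<partial>gauss {..<k}) \<le> ennreal (gmom p * s0 ^ p)"
      using Ss unfolding S_def rinv_apply_def by simp
     have p1: "1 \<le> p" using p by simp
     note opm = op_from_moment[OF p1 s0 mom]
     \<comment> \<open>If \<open>s0\<close> were zero the right inverse would vanish, contrary to
       its nonzero first column; \<open>s0\<close> is about to become a denominator.\<close>
     have s0pos: "s0 > 0"
     proof (rule ccontr)
      assume "\<not> s0 > 0"
      then have z: "s0 = 0" using s0 by simp
      have "(\<Sum>c<m. (rinv_apply k m g (\<lambda>i. if i = 0 then 1 else 0) c)^2) \<le> 0"
       using opm(2)[of "\<lambda>i. if i = 0 then 1 else 0"] unfolding z rinv_apply_def by simp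
      then have "sqn (rinv k m g *\<^sub>v unit_vec k 0) \<le> 0"
       unfolding rinv_apply_sqn by (simp add: unit_vec_def)
      then show False using sqn_rinv_unit_pos[of 0 k m g] det k by simp
     qed
     have opN: "(\<Sum>a<k. (\<Sum>c<m. N g c a * x c)^2) \<le> \<kappa> * s0^2 * (\<Sum>c<m. (x c)^2)" for x
     proof -
      have "(\<Sum>c<m. N g c a * x c) = (\<Sum>a'<k. L a' a * (\<Sum>c<m. rinv k m g $$ (c, a') * x c))" for a
       unfolding N_def sum_distrib_left sum_distrib_right by (subst sum.swap) (simp add: mult_ac)
      then have "(\<Sum>a<k. (\<Sum>c<m. N g c a * x c)^2) \<le> \<kappa> * (\<Sum>a<k. (\<Sum>c<m. rinv k m g $$ (c, a) * x c)^2)"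
       using opL[of "\<lambda>a'. \<Sum>c<m. rinv k m g $$ (c, a') * x c"] by simp
      also have "... \<le> \<kappa> * (s0^2 * (\<Sum>c<m. (x c)^2))" using \<kappa> by (intro mult_left_mono opm(1)) auto
      finally show ?thesis by (simp add: mult.assoc)
     qed
     have fN: "(\<Sum>c<m. \<Sum>a<k. (N g c a)^2) \<le> \<kappa> * f2"
     proof -
      have "(\<Sum>a<k. (N g c a)^2) \<le> \<kappa> * (\<Sum>a<k. (rinv k m g $$ (c, a))^2)" for c
       using opL[of "\<lambda>a'. rinv k m g $$ (c, a')"] unfolding N_def by (simp add: mult.commute)
      then have "(\<Sum>c<m. \<Sum>a<k. (N g c a)^2) \<le> (\<Sum>c<m. \<kappa> * (\<Sum>a<k. (rinv k m g $$ (c, a))^2))" by (intro sum_mono)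
      then show ?thesis unfolding f2_def frob2_rinv by (simp only: sum_distrib_left)
     qed
     \<comment> \<open>With this level the product \<open>u'^2 * s0^2\<close> no longer depends on
       \<open>g\<close>: the threshold is deterministic and only the probability feels
       \<open>s0\<close>.\<close>
     define u' where "u' = u * sqrt \<omega> / s0"
     have u': "u' \<ge> 0" "u'^2 = u^2 * \<omega> / s0^2" using u \<omega> s0pos by (auto simp: u'_def power_mult_distrib power_divide)
     have thr: "(\<beta> + \<rho> * (\<Sum>c<m. \<Sum>a<k. (N g c a)^2)) / y + u'^2 * (M * (\<kappa> * s0^2)) / (1 - y)
      \<le> 2 * \<beta> + d1 * t^2 * \<kappa> * \<rho> + 2 * d2 * t^2 * u^2 * \<kappa> * M"
     proof -
      have "\<beta> \<le> 2 * \<beta> * y" using y nn mult_left_mono[of "1/2" y "2 * \<beta>"] by simp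
      then have a: "\<beta> / y \<le> 2 * \<beta>" using yy by (simp add: pos_divide_le_eq)
      have "\<kappa> * f2 \<le> \<kappa> * \<tau>" using f2 \<kappa> by (intro mult_left_mono) auto
      then have "\<rho> * (\<Sum>c<m. \<Sum>a<k. (N g c a)^2) \<le> \<rho> * (\<kappa> * \<tau>)" using fN nn by (intro mult_left_mono) auto
      also have "... = d1 * t^2 * \<kappa> * \<rho> * y" by (simp add: \<tau>_def)
      finally have b: "\<rho> * (\<Sum>c<m. \<Sum>a<k. (N g c a)^2) / y \<le> d1 * t^2 * \<kappa> * \<rho>" using yy by (simp add: pos_divide_le_eq)
      have "u'^2 * (M * (\<kappa> * s0^2)) = u^2 * \<omega> * (M * \<kappa>)" unfolding u'(2) using s0pos by simp
      also have "... = (2 * d2 * t^2 * u^2 * \<kappa> * M) * (1 - y)" unfolding \<omega>_def by simp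
      finally have c0: "u'^2 * (M * (\<kappa> * s0^2)) = (2 * d2 * t^2 * u^2 * \<kappa> * M) * (1 - y)" .
      have c: "u'^2 * (M * (\<kappa> * s0^2)) / (1 - y) = 2 * d2 * t^2 * u^2 * \<kappa> * M"
       unfolding c0 by (rule nonzero_mult_div_cancel_right) (use y in simp)
      show ?thesis unfolding add_divide_distrib c using a b by linarith
     qed
     have "(\<integral>\<^sup>+h. F g h \<partial>?H) \<le> ennreal (exp (- u'\<^sup>2 / 2))"
     proof (rule nuclear_conditional_tail[OF opD M _ opN yy y(2) u'(1) F1])
      fix h
      assume "(\<Sum>j<b. \<Sum>a<k. (B j a + (\<Sum>i<b'. D $$ (j, i) * (\<Sum>c<m. h (i, c) * N g c a)))^2)
       \<le> ((\<Sum>j<b. \<Sum>a<k. (B j a)^2) + (\<Sum>j<b. \<Sum>i<b'. (D $$ (j, i))^2) * (\<Sum>c<m. \<Sum>a<k. (N g c a)^2)) / y + u'^2 * (M * (\<kappa> * s0^2)) / (1 - y)"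
      then show "F g h = 0" using thr det unfolding \<rho>_def[symmetric] \<beta>_def[symmetric] by (intro F0) auto
     qed (use \<kappa> s0pos in simp)
     also have "- u'\<^sup>2 / 2 = - (v / (s0^2 / \<omega>))" unfolding u'(2) v_def by simp
     also have "ennreal (exp (- (v / (s0^2 / \<omega>)))) \<le> ennreal (exp (- v) + (s0^2 / \<omega>) powr q / (2 * q * exp 1))"
      using s0pos \<omega> q by (intro ennreal_leI exp_inverse_tradeoff) (auto simp: v_def)
     also have "(s0^2 / \<omega>) powr q / (2 * q * exp 1) = C2 * (gmom p * s0 ^ p)"
     proof -
      have "(s0^2) powr q = s0 ^ p" unfolding q_def using s0 p by (intro square_powr_half) auto
      then show ?thesis unfolding C2_def powr_divide using gmom_pos[of p] by simp
     qed
     also have "ennreal (exp (- v) + C2 * (gmom p * s0 ^ p)) = ennreal (exp (- v)) + ennreal C2 * S g"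
      unfolding Ss using C s0 gmom_pos[of p] by (subst ennreal_plus) (auto simp: ennreal_mult' less_imp_le)
     also have "... \<le> ennreal C1 * ennreal (f2 powr q) + (ennreal (exp (- v)) + ennreal C2 * S g)" by simp
     finally show ?thesis using det by (simp add: f2_def)
    qed
   qed
  qed
 qed
 have fm: "(\<lambda>g. ?\<chi> g * ennreal (frob2 (rinv k m g) powr q)) \<in> borel_measurable ?G"
 proof -
  have "(\<lambda>g. frob2 (rinv k m g)) \<in> borel_measurable ?G"
   unfolding frob2_rinv using meas_matD(2)[OF meas_mat_rinv[of k m]]
   by (intro borel_measurable_sum borel_measurable_power) (auto simp: sets_gauss cong: measurable_cong_sets)
  then show ?thesis using measurable_gram_indicator[of k m] by measurable
 qed
 have Sm: "(\<lambda>g. ?\<chi> g * S g) \<in> borel_measurable ?G"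
 proof (rule borel_measurable_times_ennreal[OF measurable_gram_indicator])
  have "(\<lambda>z. ennreal (sqrt (\<Sum>c<m. (rinv_apply k m (fst z) (snd z) c)^2) ^ p)) \<in> borel_measurable (?G \<Otimes>\<^sub>M ?V)"
   using measurable_rinv_apply by measurable
  then show "S \<in> borel_measurable ?G" unfolding S_def
   by (intro borel_measurable_nn_integral_gauss) (simp add: case_prod_beta')
 qed
 have zm: "?Z \<in> borel_measurable ?G"
 proof -
  have "?Z g = 1 - ?\<chi> g" for g by (simp add: indicator_def)
  then show ?thesis using measurable_gram_indicator[of k m] by simp
 qed
 have km: "k \<le> m" using m by simp
 define I1 where "I1 = (\<integral>\<^sup>+g. ?\<chi> g * ennreal (frob2 (rinv k m g) powr q) \<partial>?G)"
 define I2 where "I2 = (\<integral>\<^sup>+g. ?\<chi> g * S g \<partial>?G)"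
 have "(\<integral>\<^sup>+g. (\<integral>\<^sup>+h. F g h \<partial>?H) \<partial>?G)
  \<le> (\<integral>\<^sup>+g. ?Z g + (ennreal C1 * (?\<chi> g * ennreal (frob2 (rinv k m g) powr q)) + (ennreal (exp (- v)) + ennreal C2 * (?\<chi> g * S g))) \<partial>?G)"
  by (rule nn_integral_mono) (rule pt)
 also have "... = (\<integral>\<^sup>+g. ?Z g \<partial>?G) + ((\<integral>\<^sup>+g. ennreal C1 * (?\<chi> g * ennreal (frob2 (rinv k m g) powr q)) \<partial>?G)
   + ((\<integral>\<^sup>+g. ennreal (exp (- v)) \<partial>?G) + (\<integral>\<^sup>+g. ennreal C2 * (?\<chi> g * S g) \<partial>?G)))"
 proof -
  note c1 = borel_measurable_times_ennreal[OF borel_measurable_const fm, of "ennreal C1"]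
  note c2 = borel_measurable_times_ennreal[OF borel_measurable_const Sm, of "ennreal C2"]
  note c3 = borel_measurable_const[of "ennreal (exp (- v))" ?G]
  show ?thesis
   unfolding nn_integral_add[OF zm borel_measurable_add[OF c1 borel_measurable_add[OF c3 c2]]]
    nn_integral_add[OF c1 borel_measurable_add[OF c3 c2]] nn_integral_add[OF c3 c2] ..
 qed
 also have "... = 0 + (ennreal C1 * I1 + (ennreal (exp (- v)) + ennreal C2 * I2))"
  unfolding nn_integral_gram_null[OF km] nn_integral_cmult[OF fm] nn_integral_cmult[OF Sm] nn_integral_gauss_const I1_def I2_def ..
 also have "... = ennreal C1 * I1 + (ennreal (exp (- v)) + ennreal C2 * I2)" by (rule add_0)
 also have "... \<le> ennreal C1 * ennreal ((real k / 2) powr q * (q + 1) / gmom p)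
  + (ennreal (exp (- v)) + ennreal C2 * ennreal ((real k + q) powr q / gmom p))"
 proof (intro add_mono mult_left_mono order_refl)
  have "ennreal (gmom p) * I1 \<le> ennreal ((real k / 2) powr q * (q + 1))"
   unfolding I1_def q_def using k p m by (intro nn_integral_frob2_rinv) auto
  also have "... = ennreal (gmom p) * ennreal ((real k / 2) powr q * (q + 1) / gmom p)"
   using gmom_pos[of p] q by (simp add: ennreal_mult'[symmetric])
  finally show "I1 \<le> ennreal ((real k / 2) powr q * (q + 1) / gmom p)" by (rule ennreal_mult_left_cancel_le[OF gmom_pos])
  have "I2 \<le> ennreal ((real k + real p / 2) powr (real p / 2) / gmom p powr (real p / real p))"
   unfolding I2_def S_def using k p m by (intro nn_integral_rinv_moment) auto
  then show "I2 \<le> ennreal ((real k + q) powr q / gmom p)" using p gmom_pos[of p] by (simp add: q_def)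
 qed auto
 also have "... = ennreal (C1 * ((real k / 2) powr q * (q + 1) / gmom p) + (exp (- v) + C2 * ((real k + q) powr q / gmom p)))"
  using C q gmom_pos[of p] by (simp add: ennreal_mult'[symmetric] ennreal_plus[symmetric] del: ennreal_plus)
 also have "... \<le> ennreal (2 * t powr (- real p) + exp (- u\<^sup>2 / 2))"
 proof (rule ennreal_leI)
  have tq: "(t^2) powr q = t ^ p" unfolding q_def using t p by (intro square_powr_half) auto
  have tp: "t powr (- real p) = 1 / t ^ p" using t by (simp add: powr_minus powr_realpow divide_inverse)
  have a: "C1 * ((real k / 2) powr q * (q + 1) / gmom p) = (((real p + 1) / 6) powr q * (q + 1) / gmom p * (1 / y) powr q) * t powr (- real p)"
  proof -
   have "(real k / 2) powr q / \<tau> powr q = (real k / 2 / \<tau>) powr q" by (rule powr_divide[symmetric])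
   also have "real k / 2 / \<tau> = (real p + 1) / 6 * (1 / y) * (1 / t^2)" using k t yy by (simp add: \<tau>_def d1_def field_simps)
   also have "... powr q = ((real p + 1) / 6) powr q * (1 / y) powr q * (1 / t ^ p)" unfolding powr_mult powr_divide tq by simp
   finally have e: "(real k / 2) powr q / \<tau> powr q = ((real p + 1) / 6) powr q * (1 / y) powr q * (1 / t ^ p)" .
   have "C1 * ((real k / 2) powr q * (q + 1) / gmom p) = (real k / 2) powr q / \<tau> powr q * ((q + 1) / gmom p)"
    by (simp add: C1_def)
   also have "... = (((real p + 1) / 6) powr q * (q + 1) / gmom p * (1 / y) powr q) * t powr (- real p)"
    unfolding e tp by (simp add: mult_ac)
   finally show ?thesis .
  qed
  have b: "C2 * ((real k + q) powr q / gmom p) \<le> (((real p + 1)^2 / (exp 1)^2) powr q / (gmom p)^2 * (1 / (2 * (1 - y))) powr q / (2 * q * exp 1)) * t powr (- real p)"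
  proof -
   have "(real k + q) powr q / \<omega> powr q = ((real k + q) / \<omega>) powr q" by (rule powr_divide[symmetric])
   also have "... \<le> ((real k + real p) / \<omega>) powr q" using q \<omega> by (intro powr_mono2 divide_right_mono) auto
   also have "(real k + real p) / \<omega> = (real p + 1)^2 / (exp 1)^2 * (1 / (2 * (1 - y))) * (1 / t^2)"
   proof -
    have "real k + real p > 0" using k by simp
    then show ?thesis unfolding \<omega>_def d2_def e2 by simp
   qed
   also have "... powr q = ((real p + 1)^2 / (exp 1)^2) powr q * (1 / (2 * (1 - y))) powr q * (1 / t ^ p)"
    unfolding powr_mult powr_divide[of 1 "t^2"] tq by simp
   finally have "(real k + q) powr q / \<omega> powr q * (1 / ((gmom p)^2 * (2 * q * exp 1)))
    \<le> ((real p + 1)^2 / (exp 1)^2) powr q * (1 / (2 * (1 - y))) powr q * (1 / t ^ p) * (1 / ((gmom p)^2 * (2 * q * exp 1)))"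
    using q by (intro mult_right_mono) auto
   then show ?thesis unfolding C2_def tp by (simp add: power2_eq_square mult_ac)
  qed
  have "(((real p + 1) / 6) powr q * (q + 1) / gmom p * (1 / y) powr q) * t powr (- real p)
   + (((real p + 1)^2 / (exp 1)^2) powr q / (gmom p)^2 * (1 / (2 * (1 - y))) powr q / (2 * q * exp 1)) * t powr (- real p)
   \<le> 2 * t powr (- real p)"
   unfolding distrib_right[symmetric] by (intro mult_right_mono ysum) auto
  moreover have "exp (- v) = exp (- u\<^sup>2 / 2)" by (simp add: v_def)
  ultimately show "C1 * ((real k / 2) powr q * (q + 1) / gmom p) + (exp (- v) + C2 * ((real k + q) powr q / gmom p))
   \<le> 2 * t powr (- real p) + exp (- u\<^sup>2 / 2)" using a b by linarith
 qed
 finally show ?thesis .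
qed

section \<open>Assembling the bound\<close>

text \<open>Here and in the next two lemmas the side conditions are dimension equations, which lets
  the simplifier normalise products of rectangular matrices to the right.\<close>

lemma mult_assoc_dim: "dim_col A = dim_row B \<Longrightarrow> dim_col B = dim_row C \<Longrightarrow> A * B * C = A * (B * C :: real mat)"
 by (rule assoc_mult_mat[of A "dim_row A" "dim_col A" B "dim_col B" C "dim_col C"]) auto

lemma transpose_mult_dim: "dim_col A = dim_row B \<Longrightarrow> (A * B)\<^sup>T = B\<^sup>T * (A :: real mat)\<^sup>T"
 by (rule transpose_mult[of A "dim_row A" "dim_col A" B "dim_col B"]) auto

lemma cancel_mult_dim: "A * B = 1\<^sub>m n \<Longrightarrow> dim_col A = dim_row B \<Longrightarrow> dim_col B = dim_row C \<Longrightarrow> dim_row C = n \<Longrightarrow> A * (B * C) = (C :: real mat)"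
 by (subst mult_assoc_dim[symmetric]) auto

section \<open>Measurability of the error norms\<close>

lemma quad_form_sum:
 assumes "M \<in> carrier_mat n n" "x \<in> carrier_vec n"
 shows "ip x (M *\<^sub>v x) = (\<Sum>r<n. \<Sum>s<n. x $ r * M $$ (r, s) * x $ s)"
proof -
 have "M *\<^sub>v x \<in> carrier_vec n" using assms by (rule mult_mat_vec_carrier)
 then show ?thesis
  by (simp add: ip_sum[OF assms(2)] mult_mat_vec_entry[OF assms] sum_distrib_left mult.assoc del: index_mult_mat_vec)
qed

lemma quad_form_tendsto:
 assumes M: "M \<in> carrier_mat n n" and x: "x \<in> carrier_vec n" and s: "\<And>N. s N \<in> carrier_vec n"
  and lim: "\<And>r. r < n \<Longrightarrow> (\<lambda>N. s N $ r) \<longlonglongrightarrow> x $ r"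
 shows "(\<lambda>N. ip (s N) (M *\<^sub>v s N)) \<longlonglongrightarrow> ip x (M *\<^sub>v x)"
 unfolding quad_form_sum[OF M x] quad_form_sum[OF M s] by (intro tendsto_intros lim) auto

text \<open>Quadratic forms are continuous, so rational vectors suffice; the event becomes a
  countable intersection.\<close>

lemma spec_norm_le_iff_rat:
 assumes E: "sym_psd n E" and c: "0 \<le> c"
 shows "spec_norm E \<le> c \<longleftrightarrow> (\<forall>x\<in>rat_vecs n. ip x (E *\<^sub>v x) \<le> c * ip x x)"
proof
 assume le: "spec_norm E \<le> c"
 show "\<forall>x\<in>rat_vecs n. ip x (E *\<^sub>v x) \<le> c * ip x x"
 proof
  fix x assume "x \<in> rat_vecs n"
  then have "ip x (E *\<^sub>v x) \<le> spec_norm E * ip x x" by (intro spec_norm_psd_ge[OF E] rat_vecs_carrier)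
  also have "... \<le> c * ip x x" using le by (intro mult_right_mono ip_self_nonneg)
  finally show "ip x (E *\<^sub>v x) \<le> c * ip x x" .
 qed
next
 assume R: "\<forall>x\<in>rat_vecs n. ip x (E *\<^sub>v x) \<le> c * ip x x"
 show "spec_norm E \<le> c"
 proof (rule spec_norm_psd_le[OF E c])
  fix v :: "real vec" assume v: "v \<in> carrier_vec n"
  obtain s where s: "\<And>N. s N \<in> rat_vecs n" "\<And>r. r < n \<Longrightarrow> (\<lambda>N. s N $ r) \<longlonglongrightarrow> v $ r"
   using rat_vecs_approx[OF v] by blast
  have sc: "s N \<in> carrier_vec n" for N by (rule rat_vecs_carrier[OF s(1)])
  have "(\<lambda>N. ip (s N) (E *\<^sub>v s N)) \<longlonglongrightarrow> ip v (E *\<^sub>v v)" by (rule quad_form_tendsto[OF sym_psdD(1)[OF E] v sc s(2)])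
  moreover have "(\<lambda>N. c * ip (s N) (s N)) \<longlonglongrightarrow> c * ip v v"
   unfolding ip_sum[OF sc sc] ip_sum[OF v v] by (intro tendsto_intros s(2)) auto
  ultimately show "ip v (E *\<^sub>v v) \<le> c * ip v v" using R s(1) by (intro LIMSEQ_le) auto
 qed
qed

text \<open>The pseudoinverse is not continuous, so measurability is not read off the formula. The
  error form is the attained minimum over \<open>z\<close> of forms polynomial in \<open>g\<close>;
  a strict inequality for the minimum holds if and only if it holds for some rational
  \<open>z\<close>, which gives a countable union.\<close>

lemma measurable_nystrom_quad:
 assumes A: "sym_psd n A" and S: "S \<in> carrier_mat n n" and x: "x \<in> carrier_vec n"
 shows "(\<lambda>g. ip x ((A - nystrom A (S * to_mat n m g)) *\<^sub>v x)) \<in> borel_measurable (gaussm n m)"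
 unfolding borel_measurable_iff_less
proof
 fix c
 let ?M = "gaussm n m"
 define \<Omega> where "\<Omega> = (\<lambda>g. S * to_mat n m g)"
 have O: "\<Omega> g \<in> carrier_mat n m" for g unfolding \<Omega>_def using S by auto
 define q where "q = (\<lambda>g z. ip (x - \<Omega> g *\<^sub>v z) (A *\<^sub>v (x - \<Omega> g *\<^sub>v z)))"
 have Ac: "A \<in> carrier_mat n n" by (rule sym_psdD(1)[OF A])
 have rc: "x - \<Omega> g *\<^sub>v z \<in> carrier_vec n" if "z \<in> carrier_vec m" for g z
  by (rule vec_sub_carrier[OF x mult_mat_vec_carrier[OF O that]])
 have re: "(x - \<Omega> g *\<^sub>v z) $ r = x $ r - (\<Sum>c<m. (\<Sum>l<n. S $$ (r, l) * g (l, c)) * z $ c)" if z: "z \<in> carrier_vec m" and r: "r < n" for g z r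
 proof -
  have "(x - \<Omega> g *\<^sub>v z) $ r = x $ r - (\<Omega> g *\<^sub>v z) $ r"
   by (rule index_minus_vec(1)) (use r carrier_vecD[OF mult_mat_vec_carrier[OF O z, of g]] in simp)
  also have "(\<Omega> g *\<^sub>v z) $ r = (\<Sum>c<m. \<Omega> g $$ (r, c) * z $ c)" by (rule mult_mat_vec_entry[OF O z r])
  also have "... = (\<Sum>c<m. (\<Sum>l<n. S $$ (r, l) * g (l, c)) * z $ c)"
  proof (intro sum.cong refl arg_cong2[where f="(*)"])
   fix c assume "c \<in> {..<m}"
   then show "\<Omega> g $$ (r, c) = (\<Sum>l<n. S $$ (r, l) * g (l, c))"
    unfolding \<Omega>_def using r by (subst mult_mat_entry[OF S to_mat_carrier]) (auto simp: to_mat_def)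
  qed
  finally show ?thesis .
 qed
 have qm: "(\<lambda>g. q g z) \<in> borel_measurable ?M" if z: "z \<in> carrier_vec m" for z
 proof -
  have gm: "(\<lambda>g. g (l, c)) \<in> borel_measurable ?M" if "l < n" "c < m" for l c
   using that by (simp add: sets_gauss cong: measurable_cong_sets)
  have "(\<lambda>g. (x - \<Omega> g *\<^sub>v z) $ r) \<in> borel_measurable ?M" if "r < n" for r
   unfolding re[OF z that]
   by (intro borel_measurable_diff borel_measurable_sum borel_measurable_times borel_measurable_const gm) auto
  then show ?thesis unfolding q_def quad_form_sum[OF Ac rc[OF z]]
   by (intro borel_measurable_sum borel_measurable_times borel_measurable_const) auto
 qed
 have "{g \<in> space ?M. ip x ((A - nystrom A (\<Omega> g)) *\<^sub>v x) < c} = (\<Union>z\<in>rat_vecs m. {g \<in> space ?M. q g z < c})"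
 proof (intro Set.set_eqI iffI)
  fix g assume g: "g \<in> {g \<in> space ?M. ip x ((A - nystrom A (\<Omega> g)) *\<^sub>v x) < c}"
  then obtain z where z: "z \<in> carrier_vec m" "q g z < c"
   using nystrom_error(3)[OF A O x, of g] unfolding q_def by auto
  obtain s where s: "\<And>N. s N \<in> rat_vecs m" "\<And>r. r < m \<Longrightarrow> (\<lambda>N. s N $ r) \<longlonglongrightarrow> z $ r"
   using rat_vecs_approx[OF z(1)] by blast
  have sc: "s N \<in> carrier_vec m" for N by (rule rat_vecs_carrier[OF s(1)])
  have "(\<lambda>N. q g (s N)) \<longlonglongrightarrow> q g z" unfolding q_def
  proof (rule quad_form_tendsto[OF Ac rc[OF z(1)] rc[OF sc]])
   fix r assume r: "r < n"
   show "(\<lambda>N. (x - \<Omega> g *\<^sub>v s N) $ r) \<longlonglongrightarrow> (x - \<Omega> g *\<^sub>v z) $ r"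
    unfolding re[OF z(1) r] re[OF sc r] by (intro tendsto_intros s(2)) auto
  qed
  then have "eventually (\<lambda>N. q g (s N) < c) sequentially" using z(2) by (rule order_tendstoD)
  then obtain N where "q g (s N) < c" by (auto simp: eventually_sequentially)
  then show "g \<in> (\<Union>z\<in>rat_vecs m. {g \<in> space ?M. q g z < c})" using g s(1) by auto
 next
  fix g assume "g \<in> (\<Union>z\<in>rat_vecs m. {g \<in> space ?M. q g z < c})"
  then obtain z where z: "z \<in> rat_vecs m" "g \<in> space ?M" "q g z < c" by auto
  then show "g \<in> {g \<in> space ?M. ip x ((A - nystrom A (\<Omega> g)) *\<^sub>v x) < c}"
   using nystrom_error(2)[OF A O x rat_vecs_carrier[OF z(1)], of g] unfolding q_def by simp
 qed
 also have "... \<in> sets ?M"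
  using qm[OF rat_vecs_carrier] by (intro sets.countable_UN' countable_rat_vecs) (auto simp: borel_measurable_iff_less)
 finally show "{g \<in> space ?M. ip x ((A - nystrom A (S * to_mat n m g)) *\<^sub>v x) < c} \<in> sets ?M" unfolding \<Omega>_def .
qed

lemma sets_nystrom_spec:
 assumes A: "sym_psd n A" and S: "S \<in> carrier_mat n n" and c: "0 \<le> c"
 shows "{g \<in> space (gaussm n m). spec_norm (A - nystrom A (S * to_mat n m g)) \<le> c} \<in> sets (gaussm n m)"
proof -
 let ?M = "gaussm n m"
 have O: "S * to_mat n m g \<in> carrier_mat n m" for g using S by auto
 have "Measurable.pred ?M (\<lambda>g. \<forall>x\<in>rat_vecs n. ip x ((A - nystrom A (S * to_mat n m g)) *\<^sub>v x) \<le> c * ip x x)"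
  unfolding ball_rat_vecs
 proof (intro pred_intros_countable)
  fix xs :: "rat list"
  let ?x = "Matrix.vec n (\<lambda>c. real_of_rat (xs ! c))"
  have "(\<lambda>g. ip ?x ((A - nystrom A (S * to_mat n m g)) *\<^sub>v ?x)) \<in> borel_measurable ?M"
   by (rule measurable_nystrom_quad[OF A S]) simp
  then show "Measurable.pred ?M (\<lambda>g. ip ?x ((A - nystrom A (S * to_mat n m g)) *\<^sub>v ?x) \<le> c * ip ?x ?x)"
   by measurable
 qed
 then show ?thesis unfolding spec_norm_le_iff_rat[OF nystrom_error(1)[OF A O] c] pred_def .
qed

lemma sets_nystrom_nuc:
 assumes A: "sym_psd n A" and S: "S \<in> carrier_mat n n"
 shows "{g \<in> space (gaussm n m). nuc_norm (A - nystrom A (S * to_mat n m g)) \<le> c} \<in> sets (gaussm n m)"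
proof -
 let ?M = "gaussm n m"
 have O: "S * to_mat n m g \<in> carrier_mat n m" for g using S by auto
 have "orthonormal_family n n (unit_vec n)" by (auto simp: orthonormal_family_def)
 then have nuc: "nuc_norm (A - nystrom A (S * to_mat n m g)) = (\<Sum>i<n. ip (unit_vec n i) ((A - nystrom A (S * to_mat n m g)) *\<^sub>v unit_vec n i))" for g
  using nuc_norm_psd[OF nystrom_error(1)[OF A O]] trace_orthonormal sym_psdD(1)[OF nystrom_error(1)[OF A O]] by metis
 have "(\<lambda>g. nuc_norm (A - nystrom A (S * to_mat n m g))) \<in> borel_measurable ?M"
  unfolding nuc by (intro borel_measurable_sum measurable_nystrom_quad[OF A S]) auto
 then show ?thesis by measurable
qed

section \<open>Block factorisation of the covariance\<close>

lemma congruence_entry: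
 fixes X Y S :: "real mat"
 assumes X: "X \<in> carrier_mat n a" and Y: "Y \<in> carrier_mat n c" and S: "S \<in> carrier_mat n n" and ij: "i < a" "j < c"
 shows "(X\<^sup>T * (S * S\<^sup>T) * Y) $$ (i, j) = ip (S\<^sup>T *\<^sub>v col X i) (S\<^sup>T *\<^sub>v col Y j)"
proof -
 have St: "S\<^sup>T \<in> carrier_mat n n" using S by simp
 have cx: "col X i \<in> carrier_vec n" "col Y j \<in> carrier_vec n" using X Y by (auto intro: col_dim)
 have sv: "S\<^sup>T *\<^sub>v col Y j \<in> carrier_vec n" by (rule mult_mat_vec_carrier[OF St cx(2)])
 have K: "S * S\<^sup>T \<in> carrier_mat n n" by (rule mult_carrier_mat[OF S St])
 have "X\<^sup>T * (S * S\<^sup>T) * Y = X\<^sup>T * ((S * S\<^sup>T) * Y)"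
  using X Y S by (intro mult_assoc_dim) auto
 also have "... $$ (i, j) = ip (Matrix.row (X\<^sup>T) i) (col ((S * S\<^sup>T) * Y) j)"
  using X Y S ij by (intro index_mult_mat(1)) auto
 also have "Matrix.row (X\<^sup>T) i = col X i" using X ij by simp
 also have "col ((S * S\<^sup>T) * Y) j = (S * S\<^sup>T) *\<^sub>v col Y j" by (rule col_mult2[OF K Y ij(2)])
 also have "... = S *\<^sub>v (S\<^sup>T *\<^sub>v col Y j)" by (rule assoc_mult_mat_vec[OF S St cx(2)])
 also have "ip (col X i) (S *\<^sub>v (S\<^sup>T *\<^sub>v col Y j)) = ip (S\<^sup>T *\<^sub>v col X i) (S\<^sup>T *\<^sub>v col Y j)"
  by (rule ip_mult_mat_vec[OF S sv cx(1)])
 finally show ?thesis .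
qed

lemma mult_transpose_entry:
 fixes M N :: "real mat"
 assumes "M \<in> carrier_mat a c" "N \<in> carrier_mat b c" "i < a" "j < b"
 shows "(M * N\<^sup>T) $$ (i, j) = (\<Sum>l<c. M $$ (i, l) * N $$ (j, l))"
 using assms by (subst mult_mat_entry[of _ a c _ b]) auto

lemma col_U1: "U \<in> carrier_mat n n \<Longrightarrow> k \<le> n \<Longrightarrow> i < k \<Longrightarrow> col (U1 n k U) i = col U i"
 by (rule eq_vecI) (auto simp: U1_def)

lemma col_U2: "U \<in> carrier_mat n n \<Longrightarrow> k \<le> n \<Longrightarrow> j < n - k \<Longrightarrow> col (U2 n k U) j = col U (j + k)"
 by (rule eq_vecI) (auto simp: U2_def)

text \<open>Choosing an orthonormal basis adapted to the kernel of \<open>U\<^sub>1\<^sup>T S\<close> makes the covariance factor block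
 lower triangular; the lower right block is then a square root of the Schur complement.\<close>
lemma covariance_factorisation:
 fixes U S K :: "real mat"
 assumes U: "orthonormal_mat n U" and kn: "k \<le> n" and S: "S \<in> carrier_mat n n" and SK: "S * S\<^sup>T = K"
  and K11: "invertible_mat (Ktil11 n k U K)"
 obtains w L Li M R where
  "orthonormal_family n n w"
  "L \<in> carrier_mat k k" "Li \<in> carrier_mat k k" "M \<in> carrier_mat (n - k) k" "R \<in> carrier_mat (n - k) (n - k)"
  "L * Li = 1\<^sub>m k" "Li * L = 1\<^sub>m k"
  "\<And>i a. i < k \<Longrightarrow> a < k \<Longrightarrow> ip (S\<^sup>T *\<^sub>v col U i) (w a) = L $$ (i, a)"
  "\<And>i b. i < k \<Longrightarrow> b < n - k \<Longrightarrow> ip (S\<^sup>T *\<^sub>v col U i) (w (b + k)) = 0"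
  "\<And>j a. j < n - k \<Longrightarrow> a < k \<Longrightarrow> ip (S\<^sup>T *\<^sub>v col U (j + k)) (w a) = M $$ (j, a)"
  "\<And>j b. j < n - k \<Longrightarrow> b < n - k \<Longrightarrow> ip (S\<^sup>T *\<^sub>v col U (j + k)) (w (b + k)) = R $$ (j, b)"
  "Ktil11 n k U K = L * L\<^sup>T" "Ktil21 n k U K = M * L\<^sup>T"
  "Ktil22 n k U K = M * M\<^sup>T + R * R\<^sup>T"
proof -
 have Uc: "U \<in> carrier_mat n n" using U by (simp add: orthonormal_mat_def)
 define s where "s = (\<lambda>i. S\<^sup>T *\<^sub>v col U i)"
 have sd: "S\<^sup>T *\<^sub>v col U i = s i" for i by (simp add: s_def)
 have St: "S\<^sup>T \<in> carrier_mat n n" using S by simp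
 have sc: "s i \<in> carrier_vec n" for i
  unfolding s_def by (rule mult_mat_vec_carrier[OF St]) (use Uc in \<open>auto intro: col_dim\<close>)
 define P where "P = Matrix.mat k n (\<lambda>(i, r). s i $ r)"
 have P: "P \<in> carrier_mat k n" by (simp add: P_def)
 \<comment> \<open>\<open>w2\<close> consists of directions orthogonal to all \<open>s i\<close>
   with \<open>i < k\<close>, which produces the zero block; \<open>w1\<close> completes it to a
   basis.\<close>
 obtain w2 where w2: "orthonormal_family n (n - k) w2" "\<forall>i<n-k. P *\<^sub>v w2 i = 0\<^sub>v k"
  using orthonormal_in_kernel[OF P, of "n - k"] kn by auto
 have w2c: "w2 b \<in> carrier_vec n" if "b < n - k" for b using w2(1) that by (simp add: orthonormal_family_def)
 define P2 where "P2 = Matrix.mat (n - k) n (\<lambda>(i, r). w2 i $ r)"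
 have P2: "P2 \<in> carrier_mat (n - k) n" by (simp add: P2_def)
 obtain w1 where w1: "orthonormal_family n k w1" "\<forall>i<k. P2 *\<^sub>v w1 i = 0\<^sub>v (n - k)"
  using orthonormal_in_kernel[OF P2, of k] kn by auto
 have w1c: "w1 a \<in> carrier_vec n" if "a < k" for a using w1(1) that by (simp add: orthonormal_family_def)
 have sw2: "ip (s i) (w2 b) = 0" if "i < k" "b < n - k" for i b
 proof -
  have "ip (s i) (w2 b) = (P *\<^sub>v w2 b) $ i"
   unfolding ip_sum[OF sc w2c[OF that(2)]] by (subst mult_mat_vec_entry[OF P w2c[OF that(2)] that(1)]) (use that in \<open>simp add: P_def\<close>)
  then show ?thesis using w2(2) that by simp
 qed
 have w21: "ip (w2 b) (w1 a) = 0" if "a < k" "b < n - k" for a b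
 proof -
  have "ip (w2 b) (w1 a) = (P2 *\<^sub>v w1 a) $ b"
   unfolding ip_sum[OF w2c[OF that(2)] w1c[OF that(1)]]
   by (subst mult_mat_vec_entry[OF P2 w1c[OF that(1)] that(2)]) (use that in \<open>simp add: P2_def\<close>)
  then show ?thesis using w1(2) that by simp
 qed
 define w where "w = (\<lambda>i. if i < k then w1 i else w2 (i - k))"
 have wo: "orthonormal_family n n w"
  unfolding orthonormal_family_def
 proof (intro conjI allI impI)
  fix i assume "i < n" then show "w i \<in> carrier_vec n" using w1c[of i] w2c[of "i - k"] by (auto simp: w_def)
 next
  fix i j assume ij: "i < n" "j < n"
  consider "i < k" "j < k" | "i < k" "\<not> j < k" | "\<not> i < k" "j < k" | "\<not> i < k" "\<not> j < k" by blast
  then show "ip (w i) (w j) = (if i = j then 1 else 0)"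
  proof cases
   case 1 then show ?thesis using w1(1) by (simp add: w_def orthonormal_family_def)
  next
   case 2
   then have "j - k < n - k" using ij by simp
   then show ?thesis using 2 w21[of i "j - k"] ip_comm[OF w1c[OF 2(1)] w2c[of "j - k"]] by (auto simp: w_def)
  next
   case 3
   then have "i - k < n - k" using ij by simp
   then show ?thesis using 3 w21[of j "i - k"] by (auto simp: w_def)
  next
   case 4
   then have "i - k < n - k" "j - k < n - k" "i - k = j - k \<longleftrightarrow> i = j" using ij by auto
   then show ?thesis using 4 w2(1) by (simp add: w_def orthonormal_family_def)
  qed
 qed
 have wc: "i < n \<Longrightarrow> w i \<in> carrier_vec n" for i using wo by (simp add: orthonormal_family_def)
 define L where "L = Matrix.mat k k (\<lambda>(i, a). ip (s i) (w a))"
 define M where "M = Matrix.mat (n - k) k (\<lambda>(j, a). ip (s (j + k)) (w a))"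
 define R where "R = Matrix.mat (n - k) (n - k) (\<lambda>(j, b). ip (s (j + k)) (w (b + k)))"
 have car: "L \<in> carrier_mat k k" "M \<in> carrier_mat (n - k) k" "R \<in> carrier_mat (n - k) (n - k)"
  by (simp_all add: L_def M_def R_def)
 have swk: "ip (s i) (w (b + k)) = 0" if "i < k" "b < n - k" for i b using sw2[OF that] by (simp add: w_def)
 have ss: "ip (s i) (s j) = (\<Sum>a<k. ip (s i) (w a) * ip (s j) (w a)) + (\<Sum>b<n-k. ip (s i) (w (b + k)) * ip (s j) (w (b + k)))" for i j
 proof -
  have "ip (s i) (s j) = (\<Sum>l<n. ip (s i) (w l) * ip (s j) (w l))"
   unfolding orthonormal_parseval_bilinear[OF wo sc sc]
   by (intro sum.cong refl arg_cong2[where f="(*)"] ip_comm[OF wc sc]) auto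
  then show ?thesis unfolding sum_split_at[OF kn] .
 qed
 have U12: "U1 n k U \<in> carrier_mat n k" "U2 n k U \<in> carrier_mat n (n - k)" by (simp_all add: U1_def U2_def)
 have K1: "Ktil11 n k U K = L * L\<^sup>T"
 proof (rule eq_matI)
  fix i j assume "i < dim_row (L * L\<^sup>T)" "j < dim_col (L * L\<^sup>T)"
  then have ij: "i < k" "j < k" using car by auto
  show "Ktil11 n k U K $$ (i, j) = (L * L\<^sup>T) $$ (i, j)"
   unfolding Ktil11_def SK[symmetric] congruence_entry[OF U12(1) U12(1) S ij] mult_transpose_entry[OF car(1) car(1) ij]
    col_U1[OF Uc kn ij(1)] col_U1[OF Uc kn ij(2)] sd ss
   using ij swk by (simp add: L_def)
 qed (use car U12 in \<open>auto simp: Ktil11_def\<close>)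
 have K2: "Ktil21 n k U K = M * L\<^sup>T"
 proof (rule eq_matI)
  fix i j assume "i < dim_row (M * L\<^sup>T)" "j < dim_col (M * L\<^sup>T)"
  then have ij: "i < n - k" "j < k" using car by auto
  show "Ktil21 n k U K $$ (i, j) = (M * L\<^sup>T) $$ (i, j)"
   unfolding Ktil21_def SK[symmetric] congruence_entry[OF U12(2) U12(1) S ij] mult_transpose_entry[OF car(2) car(1) ij]
    col_U2[OF Uc kn ij(1)] col_U1[OF Uc kn ij(2)] sd ss
   using ij swk by (simp add: L_def M_def)
 qed (use car U12 in \<open>auto simp: Ktil21_def\<close>)
 have K3: "Ktil22 n k U K = M * M\<^sup>T + R * R\<^sup>T"
 proof (rule eq_matI)
  fix i j assume "i < dim_row (M * M\<^sup>T + R * R\<^sup>T)" "j < dim_col (M * M\<^sup>T + R * R\<^sup>T)"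
  then have ij: "i < n - k" "j < n - k" using car by auto
  have "(M * M\<^sup>T + R * R\<^sup>T) $$ (i, j) = (M * M\<^sup>T) $$ (i, j) + (R * R\<^sup>T) $$ (i, j)"
   using ij car by (intro index_add_mat(1)) auto
  then show "Ktil22 n k U K $$ (i, j) = (M * M\<^sup>T + R * R\<^sup>T) $$ (i, j)"
   unfolding Ktil22_def SK[symmetric] congruence_entry[OF U12(2) U12(2) S ij] mult_transpose_entry[OF car(2) car(2) ij] mult_transpose_entry[OF car(3) car(3) ij]
    col_U2[OF Uc kn ij(1)] col_U2[OF Uc kn ij(2)] sd ss
   using ij by (simp add: M_def R_def)
 qed (use car U12 in \<open>auto simp: Ktil22_def\<close>)
 obtain X where X: "Ktil11 n k U K * X = 1\<^sub>m k" "X * Ktil11 n k U K = 1\<^sub>m (dim_row X)"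
  using K11 car unfolding invertible_mat_def inverts_mat_def K1 by auto
 have X2: "L * L\<^sup>T * X = 1\<^sub>m k" "X * (L * L\<^sup>T) = 1\<^sub>m (dim_row X)" using X unfolding K1 by auto
 have "dim_col X = k" using arg_cong[OF X2(1), of dim_col] by simp
 moreover have "dim_row X = k" using arg_cong[OF X2(2), of dim_col] car by simp
 ultimately have Xc: "X \<in> carrier_mat k k" by auto
 \<comment> \<open>Invertibility of \<open>L * L\<^sup>T\<close> transfers to its square factor
   \<open>L\<close>.\<close>
 define Li where "Li = L\<^sup>T * X"
 have Li: "Li \<in> carrier_mat k k" using car Xc by (simp add: Li_def)
 have LLi: "L * Li = 1\<^sub>m k"
  unfolding Li_def X2(1)[symmetric] using car Xc by (intro mult_assoc_dim[symmetric]) auto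
 have LiL: "Li * L = 1\<^sub>m k" by (rule mat_mult_left_right_inverse[OF car(1) Li LLi])
 show ?thesis
  by (rule that[OF wo car(1) Li car(2,3) LLi LiL _ _ _ _ K1 K2 K3])
   (use swk in \<open>auto simp: L_def M_def R_def s_def\<close>)
qed

text \<open>\<open>L\<close> is an invertible square root of the leading block, so the inverse of
  that block cancels factors of \<open>L\<close>: the Schur complement loses
  \<open>M * M\<^sup>T\<close> and keeps \<open>R * R\<^sup>T\<close>, and \<open>Ktil21\<close>
  times the inverse is \<open>M * Li\<close>. This writes the matrices inside \<open>beta_k\<close>
  and \<open>delta_k\<close> as products with their own transpose.\<close>

lemma whitened_parameters:
 fixes \<sigma> :: "nat \<Rightarrow> real"
 assumes L: "L \<in> carrier_mat k k" and Li: "Li \<in> carrier_mat k k" and M: "M \<in> carrier_mat (n - k) k"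
  and R: "R \<in> carrier_mat (n - k) (n - k)" and inv: "L * Li = 1\<^sub>m k" "Li * L = 1\<^sub>m k"
  and K1: "Ktil11 n k U K = L * L\<^sup>T" and K2: "Ktil21 n k U K = M * L\<^sup>T"
  and K3: "Ktil22 n k U K = M * M\<^sup>T + R * R\<^sup>T"
 defines "H \<equiv> Sigma2_half n k \<sigma>"
 shows "mat_inv (Ktil11 n k U K) = Li\<^sup>T * Li"
  and "H * Ktil22_1 n k U K * H = (H * R) * (H * R)\<^sup>T"
  and "H * Ktil21 n k U K * mat_inv (Ktil11 n k U K) * mat_inv (Ktil11 n k U K) * (Ktil21 n k U K)\<^sup>T * H
   = (H * (M * Li)) * (H * (M * Li))\<^sup>T"
proof -
 note d = carrier_matD[OF L] carrier_matD[OF Li] carrier_matD[OF M] carrier_matD[OF R]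
 have tinv: "L\<^sup>T * Li\<^sup>T = 1\<^sub>m k" "Li\<^sup>T * L\<^sup>T = 1\<^sub>m k"
  using inv d by (simp_all flip: transpose_mult_dim)
 note c = cancel_mult_dim[OF inv(1)] cancel_mult_dim[OF inv(2)] cancel_mult_dim[OF tinv(1)] cancel_mult_dim[OF tinv(2)]
 have Hd: "dim_row H = n - k" "dim_col H = n - k" "H\<^sup>T = H"
  by (auto simp: H_def Sigma2_half_def mat_diag_def intro!: eq_matI)
 show mi: "mat_inv (Ktil11 n k U K) = Li\<^sup>T * Li"
  unfolding K1
 proof (rule mat_inv_eq)
  show "L * L\<^sup>T * (Li\<^sup>T * Li) = 1\<^sub>m k"
   using d by (simp add: mult_assoc_dim c inv)
 qed (use L Li in auto)
 have "Ktil21 n k U K * mat_inv (Ktil11 n k U K) * (Ktil21 n k U K)\<^sup>T = M * M\<^sup>T"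
  unfolding mi K2 using d by (simp add: mult_assoc_dim transpose_mult_dim c)
 then have "Ktil22_1 n k U K = R * R\<^sup>T"
  unfolding Ktil22_1_def K3 using d by (intro eq_matI) auto
 then show "H * Ktil22_1 n k U K * H = (H * R) * (H * R)\<^sup>T"
  using d Hd by (simp add: mult_assoc_dim transpose_mult_dim)
 show "H * Ktil21 n k U K * mat_inv (Ktil11 n k U K) * mat_inv (Ktil11 n k U K) * (Ktil21 n k U K)\<^sup>T * H
   = (H * (M * Li)) * (H * (M * Li))\<^sup>T"
  unfolding mi K2 using d Hd by (simp add: mult_assoc_dim transpose_mult_dim c)
qed

lemma gram_sym_psd:
 assumes D: "D \<in> carrier_mat b c"
 shows "sym_psd b (D * D\<^sup>T)"
 unfolding sym_psd_def
proof (intro conjI ballI)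
 have Dt: "D\<^sup>T \<in> carrier_mat c b" using D by simp
 show "D * D\<^sup>T \<in> carrier_mat b b" by (rule mult_carrier_mat[OF D Dt])
 show "(D * D\<^sup>T)\<^sup>T = D * D\<^sup>T" using D by (simp add: transpose_mult_dim)
 fix v :: "real vec" assume v: "v \<in> carrier_vec b"
 have tv: "D\<^sup>T *\<^sub>v v \<in> carrier_vec c" by (rule mult_mat_vec_carrier[OF Dt v])
 show "0 \<le> ip v (D * D\<^sup>T *\<^sub>v v)"
  unfolding assoc_mult_mat_vec[OF D Dt v] ip_mult_mat_vec[OF D tv v] by (rule ip_self_nonneg)
qed

lemma gram_norms:
 assumes D: "D \<in> carrier_mat b c"
 shows "nuc_norm (D * D\<^sup>T) = (\<Sum>j<b. \<Sum>i<c. (D $$ (j, i))^2)"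
  and "(\<Sum>j<b. (\<Sum>i<c. D $$ (j, i) * y i)^2) \<le> spec_norm (D * D\<^sup>T) * (\<Sum>i<c. (y i)^2)"
  and "(\<Sum>i<c. (\<Sum>j<b. D $$ (j, i) * x j)^2) \<le> spec_norm (D * D\<^sup>T) * (\<Sum>j<b. (x j)^2)"
proof -
 note psd = gram_sym_psd[OF D]
 have Dt: "D\<^sup>T \<in> carrier_mat c b" using D by simp
 show "nuc_norm (D * D\<^sup>T) = (\<Sum>j<b. \<Sum>i<c. (D $$ (j, i))^2)"
  unfolding nuc_norm_psd[OF psd] using mult_transpose_entry[OF D D] by (simp add: power2_eq_square)
 show *: "(\<Sum>i<c. (\<Sum>j<b. D $$ (j, i) * x j)^2) \<le> spec_norm (D * D\<^sup>T) * (\<Sum>j<b. (x j)^2)" for x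
 proof -
  define v where "v = Matrix.vec b x"
  have v: "v \<in> carrier_vec b" by (simp add: v_def)
  have tv: "D\<^sup>T *\<^sub>v v \<in> carrier_vec c" by (rule mult_mat_vec_carrier[OF Dt v])
  have "(D\<^sup>T *\<^sub>v v) $ i = (\<Sum>j<b. D $$ (j, i) * x j)" if "i < c" for i
   using that D by (subst mult_mat_vec_entry[OF Dt v that]) (simp add: v_def)
  then have "(\<Sum>i<c. (\<Sum>j<b. D $$ (j, i) * x j)^2) = ip v (D * D\<^sup>T *\<^sub>v v)"
   unfolding assoc_mult_mat_vec[OF D Dt v] ip_mult_mat_vec[OF D tv v] ip_sum[OF tv tv] by (simp add: power2_eq_square)
  also have "... \<le> spec_norm (D * D\<^sup>T) * ip v v" by (rule spec_norm_psd_ge[OF psd v])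
  also have "ip v v = (\<Sum>j<b. (x j)^2)" unfolding ip_sum[OF v v] by (simp add: v_def power2_eq_square)
  finally show ?thesis .
 qed
 show "(\<Sum>j<b. (\<Sum>i<c. D $$ (j, i) * y i)^2) \<le> spec_norm (D * D\<^sup>T) * (\<Sum>i<c. (y i)^2)"
  by (rule op_transpose[OF spec_norm_nonneg *])
qed

lemma sym_psd_zero: "sym_psd b (0\<^sub>m b b)"
proof -
 have "ip v (0\<^sub>m b b *\<^sub>v v) = 0" if "v \<in> carrier_vec b" for v :: "real vec"
  using that by (subst quad_form_sum[of _ b]) auto
 then show ?thesis by (auto simp: sym_psd_def)
qed

lemma spec_norm_zero: "spec_norm (0\<^sub>m b b) = 0"
proof -
 have "ip v (0\<^sub>m b b *\<^sub>v v) \<le> 0 * ip v v" if "v \<in> carrier_vec b" for v :: "real vec"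
  using that by (subst quad_form_sum[of _ b]) auto
 then have "spec_norm (0\<^sub>m b b) \<le> 0" by (intro spec_norm_psd_le[OF sym_psd_zero]) auto
 then show ?thesis using spec_norm_nonneg[of "0\<^sub>m b b"] by simp
qed

lemma nuc_norm_zero: "nuc_norm (0\<^sub>m b b) = 0"
 using nuc_norm_psd[OF sym_psd_zero[of b]] by simp

section \<open>The Gaussian matrix in the adapted basis\<close>

definition mix :: "nat \<Rightarrow> nat \<Rightarrow> nat \<Rightarrow> (nat \<Rightarrow> real vec) \<Rightarrow> (nat \<times> nat \<Rightarrow> real) \<Rightarrow> (nat \<times> nat \<Rightarrow> real) \<Rightarrow> nat \<times> nat \<Rightarrow> real" where
 "mix n k m w g h = (\<lambda>q\<in>{0..<n} \<times> {0..<m}. (\<Sum>a<k. w a $ fst q * g (a, snd q)) + (\<Sum>b<n-k. w (b + k) $ fst q * h (b, snd q)))"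

text \<open>\<open>mix\<close> writes the columns of the Gaussian matrix in the basis
  \<open>w\<close>; as a linear map on the disjoint sum of the index sets it has orthonormal rows
  because the basis matrix does.\<close>

lemma nn_integral_gauss_mix:
 assumes w: "orthonormal_family n n w" and kn: "k \<le> n"
  and F: "F \<in> borel_measurable (borelm n m)"
 shows "(\<integral>\<^sup>+z. F z \<partial>gaussm n m)
  = (\<integral>\<^sup>+g. (\<integral>\<^sup>+h. F (mix n k m w g h) \<partial>gaussm (n-k) m) \<partial>gaussm k m)"
proof -
 let ?A = "{0..<k} \<times> {0..<m}" and ?B = "{0..<n-k} \<times> {0..<m}" and ?J = "{0..<n} \<times> {0..<m}"
 define Q where "Q = (\<lambda>(r :: nat, c :: nat) s. case s of Inl (a :: nat, c' :: nat) \<Rightarrow> if c' = c then w a $ r else 0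
  | Inr (b :: nat, c' :: nat) \<Rightarrow> if c' = c then w (b + k) $ r else (0::real))"
 have Qsum: "(\<Sum>s\<in>?A <+> ?B. Q (r, c) s * f s) = (\<Sum>a<k. w a $ r * f (Inl (a, c))) + (\<Sum>b<n-k. w (b + k) $ r * f (Inr (b, c)))"
  if c: "c < m" for r c and f :: "(nat \<times> nat) + (nat \<times> nat) \<Rightarrow> real"
 proof -
  have one: "(\<Sum>c'<m. (if c' = c then x else 0) * y c') = x * y c" for x and y :: "nat \<Rightarrow> real"
   using c by (simp add: if_distrib[where f="\<lambda>z. z * _"] cong: if_cong)
  show ?thesis
   by (simp add: sum.Plus sum_pairs Q_def one)
 qed
 have Q: "orthonormal_on ?J (?A <+> ?B) Q"
  unfolding orthonormal_on_def
 proof (intro ballI)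
  fix q q' assume qs: "q \<in> ?J" "q' \<in> ?J"
  obtain r c r' c' where q: "q = (r, c)" "q' = (r', c')" by (cases q, cases q')
  have rc: "r < n" "c < m" "r' < n" "c' < m" using qs q by auto
  have "(\<Sum>s\<in>?A <+> ?B. Q q s * Q q' s) = (\<Sum>a<k. w a $ r * Q q' (Inl (a, c))) + (\<Sum>b<n-k. w (b + k) $ r * Q q' (Inr (b, c)))"
   unfolding q(1) by (rule Qsum[OF rc(2)])
  also have "... = (if c = c' then (\<Sum>a<k. w a $ r * w a $ r') + (\<Sum>b<n-k. w (b + k) $ r * w (b + k) $ r') else 0)"
   unfolding q(2) Q_def by simp
  also have "(\<Sum>a<k. w a $ r * w a $ r') + (\<Sum>b<n-k. w (b + k) $ r * w (b + k) $ r') = (\<Sum>l<n. w l $ r * w l $ r')"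
   by (rule sum_split_at[OF kn, symmetric])
  also have "... = (if r = r' then 1 else 0)" by (rule orthonormal_parseval(1)[OF w rc(1,3)])
  finally show "(\<Sum>s\<in>?A <+> ?B. Q q s * Q q' s) = (if q = q' then 1 else 0)" unfolding q by simp
 qed
 have fin: "finite ?A" "finite ?B" "finite (?A <+> ?B)" "finite ?J" by auto
 have Lm: "(\<lambda>x. F (\<lambda>j\<in>?J. \<Sum>s\<in>?A <+> ?B. Q j s * x s)) \<in> borel_measurable (PiM (?A <+> ?B) (\<lambda>_. borel))"
  by (rule measurable_compose[OF _ F]) measurable
 have eq: "(\<lambda>j\<in>?J. \<Sum>s\<in>?A <+> ?B. Q j s * (\<lambda>s\<in>?A <+> ?B. case s of Inl i \<Rightarrow> g i | Inr j \<Rightarrow> h j) s) = mix n k m w g h" for g h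
  unfolding mix_def
 proof (rule restrict_ext)
  fix q assume "q \<in> ?J"
  then obtain r c where q: "q = (r, c)" "c < m" by auto
  have "(\<Sum>s\<in>?A <+> ?B. Q q s * (\<lambda>s\<in>?A <+> ?B. case s of Inl i \<Rightarrow> g i | Inr j \<Rightarrow> h j) s)
   = (\<Sum>s\<in>?A <+> ?B. Q q s * (case s of Inl i \<Rightarrow> g i | Inr j \<Rightarrow> h j))" by (intro sum.cong) auto
  then show "(\<Sum>s\<in>?A <+> ?B. Q q s * (\<lambda>s\<in>?A <+> ?B. case s of Inl i \<Rightarrow> g i | Inr j \<Rightarrow> h j) s)
   = (\<Sum>a<k. w a $ fst q * g (a, snd q)) + (\<Sum>b<n-k. w (b + k) $ fst q * h (b, snd q))"
   unfolding q(1) Qsum[OF q(2)] by simp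
 qed
 show ?thesis
  unfolding nn_integral_gauss_orthonormal[OF fin(3,4) Q F, symmetric] nn_integral_gauss_Plus[OF fin(1,2) Lm] eq ..
qed

lemma mix_entry:
 assumes X: "X \<in> carrier_mat n d" and S: "S \<in> carrier_mat n n" and w: "orthonormal_family n n w" and kn: "k \<le> n"
  and i: "i < d" and c: "c < m"
 shows "(X\<^sup>T * (S * to_mat n m (mix n k m w g h))) $$ (i, c)
  = (\<Sum>a<k. ip (S\<^sup>T *\<^sub>v col X i) (w a) * g (a, c)) + (\<Sum>b<n-k. ip (S\<^sup>T *\<^sub>v col X i) (w (b + k)) * h (b, c))"
proof -
 let ?Z = "to_mat n m (mix n k m w g h)"
 have Z: "?Z \<in> carrier_mat n m" by simp
 have St: "S\<^sup>T \<in> carrier_mat n n" using S by simp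
 have cx: "col X i \<in> carrier_vec n" using col_dim[of X i] X by simp
 have cz: "col ?Z c \<in> carrier_vec n" using col_dim[of ?Z c] by simp
 define s where "s = S\<^sup>T *\<^sub>v col X i"
 have s: "s \<in> carrier_vec n" unfolding s_def by (rule mult_mat_vec_carrier[OF St cx])
 have wc: "w l \<in> carrier_vec n" if "l < n" for l using w that by (simp add: orthonormal_family_def)
 have "(X\<^sup>T * (S * ?Z)) $$ (i, c) = ip (Matrix.row (X\<^sup>T) i) (col (S * ?Z) c)"
  using X S i c by (intro index_mult_mat(1)) auto
 also have "Matrix.row (X\<^sup>T) i = col X i" using X i by simp
 also have "col (S * ?Z) c = S *\<^sub>v col ?Z c" by (rule col_mult2[OF S Z c])
 also have "ip (col X i) (S *\<^sub>v col ?Z c) = ip s (col ?Z c)" unfolding s_def by (rule ip_mult_mat_vec[OF S cz cx])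
 also have "... = (\<Sum>r<n. s $ r * mix n k m w g h (r, c))"
  unfolding ip_sum[OF s cz] using c by (intro sum.cong) (auto simp: to_mat_def)
 also have "... = (\<Sum>r<n. (\<Sum>a<k. s $ r * w a $ r * g (a, c)) + (\<Sum>b<n-k. s $ r * w (b + k) $ r * h (b, c)))"
  using c by (intro sum.cong) (auto simp: mix_def distrib_left sum_distrib_left mult.assoc)
 also have "... = (\<Sum>a<k. \<Sum>r<n. s $ r * w a $ r * g (a, c)) + (\<Sum>b<n-k. \<Sum>r<n. s $ r * w (b + k) $ r * h (b, c))"
  unfolding sum.distrib by (intro arg_cong2[where f="(+)"] sum.swap)
 also have "... = (\<Sum>a<k. ip s (w a) * g (a, c)) + (\<Sum>b<n-k. ip s (w (b + k)) * h (b, c))"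
  using kn by (intro arg_cong2[where f="(+)"] sum.cong refl) (auto simp: ip_sum[OF s wc] sum_distrib_right)
 finally show ?thesis unfolding s_def .
qed

text \<open>The right inverse inside \<open>N\<close> cancels the block \<open>G\<close> standing to
  its left, so the part correlated with the leading block becomes the deterministic matrix
  \<open>M * Li\<close>, and the randomness of \<open>H\<close> enters only through
  \<open>R H N\<close>.\<close>

lemma sampled_factor:
 fixes \<sigma> :: "nat \<Rightarrow> real" and h :: "nat \<times> nat \<Rightarrow> real"
 assumes U: "U \<in> carrier_mat n n" and kn: "k \<le> n" and S: "S \<in> carrier_mat n n" and w: "orthonormal_family n n w"
  and L: "L \<in> carrier_mat k k" and Li: "Li \<in> carrier_mat k k" and M: "M \<in> carrier_mat (n - k) k"
  and R: "R \<in> carrier_mat (n - k) (n - k)" and inv: "L * Li = 1\<^sub>m k"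
  and sL: "\<And>i a. i < k \<Longrightarrow> a < k \<Longrightarrow> ip (S\<^sup>T *\<^sub>v col U i) (w a) = L $$ (i, a)"
  and s0: "\<And>i b. i < k \<Longrightarrow> b < n - k \<Longrightarrow> ip (S\<^sup>T *\<^sub>v col U i) (w (b + k)) = 0"
  and sM: "\<And>j a. j < n - k \<Longrightarrow> a < k \<Longrightarrow> ip (S\<^sup>T *\<^sub>v col U (j + k)) (w a) = M $$ (j, a)"
  and sR: "\<And>j b. j < n - k \<Longrightarrow> b < n - k \<Longrightarrow> ip (S\<^sup>T *\<^sub>v col U (j + k)) (w (b + k)) = R $$ (j, b)"
  and det: "gdet k m g \<noteq> 0"
 defines "\<Omega> \<equiv> S * to_mat n m (mix n k m w g h)" and "N \<equiv> rinv k m g * Li" and "H \<equiv> Sigma2_half n k \<sigma>"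
 shows "(U1 n k U)\<^sup>T * \<Omega> * N = 1\<^sub>m k"
  and "H * ((U2 n k U)\<^sup>T * \<Omega> * N) = H * (M * Li) + H * R * (to_mat (n - k) m h * N)"
proof -
 note d = carrier_matD[OF L] carrier_matD[OF Li] carrier_matD[OF M] carrier_matD[OF R] carrier_matD[OF S] carrier_matD[OF rinv_carrier]
 have U12: "U1 n k U \<in> carrier_mat n k" "U2 n k U \<in> carrier_mat n (n - k)" by (simp_all add: U1_def U2_def)
 have gi: "to_mat k m g * rinv k m g = 1\<^sub>m k" by (rule right_inv[OF to_mat_carrier det])
 have H: "H \<in> carrier_mat (n - k) (n - k)" by (simp add: H_def Sigma2_half_def)
 have A1: "(U1 n k U)\<^sup>T * \<Omega> = L * to_mat k m g"
 proof (rule eq_matI)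
  fix i c assume "i < dim_row (L * to_mat k m g)" "c < dim_col (L * to_mat k m g)"
  then have ic: "i < k" "c < m" using d by auto
  have "(L * to_mat k m g) $$ (i, c) = (\<Sum>a<k. L $$ (i, a) * g (a, c))"
   using ic by (subst mult_mat_entry[OF L to_mat_carrier]) (auto simp: to_mat_def)
  then show "((U1 n k U)\<^sup>T * \<Omega>) $$ (i, c) = (L * to_mat k m g) $$ (i, c)"
   unfolding \<Omega>_def mix_entry[OF U12(1) S w kn ic] col_U1[OF U kn ic(1)] using ic sL s0 by simp
 qed (use d U12 in \<open>auto simp: \<Omega>_def\<close>)
 have A2: "(U2 n k U)\<^sup>T * \<Omega> = M * to_mat k m g + R * to_mat (n - k) m h"
 proof (rule eq_matI)
  fix j c assume "j < dim_row (M * to_mat k m g + R * to_mat (n - k) m h)" "c < dim_col (M * to_mat k m g + R * to_mat (n - k) m h)"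
  then have jc: "j < n - k" "c < m" using d by auto
  have "(M * to_mat k m g + R * to_mat (n - k) m h) $$ (j, c) = (M * to_mat k m g) $$ (j, c) + (R * to_mat (n - k) m h) $$ (j, c)"
   using jc d by (intro index_add_mat(1)) auto
  also have "(M * to_mat k m g) $$ (j, c) = (\<Sum>a<k. M $$ (j, a) * g (a, c))"
   using jc by (subst mult_mat_entry[OF M to_mat_carrier]) (auto simp: to_mat_def)
  also have "(R * to_mat (n - k) m h) $$ (j, c) = (\<Sum>b<n-k. R $$ (j, b) * h (b, c))"
   using jc by (subst mult_mat_entry[OF R to_mat_carrier]) (auto simp: to_mat_def)
  finally show "((U2 n k U)\<^sup>T * \<Omega>) $$ (j, c) = (M * to_mat k m g + R * to_mat (n - k) m h) $$ (j, c)"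
   unfolding \<Omega>_def mix_entry[OF U12(2) S w kn jc] col_U2[OF U kn jc(1)] using jc sM sR by simp
 qed (use d U12 in \<open>auto simp: \<Omega>_def\<close>)
 show "(U1 n k U)\<^sup>T * \<Omega> * N = 1\<^sub>m k"
  unfolding A1 N_def using d by (simp add: mult_assoc_dim cancel_mult_dim[OF gi] inv)
 have Nc: "N \<in> carrier_mat m k" unfolding N_def using rinv_carrier Li by (rule mult_carrier_mat)
 have "(M * to_mat k m g + R * to_mat (n - k) m h) * N = M * to_mat k m g * N + R * to_mat (n - k) m h * N"
  using M R Nc by (intro add_mult_distrib_mat[of _ "n - k" m _ _ k]) (auto intro: mult_carrier_mat)
 also have "M * to_mat k m g * N = M * Li"
  unfolding N_def using d by (simp add: mult_assoc_dim cancel_mult_dim[OF gi])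
 also have "R * to_mat (n - k) m h * N = R * (to_mat (n - k) m h * N)"
  using d Nc by (intro mult_assoc_dim) auto
 finally have e: "(U2 n k U)\<^sup>T * \<Omega> * N = M * Li + R * (to_mat (n - k) m h * N)" unfolding A2 .
 have MLi: "M * Li \<in> carrier_mat (n - k) k" using M Li by (rule mult_carrier_mat)
 have RN: "R * (to_mat (n - k) m h * N) \<in> carrier_mat (n - k) k"
  by (rule mult_carrier_mat[OF R mult_carrier_mat[OF to_mat_carrier Nc]])
 have "H * (M * Li + R * (to_mat (n - k) m h * N)) = H * (M * Li) + H * (R * (to_mat (n - k) m h * N))"
  by (rule mult_add_distrib_mat[OF H MLi RN])
 also have "H * (R * (to_mat (n - k) m h * N)) = H * R * (to_mat (n - k) m h * N)"
  using H R Nc by (intro mult_assoc_dim[symmetric]) auto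
 finally show "H * ((U2 n k U)\<^sup>T * \<Omega> * N) = H * (M * Li) + H * R * (to_mat (n - k) m h * N)" unfolding e .
qed

lemma factor_entry:
 assumes B: "B \<in> carrier_mat d k" and D: "D \<in> carrier_mat d d" and N: "N \<in> carrier_mat m k" and ja: "j < d" "a < k"
 shows "(B + D * (to_mat d m h * N)) $$ (j, a) = B $$ (j, a) + (\<Sum>i<d. D $$ (j, i) * (\<Sum>c<m. h (i, c) * N $$ (c, a)))"
proof -
 have HN: "to_mat d m h * N \<in> carrier_mat d k" by (rule mult_carrier_mat[OF to_mat_carrier N])
 have "(to_mat d m h * N) $$ (i, a) = (\<Sum>c<m. h (i, c) * N $$ (c, a))" if "i < d" for i
  using that ja by (subst mult_mat_entry[OF to_mat_carrier N]) (auto simp: to_mat_def)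
 then have "(D * (to_mat d m h * N)) $$ (j, a) = (\<Sum>i<d. D $$ (j, i) * (\<Sum>c<m. h (i, c) * N $$ (c, a)))"
  using ja by (subst mult_mat_entry[OF D HN]) auto
 then show ?thesis using ja carrier_matD[OF D] carrier_matD[OF N] by (subst index_add_mat(1)) auto
qed

section \<open>Degenerate cases and passage to probabilities\<close>

lemma gram_norm_zero:
 assumes D: "D \<in> carrier_mat b c" and z: "spec_norm (D * D\<^sup>T) = 0 \<or> nuc_norm (D * D\<^sup>T) = 0"
 shows "D = 0\<^sub>m b c"
proof (rule eq_matI)
 fix i j assume "i < dim_row (0\<^sub>m b c)" "j < dim_col (0\<^sub>m b c)"
 then have ij: "i < b" "j < c" by auto
 have "(D $$ (i, j))^2 \<le> 0"
  using z
 proof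
  assume z: "spec_norm (D * D\<^sup>T) = 0"
  have "(\<Sum>i<b. (\<Sum>l<c. D $$ (i, l) * (if l = j then 1 else 0))^2) \<le> 0"
   using gram_norms(2)[OF D, of "\<lambda>l. if l = j then 1 else 0"] unfolding z by simp
  then have "(\<Sum>i<b. (D $$ (i, j))^2) \<le> 0"
   using ij by (simp add: if_distrib[where f="\<lambda>z. _ * z"] cong: if_cong)
  moreover have "(D $$ (i, j))^2 \<le> (\<Sum>i<b. (D $$ (i, j))^2)" using ij by (intro member_le_sum) auto
  ultimately show ?thesis by linarith
 next
  assume z: "nuc_norm (D * D\<^sup>T) = 0"
  have "(D $$ (i, j))^2 \<le> (\<Sum>l<c. (D $$ (i, l))^2)" using ij by (intro member_le_sum) auto
  also have "... \<le> (\<Sum>i<b. \<Sum>l<c. (D $$ (i, l))^2)"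
   using ij by (intro member_le_sum[where f="\<lambda>i. \<Sum>l<c. (D $$ (i, l))^2"]) (auto intro: sum_nonneg)
  finally show ?thesis using z unfolding gram_norms(1)[OF D] by simp
 qed
 then show "D $$ (i, j) = 0\<^sub>m b c $$ (i, j)" using ij by simp
qed (use D in auto)

lemma Sigma2_gram:
 assumes "\<forall>i<n. 0 \<le> \<sigma> i" and "k \<le> n"
 shows "Sigma2 n k \<sigma> = Sigma2_half n k \<sigma> * (Sigma2_half n k \<sigma>)\<^sup>T"
proof (rule eq_matI)
 have H: "Sigma2_half n k \<sigma> \<in> carrier_mat (n - k) (n - k)" by (simp add: Sigma2_half_def)
 fix i j assume "i < dim_row (Sigma2_half n k \<sigma> * (Sigma2_half n k \<sigma>)\<^sup>T)"
  "j < dim_col (Sigma2_half n k \<sigma> * (Sigma2_half n k \<sigma>)\<^sup>T)"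
 then have ij: "i < n - k" "j < n - k" using H by auto
 have e: "Sigma2_half n k \<sigma> $$ (i, l) = (if l = i then sqrt (\<sigma> (i + k)) else 0)" if "i < n - k" "l < n - k" for i l
  using that by (auto simp: Sigma2_half_def mat_diag_def)
 have "0 \<le> \<sigma> (i + k)" using assms ij by auto
 moreover have "(Sigma2_half n k \<sigma> * (Sigma2_half n k \<sigma>)\<^sup>T) $$ (i, j)
  = (\<Sum>l<n-k. if l = i then sqrt (\<sigma> (i + k)) * (if i = j then sqrt (\<sigma> (j + k)) else 0) else 0)"
  unfolding mult_transpose_entry[OF H H ij] using ij by (intro sum.cong) (auto simp: e)
 ultimately show "Sigma2 n k \<sigma> $$ (i, j) = (Sigma2_half n k \<sigma> * (Sigma2_half n k \<sigma>)\<^sup>T) $$ (i, j)"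
  using ij by (auto simp: Sigma2_def mat_diag_def)
qed (auto simp: Sigma2_def Sigma2_half_def)

text \<open>\<open>beta_k\<close> and \<open>delta_k\<close> divide by the norm of
  \<open>Sigma2\<close>. If that norm is zero, so is \<open>Sigma2_half\<close>, and with it the
  numerator; the convention \<open>0 / 0 = 0\<close> is then consistent with multiplying
  back.\<close>

lemma relative_norm_cancel:
 assumes \<sigma>: "\<forall>i<n. 0 \<le> \<sigma> i" "k \<le> n" and X: "X \<in> carrier_mat (n - k) c" and nrm: "nrm = spec_norm \<or> nrm = nuc_norm"
 defines "D \<equiv> Sigma2_half n k \<sigma> * X"
 shows "nrm (D * D\<^sup>T) / nrm (Sigma2 n k \<sigma>) * nrm (Sigma2 n k \<sigma>) = nrm (D * D\<^sup>T)"
proof (cases "nrm (Sigma2 n k \<sigma>) = 0")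
 case True
 have H: "Sigma2_half n k \<sigma> \<in> carrier_mat (n - k) (n - k)" by (simp add: Sigma2_half_def)
 have "Sigma2_half n k \<sigma> = 0\<^sub>m (n - k) (n - k)"
  using gram_norm_zero[OF H] True nrm unfolding Sigma2_gram[OF \<sigma>] by auto
 then have "D = 0\<^sub>m (n - k) c" unfolding D_def using X by simp
 then have "D * D\<^sup>T = 0\<^sub>m (n - k) (n - k)" by simp
 then show ?thesis using True nrm spec_norm_zero nuc_norm_zero by auto
next
 case False then show ?thesis by simp
qed

lemma measure_ge_of_complement:
 assumes M: "prob_space M" and E: "E \<in> sets M" and le: "(\<integral>\<^sup>+x. indicator (space M - E) x \<partial>M) \<le> ennreal \<epsilon>" and \<epsilon>: "0 \<le> \<epsilon>"
 shows "1 - \<epsilon> \<le> measure M E"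
proof -
 interpret prob_space M by fact
 have "(\<integral>\<^sup>+x. indicator (space M - E) x \<partial>M) = emeasure M (space M - E)"
  using E by (intro nn_integral_indicator) auto
 then have "emeasure M (space M - E) \<le> ennreal \<epsilon>" using le by (simp only:)
 then have "measure M (space M - E) \<le> \<epsilon>" using \<epsilon> by (simp add: emeasure_eq_measure)
 then show ?thesis unfolding prob_compl[OF E] by linarith
qed

text \<open>Covers the case \<open>D = 0\<close>, in which \<open>H\<close> drops out and the tail
  lemmas, which assume \<open>M > 0\<close>, do not apply; only the null event of rank deficiency
  remains.\<close>

lemma nn_integral_null_of_gram:
 fixes F :: "(nat \<times> nat \<Rightarrow> real) \<Rightarrow> (nat \<times> nat \<Rightarrow> real) \<Rightarrow> ennreal"
 assumes km: "k \<le> m" and F1: "\<And>g h. F g h \<le> 1" and F0: "\<And>g h. gdet k m g \<noteq> 0 \<Longrightarrow> F g h = 0"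
 shows "(\<integral>\<^sup>+g. (\<integral>\<^sup>+h. F g h \<partial>gauss I) \<partial>gaussm k m) = 0"
proof -
 have "(\<integral>\<^sup>+g. (\<integral>\<^sup>+h. F g h \<partial>gauss I) \<partial>gaussm k m)
  \<le> (\<integral>\<^sup>+g. low_rk k m g \<partial>gaussm k m)"
 proof (rule nn_integral_mono)
  fix g
  have "(\<integral>\<^sup>+h. F g h \<partial>gauss I) \<le> (\<integral>\<^sup>+h. low_rk k m g \<partial>gauss I)"
   using F1 F0 by (intro nn_integral_mono) (auto simp: indicator_def)
  then show "(\<integral>\<^sup>+h. F g h \<partial>gauss I) \<le> low_rk k m g"
   by (simp only: nn_integral_gauss_const)
 qed
 then show ?thesis unfolding nn_integral_gram_null[OF km] by simp
qed

theorem theorem2p3: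
  fixes A K S U :: "real mat" and \<sigma> :: "nat \<Rightarrow> real" and n k p :: nat and u t :: real
  assumes A_psd: "sym_psd n A"
    and k_ge: "2 \<le> k" and k_rank: "k \<le> vec_space.rank n A"
    and p_ge: "4 \<le> p"
    and U_orth: "orthonormal_mat n U"
    and \<sigma>_sorted: "\<forall>i j. i \<le> j \<longrightarrow> j < n \<longrightarrow> \<sigma> j \<le> \<sigma> i"
    and \<sigma>_nonneg: "\<forall>i < n. 0 \<le> \<sigma> i"
    and A_eig: "A = U * mat_diag n \<sigma> * transpose_mat U"
    and K_psd: "sym_psd n K"
    and K11_inv: "invertible_mat (Ktil11 n k U K)"
    and S_dim: "S \<in> carrier_mat n n" and S_sqrt: "S * transpose_mat S = K"
    and u_ge: "1 \<le> u" and t_ge: "1 \<le> t"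
  shows
    "measure (gauss_mat_measure n (k + p))
       {g \<in> space (gauss_mat_measure n (k + p)).
          spec_norm (A - nystrom A (S * to_mat n (k + p) g))
          \<le> (1 + 4 * delta_k spec_norm n k U \<sigma> K
               + 4 * (3 * real k / (real p + 1) + exp 2 * (real k + real p) / (real p + 1)^2 * u^2)
                   * t^2 * beta_k spec_norm n k U \<sigma> K) * spec_norm (Sigma2 n k \<sigma>)
            + 4 * (exp 2 * (real k + real p) / (real p + 1)^2) * t^2 * beta_k nuc_norm n k U \<sigma> K
                * nuc_norm (Sigma2 n k \<sigma>)}
     \<ge> 1 - 2 * t powr (- real p) - exp (- (u^2) / 2)
   \<and> measure (gauss_mat_measure n (k + p))
       {g \<in> space (gauss_mat_measure n (k + p)).
          nuc_norm (A - nystrom A (S * to_mat n (k + p) g))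
          \<le> (1 + 2 * delta_k nuc_norm n k U \<sigma> K
               + 3 * real k / (real p + 1) * t^2 * beta_k nuc_norm n k U \<sigma> K) * nuc_norm (Sigma2 n k \<sigma>)
            + 2 * (exp 2 * (real k + real p) / (real p + 1)^2) * t^2 * u^2 * beta_k spec_norm n k U \<sigma> K
                * spec_norm (Sigma2 n k \<sigma>)}
     \<ge> 1 - 2 * t powr (- real p) - exp (- (u^2) / 2)"
proof -
 define m where "m = k + p"
 define \<epsilon> where "\<epsilon> = 2 * t powr (- real p) + exp (- u\<^sup>2 / 2)"
 have \<epsilon>: "0 \<le> \<epsilon>" by (simp add: \<epsilon>_def)
 have Ac: "A \<in> carrier_mat n n" by (rule sym_psdD(1)[OF A_psd])
 have kn: "k \<le> n" using vec_space.rank_le_nc[OF Ac] k_rank by simp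
 have km: "k \<le> m" by (simp add: m_def)
 have Uc: "U \<in> carrier_mat n n" using U_orth by (simp add: orthonormal_mat_def)
 obtain w L Li M R where w: "orthonormal_family n n w"
  and car: "L \<in> carrier_mat k k" "Li \<in> carrier_mat k k" "M \<in> carrier_mat (n - k) k" "R \<in> carrier_mat (n - k) (n - k)"
  and inv: "L * Li = 1\<^sub>m k" "Li * L = 1\<^sub>m k"
  and s: "\<And>i a. i < k \<Longrightarrow> a < k \<Longrightarrow> ip (S\<^sup>T *\<^sub>v col U i) (w a) = L $$ (i, a)"
   "\<And>i b. i < k \<Longrightarrow> b < n - k \<Longrightarrow> ip (S\<^sup>T *\<^sub>v col U i) (w (b + k)) = 0"
   "\<And>j a. j < n - k \<Longrightarrow> a < k \<Longrightarrow> ip (S\<^sup>T *\<^sub>v col U (j + k)) (w a) = M $$ (j, a)"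
   "\<And>j b. j < n - k \<Longrightarrow> b < n - k \<Longrightarrow> ip (S\<^sup>T *\<^sub>v col U (j + k)) (w (b + k)) = R $$ (j, b)"
  and Kt: "Ktil11 n k U K = L * L\<^sup>T" "Ktil21 n k U K = M * L\<^sup>T"
   "Ktil22 n k U K = M * M\<^sup>T + R * R\<^sup>T"
  using covariance_factorisation[OF U_orth kn S_dim S_sqrt K11_inv] by blast
 define d where "d = n - k"
 define H where "H = Sigma2_half n k \<sigma>"
 have H: "H \<in> carrier_mat d d" by (simp add: H_def Sigma2_half_def d_def)
 note wp = whitened_parameters(1)[OF car inv Kt] whitened_parameters(2,3)[OF car inv Kt, where \<sigma>=\<sigma>]
 define D where "D = H * R"
 define B where "B = H * (M * Li)"
 have D: "D \<in> carrier_mat d d" and B: "B \<in> carrier_mat d k"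
  using car H by (auto simp: D_def B_def d_def intro!: mult_carrier_mat)
 define \<kappa> where "\<kappa> = spec_norm (mat_inv (Ktil11 n k U K))"
 have Lit: "Li\<^sup>T \<in> carrier_mat k k" using car by simp
 have \<kappa>e: "\<kappa> = spec_norm (Li\<^sup>T * (Li\<^sup>T)\<^sup>T)" by (simp add: \<kappa>_def wp(1))
 \<comment> \<open>A zero norm would force \<open>Li = 0\<close>, contradicting
   \<open>L * Li = 1\<^sub>m k\<close> in positive dimension.\<close>
 have \<kappa>0: "0 < \<kappa>"
 proof (rule ccontr)
  assume "\<not> 0 < \<kappa>"
  then have "\<kappa> = 0" using spec_norm_nonneg[of "mat_inv (Ktil11 n k U K)"] by (simp add: \<kappa>_def)
  then have tz: "Li\<^sup>T = 0\<^sub>m k k" using gram_norm_zero[OF Lit] unfolding \<kappa>e by blast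
  have "Li = (Li\<^sup>T)\<^sup>T" by simp
  also have "... = 0\<^sub>m k k" unfolding tz by (rule eq_matI) auto
  finally have z: "Li = 0\<^sub>m k k" .
  have "(L * Li) $$ (0, 0) = 0" unfolding z using car k_ge by simp
  then show False using inv k_ge by simp
 qed
 have opLi: "(\<Sum>a<k. (\<Sum>a'<k. Li $$ (a, a') * y a')^2) \<le> \<kappa> * (\<Sum>a<k. (y a)^2)"
  "(\<Sum>a<k. (\<Sum>a'<k. Li $$ (a', a) * y a')^2) \<le> \<kappa> * (\<Sum>a<k. (y a)^2)" for y
  using gram_norms(3)[OF Lit, of y] gram_norms(2)[OF Lit, of y] car(2) unfolding \<kappa>e by simp_all
 define \<mu> where "\<mu> = spec_norm (D * D\<^sup>T)"
 define \<rho> where "\<rho> = (\<Sum>j<d. \<Sum>i<d. (D $$ (j, i))^2)"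
 define \<beta> where "\<beta> = (\<Sum>j<d. \<Sum>a<k. (B $$ (j, a))^2)"
 define \<delta> where "\<delta> = spec_norm (B * B\<^sup>T)"
 have nonneg: "0 \<le> \<mu>" "0 \<le> \<rho>" "0 \<le> \<delta>"
  by (auto simp: \<mu>_def \<rho>_def \<delta>_def spec_norm_nonneg intro!: sum_nonneg)
 have opD: "(\<Sum>j<d. (\<Sum>i<d. D $$ (j, i) * y i)^2) \<le> \<mu> * (\<Sum>i<d. (y i)^2)" for y
  unfolding \<mu>_def by (rule gram_norms(2)[OF D])
 have D0: "D = 0\<^sub>m d d" if "\<not> 0 < \<mu>"
  using gram_norm_zero[OF D] that nonneg(1) unfolding \<mu>_def by auto
 define d1 where "d1 = 3 * real k / (real p + 1)"
 define d2 where "d2 = exp 2 * (real k + real p) / (real p + 1)^2"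
 have dpos: "0 < d1" "0 < d2" using k_ge by (auto simp: d1_def d2_def add_pos_pos)
 let ?s2 = "spec_norm (Sigma2 n k \<sigma>)" and ?n2 = "nuc_norm (Sigma2 n k \<sigma>)"
 have Xc: "R \<in> carrier_mat (n - k) (n - k)" "M * Li \<in> carrier_mat (n - k) k" using car by (auto intro: mult_carrier_mat)
 note cancel = relative_norm_cancel[OF \<sigma>_nonneg kn Xc(1), folded H_def D_def] relative_norm_cancel[OF \<sigma>_nonneg kn Xc(2), folded H_def B_def]
 have w2: "H * Ktil22_1 n k U K * H = D * D\<^sup>T" unfolding H_def D_def by (rule wp(2))
 have w3: "H * Ktil21 n k U K * mat_inv (Ktil11 n k U K) * mat_inv (Ktil11 n k U K) * (Ktil21 n k U K)\<^sup>T * H = B * B\<^sup>T"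
  unfolding H_def B_def by (rule wp(3))
 \<comment> \<open>The claim contains the relative quantities only multiplied by the matching norms
   of \<open>Sigma2\<close>, so the possibly vanishing denominators disappear here.\<close>
 have bs: "beta_k spec_norm n k U \<sigma> K * ?s2 = \<mu> * \<kappa>"
  unfolding beta_k_def H_def[symmetric] w2 \<kappa>_def[symmetric] \<mu>_def
  using cancel(1)[of spec_norm] by (cases "?s2 = 0") simp_all
 have bn: "beta_k nuc_norm n k U \<sigma> K * ?n2 = \<rho> * \<kappa>"
  unfolding beta_k_def H_def[symmetric] w2 \<kappa>_def[symmetric] \<rho>_def gram_norms(1)[OF D, symmetric]
  using cancel(1)[of nuc_norm] by (cases "?n2 = 0") simp_all
 have ds: "delta_k spec_norm n k U \<sigma> K * ?s2 = \<delta>"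
  unfolding delta_k_def H_def[symmetric] w3 \<delta>_def using cancel(2)[of spec_norm] by simp
 have dn: "delta_k nuc_norm n k U \<sigma> K * ?n2 = \<beta>"
  unfolding delta_k_def H_def[symmetric] w3 \<beta>_def gram_norms(1)[OF B, symmetric] using cancel(2)[of nuc_norm] by simp
 let ?P = "gaussm n m"
 have gm: "gauss_mat_measure n m = ?P" by (simp add: gauss_mat_measure_def gauss_def m_def)
 have mix_space: "mix n k m w g h \<in> space ?P" for g h unfolding space_gauss mix_def by simp
 define \<Omega> where "\<Omega> = (\<lambda>g h. S * to_mat n m (mix n k m w g h))"
 define N where "N = (\<lambda>g. rinv k m g * Li)"
 define Y where "Y = (\<lambda>g h. B + D * (to_mat d m h * N g))"
 have O: "\<Omega> g h \<in> carrier_mat n m" for g h unfolding \<Omega>_def using S_dim by auto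
 have Nc: "N g \<in> carrier_mat m k" for g unfolding N_def by (rule mult_carrier_mat[OF rinv_carrier car(2)])
 have Yc: "Y g h \<in> carrier_mat d k" for g h
  unfolding Y_def using B D Nc by (intro add_carrier_mat mult_carrier_mat[OF D mult_carrier_mat[OF to_mat_carrier Nc]])
 have sig: "\<And>i. i < n \<Longrightarrow> 0 \<le> \<sigma> i" using \<sigma>_nonneg by simp
 have factor: "(U1 n k U)\<^sup>T * \<Omega> g h * N g = 1\<^sub>m k"
  "Y g h = Sigma2_half n k \<sigma> * ((U2 n k U)\<^sup>T * \<Omega> g h * N g)"
  if "gdet k m g \<noteq> 0" for g h
  using sampled_factor(1)[OF Uc kn S_dim w car inv(1) s that, where h=h]
   sampled_factor(2)[OF Uc kn S_dim w car inv(1) s that, where h=h and \<sigma>=\<sigma>]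
  unfolding \<Omega>_def N_def Y_def B_def D_def H_def d_def by simp_all
 have Ne: "N g $$ (c, a) = (\<Sum>a'<k. rinv k m g $$ (c, a') * Li $$ (a', a))" if "c < m" "a < k" for g c a
  unfolding N_def by (rule mult_mat_entry[OF rinv_carrier car(2) that])
 have Ye: "Y g h $$ (j, a) = B $$ (j, a) + (\<Sum>i<d. D $$ (j, i) * (\<Sum>c<m. h (i, c) * N g $$ (c, a)))" if "j < d" "a < k" for g h j a
  unfolding Y_def by (rule factor_entry[OF B D Nc that])
 \<comment> \<open>The probability of failure is rewritten as an iterated integral over the
   independent blocks \<open>g\<close> and \<open>h\<close>, the form in which the tail lemmas are
   stated.\<close>
 have transfer: "1 - \<epsilon> \<le> measure ?P E"
  if E: "E \<in> sets ?P" and le: "(\<integral>\<^sup>+g. (\<integral>\<^sup>+h. indicator (space ?P - E) (mix n k m w g h) \<partial>gaussm d m) \<partial>gaussm k m) \<le> ennreal \<epsilon>" for E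
 proof (rule measure_ge_of_complement[OF prob_space_gauss E _ \<epsilon>])
  have "(indicator (space ?P - E) :: _ \<Rightarrow> ennreal) \<in> borel_measurable (borelm n m)"
  proof (rule borel_measurable_indicator)
   have "space ?P - E \<in> sets ?P" using E by auto
   then show "space ?P - E \<in> sets (borelm n m)" unfolding sets_gauss .
  qed
  from nn_integral_gauss_mix[OF w kn this]
  show "(\<integral>\<^sup>+x. indicator (space ?P - E) x \<partial>?P) \<le> ennreal \<epsilon>" using le unfolding d_def by simp
 qed
 have spectral: "1 - \<epsilon> \<le> measure ?P {g \<in> space ?P. spec_norm (A - nystrom A (S * to_mat n m g)) \<le>
   ?s2 + (4 * \<delta> + 4 / 3 * (3 * t^2 * (d1 * \<mu> + d2 * u^2 * \<mu> + d2 * \<rho>)) * \<kappa>)}" (is "_ \<le> measure ?P ?E")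
 proof (rule transfer)
  define \<theta> where "\<theta> = 3 * t^2 * (d1 * \<mu> + d2 * u^2 * \<mu> + d2 * \<rho>)"
  have \<theta>: "0 \<le> \<theta>" unfolding \<theta>_def using nonneg dpos by (intro mult_nonneg_nonneg add_nonneg_nonneg) auto
  have y2: "0 \<le> 4 * \<delta> + 4 / 3 * \<theta> * \<kappa>" using \<theta> nonneg \<kappa>0 by simp
  show "?E \<in> sets ?P" using y2 spec_norm_nonneg[of "Sigma2 n k \<sigma>"] unfolding \<theta>_def[symmetric]
   by (intro sets_nystrom_spec[OF A_psd S_dim]) auto
  define F where "F = (\<lambda>g h. indicator (space ?P - ?E) (mix n k m w g h) :: ennreal)"
  have F1: "F g h \<le> 1" for g h by (simp add: F_def indicator_def)
  have F0: "F g h = 0" if det: "gdet k m g \<noteq> 0"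
   and le: "\<And>v. dhn2 D d d m (rinv_apply k m g v) h \<le> \<theta> * (\<Sum>i<k. (v i)^2)" for g h
  proof -
   have "spec_norm (A - nystrom A (\<Omega> g h)) \<le> ?s2 + (4 * \<delta> + 4 / 3 * \<theta> * \<kappa>)"
   proof (rule nystrom_spec_bound[OF A_psd kn U_orth A_eig sig O Nc factor[OF det] y2])
    fix a :: "real vec" assume a: "a \<in> carrier_vec k"
    have Ya: "Y g h *\<^sub>v a \<in> carrier_vec d" by (rule mult_mat_vec_carrier[OF Yc a])
    define v where "v = (\<lambda>a'. \<Sum>l<k. Li $$ (a', l) * a $ l)"
    define x where "x = (\<lambda>j. \<Sum>i<d. D $$ (j, i) * (\<Sum>c<m. h (i, c) * rinv_apply k m g v c))"
    define b where "b = (\<lambda>j. \<Sum>l<k. B $$ (j, l) * a $ l)"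
    have aa: "(\<Sum>l<k. (a $ l)^2) = ip a a" unfolding ip_sum[OF a a] by (simp add: power2_eq_square)
    have Nv: "(\<Sum>l<k. N g $$ (c, l) * a $ l) = rinv_apply k m g v c" if "c < m" for c
    proof -
     have "(\<Sum>l<k. N g $$ (c, l) * a $ l) = (\<Sum>l<k. \<Sum>a'<k. rinv k m g $$ (c, a') * Li $$ (a', l) * a $ l)"
      using that by (simp add: Ne sum_distrib_right)
     also have "... = rinv_apply k m g v c"
      unfolding rinv_apply_def v_def sum_distrib_left by (subst sum.swap) (simp add: mult.assoc)
     finally show ?thesis .
    qed
    have Yaj: "(Y g h *\<^sub>v a) $ j = b j + x j" if j: "j < d" for j
    proof -
     have "(Y g h *\<^sub>v a) $ j = (\<Sum>l<k. B $$ (j, l) * a $ l + (\<Sum>i<d. D $$ (j, i) * (\<Sum>c<m. h (i, c) * N g $$ (c, l))) * a $ l)"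
      unfolding mult_mat_vec_entry[OF Yc a j] using j by (intro sum.cong) (auto simp: Ye distrib_right)
     also have "... = b j + (\<Sum>l<k. \<Sum>i<d. D $$ (j, i) * (\<Sum>c<m. h (i, c) * (N g $$ (c, l) * a $ l)))"
      unfolding b_def sum.distrib by (simp add: sum_distrib_right sum_distrib_left mult.assoc)
     also have "(\<Sum>l<k. \<Sum>i<d. D $$ (j, i) * (\<Sum>c<m. h (i, c) * (N g $$ (c, l) * a $ l)))
      = (\<Sum>i<d. \<Sum>l<k. D $$ (j, i) * (\<Sum>c<m. h (i, c) * (N g $$ (c, l) * a $ l)))" by (rule sum.swap)
     also have "... = (\<Sum>i<d. D $$ (j, i) * (\<Sum>c<m. h (i, c) * (\<Sum>l<k. N g $$ (c, l) * a $ l)))"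
     proof (rule sum.cong[OF refl])
      fix i
      have "(\<Sum>l<k. \<Sum>c<m. h (i, c) * (N g $$ (c, l) * a $ l)) = (\<Sum>c<m. \<Sum>l<k. h (i, c) * (N g $$ (c, l) * a $ l))"
       by (rule sum.swap)
      then show "(\<Sum>l<k. D $$ (j, i) * (\<Sum>c<m. h (i, c) * (N g $$ (c, l) * a $ l)))
       = D $$ (j, i) * (\<Sum>c<m. h (i, c) * (\<Sum>l<k. N g $$ (c, l) * a $ l))"
       by (simp only: sum_distrib_left[symmetric])
     qed
     also have "... = x j" unfolding x_def by (simp add: Nv)
     finally show ?thesis .
    qed
    have "ip (Y g h *\<^sub>v a) (Y g h *\<^sub>v a) = (\<Sum>j<d. (b j + x j)^2)"
     unfolding ip_sum[OF Ya Ya] using Yaj by (simp add: power2_eq_square del: index_mult_mat_vec)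
    \<comment> \<open>Weight \<open>1/4\<close> produces the coefficient \<open>4\<close> of
      \<open>\<delta>\<close>, and \<open>4 / 3\<close> times the factor \<open>3\<close> in
      \<open>\<theta>\<close> gives the coefficient \<open>4\<close> of the remaining terms.\<close>
    also have "... \<le> (\<Sum>j<d. 4 * (b j)^2 + 4 / 3 * (x j)^2)"
    proof (rule sum_mono)
     fix j
     show "(b j + x j)^2 \<le> 4 * (b j)^2 + 4 / 3 * (x j)^2"
      using square_add_le_weighted[of "1/4" "b j" "x j"] by simp
    qed
    also have "... = 4 * (\<Sum>j<d. (b j)^2) + 4 / 3 * (\<Sum>j<d. (x j)^2)" by (simp add: sum.distrib sum_distrib_left)
    finally have sum_le: "ip (Y g h *\<^sub>v a) (Y g h *\<^sub>v a) \<le> 4 * (\<Sum>j<d. (b j)^2) + 4 / 3 * (\<Sum>j<d. (x j)^2)" .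
    have b_le: "(\<Sum>j<d. (b j)^2) \<le> \<delta> * ip a a"
     unfolding b_def \<delta>_def aa[symmetric] by (rule gram_norms(2)[OF B])
    have "(\<Sum>j<d. (x j)^2) = dhn2 D d d m (rinv_apply k m g v) h" unfolding x_def dhn2_def ..
    also have "... \<le> \<theta> * (\<Sum>i<k. (v i)^2)" by (rule le)
    also have "... \<le> \<theta> * (\<kappa> * ip a a)" using \<theta> unfolding v_def aa[symmetric] by (intro mult_left_mono opLi(1))
    finally have "(\<Sum>j<d. (x j)^2) \<le> \<theta> * \<kappa> * ip a a" by (simp only: mult.assoc)
    then show "ip (Y g h *\<^sub>v a) (Y g h *\<^sub>v a) \<le> (4 * \<delta> + 4 / 3 * \<theta> * \<kappa>) * ip a a"
     using sum_le b_le by (simp add: algebra_simps)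
   qed
   then show ?thesis using mix_space[of g h] unfolding F_def \<Omega>_def \<theta>_def by simp
  qed
  show "(\<integral>\<^sup>+g. (\<integral>\<^sup>+h. indicator (space ?P - ?E) (mix n k m w g h) \<partial>gaussm d m) \<partial>gaussm k m) \<le> ennreal \<epsilon>"
  proof (cases "0 < \<mu>")
   case True
   show ?thesis
    using spectral_tail[OF k_ge p_ge m_def u_ge t_ge opD True, of F] F1 F0
    unfolding F_def \<theta>_def \<rho>_def d1_def d2_def \<epsilon>_def by simp
  next
   case False
   have "dhn2 D d d m y h \<le> 0" for y h using D0[OF False] by (simp add: dhn2_def)
   moreover have "0 \<le> \<theta> * (\<Sum>i<k. (v i)^2)" for v :: "nat \<Rightarrow> real" using \<theta> by (intro mult_nonneg_nonneg sum_nonneg) auto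
   ultimately have "F g h = 0" if "gdet k m g \<noteq> 0" for g h
    by (intro F0[OF that]) (rule order_trans)
   from nn_integral_null_of_gram[OF km F1 this] show ?thesis unfolding F_def by simp
  qed
 qed
 have nuclear: "1 - \<epsilon> \<le> measure ?P {g \<in> space ?P. nuc_norm (A - nystrom A (S * to_mat n m g)) \<le>
   ?n2 + (2 * \<beta> + d1 * t^2 * \<kappa> * \<rho> + 2 * d2 * t^2 * u^2 * \<kappa> * \<mu>)}" (is "_ \<le> measure ?P ?E")
 proof (rule transfer)
  show "?E \<in> sets ?P" by (rule sets_nystrom_nuc[OF A_psd S_dim])
  define \<theta> where "\<theta> = 2 * \<beta> + d1 * t^2 * \<kappa> * \<rho> + 2 * d2 * t^2 * u^2 * \<kappa> * \<mu>"
  define F where "F = (\<lambda>g h. indicator (space ?P - ?E) (mix n k m w g h) :: ennreal)"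
  have F1: "F g h \<le> 1" for g h by (simp add: F_def indicator_def)
  define N' where "N' = (\<lambda>g c a. \<Sum>a'<k. rinv k m g $$ (c, a') * Li $$ (a', a))"
  have F0: "F g h = 0" if det: "gdet k m g \<noteq> 0"
   and le: "(\<Sum>j<d. \<Sum>a<k. (B $$ (j, a) + (\<Sum>i<d. D $$ (j, i) * (\<Sum>c<m. h (i, c) * N' g c a)))^2) \<le> \<theta>" for g h
  proof -
   have "frob2 (Y g h) = (\<Sum>j<d. \<Sum>a<k. (B $$ (j, a) + (\<Sum>i<d. D $$ (j, i) * (\<Sum>c<m. h (i, c) * N' g c a)))^2)"
    unfolding frob2_def carrier_matD[OF Yc] N'_def by (intro sum.cong refl) (simp add: Ye Ne)
   moreover have "nuc_norm (A - nystrom A (\<Omega> g h)) \<le> ?n2 + frob2 (Y g h)"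
    by (rule nystrom_nuc_bound[OF A_psd kn U_orth A_eig sig O Nc factor[OF det]])
   ultimately have "nuc_norm (A - nystrom A (\<Omega> g h)) \<le> ?n2 + \<theta>" using le by linarith
   then show ?thesis using mix_space[of g h] unfolding F_def \<Omega>_def \<theta>_def by simp
  qed
  show "(\<integral>\<^sup>+g. (\<integral>\<^sup>+h. indicator (space ?P - ?E) (mix n k m w g h) \<partial>gaussm d m) \<partial>gaussm k m) \<le> ennreal \<epsilon>"
  proof (cases "0 < \<mu>")
   case True
   show ?thesis
    using nuclear_tail[OF k_ge p_ge m_def u_ge t_ge opD True opLi(2) \<kappa>0, of F "\<lambda>j a. B $$ (j, a)"] F1 F0
    unfolding F_def \<theta>_def \<rho>_def \<beta>_def d1_def d2_def \<epsilon>_def N'_def by simp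
  next
   case False
   have "(\<Sum>j<d. \<Sum>a<k. (B $$ (j, a) + (\<Sum>i<d. D $$ (j, i) * x i a))^2) \<le> \<theta>" for x :: "nat \<Rightarrow> nat \<Rightarrow> real"
   proof -
    have "(\<Sum>j<d. \<Sum>a<k. (B $$ (j, a) + (\<Sum>i<d. D $$ (j, i) * x i a))^2) = \<beta>"
     unfolding \<beta>_def using D0[OF False] by simp
    moreover have "0 \<le> \<beta>" unfolding \<beta>_def by (intro sum_nonneg) auto
    moreover have "0 \<le> d1 * t^2 * \<kappa> * \<rho> + 2 * d2 * t^2 * u^2 * \<kappa> * \<mu>"
     using nonneg dpos \<kappa>0 by (intro add_nonneg_nonneg mult_nonneg_nonneg) auto
    ultimately show ?thesis unfolding \<theta>_def by linarith
   qed
   then have "F g h = 0" if "gdet k m g \<noteq> 0" for g h by (intro F0[OF that])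
   from nn_integral_null_of_gram[OF km F1 this] show ?thesis unfolding F_def by simp
  qed
 qed
 have rhs_s: "(1 + 4 * delta_k spec_norm n k U \<sigma> K + 4 * (3 * real k / (real p + 1) + exp 2 * (real k + real p) / (real p + 1)^2 * u^2)
    * t^2 * beta_k spec_norm n k U \<sigma> K) * ?s2
   + 4 * (exp 2 * (real k + real p) / (real p + 1)^2) * t^2 * beta_k nuc_norm n k U \<sigma> K * ?n2
  = ?s2 + (4 * \<delta> + 4 / 3 * (3 * t^2 * (d1 * \<mu> + d2 * u^2 * \<mu> + d2 * \<rho>)) * \<kappa>)"
 proof -
  have "(1 + 4 * x + 4 * (d1 + d2 * u^2) * t^2 * y) * ?s2 + 4 * d2 * t^2 * z * ?n2
   = ?s2 + 4 * (x * ?s2) + 4 * (d1 + d2 * u^2) * t^2 * (y * ?s2) + 4 * d2 * t^2 * (z * ?n2)" for x y z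
   by (simp add: algebra_simps)
  then show ?thesis unfolding d1_def[symmetric] d2_def[symmetric] by (simp only: bs bn ds) (simp add: algebra_simps)
 qed
 have rhs_n: "(1 + 2 * delta_k nuc_norm n k U \<sigma> K + 3 * real k / (real p + 1) * t^2 * beta_k nuc_norm n k U \<sigma> K) * ?n2
   + 2 * (exp 2 * (real k + real p) / (real p + 1)^2) * t^2 * u^2 * beta_k spec_norm n k U \<sigma> K * ?s2
  = ?n2 + (2 * \<beta> + d1 * t^2 * \<kappa> * \<rho> + 2 * d2 * t^2 * u^2 * \<kappa> * \<mu>)"
 proof -
  have "(1 + 2 * x + d1 * t^2 * y) * ?n2 + 2 * d2 * t^2 * u^2 * z * ?s2
   = ?n2 + 2 * (x * ?n2) + d1 * t^2 * (y * ?n2) + 2 * d2 * t^2 * u^2 * (z * ?s2)" for x y z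
   by (simp add: algebra_simps)
  then show ?thesis unfolding d1_def[symmetric] d2_def[symmetric] by (simp only: bs bn dn) (simp add: algebra_simps)
 qed
 have eps: "1 - 2 * t powr (- real p) - exp (- (u^2) / 2) = 1 - \<epsilon>" by (simp add: \<epsilon>_def)
 show ?thesis
  unfolding eps rhs_s rhs_n m_def[symmetric] gm by (intro conjI spectral nuclear)
qed

end
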